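(* Let $\Bbbk$ be a field and let $(A,B,C)$ be a balanced degree triplet of type $n$ such that $B$ and $C$ are intervals, i.e. $B=[a,n-c]$ and $C=[b,n-a]$ (so the only internal nondegrees are those of $A$ in $[c,n-b]$). Then there exists a triplet of pure free squarefree complexes over the polynomial ring $\Bbbk[x_1,\ldots,x_n]$ whose degree sequences are given by $A$, $B$ and $C$; that is, a bounded complex $F^\bullet$ of free squarefree modules such that $F^\bullet$, $\mathbb A\circ\mathbb D(F^\bullet)$ and $(\mathbb A\circ\mathbb D)^2(F^\bullet)$ are pure with sets of degrees $A$, $B$ and $C$ respectively.
   Context: Let $S=\Bbbk[x_1,\ldots,x_n]$, $\mathbb Z^n$-graded, with $\epsilon_i$ the $i$-th unit vector and $\mathbf 1=(1,\ldots,1)$. Subsets $R\subseteq[n]$ are identified with their $0/1$-vectors; $R^c=[n]\setminus R$. A finitely generated $\mathbb N^n$-graded $S$-module $M$ is squarefree if $x_i:M_{\mathbf b}\to M_{\mathbf b+\epsilon_i}$ is an isomorphism whenever $b_i\ge1$. Finite direct sums of modules $S(-R)$, $R\subseteq[n]$, are the free squarefree modules. Complexes are cohomologically graded. Every bounded complex $X^\bullet$ of squarefree modules has a minimal free squarefree resolution $\mathrm{res}(X^\bullet)\to X^\bullet$ (a quasi-isomorphism from a bounded complex $F^\bullet$ of free squarefree modules with zero differentials in $F^\bullet\otimes_S\Bbbk$), unique up to isomorphism. The Alexander dual $\mathbf A(M)$ of a squarefree module $M$ is the squarefree module with $\mathbf A(M)_R=\mathrm{Hom}_\Bbbk(M_{R^c},\Bbbk)$,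 multiplication by $x_v$ ($v\notin R$) being dual to $x_v:M_{(R\cup\{v\})^c}\to M_{R^c}$; it is applied to complexes by $\mathbf A(X^\bullet)^i=\mathbf A(X^{-i})$. For bounded complexes $F^\bullet$ of free squarefree modules put $\mathbb A(F^\bullet)=\mathrm{res}(\mathbf A(F^\bullet))$ and $\mathbb D(F^\bullet)=\mathrm{Hom}_S(F^\bullet,S(-\mathbf 1))$. A bounded complex of free squarefree modules is pure if, as a singly graded complex, it has the form $S(-d_0)^{\beta_0}\leftarrow S(-d_1)^{\beta_1}\leftarrow\cdots\leftarrow S(-d_r)^{\beta_r}$ (consecutive cohomological positions) with $d_0<\cdots<d_r$ and all $\beta_i\ge1$; the $d_i$ are its degrees. For an integer $d$ put $\overline d=n-d$, and $\overline D=\{\overline d: d\in D\}$ for a set $D$ of integers. A triplet of nonempty subsets $(A,B,C)$ of $\mathbb N_0$ is a balanced degree triplet of type $n$ if there are integers $0\le a,b,c\le n$ such that: (1) $A\subseteq[c,\overline b]$, $B\subseteq[a,\overline c]$, $C\subseteq[b,\overline a]$ and the endpoints of each interval lie in the respective subset; (2) with $e_A=|[c,\overline b]\setminus A|$, $e_B=|[a,\overline c]\setminus B|$, $e_C=|[b,\overline a]\setminus C|$ one has $n=a+b+c+e_A+e_B+e_C$; (3) for each $c\le v\le n$ the number of elements of $[c,v]$ in $A$ is greater than the number of elements of $[c,v]$ not in $\overline B$; likewise for $B$ and $\overline C$ with respect to $a$ (intervals $[a,v]$, $a\le v\le n$), and for $C$ and $\overline A$ with respect to $b$ (intervals $[b,v]$,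 $b\le v\le n$). *)

theory Defs
  imports "HOL-Library.Poly_Mapping" "HOL-Library.Function_Algebras"
begin

section \<open>Graded modules over a polynomial ring\<close>

text \<open>
  The variables of \<open>S = k[x\<^sub>1, \<dots>, x\<^sub>n]\<close> are indexed by \<open>{..<n}\<close>, which plays the
  role of \<open>[n]\<close>. The ring \<open>S\<close> is the subring \<open>polys n\<close> of the polynomials in countably many variables;
  \<open>n = 0\<close> is allowed. Elements of \<open>\<int>\<^sup>n\<close> are functions \<open>nat \<Rightarrow> int\<close> vanishing outside \<open>{..<n}\<close>.
\<close>

type_synonym 'k mpoly = "(nat \<Rightarrow>\<^sub>0 nat) \<Rightarrow>\<^sub>0 'k"
type_synonym mdegree = "nat \<Rightarrow> int"

definition monoms :: "nat \<Rightarrow> (nat \<Rightarrow>\<^sub>0 nat) set" where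
  "monoms n = {u. Poly_Mapping.keys u \<subseteq> {..<n}}"

definition polys :: "nat \<Rightarrow> 'k::field mpoly set" where
  "polys n = {p. Poly_Mapping.keys p \<subseteq> monoms n}"

definition const :: "'k::field \<Rightarrow> 'k mpoly" where
  "const c = Poly_Mapping.single 0 c"

definition sqf_monom :: "nat set \<Rightarrow> 'k::field mpoly" where
  "sqf_monom T = Poly_Mapping.single (\<Sum>i\<in>T. Poly_Mapping.single i 1) 1"

definition fine_deg :: "(nat \<Rightarrow>\<^sub>0 nat) \<Rightarrow> mdegree" where
  "fine_deg u = (\<lambda>i. int (Poly_Mapping.lookup u i))"

definition total_deg :: "(nat \<Rightarrow>\<^sub>0 nat) \<Rightarrow> int" where
  "total_deg u = (\<Sum>i\<in>Poly_Mapping.keys u. int (Poly_Mapping.lookup u i))"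

definition unit_vec :: "nat set \<Rightarrow> mdegree" where
  "unit_vec R = (\<lambda>i. of_bool (i \<in> R))"

definition nonneg_degs :: "nat \<Rightarrow> mdegree set" where
  "nonneg_degs n = {b. (\<forall>i. 0 \<le> b i) \<and> (\<forall>i\<ge>n. b i = 0)}"

definition supp :: "mdegree \<Rightarrow> nat set" where
  "supp b = {i. b i \<noteq> 0}"

text \<open>
  The addition of a module is the one of the type \<open>'m\<close>, of which the module is the subset \<open>carr\<close>.
  The grading group is a type parameter \<open>'g\<close>, and the grading of \<open>S\<close> is given by the degree \<open>w\<close> of
  monomials, since both the fine grading (\<open>fine_deg\<close>) and the standard grading (\<open>total_deg\<close>)
  are needed.
\<close>

record (overloaded) ('k::zero, 'g, 'm) gmod =
  carr :: "'m set"
  scal :: "'k mpoly \<Rightarrow> 'm \<Rightarrow> 'm"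
  hcomp :: "'g \<Rightarrow> 'm set"

locale graded_module =
  fixes n :: nat
    and w :: "(nat \<Rightarrow>\<^sub>0 nat) \<Rightarrow> 'g::ab_group_add"
    and M :: "('k::field, 'g, 'm::ab_group_add) gmod"
  assumes zero_closed: "0 \<in> carr M"
    and add_closed: "\<lbrakk>x \<in> carr M; y \<in> carr M\<rbrakk> \<Longrightarrow> x + y \<in> carr M"
    and scal_closed: "\<lbrakk>p \<in> polys n; x \<in> carr M\<rbrakk> \<Longrightarrow> scal M p x \<in> carr M"
    and scal_right_distrib:
      "\<lbrakk>p \<in> polys n; x \<in> carr M; y \<in> carr M\<rbrakk> \<Longrightarrow> scal M p (x + y) = scal M p x + scal M p y"
    and scal_left_distrib:
      "\<lbrakk>p \<in> polys n; q \<in> polys n; x \<in> carr M\<rbrakk> \<Longrightarrow> scal M (p + q) x = scal M p x + scal M q x"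
    and scal_scal:
      "\<lbrakk>p \<in> polys n; q \<in> polys n; x \<in> carr M\<rbrakk> \<Longrightarrow> scal M p (scal M q x) = scal M (p * q) x"
    and scal_one: "x \<in> carr M \<Longrightarrow> scal M 1 x = x"
    and hcomp_carr: "hcomp M b \<subseteq> carr M"
    and hcomp_zero: "0 \<in> hcomp M b"
    and hcomp_add: "\<lbrakk>x \<in> hcomp M b; y \<in> hcomp M b\<rbrakk> \<Longrightarrow> x + y \<in> hcomp M b"
    and hcomp_scal:
      "\<lbrakk>u \<in> monoms n; x \<in> hcomp M b\<rbrakk> \<Longrightarrow> scal M (Poly_Mapping.single u c) x \<in> hcomp M (w u + b)"
    and direct_sum_decomp:
      "x \<in> carr M \<Longrightarrow>
        \<exists>!y. (\<forall>b. y b \<in> hcomp M b) \<and> finite {b. y b \<noteq> 0} \<and> x = (\<Sum>b | y b \<noteq> 0. y b)"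

definition lin_map ::
  "nat \<Rightarrow> ('k::field, 'g, 'm::ab_group_add) gmod \<Rightarrow> ('k, 'h, 'l::ab_group_add) gmod
    \<Rightarrow> ('m \<Rightarrow> 'l) \<Rightarrow> bool" where
  "lin_map n M N f \<longleftrightarrow>
     (\<forall>x\<in>carr M. f x \<in> carr N) \<and>
     (\<forall>x\<in>carr M. \<forall>y\<in>carr M. f (x + y) = f x + f y) \<and>
     (\<forall>p\<in>polys n. \<forall>x\<in>carr M. f (scal M p x) = scal N p (f x))"

definition graded_hom ::
  "nat \<Rightarrow> ('k::field, 'g, 'm::ab_group_add) gmod \<Rightarrow> ('k, 'g, 'l::ab_group_add) gmod
    \<Rightarrow> ('m \<Rightarrow> 'l) \<Rightarrow> bool" where
  "graded_hom n M N f \<longleftrightarrow> lin_map n M N f \<and> (\<forall>b. f ` hcomp M b \<subseteq> hcomp N b)"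

definition graded_iso ::
  "nat \<Rightarrow> ('k::field, 'g, 'm::ab_group_add) gmod \<Rightarrow> ('k, 'g, 'l::ab_group_add) gmod \<Rightarrow> bool" where
  "graded_iso n M N \<longleftrightarrow>
     (\<exists>f. lin_map n M N f \<and> bij_betw f (carr M) (carr N) \<and> (\<forall>b. f ` hcomp M b = hcomp N b))"

definition S_mod :: "nat \<Rightarrow> ((nat \<Rightarrow>\<^sub>0 nat) \<Rightarrow> 'g) \<Rightarrow> ('k::field, 'g, 'k mpoly) gmod" where
  "S_mod n w =
     \<lparr>carr = polys n, scal = (*), hcomp = (\<lambda>b. {p \<in> polys n. \<forall>u\<in>Poly_Mapping.keys p. w u = b})\<rparr>"

text \<open>\<open>twist M c\<close> is \<open>M(-c)\<close>.\<close>

definition twist :: "('k::zero, 'g::ab_group_add, 'm) gmod \<Rightarrow> 'g \<Rightarrow> ('k, 'g, 'm) gmod" where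
  "twist M c = \<lparr>carr = carr M, scal = scal M, hcomp = (\<lambda>b. hcomp M (b - c))\<rparr>"

definition dsum ::
  "('k::zero, 'g, 'm::zero) gmod list \<Rightarrow> ('k, 'g, nat \<Rightarrow> 'm) gmod" where
  "dsum Ms =
     \<lparr>carr = {f. \<forall>j. if j < length Ms then f j \<in> carr (Ms ! j) else f j = 0},
      scal = (\<lambda>p f j. if j < length Ms then scal (Ms ! j) p (f j) else 0),
      hcomp = (\<lambda>b. {f. \<forall>j. if j < length Ms then f j \<in> hcomp (Ms ! j) b else f j = 0})\<rparr>"

text \<open>The underlying singly graded module: \<open>M\<^sub>d\<close> is the sum of all \<open>M\<^sub>b\<close> with \<open>b\<^sub>1 + \<dots> + b\<^sub>n = d\<close>.\<close>

definition singly_graded ::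
  "nat \<Rightarrow> ('k::zero, mdegree, 'm::ab_group_add) gmod \<Rightarrow> ('k, int, 'm) gmod" where
  "singly_graded n M =
     \<lparr>carr = carr M, scal = scal M,
      hcomp = (\<lambda>d. {\<Sum>b\<in>T. x b | T x. finite T \<and> (\<forall>b\<in>T. (\<Sum>i<n. b i) = d \<and> x b \<in> hcomp M b)})\<rparr>"

definition free_sqf :: "nat \<Rightarrow> ('k::field, mdegree, 'm::ab_group_add) gmod \<Rightarrow> bool" where
  "free_sqf n M \<longleftrightarrow>
     graded_module n fine_deg M \<and>
     (\<exists>Rs. (\<forall>R\<in>set Rs. R \<subseteq> {..<n}) \<and>
        graded_iso n M (dsum (map (\<lambda>R. twist (S_mod n fine_deg) (unit_vec R)) Rs)))"


section \<open>Complexes\<close>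

record (overloaded) ('k::zero, 'm) cplx =
  obj :: "int \<Rightarrow> ('k, mdegree, 'm) gmod"
  diff :: "int \<Rightarrow> 'm \<Rightarrow> 'm"

definition bounded_complex :: "nat \<Rightarrow> ('k::field, 'm::ab_group_add) cplx \<Rightarrow> bool" where
  "bounded_complex n X \<longleftrightarrow>
     (\<forall>i. graded_hom n (obj X i) (obj X (i + 1)) (diff X i)) \<and>
     (\<forall>i. \<forall>x\<in>carr (obj X i). diff X (i + 1) (diff X i x) = 0) \<and>
     (\<exists>N. \<forall>i. \<bar>i\<bar> > N \<longrightarrow> carr (obj X i) = {0})"

definition cocycles :: "('k::zero, 'm::zero) cplx \<Rightarrow> int \<Rightarrow> 'm set" where
  "cocycles X i = {x \<in> carr (obj X i). diff X i x = 0}"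

definition coboundaries :: "('k::zero, 'm) cplx \<Rightarrow> int \<Rightarrow> 'm set" where
  "coboundaries X i = diff X (i - 1) ` carr (obj X (i - 1))"

text \<open>The last two conditions state injectivity and surjectivity of the map induced on cohomology.\<close>

definition quasi_iso ::
  "nat \<Rightarrow> ('k::field, 'm::ab_group_add) cplx \<Rightarrow> ('k, 'l::ab_group_add) cplx
    \<Rightarrow> (int \<Rightarrow> 'm \<Rightarrow> 'l) \<Rightarrow> bool" where
  "quasi_iso n X Y f \<longleftrightarrow>
     (\<forall>i. graded_hom n (obj X i) (obj Y i) (f i)) \<and>
     (\<forall>i. \<forall>x\<in>carr (obj X i). f (i + 1) (diff X i x) = diff Y i (f i x)) \<and>
     (\<forall>i. \<forall>x\<in>cocycles X i. f i x \<in> coboundaries Y i \<longrightarrow> x \<in> coboundaries X i) \<and>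
     (\<forall>i. \<forall>y\<in>cocycles Y i. \<exists>x\<in>cocycles X i. y - f i x \<in> coboundaries Y i)"

definition free_sqf_complex :: "nat \<Rightarrow> ('k::field, 'm::ab_group_add) cplx \<Rightarrow> bool" where
  "free_sqf_complex n F \<longleftrightarrow> bounded_complex n F \<and> (\<forall>i. free_sqf n (obj F i))"

text \<open>\<open>max_ideal_mult n M\<close> is \<open>(x\<^sub>1, \<dots>, x\<^sub>n) M\<close>, the kernel of \<open>M \<rightarrow> M \<otimes> k\<close>.\<close>

definition max_ideal_mult :: "nat \<Rightarrow> ('k::field, 'g, 'm::ab_group_add) gmod \<Rightarrow> 'm set" where
  "max_ideal_mult n M = {\<Sum>i<n. scal M (sqf_monom {i}) (y i) | y. \<forall>i<n. y i \<in> carr M}"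

definition minimal_complex :: "nat \<Rightarrow> ('k::field, 'm::ab_group_add) cplx \<Rightarrow> bool" where
  "minimal_complex n F \<longleftrightarrow>
     (\<forall>i. diff F i ` carr (obj F i) \<subseteq> max_ideal_mult n (obj F (i + 1)))"

text \<open>\<open>is_res n F X\<close>: the complex \<open>F\<close> is (up to isomorphism) \<open>res(X)\<close>.\<close>

definition is_res ::
  "nat \<Rightarrow> ('k::field, 'm::ab_group_add) cplx \<Rightarrow> ('k, 'l::ab_group_add) cplx \<Rightarrow> bool" where
  "is_res n F X \<longleftrightarrow>
     free_sqf_complex n F \<and> minimal_complex n F \<and> (\<exists>f. quasi_iso n F X f)"


section \<open>The two dualities\<close>

text \<open>
  Homomorphisms are extended by \<open>0\<close> outside the carrier, so that equal maps are equal functions.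
  The sign conventions for differentials of dual complexes only change them up to isomorphism;
  no signs are used here.
\<close>

definition Hom_mod ::
  "nat \<Rightarrow> ('k::field, 'g::ab_group_add, 'm::ab_group_add) gmod \<Rightarrow> ('k, 'g, 'l::ab_group_add) gmod
    \<Rightarrow> ('k, 'g, 'm \<Rightarrow> 'l) gmod" where
  "Hom_mod n M N =
     \<lparr>carr = {f. lin_map n M N f \<and> (\<forall>x. x \<notin> carr M \<longrightarrow> f x = 0)},
      scal = (\<lambda>p f x. if x \<in> carr M then scal N p (f x) else 0),
      hcomp = (\<lambda>b. {f. lin_map n M N f \<and> (\<forall>x. x \<notin> carr M \<longrightarrow> f x = 0) \<and>
                      (\<forall>a. f ` hcomp M a \<subseteq> hcomp N (a + b))})\<rparr>"

definition std_dual ::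
  "nat \<Rightarrow> ('k::field, 'm::ab_group_add) cplx \<Rightarrow> ('k, 'm \<Rightarrow> 'k mpoly) cplx" where
  "std_dual n F =
     \<lparr>obj = (\<lambda>i. Hom_mod n (obj F (- i)) (twist (S_mod n fine_deg) (unit_vec {..<n}))),
      diff = (\<lambda>i f x. if x \<in> carr (obj F (- (i + 1))) then f (diff F (- (i + 1)) x) else 0)\<rparr>"

definition dual_space ::
  "('k::field, 'g, 'm::ab_group_add) gmod \<Rightarrow> 'm set \<Rightarrow> ('m \<Rightarrow> 'k) set" where
  "dual_space M V =
     {h. (\<forall>x\<in>V. \<forall>y\<in>V. h (x + y) = h x + h y) \<and>
         (\<forall>c. \<forall>x\<in>V. h (scal M (const c) x) = c * h x) \<and>
         (\<forall>x. x \<notin> V \<longrightarrow> h x = 0)}"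

text \<open>\<open>dual_arg n M b\<close> is the space \<open>M\<^bsub>R\<^sup>c\<^esub>\<close> for \<open>R = supp b\<close>.\<close>

definition dual_arg :: "nat \<Rightarrow> ('k::zero, mdegree, 'm) gmod \<Rightarrow> mdegree \<Rightarrow> 'm set" where
  "dual_arg n M b = hcomp M (unit_vec ({..<n} - supp b))"

text \<open>
  A squarefree module is determined by its components in squarefree degrees: its component in degree
  \<open>b \<in> \<nat>\<^sup>n\<close> is identified with the one in degree \<open>supp b\<close>. So an element of the Alexander dual is a
  finitely supported family \<open>\<phi>\<close> with \<open>\<phi> b\<close> a linear form on \<open>M\<^bsub>R\<^sup>c\<^esub>\<close> for \<open>R = supp b\<close>. A monomial of degree
  \<open>u\<close> maps degree \<open>b - u\<close> to degree \<open>b\<close> by the dual of the multiplication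
  \<open>M\<^bsub>(supp b)\<^sup>c\<^esub> \<rightarrow> M\<^bsub>(supp (b - u))\<^sup>c\<^esub>\<close> by the product of the variables in \<open>supp b - supp (b - u)\<close>; this is the
  composite of the duals of the multiplications by single variables (and of identities).
\<close>

definition alex_mod ::
  "nat \<Rightarrow> ('k::field, mdegree, 'm::ab_group_add) gmod \<Rightarrow> ('k, mdegree, mdegree \<Rightarrow> 'm \<Rightarrow> 'k) gmod" where
  "alex_mod n M =
     (let C = {\<phi>. finite {b. \<phi> b \<noteq> 0} \<and>
                 (\<forall>b. if b \<in> nonneg_degs n then \<phi> b \<in> dual_space M (dual_arg n M b) else \<phi> b = 0)}
      in \<lparr>carr = C,
          scal = (\<lambda>p \<phi> b x. if x \<in> dual_arg n M b then
                    \<Sum>u | u \<in> Poly_Mapping.keys p \<and> b - fine_deg u \<in> nonneg_degs n.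
                      Poly_Mapping.lookup p u *
                      \<phi> (b - fine_deg u) (scal M (sqf_monom (supp b - supp (b - fine_deg u))) x)
                  else 0),
          hcomp = (\<lambda>b. {\<phi> \<in> C. \<forall>a. a \<noteq> b \<longrightarrow> \<phi> a = 0})\<rparr>)"

definition alex_dual ::
  "nat \<Rightarrow> ('k::field, 'm::ab_group_add) cplx \<Rightarrow> ('k, mdegree \<Rightarrow> 'm \<Rightarrow> 'k) cplx" where
  "alex_dual n X =
     \<lparr>obj = (\<lambda>i. alex_mod n (obj X (- i))),
      diff = (\<lambda>i \<phi> b x. if x \<in> dual_arg n (obj X (- (i + 1))) b
                       then \<phi> b (diff X (- (i + 1)) x) else 0)\<rparr>"

text \<open>\<open>is_AD n F G\<close>: the complex \<open>G\<close> is (up to isomorphism) the value at \<open>F\<close> of the composite of the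
  two functors on complexes of free squarefree modules.\<close>

definition is_AD ::
  "nat \<Rightarrow> ('k::field, 'm::ab_group_add) cplx \<Rightarrow> ('k, 'l::ab_group_add) cplx \<Rightarrow> bool" where
  "is_AD n F G \<longleftrightarrow> is_res n G (alex_dual n (std_dual n F))"


section \<open>Pure complexes and degree triplets\<close>

text \<open>
  The term \<open>S(-d\<^sub>0)\<^bsup>\<beta>\<^sub>0\<^esup>\<close> sits in cohomological position \<open>p\<close>; since differentials raise the position
  by one, \<open>S(-d\<^sub>j)\<^bsup>\<beta>\<^sub>j\<^esup>\<close> sits in position \<open>p - j\<close>.
\<close>

definition pure_complex ::
  "nat \<Rightarrow> ('k::field, 'm::ab_group_add) cplx \<Rightarrow> int set \<Rightarrow> bool" where
  "pure_complex n F D \<longleftrightarrow>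
     free_sqf_complex n F \<and>
     (\<exists>(p::int) ds \<beta>.
        ds \<noteq> [] \<and> sorted_wrt (<) ds \<and> set ds = D \<and>
        (\<forall>j<length ds. \<beta> j \<ge> 1 \<and>
           graded_iso n (singly_graded n (obj F (p - int j)))
             (dsum (replicate (\<beta> j) (twist (S_mod n total_deg) (ds ! j))))) \<and>
        (\<forall>i. i > p \<or> i \<le> p - int (length ds) \<longrightarrow> carr (obj F i) = {0}))"

text \<open>
  Truncated subtraction is harmless: the first three conditions force \<open>A\<close>, \<open>B\<close>, \<open>C\<close> into \<open>{..n}\<close>.
\<close>

definition bar :: "nat \<Rightarrow> nat set \<Rightarrow> nat set" where
  "bar n D = (\<lambda>d. n - d) ` D"

definition balanced_degree_triplet :: "nat \<Rightarrow> nat set \<Rightarrow> nat set \<Rightarrow> nat set \<Rightarrow> bool" where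
  "balanced_degree_triplet n A B C \<longleftrightarrow>
     A \<noteq> {} \<and> B \<noteq> {} \<and> C \<noteq> {} \<and>
     (\<exists>a b c. a \<le> n \<and> b \<le> n \<and> c \<le> n \<and>
        (A \<subseteq> {c..n - b} \<and> c \<in> A \<and> n - b \<in> A) \<and>
        (B \<subseteq> {a..n - c} \<and> a \<in> B \<and> n - c \<in> B) \<and>
        (C \<subseteq> {b..n - a} \<and> b \<in> C \<and> n - a \<in> C) \<and>
        n = a + b + c + card ({c..n - b} - A) + card ({a..n - c} - B) + card ({b..n - a} - C) \<and>
        (\<forall>v\<in>{c..n}. card ({c..v} \<inter> A) > card ({c..v} - bar n B)) \<and>
        (\<forall>v\<in>{a..n}. card ({a..v} \<inter> B) > card ({a..v} - bar n C)) \<and>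
        (\<forall>v\<in>{b..n}. card ({b..v} \<inter> C) > card ({b..v} - bar n A)))"

end

(* If B and C are intervals, the triplet is given by a Cohen-Macaulay squarefree module M of codimension a
   with a pure resolution F with degrees A: then A(D(F)) and its second iterate are linear, since F and
   D(F) have cohomology in one position only. To construct F, start from the Koszul complex, whose degrees
   are 0,...,n, and remove the degrees g not in A one after the other. In the spirit of the push-down
   construction of Eisenbud and Schreyer, replace x_i by x_i f_i with general forms f_i of degree d on P^1
   and take the cohomology of the twist by O(dg - 1). With K the forms of degree dg - 1 and E_i their
   residues modulo f_i, this is the cone of F (x) K -> (+)_i F_i (x) E_i, where F_i consists of the terms
   S(-T) with i in T: in degree T it is K -> (+)_{i in T} E_i, which is surjective for |T| <= g, injective
   for |T| >= g, and hence removes exactly the degree g after passing to a minimal complex. Exactness of F in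
   all degrees B with |B| > n - a implies by the long exact sequences of F[P, U], the terms S(-T) with
   P <= T <= U, that F and D(F) are resolutions. The functor A o D is computed by replacing S(-T) with
   the Koszul resolution of S/(x_v : v not in T). *)

theory Submission
  imports Defs "HOL-Computational_Algebra.Polynomial"
begin

section \<open>Finite complexes with a basis\<close>

text \<open>In degree T the map K -> (+) E_i goes from dimension d g to dimension d |T|, so only |T|
  = g can make it bijective; this is the reason for the twist by d g - 1. Each removal costs one
  degree and raises by one the size of B from which exactness is known: n + 1 degrees and |B| > 0 at
  the start become |A| degrees and |B| > n + 1 - |A|. As B and C have no gaps, the balance condition
  gives |A| = a + 1, whence the bound n - a. Everything is done with finite matrices indexed by a
  basis whose elements carry subsets of [n] as labels. Three kinds of subquotients matter: the
  labels inside B give F in degree B, the labels containing B give A(D(F)) in degree B, and a single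
  label gives Tor. Minimization must respect all of them at once, which is why it cancels only pairs
  with equal labels and why order-convex families of labels appear. The Betti numbers of A(D(F))
  with label R are the cohomology of F in the complementary degree; linearity thus becomes a
  vanishing statement, and the endpoints of the linear strands come from min A = c, max A = n - b
  and |A| = a + 1.\<close>

definition vecs :: "'j set \<Rightarrow> ('j \<Rightarrow> 'k::field) set" where
  "vecs Z = {x. \<forall>j. j \<notin> Z \<longrightarrow> x j = 0}"

text \<open>Vectors are rows: \<open>M j l\<close> is the coefficient of the basis element \<open>l\<close> in the image of \<open>j\<close>.\<close>

definition mapp :: "('j \<Rightarrow> 'l \<Rightarrow> 'k::field) \<Rightarrow> 'j set \<Rightarrow> 'l set \<Rightarrow> ('j \<Rightarrow> 'k) \<Rightarrow> 'l \<Rightarrow> 'k" where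
  "mapp M Z Z' x l = (if l \<in> Z' then \<Sum>j\<in>Z. x j * M j l else 0)"

definition gr :: "('j \<Rightarrow> int) \<Rightarrow> 'j set \<Rightarrow> int \<Rightarrow> 'j set" where
  "gr pos Z i = {j \<in> Z. pos j = i}"

definition bcx :: "('j \<Rightarrow> 'j \<Rightarrow> 'k::field) \<Rightarrow> ('j \<Rightarrow> int) \<Rightarrow> 'j set \<Rightarrow> bool" where
  "bcx D pos Z \<longleftrightarrow> finite Z \<and> (\<forall>j\<in>Z. \<forall>l\<in>Z. D j l \<noteq> 0 \<longrightarrow> pos l = pos j + 1) \<and>
     (\<forall>j\<in>Z. \<forall>l\<in>Z. (\<Sum>m\<in>Z. D j m * D m l) = 0)"

text \<open>Exactness is recorded position by position, because the long exact sequences below shift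
  the position and the known range depends on it.\<close>

definition ex_at :: "('j \<Rightarrow> 'j \<Rightarrow> 'k::field) \<Rightarrow> ('j \<Rightarrow> int) \<Rightarrow> 'j set \<Rightarrow> int \<Rightarrow> bool" where
  "ex_at D pos Z i \<longleftrightarrow>
     (\<forall>x\<in>vecs (gr pos Z i). mapp D Z Z x = 0 \<longrightarrow> (\<exists>y\<in>vecs (gr pos Z (i - 1)). mapp D Z Z y = x))"

text \<open>The last two conjuncts are injectivity and surjectivity on cohomology, in the form in
  which \<open>quasi_iso\<close> asks for them; \<open>is_AD_model\<close> transfers them degree by
  degree.\<close>

definition qiso ::
  "('j \<Rightarrow> 'j \<Rightarrow> 'k::field) \<Rightarrow> ('j \<Rightarrow> int) \<Rightarrow> 'j set \<Rightarrow> ('l \<Rightarrow> 'l \<Rightarrow> 'k) \<Rightarrow> ('l \<Rightarrow> int) \<Rightarrow> 'l set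
    \<Rightarrow> ('j \<Rightarrow> 'l \<Rightarrow> 'k) \<Rightarrow> bool" where
  "qiso D pos Z D' pos' Z' \<Phi> \<longleftrightarrow>
     (\<forall>j\<in>Z. \<forall>l\<in>Z'. \<Phi> j l \<noteq> 0 \<longrightarrow> pos' l = pos j) \<and>
     (\<forall>j\<in>Z. \<forall>l\<in>Z'. (\<Sum>m\<in>Z. D j m * \<Phi> m l) = (\<Sum>m\<in>Z'. \<Phi> j m * D' m l)) \<and>
     (\<forall>i. \<forall>x\<in>vecs (gr pos Z i). mapp D Z Z x = 0 \<longrightarrow>
        (\<exists>y\<in>vecs (gr pos' Z' (i - 1)). mapp \<Phi> Z Z' x = mapp D' Z' Z' y) \<longrightarrow>
        (\<exists>y\<in>vecs (gr pos Z (i - 1)). x = mapp D Z Z y)) \<and>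
     (\<forall>i. \<forall>y\<in>vecs (gr pos' Z' i). mapp D' Z' Z' y = 0 \<longrightarrow>
        (\<exists>x\<in>vecs (gr pos Z i). mapp D Z Z x = 0 \<and>
           (\<exists>z\<in>vecs (gr pos' Z' (i - 1)). y = mapp \<Phi> Z Z' x + mapp D' Z' Z' z)))"

lemma ex_at_sucE:
  assumes "ex_at D pos Z (i + 1)" "x \<in> vecs (gr pos Z (i + 1))" "mapp D Z Z x = 0"
  obtains y where "y \<in> vecs (gr pos Z i)" "mapp D Z Z y = x"
  using assms unfolding ex_at_def by fastforce

lemma vecs_0 [simp]: "0 \<in> vecs Z"
  by (simp add: vecs_def)

lemma vecs_add: "x \<in> vecs Z \<Longrightarrow> y \<in> vecs Z \<Longrightarrow> x + y \<in> vecs Z"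
  by (simp add: vecs_def)

lemma vecs_diff: "x \<in> vecs Z \<Longrightarrow> y \<in> vecs Z \<Longrightarrow> x - y \<in> vecs Z"
  by (simp add: vecs_def)

lemma vecs_mono: "x \<in> vecs Z \<Longrightarrow> Z \<subseteq> Z' \<Longrightarrow> x \<in> vecs Z'"
  by (auto simp: vecs_def)

lemma vecs_D: "x \<in> vecs Z \<Longrightarrow> j \<notin> Z \<Longrightarrow> x j = 0"
  by (auto simp: vecs_def)

lemma vecs_gr_D: "x \<in> vecs (gr pos Z i) \<Longrightarrow> x j \<noteq> 0 \<Longrightarrow> j \<in> Z \<and> pos j = i"
  by (auto simp: vecs_def gr_def)

lemma vecs_gr_vecs: "x \<in> vecs (gr pos Z i) \<Longrightarrow> x \<in> vecs Z"
  by (auto simp: vecs_def gr_def)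

lemma gr_mono: "Z \<subseteq> Z' \<Longrightarrow> gr pos Z i \<subseteq> gr pos Z' i"
  by (auto simp: gr_def)

lemma mapp_0 [simp]: "mapp M Z Z' 0 = 0"
  by (auto simp: mapp_def fun_eq_iff)

lemma mapp_add: "mapp M Z Z' (x + y) = mapp M Z Z' x + mapp M Z Z' y"
  by (auto simp: mapp_def fun_eq_iff algebra_simps sum.distrib)

lemma mapp_diff: "mapp M Z Z' (x - y) = mapp M Z Z' x - mapp M Z Z' y"
  by (auto simp: mapp_def fun_eq_iff algebra_simps sum_subtractf)

lemma mapp_vecs: "mapp M Z Z' x \<in> vecs Z'"
  by (simp add: mapp_def vecs_def)

lemma mapp_mapp:
  "mapp N Z' Z'' (mapp M Z Z' x) = mapp (\<lambda>j l. \<Sum>m\<in>Z'. M j m * N m l) Z Z'' x"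
proof
  fix l
  have "(\<Sum>m\<in>Z'. mapp M Z Z' x m * N m l) = (\<Sum>m\<in>Z'. \<Sum>j\<in>Z. x j * M j m * N m l)"
    by (intro sum.cong) (auto simp: mapp_def sum_distrib_right)
  also have "\<dots> = (\<Sum>j\<in>Z. \<Sum>m\<in>Z'. x j * M j m * N m l)"
    by (rule sum.swap)
  finally show "mapp N Z' Z'' (mapp M Z Z' x) l = mapp (\<lambda>j l. \<Sum>m\<in>Z'. M j m * N m l) Z Z'' x l"
    by (simp add: mapp_def[of N] mapp_def[of "\<lambda>j l. \<Sum>m\<in>Z'. M j m * N m l"] sum_distrib_left mult.assoc)
qed

lemma mapp_cong:
  assumes "\<And>j l. j \<in> Z \<Longrightarrow> l \<in> Z' \<Longrightarrow> x j * M j l = x j * N j l"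
  shows "mapp M Z Z' x = mapp N Z Z' x"
  using assms by (auto simp: mapp_def fun_eq_iff intro!: sum.cong)

lemma mapp_gr:
  assumes "\<And>j l. j \<in> Z \<Longrightarrow> l \<in> Z' \<Longrightarrow> M j l \<noteq> 0 \<Longrightarrow> pos' l = pos j + e"
    and "x \<in> vecs (gr pos Z i)"
  shows "mapp M Z Z' x \<in> vecs (gr pos' Z' (i + e))"
  unfolding vecs_def
proof (intro CollectI allI impI)
  fix l assume l: "l \<notin> gr pos' Z' (i + e)"
  show "mapp M Z Z' x l = 0"
  proof (cases "l \<in> Z'")
    case True
    have "x j * M j l = 0" if "j \<in> Z" for j
      using assms(1)[OF that True] assms(2) l True vecs_gr_D[of x pos Z i j]
      by (auto simp: gr_def)
    then show ?thesis unfolding mapp_def by (auto intro!: sum.neutral)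
  qed (simp add: mapp_def)
qed

definition del1 :: "'j \<Rightarrow> 'k::field \<Rightarrow> 'j \<Rightarrow> 'k" where
  "del1 p c j = (if j = p then c else 0)"

lemma del1_same [simp]: "del1 p c p = c"
  by (simp add: del1_def)

lemma del1_vecs: "(c \<noteq> 0 \<Longrightarrow> p \<in> Z) \<Longrightarrow> del1 p c \<in> vecs Z"
  by (auto simp: del1_def vecs_def)

lemma mapp_del1:
  assumes "finite Z" "p \<in> Z" "l \<in> Z'"
  shows "mapp M Z Z' (del1 p c) l = c * M p l"
proof -
  have "(\<Sum>j\<in>Z. del1 p c j * M j l) = (\<Sum>j\<in>Z. if j = p then c * M p l else 0)"
    by (intro sum.cong) (auto simp: del1_def)
  then show ?thesis using assms by (simp add: mapp_def)
qed

lemma bcx_finite: "bcx D pos Z \<Longrightarrow> finite Z"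
  by (simp add: bcx_def)

lemma bcx_pos: "bcx D pos Z \<Longrightarrow> j \<in> Z \<Longrightarrow> l \<in> Z \<Longrightarrow> D j l \<noteq> 0 \<Longrightarrow> pos l = pos j + 1"
  by (auto simp: bcx_def)

lemma bcx_diag: "bcx D pos Z \<Longrightarrow> j \<in> Z \<Longrightarrow> D j j = 0"
  using bcx_pos by fastforce

lemma bcx_dd:
  assumes "bcx D pos Z" shows "mapp D Z Z (mapp D Z Z x) = 0"
proof -
  have "mapp (\<lambda>j l. \<Sum>m\<in>Z. D j m * D m l) Z Z x = mapp (\<lambda>j l. 0) Z Z x"
    using assms by (intro mapp_cong) (auto simp: bcx_def)
  then show ?thesis unfolding mapp_mapp by (simp add: mapp_def fun_eq_iff)
qed

lemma bcx_gr:
  assumes "bcx D pos Z" "x \<in> vecs (gr pos Z i)"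
  shows "mapp D Z Z x \<in> vecs (gr pos Z (i + 1))"
  using assms bcx_pos[OF assms(1)] by (intro mapp_gr) auto

lemma bcx_gr':
  assumes "bcx D pos Z" "x \<in> vecs (gr pos Z (i - 1))"
  shows "mapp D Z Z x \<in> vecs (gr pos Z i)"
  using bcx_gr[OF assms] by simp

text \<open>Convexity says that every path of length two between elements of \<open>W\<close> stays
  in \<open>W\<close>, so the sum for the square of \<open>D\<close> loses only zero terms.\<close>

lemma bcx_subset:
  assumes b: "bcx D pos Z" and "W \<subseteq> Z"
    and convex: "\<And>j m l. j \<in> W \<Longrightarrow> l \<in> W \<Longrightarrow> m \<in> Z \<Longrightarrow> D j m \<noteq> 0 \<Longrightarrow> D m l \<noteq> 0 \<Longrightarrow> m \<in> W"
  shows "bcx D pos W"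
  unfolding bcx_def
proof (intro conjI ballI impI)
  show "finite W" using b \<open>W \<subseteq> Z\<close> finite_subset by (auto simp: bcx_def)
  fix j l assume jl: "j \<in> W" "l \<in> W"
  { assume "D j l \<noteq> 0" then show "pos l = pos j + 1" using b jl \<open>W \<subseteq> Z\<close> unfolding bcx_def by blast }
  have "(\<Sum>m\<in>W. D j m * D m l) = (\<Sum>m\<in>Z. D j m * D m l)"
    using b \<open>W \<subseteq> Z\<close> convex[OF jl] by (intro sum.mono_neutral_left) (auto simp: bcx_def)
  moreover have "(\<Sum>m\<in>Z. D j m * D m l) = 0" using b jl \<open>W \<subseteq> Z\<close> unfolding bcx_def by blast
  ultimately show "(\<Sum>m\<in>W. D j m * D m l) = 0" by simp
qed

definition restr :: "'j set \<Rightarrow> ('j \<Rightarrow> 'k::field) \<Rightarrow> 'j \<Rightarrow> 'k" where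
  "restr W x j = (if j \<in> W then x j else 0)"

lemma restr_gr: "x \<in> vecs (gr pos Z i) \<Longrightarrow> W \<subseteq> Z \<Longrightarrow> restr W x \<in> vecs (gr pos W i)"
  by (auto simp: restr_def vecs_def gr_def)

lemma restr_0 [simp]: "restr W 0 = 0"
  by (auto simp: restr_def fun_eq_iff)

lemma restr_diff: "restr W (x - y) = restr W x - restr W y"
  by (auto simp: restr_def fun_eq_iff)

text \<open>\<open>Z1\<close> spans a subcomplex, with quotient spanned by \<open>Z2\<close>.\<close>

locale split_cx =
  fixes D :: "'j \<Rightarrow> 'j \<Rightarrow> 'k::field" and pos :: "'j \<Rightarrow> int" and Z1 Z2 :: "'j set"
  assumes b: "bcx D pos (Z1 \<union> Z2)" and disj: "Z1 \<inter> Z2 = {}"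
    and closed: "\<And>j l. j \<in> Z1 \<Longrightarrow> l \<in> Z2 \<Longrightarrow> D j l = 0"
begin

abbreviation "Z \<equiv> Z1 \<union> Z2"

lemma fin: "finite Z1" "finite Z2" using bcx_finite[OF b] by auto

lemma bcx1: "bcx D pos Z1" and bcx2: "bcx D pos Z2"
  using b by (rule bcx_subset; use closed in auto)+

lemma app_sub:
  assumes x: "x \<in> vecs Z1" shows "mapp D Z Z x = mapp D Z1 Z1 x"
proof
  fix l
  have "(\<Sum>j\<in>Z. x j * D j l) = (\<Sum>j\<in>Z1. x j * D j l)"
    using fin vecs_D[OF x] by (intro sum.mono_neutral_right) auto
  moreover have "(\<Sum>j\<in>Z1. x j * D j l) = 0" if "l \<in> Z2"
    using closed that by (intro sum.neutral) auto
  ultimately show "mapp D Z Z x l = mapp D Z1 Z1 x l" by (auto simp: mapp_def)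
qed

lemma restr_app: "restr Z2 (mapp D Z Z x) = mapp D Z2 Z2 (restr Z2 x)"
  using fin disj closed by (auto simp: mapp_def fun_eq_iff restr_def sum.union_disjoint)

lemma vecs_split_gr: "x \<in> vecs (gr pos Z i) \<Longrightarrow> restr Z2 x = 0 \<Longrightarrow> x \<in> vecs (gr pos Z1 i)"
  by (auto simp: vecs_def restr_def fun_eq_iff gr_def) metis

lemma restr_id: "x \<in> vecs Z2 \<Longrightarrow> restr Z2 x = x"
  by (auto simp: vecs_def restr_def fun_eq_iff)

lemma sub_vecs: "x \<in> vecs (gr pos Z1 i) \<Longrightarrow> x \<in> vecs (gr pos Z i)"
  and quot_vecs: "x \<in> vecs (gr pos Z2 i) \<Longrightarrow> x \<in> vecs (gr pos Z i)"
  by (auto simp: vecs_def gr_def)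

text \<open>Middle term of the long exact sequence: a primitive of the image in the quotient is
  lifted, and after subtracting its boundary the cocycle lies in the subcomplex.\<close>

lemma ex_total:
  assumes "ex_at D pos Z1 i" "ex_at D pos Z2 i"
  shows "ex_at D pos Z i"
  unfolding ex_at_def
proof (intro ballI impI)
  fix x assume x: "x \<in> vecs (gr pos Z i)" and dx: "mapp D Z Z x = 0"
  have "mapp D Z2 Z2 (restr Z2 x) = 0"
    using restr_app[of x] by (simp add: dx)
  moreover have "restr Z2 x \<in> vecs (gr pos Z2 i)" using x by (rule restr_gr) auto
  ultimately obtain y where y: "y \<in> vecs (gr pos Z2 (i - 1))" "mapp D Z2 Z2 y = restr Z2 x"
    using assms(2) by (auto simp: ex_at_def)
  have yZ: "y \<in> vecs (gr pos Z (i - 1))" using y(1) by (rule quot_vecs)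
  define w where "w = x - mapp D Z Z y"
  have "restr Z2 w = restr Z2 x - restr Z2 (mapp D Z Z y)" unfolding w_def by (rule restr_diff)
  then have "restr Z2 w = 0"
    by (simp add: restr_app restr_id[OF vecs_gr_vecs[OF y(1)]] y(2))
  moreover have "w \<in> vecs (gr pos Z i)"
    unfolding w_def using x bcx_gr'[OF b yZ] by (rule vecs_diff)
  ultimately have w: "w \<in> vecs (gr pos Z1 i)" by (intro vecs_split_gr)
  have "mapp D Z Z w = 0" by (simp add: w_def mapp_diff dx bcx_dd[OF b])
  then have "mapp D Z1 Z1 w = 0" using app_sub[OF vecs_gr_vecs[OF w]] by simp
  then obtain z where z: "z \<in> vecs (gr pos Z1 (i - 1))" "mapp D Z1 Z1 z = w"
    using assms(1) w by (auto simp: ex_at_def)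
  have "mapp D Z Z (y + z) = x"
    by (simp add: mapp_add app_sub[OF vecs_gr_vecs[OF z(1)]] z(2) w_def)
  moreover have "y + z \<in> vecs (gr pos Z (i - 1))" using yZ sub_vecs[OF z(1)] by (rule vecs_add)
  ultimately show "\<exists>y\<in>vecs (gr pos Z (i - 1)). mapp D Z Z y = x" by blast
qed

text \<open>The connecting map H^i(\<open>Z2\<close>) -> H^(i+1)(\<open>Z1\<close>) has target 0, so
  every cocycle of the quotient lifts to a cocycle of the whole complex.\<close>

lemma ex_quot:
  assumes "ex_at D pos Z i" "ex_at D pos Z1 (i + 1)"
  shows "ex_at D pos Z2 i"
  unfolding ex_at_def
proof (intro ballI impI)
  fix x assume x: "x \<in> vecs (gr pos Z2 i)" and dx: "mapp D Z2 Z2 x = 0"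
  have xr: "restr Z2 x = x" by (rule restr_id[OF vecs_gr_vecs[OF x]])
  have "restr Z2 (mapp D Z Z x) = 0" by (simp add: restr_app xr dx)
  then have w: "mapp D Z Z x \<in> vecs (gr pos Z1 (i + 1))"
    using bcx_gr[OF b quot_vecs[OF x]] by (intro vecs_split_gr)
  have "mapp D Z1 Z1 (mapp D Z Z x) = 0"
    using app_sub[OF vecs_gr_vecs[OF w]] bcx_dd[OF b] by simp
  then obtain z where z: "z \<in> vecs (gr pos Z1 i)" "mapp D Z1 Z1 z = mapp D Z Z x"
    by (rule ex_at_sucE[OF assms(2) w])
  have "mapp D Z Z (x - z) = 0" by (simp add: mapp_diff app_sub[OF vecs_gr_vecs[OF z(1)]] z(2))
  moreover have "x - z \<in> vecs (gr pos Z i)" using quot_vecs[OF x] sub_vecs[OF z(1)] by (rule vecs_diff)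
  ultimately obtain y where y: "y \<in> vecs (gr pos Z (i - 1))" "mapp D Z Z y = x - z"
    using assms(1) by (auto simp: ex_at_def)
  have "restr Z2 z = 0" using vecs_gr_vecs[OF z(1)] disj by (auto simp: restr_def fun_eq_iff vecs_def)
  then have "mapp D Z2 Z2 (restr Z2 y) = x"
    using restr_app[of y] by (simp add: y(2) restr_diff xr)
  moreover have "restr Z2 y \<in> vecs (gr pos Z2 (i - 1))" using y(1) by (rule restr_gr) auto
  ultimately show "\<exists>y\<in>vecs (gr pos Z2 (i - 1)). mapp D Z2 Z2 y = x" by blast
qed

text \<open>The connecting map H^(i-1)(\<open>Z2\<close>) -> H^i(\<open>Z1\<close>) has source 0, so
  a primitive in the whole complex can be corrected to lie in the subcomplex.\<close>

lemma ex_sub: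
  assumes "ex_at D pos Z i" "ex_at D pos Z2 (i - 1)"
  shows "ex_at D pos Z1 i"
  unfolding ex_at_def
proof (intro ballI impI)
  fix x assume x: "x \<in> vecs (gr pos Z1 i)" and dx: "mapp D Z1 Z1 x = 0"
  then obtain y where y: "y \<in> vecs (gr pos Z (i - 1))" "mapp D Z Z y = x"
    using assms(1) app_sub[OF vecs_gr_vecs[OF x]] sub_vecs[OF x] by (auto simp: ex_at_def)
  have "restr Z2 x = 0" using vecs_gr_vecs[OF x] disj by (auto simp: restr_def fun_eq_iff vecs_def)
  then have "mapp D Z2 Z2 (restr Z2 y) = 0" using restr_app[of y] by (simp add: y(2))
  moreover have "restr Z2 y \<in> vecs (gr pos Z2 (i - 1))" using y(1) by (rule restr_gr) auto
  ultimately obtain z where z: "z \<in> vecs (gr pos Z2 (i - 1 - 1))" "mapp D Z2 Z2 z = restr Z2 y"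
    using assms(2) by (auto simp: ex_at_def)
  define w where "w = y - mapp D Z Z z"
  have "restr Z2 w = 0"
    unfolding w_def restr_diff by (simp add: restr_app restr_id[OF vecs_gr_vecs[OF z(1)]] z(2))
  moreover have "w \<in> vecs (gr pos Z (i - 1))"
    unfolding w_def using y(1) bcx_gr'[OF b quot_vecs[OF z(1)]] by (rule vecs_diff)
  ultimately have w: "w \<in> vecs (gr pos Z1 (i - 1))" by (intro vecs_split_gr)
  have "mapp D Z1 Z1 w = x"
    using app_sub[OF vecs_gr_vecs[OF w]] by (simp add: w_def mapp_diff y(2) bcx_dd[OF b])
  then show "\<exists>y\<in>vecs (gr pos Z1 (i - 1)). mapp D Z1 Z1 y = x" using w by blast
qed

text \<open>Long exact sequence with an acyclic subcomplex. The matrix in the statement is the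
  projection that forgets the coordinates in \<open>Z1\<close>.\<close>

lemma qiso_quot:
  assumes ex: "\<And>i. ex_at D pos Z1 i"
  shows "qiso D pos Z D pos Z2 (\<lambda>j l. of_bool (j = l))"
proof -
  have app: "mapp (\<lambda>j l. of_bool (j = l)) Z Z2 x = restr Z2 x" for x
    using fin by (auto simp: mapp_def restr_def fun_eq_iff)
  have sum1: "(\<Sum>m\<in>Z. D j m * of_bool (m = l)) = D j l" if "l \<in> Z2" for j l
    using fin that by auto
  have sum2: "(\<Sum>m\<in>Z2. of_bool (j = m) * D m l) = D j l" if "j \<in> Z" "l \<in> Z2" for j l
    using fin that closed[of j l] by auto
  show ?thesis
    unfolding qiso_def
  proof (intro conjI ballI allI impI)
    fix j l assume "j \<in> Z" "l \<in> Z2"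
    show "of_bool (j = l) \<noteq> 0 \<Longrightarrow> pos l = pos j" by (auto split: if_splits)
    show "(\<Sum>m\<in>Z. D j m * of_bool (m = l)) = (\<Sum>m\<in>Z2. of_bool (j = m) * D m l)"
      unfolding sum1[OF \<open>l \<in> Z2\<close>] sum2[OF \<open>j \<in> Z\<close> \<open>l \<in> Z2\<close>] ..
  next
    fix i x assume x: "x \<in> vecs (gr pos Z i)" "mapp D Z Z x = 0"
      and "\<exists>y\<in>vecs (gr pos Z2 (i - 1)). mapp (\<lambda>j l. of_bool (j = l)) Z Z2 x = mapp D Z2 Z2 y"
    then obtain y where y: "y \<in> vecs (gr pos Z2 (i - 1))" "restr Z2 x = mapp D Z2 Z2 y"
      by (auto simp: app)
    define w where "w = x - mapp D Z Z y"
    have "restr Z2 w = 0"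
      by (simp add: w_def restr_diff y(2) restr_app restr_id[OF vecs_gr_vecs[OF y(1)]])
    moreover have "w \<in> vecs (gr pos Z i)"
      unfolding w_def using x(1) bcx_gr'[OF b quot_vecs[OF y(1)]] by (rule vecs_diff)
    ultimately have w: "w \<in> vecs (gr pos Z1 i)" by (intro vecs_split_gr)
    have "mapp D Z1 Z1 w = 0"
      using app_sub[OF vecs_gr_vecs[OF w]] by (simp add: w_def mapp_diff x(2) bcx_dd[OF b])
    then obtain z where z: "z \<in> vecs (gr pos Z1 (i - 1))" "mapp D Z1 Z1 z = w"
      using ex w by (auto simp: ex_at_def)
    show "\<exists>y\<in>vecs (gr pos Z (i - 1)). x = mapp D Z Z y"
    proof
      show "x = mapp D Z Z (y + z)"
        by (simp add: mapp_add app_sub[OF vecs_gr_vecs[OF z(1)]] z(2) w_def)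
      show "y + z \<in> vecs (gr pos Z (i - 1))" using quot_vecs[OF y(1)] sub_vecs[OF z(1)] by (rule vecs_add)
    qed
  next
    fix i y assume y: "y \<in> vecs (gr pos Z2 i)" "mapp D Z2 Z2 y = 0"
    have yr: "restr Z2 y = y" by (rule restr_id[OF vecs_gr_vecs[OF y(1)]])
    have "restr Z2 (mapp D Z Z y) = 0" by (simp add: restr_app yr y)
    then have w: "mapp D Z Z y \<in> vecs (gr pos Z1 (i + 1))"
      using bcx_gr[OF b quot_vecs[OF y(1)]] by (intro vecs_split_gr)
    have "mapp D Z1 Z1 (mapp D Z Z y) = 0"
      using app_sub[OF vecs_gr_vecs[OF w]] bcx_dd[OF b] by simp
    then obtain z where z: "z \<in> vecs (gr pos Z1 i)" "mapp D Z1 Z1 z = mapp D Z Z y"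
      by (rule ex_at_sucE[OF ex w])
    have z0: "restr Z2 z = 0"
      using vecs_gr_vecs[OF z(1)] disj by (auto simp: restr_def fun_eq_iff vecs_def)
    show "\<exists>x\<in>vecs (gr pos Z i). mapp D Z Z x = 0 \<and>
        (\<exists>z\<in>vecs (gr pos Z2 (i - 1)). y = mapp (\<lambda>j l. of_bool (j = l)) Z Z2 x + mapp D Z2 Z2 z)"
    proof (intro bexI conjI)
      show "mapp D Z Z (y - z) = 0" by (simp add: mapp_diff app_sub[OF vecs_gr_vecs[OF z(1)]] z(2))
      show "y - z \<in> vecs (gr pos Z i)" using quot_vecs[OF y(1)] sub_vecs[OF z(1)] by (rule vecs_diff)
      show "y = mapp (\<lambda>j l. of_bool (j = l)) Z Z2 (y - z) + mapp D Z2 Z2 0"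
        by (simp add: app restr_diff yr z0)
    qed simp
  qed
qed

end

lemma ex_at_E:
  assumes "ex_at D pos Z i" "x \<in> vecs (gr pos Z i)" "mapp D Z Z x = 0"
  obtains y where "y \<in> vecs (gr pos Z (i - 1))" "mapp D Z Z y = x"
  using assms unfolding ex_at_def by fastforce

lemma ex_at_trivial:
  fixes D :: "'j \<Rightarrow> 'j \<Rightarrow> 'k::field"
  assumes "\<And>j. j \<in> Z \<Longrightarrow> pos j \<noteq> i" shows "ex_at D pos Z i"
  unfolding ex_at_def
proof (intro ballI impI)
  fix x :: "'j \<Rightarrow> 'k" assume "x \<in> vecs (gr pos Z i)"
  then have "x = 0" using assms by (auto simp: vecs_def gr_def fun_eq_iff)
  then have "mapp D Z Z 0 = x" by simp
  then show "\<exists>y\<in>vecs (gr pos Z (i - 1)). mapp D Z Z y = x" using vecs_0 by blast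
qed

text \<open>A filtration argument: \<open>D\<close> stays within a level of \<open>\<phi>\<close> or
  strictly raises \<open>\<rho>\<close>, so a level with the largest value of \<open>\<rho>\<close>
  is a subcomplex and can be split off. Different levels with equal \<open>\<rho>\<close> do not
  interact.\<close>

lemma ex_at_levels:
  fixes \<rho> :: "'o \<Rightarrow> int"
  assumes "bcx D pos Z"
    and "\<And>j l. j \<in> Z \<Longrightarrow> l \<in> Z \<Longrightarrow> D j l \<noteq> 0 \<Longrightarrow> \<phi> l = \<phi> j \<or> \<rho> (\<phi> l) > \<rho> (\<phi> j)"
    and "\<And>t. t \<in> \<phi> ` Z \<Longrightarrow> ex_at D pos {j \<in> Z. \<phi> j = t} i"
  shows "ex_at D pos Z i"
  using assms
proof (induction "card (\<phi> ` Z)" arbitrary: Z)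
  case 0
  then have "Z = {}" using bcx_finite[OF 0(2)] by simp
  then show ?case by (intro ex_at_trivial) auto
next
  case (Suc m Z)
  have fin: "finite (\<phi> ` Z)" and ne: "\<phi> ` Z \<noteq> {}"
    using Suc.hyps(2) bcx_finite[OF Suc.prems(1)] by auto
  then have "Max (\<rho> ` \<phi> ` Z) \<in> \<rho> ` \<phi> ` Z" by (intro Max_in) auto
  then obtain t where t: "t \<in> \<phi> ` Z" "\<rho> t = Max (\<rho> ` \<phi> ` Z)" by (metis imageE)
  have mx: "\<rho> (\<phi> j) \<le> \<rho> t" if "j \<in> Z" for j
    unfolding t(2) using fin that by (intro Max_ge) auto
  define Z1 Z2 where "Z1 = {j \<in> Z. \<phi> j = t}" and "Z2 = {j \<in> Z. \<phi> j \<noteq> t}"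
  have Z: "Z = Z1 \<union> Z2" by (auto simp: Z1_def Z2_def)
  interpret split_cx D pos Z1 Z2
  proof
    show "bcx D pos (Z1 \<union> Z2)" using Suc.prems(1) Z by simp
    show "Z1 \<inter> Z2 = {}" by (auto simp: Z1_def Z2_def)
    fix j l assume jl: "j \<in> Z1" "l \<in> Z2"
    show "D j l = 0"
    proof (rule ccontr)
      assume "D j l \<noteq> 0"
      then have "\<phi> l = \<phi> j \<or> \<rho> (\<phi> l) > \<rho> (\<phi> j)"
        using jl Suc.prems(2)[of j l] Z by auto
      then show False using jl mx[of l] by (auto simp: Z1_def Z2_def)
    qed
  qed
  have img: "\<phi> ` Z2 = \<phi> ` Z - {t}" by (auto simp: Z2_def)
  have "ex_at D pos Z2 i"
  proof (rule Suc.hyps(1))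
    show "m = card (\<phi> ` Z2)" using Suc.hyps(2) t(1) fin unfolding img by simp
    show "bcx D pos Z2" by (rule bcx2)
    fix j l assume "j \<in> Z2" "l \<in> Z2" "D j l \<noteq> 0"
    then show "\<phi> l = \<phi> j \<or> \<rho> (\<phi> j) < \<rho> (\<phi> l)" using Suc.prems(2)[of j l] by (auto simp: Z2_def)
  next
    fix s assume s: "s \<in> \<phi> ` Z2"
    then have "{j \<in> Z2. \<phi> j = s} = {j \<in> Z. \<phi> j = s}" by (auto simp: Z2_def)
    then show "ex_at D pos {j \<in> Z2. \<phi> j = s} i" using Suc.prems(3)[of s] s by (auto simp: img)
  qed
  moreover have "ex_at D pos Z1 i" unfolding Z1_def by (rule Suc.prems(3)[OF t(1)])
  ultimately show ?case unfolding Z by (intro ex_total)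
qed

text \<open>The factor \<open>c\<close> allows for the sign that a tensor product puts on a Koszul
  strand, and \<open>e\<close> for the shift of such a strand or of one half of a cone.\<close>

lemma ex_at_reindex:
  assumes inj: "inj_on f Z" and c: "c \<noteq> 0"
    and D: "\<And>a b. a \<in> Z \<Longrightarrow> b \<in> Z \<Longrightarrow> D' (f a) (f b) = c * D a b"
    and pos: "\<And>a. a \<in> Z \<Longrightarrow> pos' (f a) = pos a + e"
    and ex: "ex_at D pos Z i"
  shows "ex_at D' pos' (f ` Z) (i + e)"
  unfolding ex_at_def
proof (intro ballI impI)
  fix x assume x: "x \<in> vecs (gr pos' (f ` Z) (i + e))" and dx: "mapp D' (f ` Z) (f ` Z) x = 0"
  define x' where "x' = (\<lambda>a. if a \<in> Z then x (f a) else 0)"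
  have sum_f: "(\<Sum>m\<in>f ` Z. u m * D' m (f b)) = c * (\<Sum>a\<in>Z. u (f a) * D a b)" if "b \<in> Z" for u b
    using inj that by (simp add: sum.reindex D sum_distrib_left algebra_simps)
  have "x' \<in> vecs (gr pos Z i)"
    using vecs_gr_D[OF x] pos by (fastforce simp: x'_def vecs_def gr_def)
  moreover have "mapp D Z Z x' = 0"
  proof
    fix b
    have "mapp D' (f ` Z) (f ` Z) x (f b) = 0" by (simp add: dx)
    then show "mapp D Z Z x' b = 0 b"
      using sum_f[of b x] c by (auto simp: mapp_def x'_def)
  qed
  ultimately obtain y where y: "y \<in> vecs (gr pos Z (i - 1))" "mapp D Z Z y = x'"
    using ex by (rule_tac ex_at_E)
  \<comment> \<open>\<open>D'\<close> is \<open>c\<close> times \<open>D\<close>, so the transported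
    primitive is divided by \<open>c\<close>.\<close>
  define y' where "y' = (\<lambda>l. if l \<in> f ` Z then inverse c * y (inv_into Z f l) else 0)"
  have y'f: "y' (f a) = inverse c * y a" if "a \<in> Z" for a using that inj by (simp add: y'_def)
  have "y' \<in> vecs (gr pos' (f ` Z) (i + e - 1))"
    unfolding vecs_def
  proof (intro CollectI allI impI)
    fix l assume l: "l \<notin> gr pos' (f ` Z) (i + e - 1)"
    show "y' l = 0"
    proof (cases "l \<in> f ` Z")
      case True
      then obtain a where a: "a \<in> Z" "l = f a" by blast
      then have "pos a \<noteq> i - 1" using l pos by (auto simp: gr_def)
      then have "y a = 0" using vecs_gr_D[OF y(1)] by blast
      then show ?thesis using a y'f by simp
    qed (simp add: y'_def)
  qed
  moreover have "mapp D' (f ` Z) (f ` Z) y' = x"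
  proof
    fix l show "mapp D' (f ` Z) (f ` Z) y' l = x l"
    proof (cases "l \<in> f ` Z")
      case True
      then obtain b where b: "b \<in> Z" "l = f b" by blast
      have "(\<Sum>a\<in>Z. y' (f a) * D a b) = inverse c * (\<Sum>a\<in>Z. y a * D a b)"
        by (simp add: y'f sum_distrib_left algebra_simps)
      also have "(\<Sum>a\<in>Z. y a * D a b) = x (f b)"
        using fun_cong[OF y(2), of b] b by (simp add: mapp_def x'_def)
      finally show ?thesis using b sum_f[of b y'] c by (simp add: mapp_def)
    next
      case False
      then show ?thesis using vecs_D[OF vecs_gr_vecs[OF x]] by (simp add: mapp_def)
    qed
  qed
  ultimately show "\<exists>y\<in>vecs (gr pos' (f ` Z) (i + e - 1)). mapp D' (f ` Z) (f ` Z) y = x" by blast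
qed

lemma qiso_chain:
  assumes "qiso D pos Z D' pos' Z' \<Phi>"
  shows "mapp \<Phi> Z Z' (mapp D Z Z x) = mapp D' Z' Z' (mapp \<Phi> Z Z' x)"
  unfolding mapp_mapp using assms by (intro mapp_cong) (auto simp: qiso_def)

lemma qiso_gr:
  assumes "qiso D pos Z D' pos' Z' \<Phi>" "x \<in> vecs (gr pos Z i)"
  shows "mapp \<Phi> Z Z' x \<in> vecs (gr pos' Z' i)"
  using mapp_gr[of Z Z' \<Phi> pos' pos 0 x i] assms by (auto simp: qiso_def)

lemma qiso_inj:
  assumes "qiso D pos Z D' pos' Z' \<Phi>" "x \<in> vecs (gr pos Z i)" "mapp D Z Z x = 0"
    "y \<in> vecs (gr pos' Z' (i - 1))" "mapp \<Phi> Z Z' x = mapp D' Z' Z' y"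
  obtains w where "w \<in> vecs (gr pos Z (i - 1))" "x = mapp D Z Z w"
  using assms unfolding qiso_def by blast

lemma qiso_surj:
  assumes "qiso D pos Z D' pos' Z' \<Phi>" "y \<in> vecs (gr pos' Z' i)" "mapp D' Z' Z' y = 0"
  obtains x z where "x \<in> vecs (gr pos Z i)" "mapp D Z Z x = 0"
    "z \<in> vecs (gr pos' Z' (i - 1))" "y = mapp \<Phi> Z Z' x + mapp D' Z' Z' z"
  using assms unfolding qiso_def by blast

lemma qiso_comp:
  assumes q1: "qiso D pos Z D' pos' Z' \<Phi>" and q2: "qiso D' pos' Z' D'' pos'' Z'' \<Psi>"
    and b: "bcx D' pos' Z'"
  shows "qiso D pos Z D'' pos'' Z'' (\<lambda>j l. \<Sum>m\<in>Z'. \<Phi> j m * \<Psi> m l)"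
    (is "qiso _ _ _ _ _ _ ?C")
proof -
  have app: "mapp ?C Z Z'' x = mapp \<Psi> Z' Z'' (mapp \<Phi> Z Z' x)" for x by (simp add: mapp_mapp)
  show ?thesis
    unfolding qiso_def
  proof (intro conjI ballI allI impI)
    fix j l assume jl: "j \<in> Z" "l \<in> Z''"
    { assume "?C j l \<noteq> 0"
      then obtain m where "m \<in> Z'" "\<Phi> j m * \<Psi> m l \<noteq> 0" by (meson sum.neutral)
      then show "pos'' l = pos j" using q1 q2 jl unfolding qiso_def by (metis mult_zero_left mult_zero_right) }
    have "(\<Sum>m\<in>Z. D j m * ?C m l) = (\<Sum>m'\<in>Z'. (\<Sum>m\<in>Z. D j m * \<Phi> m m') * \<Psi> m' l)"
      by (simp add: sum_distrib_left sum_distrib_right mult.assoc sum.swap[of _ Z Z'])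
    also have "\<dots> = (\<Sum>m'\<in>Z'. (\<Sum>m\<in>Z'. \<Phi> j m * D' m m') * \<Psi> m' l)"
      using q1 jl by (intro sum.cong) (auto simp: qiso_def)
    also have "\<dots> = (\<Sum>m\<in>Z'. \<Sum>m'\<in>Z'. \<Phi> j m * D' m m' * \<Psi> m' l)"
      unfolding sum_distrib_right by (rule sum.swap)
    also have "\<dots> = (\<Sum>m\<in>Z'. \<Phi> j m * (\<Sum>m'\<in>Z'. D' m m' * \<Psi> m' l))"
      by (simp add: sum_distrib_left mult.assoc)
    also have "\<dots> = (\<Sum>m\<in>Z'. \<Phi> j m * (\<Sum>m'\<in>Z''. \<Psi> m m' * D'' m' l))"
      using q2 jl by (intro sum.cong) (auto simp: qiso_def)
    also have "\<dots> = (\<Sum>m\<in>Z'. \<Sum>m'\<in>Z''. \<Phi> j m * \<Psi> m m' * D'' m' l)"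
      by (simp add: sum_distrib_left mult.assoc)
    also have "\<dots> = (\<Sum>m'\<in>Z''. ?C j m' * D'' m' l)"
      unfolding sum_distrib_right by (rule sum.swap)
    finally show "(\<Sum>m\<in>Z. D j m * ?C m l) = (\<Sum>m\<in>Z''. ?C j m * D'' m l)" .
  next
    fix i x assume x: "x \<in> vecs (gr pos Z i)" "mapp D Z Z x = 0"
      and "\<exists>y\<in>vecs (gr pos'' Z'' (i - 1)). mapp ?C Z Z'' x = mapp D'' Z'' Z'' y"
    then obtain y where y: "y \<in> vecs (gr pos'' Z'' (i - 1))"
        "mapp \<Psi> Z' Z'' (mapp \<Phi> Z Z' x) = mapp D'' Z'' Z'' y" by (auto simp: app)
    have "mapp D' Z' Z' (mapp \<Phi> Z Z' x) = 0"
      using qiso_chain[OF q1, of x] by (simp add: x(2))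
    then obtain w where "w \<in> vecs (gr pos' Z' (i - 1))" "mapp \<Phi> Z Z' x = mapp D' Z' Z' w"
      using qiso_inj[OF q2 qiso_gr[OF q1 x(1)] _ y] by blast
    then obtain v where "v \<in> vecs (gr pos Z (i - 1))" "x = mapp D Z Z v"
      using qiso_inj[OF q1 x] by blast
    then show "\<exists>y\<in>vecs (gr pos Z (i - 1)). x = mapp D Z Z y" by blast
  next
    fix i y assume y: "y \<in> vecs (gr pos'' Z'' i)" "mapp D'' Z'' Z'' y = 0"
    obtain x2 z3 where x2: "x2 \<in> vecs (gr pos' Z' i)" "mapp D' Z' Z' x2 = 0"
      and z3: "z3 \<in> vecs (gr pos'' Z'' (i - 1))" "y = mapp \<Psi> Z' Z'' x2 + mapp D'' Z'' Z'' z3"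
      using qiso_surj[OF q2 y] .
    obtain x1 z2 where x1: "x1 \<in> vecs (gr pos Z i)" "mapp D Z Z x1 = 0"
      and z2: "z2 \<in> vecs (gr pos' Z' (i - 1))" "x2 = mapp \<Phi> Z Z' x1 + mapp D' Z' Z' z2"
      using qiso_surj[OF q1 x2] .
    have "y = mapp ?C Z Z'' x1 + mapp D'' Z'' Z'' (mapp \<Psi> Z' Z'' z2 + z3)"
      unfolding z3(2) z2(2) app by (simp add: mapp_add qiso_chain[OF q2] add.assoc)
    moreover have "mapp \<Psi> Z' Z'' z2 + z3 \<in> vecs (gr pos'' Z'' (i - 1))"
      using qiso_gr[OF q2 z2(1)] z3(1) by (rule vecs_add)
    ultimately show "\<exists>x\<in>vecs (gr pos Z i). mapp D Z Z x = 0 \<and>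
        (\<exists>z\<in>vecs (gr pos'' Z'' (i - 1)). y = mapp ?C Z Z'' x + mapp D'' Z'' Z'' z)"
      using x1 by blast
  qed
qed

lemma qiso_ex_iff:
  assumes q: "qiso D pos Z D' pos' Z' \<Phi>"
  shows "ex_at D pos Z i \<longleftrightarrow> ex_at D' pos' Z' i"
proof
  assume ex: "ex_at D pos Z i"
  show "ex_at D' pos' Z' i"
    unfolding ex_at_def
  proof (intro ballI impI)
    fix y assume y: "y \<in> vecs (gr pos' Z' i)" "mapp D' Z' Z' y = 0"
    obtain x z where x: "x \<in> vecs (gr pos Z i)" "mapp D Z Z x = 0"
      and z: "z \<in> vecs (gr pos' Z' (i - 1))" "y = mapp \<Phi> Z Z' x + mapp D' Z' Z' z"
      using qiso_surj[OF q y] .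
    obtain w where w: "w \<in> vecs (gr pos Z (i - 1))" "mapp D Z Z w = x"
      using ex_at_E[OF ex x] .
    have "mapp D' Z' Z' (mapp \<Phi> Z Z' w + z) = y"
      unfolding z(2) w(2)[symmetric] by (simp add: mapp_add qiso_chain[OF q])
    then show "\<exists>z\<in>vecs (gr pos' Z' (i - 1)). mapp D' Z' Z' z = y"
      using vecs_add[OF qiso_gr[OF q w(1)] z(1)] by blast
  qed
next
  assume ex: "ex_at D' pos' Z' i"
  show "ex_at D pos Z i"
    unfolding ex_at_def
  proof (intro ballI impI)
    fix x assume x: "x \<in> vecs (gr pos Z i)" "mapp D Z Z x = 0"
    have "mapp D' Z' Z' (mapp \<Phi> Z Z' x) = 0" using qiso_chain[OF q, of x] by (simp add: x)
    then obtain y where y: "y \<in> vecs (gr pos' Z' (i - 1))" "mapp D' Z' Z' y = mapp \<Phi> Z Z' x"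
      using ex_at_E[OF ex qiso_gr[OF q x(1)]] by blast
    then show "\<exists>y\<in>vecs (gr pos Z (i - 1)). mapp D Z Z y = x"
      using qiso_inj[OF q x y(1)] by metis
  qed
qed

lemma mapp_cong': "(\<And>j l. j \<in> Z \<Longrightarrow> l \<in> Z' \<Longrightarrow> M j l = N j l) \<Longrightarrow> mapp M Z Z' = mapp N Z Z'"
  by (auto simp: mapp_def fun_eq_iff intro!: sum.cong)

lemma qiso_cong:
  assumes q: "qiso D pos Z D' pos' Z' \<Phi>"
    and "\<And>j l. j \<in> Z \<Longrightarrow> l \<in> Z \<Longrightarrow> D j l = E j l"
    and "\<And>j l. j \<in> Z' \<Longrightarrow> l \<in> Z' \<Longrightarrow> D' j l = E' j l"
    and "\<And>j l. j \<in> Z \<Longrightarrow> l \<in> Z' \<Longrightarrow> \<Phi> j l = \<Psi> j l"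
  shows "qiso E pos Z E' pos' Z' \<Psi>"
proof -
  have e: "mapp D Z Z = mapp E Z Z" "mapp D' Z' Z' = mapp E' Z' Z'" "mapp \<Phi> Z Z' = mapp \<Psi> Z Z'"
    by (rule mapp_cong'; use assms in simp)+
  have "(\<Sum>m\<in>Z. E j m * \<Psi> m l) = (\<Sum>m\<in>Z'. \<Psi> j m * E' m l)" if "j \<in> Z" "l \<in> Z'" for j l
  proof -
    have "(\<Sum>m\<in>Z. E j m * \<Psi> m l) = (\<Sum>m\<in>Z. D j m * \<Phi> m l)" using assms that by simp
    also have "\<dots> = (\<Sum>m\<in>Z'. \<Phi> j m * D' m l)" using q that by (auto simp: qiso_def)
    finally show ?thesis using assms that by simp
  qed
  then show ?thesis using q assms(4) unfolding qiso_def e by simp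
qed

lemma qiso_id:
  assumes "bcx D pos Z" shows "qiso D pos Z D pos Z (\<lambda>j l. of_bool (j = l))"
proof -
  interpret split_cx D pos "{}" Z using assms by unfold_locales auto
  show ?thesis using qiso_quot[OF ex_at_trivial] by simp
qed

section \<open>Minimal models\<close>

text \<open>Gaussian elimination: the invertible entry from \<open>p\<close> to \<open>q\<close> is
  cancelled, \<open>E\<close> is the Schur complement, and \<open>\<iota>\<close> corrects each
  remaining \<open>j\<close> by the multiple of \<open>p\<close> that removes \<open>q\<close> from
  its image.\<close>

locale pivot_cx =
  fixes D :: "'j \<Rightarrow> 'j \<Rightarrow> 'k::field" and pos :: "'j \<Rightarrow> int" and Z :: "'j set" and p q :: 'j
  assumes b: "bcx D pos Z" and p: "p \<in> Z" and q: "q \<in> Z" and c: "D p q \<noteq> 0"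
begin

definition "W = Z - {p, q}"
definition "E j l = D j l - D j q / D p q * D p l"
definition "\<iota> j l = of_bool (j = l) - (if l = p then D j q / D p q else 0)"

lemma pq: "p \<noteq> q" using bcx_diag[OF b p] c by auto

lemma W_iff: "l \<in> W \<longleftrightarrow> l \<in> Z \<and> l \<noteq> p \<and> l \<noteq> q" by (auto simp: W_def)

lemma finW: "finite W" and finZ: "finite Z" using bcx_finite[OF b] by (auto simp: W_def)

lemma sumZ: "(\<Sum>m\<in>Z. f m) = f p + f q + (\<Sum>m\<in>W. f m)" for f :: "'j \<Rightarrow> 'k"
proof -
  have "Z = insert p (insert q W)" using p q by (auto simp: W_def)
  then have "(\<Sum>m\<in>Z. f m) = (\<Sum>m\<in>insert p (insert q W). f m)" by simp
  also have "\<dots> = f p + (f q + (\<Sum>m\<in>W. f m))"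
    using finW pq by (subst sum.insert; simp add: W_def)+
  finally show ?thesis by (simp add: add.assoc)
qed

lemma DD: "j \<in> Z \<Longrightarrow> l \<in> Z \<Longrightarrow> (\<Sum>m\<in>Z. D j m * D m l) = 0"
  using b unfolding bcx_def by blast

text \<open>Because of these zeros, sums over \<open>W\<close> may be taken over all of
  \<open>Z\<close>, where the relations for \<open>D\<close> are available.\<close>

lemma E_p: "E p l = 0" and E_q: "E j q = 0" using c by (auto simp: E_def)

lemma E_D: assumes "j \<in> Z" "l \<in> Z" shows "(\<Sum>m\<in>Z. E j m * D m l) = 0"
proof -
  have "(\<Sum>m\<in>Z. E j m * D m l) = (\<Sum>m\<in>Z. D j m * D m l) - D j q / D p q * (\<Sum>m\<in>Z. D p m * D m l)"
    by (simp add: E_def algebra_simps sum_subtractf sum_distrib_left)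
  then show ?thesis using DD assms p by simp
qed

lemma E_pos: assumes "j \<in> Z" "l \<in> Z" "E j l \<noteq> 0" shows "pos l = pos j + 1"
proof (cases "D j l = 0")
  case True
  then have "D j q \<noteq> 0" "D p l \<noteq> 0" using assms by (auto simp: E_def)
  then show ?thesis using bcx_pos[OF b assms(1) q] bcx_pos[OF b p assms(2)] bcx_pos[OF b p q c] by simp
next
  case False then show ?thesis using bcx_pos[OF b assms(1,2)] by simp
qed

lemma W_Z: "j \<in> W \<Longrightarrow> j \<in> Z" by (auto simp: W_def)

lemma bcx_E: "bcx E pos W"
  unfolding bcx_def
proof (intro conjI ballI impI)
  show "finite W" by (rule finW)
  fix j l assume jl: "j \<in> W" "l \<in> W"
  then have jl': "j \<in> Z" "l \<in> Z" by (auto simp: W_def)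
  { assume "E j l \<noteq> 0" then show "pos l = pos j + 1" using E_pos jl' by auto }
  have "(\<Sum>m\<in>W. E j m * E m l) = (\<Sum>m\<in>Z. E j m * E m l)"
    by (simp add: sumZ E_p E_q)
  also have "\<dots> = (\<Sum>m\<in>Z. E j m * D m l) - (\<Sum>m\<in>Z. E j m * D m q) * (D p l / D p q)"
    by (simp add: E_def[of _ l] algebra_simps sum_subtractf sum_distrib_left sum_distrib_right)
  also have "\<dots> = 0" using E_D jl' q by simp
  finally show "(\<Sum>m\<in>W. E j m * E m l) = 0" .
qed

lemma iota_app:
  "mapp \<iota> W Z w l =
    (if l \<in> W then w l else if l = p then - (\<Sum>m\<in>W. w m * D m q) / D p q else 0)"
proof -
  have 1: "(\<Sum>j\<in>W. w j * \<iota> j l) =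
      (\<Sum>j\<in>W. if l = j then w j else 0) - (if l = p then (\<Sum>m\<in>W. w m * D m q) / D p q else 0)"
    by (auto simp: \<iota>_def sum_subtractf algebra_simps sum_divide_distrib intro!: sum.cong)
  show ?thesis using finW p q pq unfolding mapp_def 1 by (auto simp: W_def)
qed

text \<open>This describes the image of \<open>\<iota>\<close>: if \<open>y\<close> has no
  \<open>q\<close>-coordinate, then the vanishing of the \<open>q\<close>-coordinate of its boundary
  determines its \<open>p\<close>-coordinate from the others.\<close>

lemma iota_restr:
  assumes y: "y \<in> vecs Z" "y q = 0" and dy: "mapp D Z Z y q = 0"
  shows "mapp \<iota> W Z (restr W y) = y"
proof
  fix l
  have "(\<Sum>m\<in>W. restr W y m * D m q) = (\<Sum>m\<in>W. y m * D m q)"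
    by (intro sum.cong) (auto simp: restr_def)
  moreover have "y p * D p q + (\<Sum>m\<in>W. y m * D m q) = 0"
    using dy q by (simp add: mapp_def sumZ y(2))
  ultimately have "- (\<Sum>m\<in>W. restr W y m * D m q) / D p q = y p"
    using c by (simp add: field_simps add_eq_0_iff)
  then show "mapp \<iota> W Z (restr W y) l = y l"
    using y vecs_D[OF y(1), of l] by (auto simp: iota_app restr_def W_iff)
qed

lemma iota_eq_D:
  assumes "mapp \<iota> W Z u = mapp \<iota> W Z v" "u \<in> vecs W" "v \<in> vecs W" shows "u = v"
proof
  fix l show "u l = v l"
    using fun_cong[OF assms(1), of l] vecs_D[OF assms(2), of l] vecs_D[OF assms(3), of l]
    by (cases "l \<in> W") (auto simp: iota_app)
qed

lemma iota_chain:
  assumes "j \<in> W" "l \<in> Z"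
  shows "(\<Sum>m\<in>W. E j m * \<iota> m l) = (\<Sum>m\<in>Z. \<iota> j m * D m l)"
proof -
  have j: "j \<in> Z" using assms by (simp add: W_def)
  have "(\<Sum>m\<in>Z. \<iota> j m * D m l) = (\<Sum>m\<in>Z. if j = m then D m l else 0) -
      (\<Sum>m\<in>Z. if m = p then D j q / D p q * D m l else 0)"
    unfolding sum_subtractf[symmetric] by (intro sum.cong) (auto simp: \<iota>_def)
  then have R: "(\<Sum>m\<in>Z. \<iota> j m * D m l) = E j l" using finZ j p by (simp add: E_def)
  have L: "(\<Sum>m\<in>W. E j m * \<iota> m l) = mapp \<iota> W Z (E j) l"
    using assms by (simp add: mapp_def)
  show ?thesis
  proof (cases "l = p")
    case True
    have "E j p * D p q + (\<Sum>m\<in>W. E j m * D m q) = 0"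
      using E_D[OF j q] by (simp add: sumZ E_q)
    then have "- (\<Sum>m\<in>W. E j m * D m q) / D p q = E j p" using c by (simp add: field_simps add_eq_0_iff)
    then show ?thesis using True unfolding L R by (simp add: iota_app W_iff)
  next
    case False
    then show ?thesis using assms E_q unfolding L R by (auto simp: iota_app W_iff)
  qed
qed

lemma iota_pos: assumes "j \<in> W" "l \<in> Z" "\<iota> j l \<noteq> 0" shows "pos l = pos j"
proof (cases "j = l")
  case False
  then have "l = p" "D j q \<noteq> 0" using assms(3) by (auto simp: \<iota>_def split: if_splits)
  then show ?thesis using bcx_pos[OF b p q c] bcx_pos[OF b W_Z[OF assms(1)] q] by simp
qed simp

lemma chain_vec: "mapp \<iota> W Z (mapp E W W x) = mapp D Z Z (mapp \<iota> W Z x)"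
  unfolding mapp_mapp by (intro mapp_cong) (simp add: iota_chain)

text \<open>The entry \<open>D p q\<close> is invertible, so a multiple of \<open>p\<close> has a
  boundary with any prescribed \<open>q\<close>-coordinate. Cocycles and primitives can therefore be
  moved into the range of \<open>iota_restr\<close>.\<close>

lemma kill_q:
  assumes y: "y \<in> vecs (gr pos Z i)"
  obtains z where "z \<in> vecs (gr pos Z (i - 1))" "(y - mapp D Z Z z) q = 0"
proof
  let ?z = "del1 p (y q / D p q)"
  have "pos q = pos p + 1" using bcx_pos[OF b p q c] .
  then show "?z \<in> vecs (gr pos Z (i - 1))"
    using vecs_gr_D[OF y, of q] p by (intro del1_vecs) (auto simp: gr_def)
  show "(y - mapp D Z Z ?z) q = 0"
    using mapp_del1[OF finZ p q, of D "y q / D p q"] c by simp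
qed

lemma elim_qiso: "qiso E pos W D pos Z \<iota>"
  unfolding qiso_def
proof (intro conjI ballI allI impI)
  fix j l assume jl: "j \<in> W" "l \<in> Z"
  { assume "\<iota> j l \<noteq> 0" then show "pos l = pos j" using iota_pos jl by auto }
  show "(\<Sum>m\<in>W. E j m * \<iota> m l) = (\<Sum>m\<in>Z. \<iota> j m * D m l)" by (rule iota_chain[OF jl])
next
  fix i x assume x: "x \<in> vecs (gr pos W i)" "mapp E W W x = 0"
    and "\<exists>y\<in>vecs (gr pos Z (i - 1)). mapp \<iota> W Z x = mapp D Z Z y"
  then obtain y where y: "y \<in> vecs (gr pos Z (i - 1))" "mapp \<iota> W Z x = mapp D Z Z y" by blast
  obtain z where z: "z \<in> vecs (gr pos Z (i - 1 - 1))" "(y - mapp D Z Z z) q = 0"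
    using kill_q[OF y(1)] .
  define w where "w = y - mapp D Z Z z"
  have w: "w \<in> vecs (gr pos Z (i - 1))"
    unfolding w_def using y(1) bcx_gr'[OF b z(1)] by (rule vecs_diff)
  have dw: "mapp D Z Z w = mapp \<iota> W Z x" by (simp add: w_def mapp_diff y(2) bcx_dd[OF b])
  have "mapp \<iota> W Z (restr W w) = w"
  proof (rule iota_restr)
    show "w q = 0" using z(2) by (simp add: w_def)
    show "mapp D Z Z w q = 0" unfolding dw by (auto simp: iota_app W_iff pq[symmetric])
  qed (rule vecs_gr_vecs[OF w])
  then have "mapp \<iota> W Z (mapp E W W (restr W w)) = mapp \<iota> W Z x" by (simp add: chain_vec dw)
  then have "mapp E W W (restr W w) = x"
    by (rule iota_eq_D) (auto simp: mapp_vecs intro: vecs_gr_vecs[OF x(1)])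
  moreover have "restr W w \<in> vecs (gr pos W (i - 1))"
    using w by (rule restr_gr) (auto simp: W_def)
  ultimately show "\<exists>y\<in>vecs (gr pos W (i - 1)). x = mapp E W W y" by blast
next
  fix i y assume y: "y \<in> vecs (gr pos Z i)" "mapp D Z Z y = 0"
  obtain z where z: "z \<in> vecs (gr pos Z (i - 1))" "(y - mapp D Z Z z) q = 0"
    using kill_q[OF y(1)] .
  define w where "w = y - mapp D Z Z z"
  have w: "w \<in> vecs (gr pos Z i)"
    unfolding w_def using y(1) bcx_gr'[OF b z(1)] by (rule vecs_diff)
  have dw: "mapp D Z Z w = 0" by (simp add: w_def mapp_diff y(2) bcx_dd[OF b])
  have iw: "mapp \<iota> W Z (restr W w) = w"
  proof (rule iota_restr)
    show "w q = 0" using z(2) by (simp add: w_def)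
  qed (auto simp: dw intro: vecs_gr_vecs[OF w])
  have "mapp \<iota> W Z (mapp E W W (restr W w)) = mapp \<iota> W Z 0" by (simp add: chain_vec dw iw)
  then have "mapp E W W (restr W w) = 0"
    by (rule iota_eq_D) (auto simp: mapp_vecs)
  moreover have "restr W w \<in> vecs (gr pos W i)"
    using w by (rule restr_gr) (auto simp: W_def)
  moreover have "y = mapp \<iota> W Z (restr W w) + mapp D Z Z z" by (simp add: iw) (simp add: w_def)
  ultimately show "\<exists>x\<in>vecs (gr pos W i). mapp E W W x = 0 \<and>
      (\<exists>z\<in>vecs (gr pos Z (i - 1)). y = mapp \<iota> W Z x + mapp D Z Z z)"
    using z(1) by blast
qed

end

text \<open>Differentials only shrink labels, so these are the families of labels whose basis
  elements span a subquotient of the complex.\<close>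

definition order_convex :: "nat set set \<Rightarrow> bool" where
  "order_convex \<Z> \<longleftrightarrow> (\<forall>S\<in>\<Z>. \<forall>U\<in>\<Z>. \<forall>T. S \<subseteq> T \<longrightarrow> T \<subseteq> U \<longrightarrow> T \<in> \<Z>)"

definition lab :: "'j set \<Rightarrow> ('j \<Rightarrow> nat set) \<Rightarrow> nat set set \<Rightarrow> 'j set" where
  "lab J \<tau> \<Z> = {j \<in> J. \<tau> j \<in> \<Z>}"

text \<open>A finite complex of free squarefree modules with a chosen basis: the basis element \<open>j\<close> generates a
  copy of \<open>S(-\<tau> j)\<close> in position \<open>pos j\<close>, and it is mapped to the sum of the
  \<open>D j l \<cdot> x\<^bsup>\<tau> j - \<tau> l\<^esup> \<cdot> l\<close>. The basis elements in \<open>lab J \<tau> {T. T \<subseteq> B}\<close> span the component of degree \<open>B\<close>.\<close>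

definition sqc ::
  "nat \<Rightarrow> 'j set \<Rightarrow> ('j \<Rightarrow> nat set) \<Rightarrow> ('j \<Rightarrow> int) \<Rightarrow> ('j \<Rightarrow> 'j \<Rightarrow> 'k::field) \<Rightarrow> bool" where
  "sqc n J \<tau> pos D \<longleftrightarrow> bcx D pos J \<and> (\<forall>j\<in>J. \<tau> j \<subseteq> {..<n}) \<and>
     (\<forall>j\<in>J. \<forall>l\<in>J. D j l \<noteq> 0 \<longrightarrow> \<tau> l \<subseteq> \<tau> j)"

text \<open>An entry between equal labels is a scalar, any other entry is multiplied by a nontrivial
  monomial; hence this is the vanishing of the differential modulo the variables.\<close>

definition min_sqc :: "'j set \<Rightarrow> ('j \<Rightarrow> nat set) \<Rightarrow> ('j \<Rightarrow> 'j \<Rightarrow> 'k::field) \<Rightarrow> bool" where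
  "min_sqc J \<tau> D \<longleftrightarrow> (\<forall>j\<in>J. \<forall>l\<in>J. D j l \<noteq> 0 \<longrightarrow> \<tau> l \<noteq> \<tau> j)"

lemma lab_subset: "lab J \<tau> \<Z> \<subseteq> J" by (auto simp: lab_def)

lemma sqc_bcx: "sqc n J \<tau> pos D \<Longrightarrow> bcx D pos J" by (simp add: sqc_def)

lemma sqc_tau: "sqc n J \<tau> pos D \<Longrightarrow> j \<in> J \<Longrightarrow> \<tau> j \<subseteq> {..<n}" by (auto simp: sqc_def)

lemma sqc_D: "sqc n J \<tau> pos D \<Longrightarrow> j \<in> J \<Longrightarrow> l \<in> J \<Longrightarrow> D j l \<noteq> 0 \<Longrightarrow> \<tau> l \<subseteq> \<tau> j"
  unfolding sqc_def by blast

lemma order_convex_D: "order_convex \<Z> \<Longrightarrow> S \<in> \<Z> \<Longrightarrow> U \<in> \<Z> \<Longrightarrow> S \<subseteq> T \<Longrightarrow> T \<subseteq> U \<Longrightarrow> T \<in> \<Z>"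
  unfolding order_convex_def by blast

lemma sqc_lab_bcx:
  assumes s: "sqc n J \<tau> pos D" and co: "order_convex \<Z>"
  shows "bcx D pos (lab J \<tau> \<Z>)"
proof (rule bcx_subset[OF sqc_bcx[OF s] lab_subset])
  fix j m l assume *: "j \<in> lab J \<tau> \<Z>" "l \<in> lab J \<tau> \<Z>" "m \<in> J" "D j m \<noteq> 0" "D m l \<noteq> 0"
  then have "\<tau> m \<subseteq> \<tau> j" "\<tau> l \<subseteq> \<tau> m" using sqc_D[OF s] by (auto simp: lab_def)
  moreover have "\<tau> l \<in> \<Z>" "\<tau> j \<in> \<Z>" using * by (auto simp: lab_def)
  ultimately have "\<tau> m \<in> \<Z>" using order_convex_D[OF co] by blast
  then show "m \<in> lab J \<tau> \<Z>" using * by (simp add: lab_def)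
qed

text \<open>Cancelling only pairs with equal labels makes one matrix \<open>\<iota>\<close> work for
  all order-convex families: a single label reads off the generators, the labels inside B the
  component of degree B. Choosing \<open>J'\<close> inside \<open>J\<close> keeps labels and
  positions.\<close>

theorem minimal_model:
  fixes D :: "'j \<Rightarrow> 'j \<Rightarrow> 'k::field"
  assumes "sqc n J \<tau> pos D"
  shows "\<exists>J' E \<iota>. J' \<subseteq> J \<and> sqc n J' \<tau> pos E \<and> min_sqc J' \<tau> E \<and>
     (\<forall>j\<in>J'. \<forall>l\<in>J. \<iota> j l \<noteq> 0 \<longrightarrow> \<tau> l \<subseteq> \<tau> j) \<and>
     (\<forall>\<Z>. order_convex \<Z> \<longrightarrow> qiso E pos (lab J' \<tau> \<Z>) D pos (lab J \<tau> \<Z>) \<iota>)"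
  using assms
proof (induction "card J" arbitrary: J D rule: less_induct)
  case (less J D)
  note s = less.prems
  show ?case
  proof (cases "min_sqc J \<tau> D")
    case True
    show ?thesis
      by (rule exI[of _ J], rule exI[of _ D], rule exI[of _ "\<lambda>j l. of_bool (j = l)"])
        (use s True qiso_id[OF sqc_lab_bcx[OF s]] in auto)
  next
    case False
    then obtain p q where pq: "p \<in> J" "q \<in> J" "D p q \<noteq> 0" "\<tau> q = \<tau> p" by (auto simp: min_sqc_def)
    interpret P: pivot_cx D pos J p q using sqc_bcx[OF s] pq by unfold_locales
    have E: "\<tau> l \<subseteq> \<tau> j" if "j \<in> J" "l \<in> J" "P.E j l \<noteq> 0" for j l
    proof (cases "D j l = 0")
      case True
      then have "D j q \<noteq> 0" "D p l \<noteq> 0" using that by (auto simp: P.E_def)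
      then show ?thesis using sqc_D[OF s that(1) pq(2)] sqc_D[OF s pq(1) that(2)] pq(4) by simp
    qed (use sqc_D[OF s] that in blast)
    have i: "\<tau> l \<subseteq> \<tau> j" if "j \<in> P.W" "l \<in> J" "P.\<iota> j l \<noteq> 0" for j l
    proof (cases "j = l")
      case False
      then have "l = p" "D j q \<noteq> 0" using that by (auto simp: P.\<iota>_def split: if_splits)
      then show ?thesis using sqc_D[OF s P.W_Z[OF that(1)] pq(2)] pq(4) by simp
    qed simp
    have sE: "sqc n P.W \<tau> pos P.E"
      unfolding sqc_def using P.bcx_E E[OF P.W_Z P.W_Z] sqc_tau[OF s P.W_Z] by blast
    have "card P.W < card J" unfolding P.W_def using pq P.finZ by (intro psubset_card_mono) auto
    then obtain J' E' \<kappa> where J': "J' \<subseteq> P.W" "sqc n J' \<tau> pos E'" "min_sqc J' \<tau> E'"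
      "\<And>j l. j \<in> J' \<Longrightarrow> l \<in> P.W \<Longrightarrow> \<kappa> j l \<noteq> 0 \<Longrightarrow> \<tau> l \<subseteq> \<tau> j"
      "\<And>\<Z>. order_convex \<Z> \<Longrightarrow> qiso E' pos (lab J' \<tau> \<Z>) P.E pos (lab P.W \<tau> \<Z>) \<kappa>"
      using less.hyps[OF _ sE] by blast
    define \<nu> where "\<nu> = (\<lambda>j l. \<Sum>m\<in>P.W. \<kappa> j m * P.\<iota> m l)"
    have \<nu>: "\<tau> l \<subseteq> \<tau> j" if jl: "j \<in> J'" "l \<in> J" "\<nu> j l \<noteq> 0" for j l
    proof -
      obtain m where "m \<in> P.W" "\<kappa> j m * P.\<iota> m l \<noteq> 0"
        using jl(3) unfolding \<nu>_def by (meson sum.neutral)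
      then show ?thesis using J'(4)[OF jl(1), of m] i[OF _ jl(2), of m] by auto
    qed
    have "qiso E' pos (lab J' \<tau> \<Z>) D pos (lab J \<tau> \<Z>) \<nu>" if co: "order_convex \<Z>" for \<Z>
    proof -
      \<comment> \<open>As \<open>p\<close> and \<open>q\<close> have the same label, the family
        contains both, and then the elimination takes place inside it, or neither.\<close>
      have Q: "qiso P.E pos (lab P.W \<tau> \<Z>) D pos (lab J \<tau> \<Z>) P.\<iota>"
      proof (cases "\<tau> p \<in> \<Z>")
        case True
        interpret Q: pivot_cx D pos "lab J \<tau> \<Z>" p q
          using sqc_lab_bcx[OF s co] pq True by unfold_locales (auto simp: lab_def)
        have "Q.W = lab P.W \<tau> \<Z>" unfolding Q.W_def P.W_def by (auto simp: lab_def)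
        moreover have "Q.E = P.E" by (auto simp: Q.E_def P.E_def fun_eq_iff)
        moreover have "Q.\<iota> = P.\<iota>" by (auto simp: Q.\<iota>_def P.\<iota>_def fun_eq_iff)
        ultimately show ?thesis using Q.elim_qiso by simp
      next
        case False
        have eq: "lab P.W \<tau> \<Z> = lab J \<tau> \<Z>" using False pq by (auto simp: lab_def P.W_def)
        \<comment> \<open>A correction term would need
          \<open>\<tau> l \<subseteq> \<tau> p \<subseteq> \<tau> j\<close>, and convexity would
          then put the label of \<open>p\<close> into the family.\<close>
        have "P.E j l = D j l" if "j \<in> lab J \<tau> \<Z>" "l \<in> lab J \<tau> \<Z>" for j l
        proof (rule ccontr)
          assume "P.E j l \<noteq> D j l"
          then have "D j q \<noteq> 0" "D p l \<noteq> 0" by (auto simp: P.E_def)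
          then have "\<tau> l \<subseteq> \<tau> p" "\<tau> p \<subseteq> \<tau> j"
            using sqc_D[OF s] that pq by (auto simp: lab_def)
          moreover have "\<tau> l \<in> \<Z>" "\<tau> j \<in> \<Z>" using that by (auto simp: lab_def)
          ultimately show False using False order_convex_D[OF co] by blast
        qed
        moreover have "P.\<iota> j l = of_bool (j = l)" if "l \<in> lab J \<tau> \<Z>" for j l
          using that False by (auto simp: P.\<iota>_def lab_def)
        ultimately show ?thesis
          unfolding eq by (intro qiso_cong[OF qiso_id[OF sqc_lab_bcx[OF s co]]]) auto
      qed
      have "qiso E' pos (lab J' \<tau> \<Z>) D pos (lab J \<tau> \<Z>) (\<lambda>j l. \<Sum>m\<in>lab P.W \<tau> \<Z>. \<kappa> j m * P.\<iota> m l)"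
        by (rule qiso_comp[OF J'(5)[OF co] Q sqc_lab_bcx[OF sE co]])
      then show ?thesis
      proof (rule qiso_cong)
        fix j l assume jl: "j \<in> lab J' \<tau> \<Z>" "l \<in> lab J \<tau> \<Z>"
        \<comment> \<open>\<open>\<nu>\<close> sums over all of \<open>P.W\<close> to be independent
          of the family. The additional terms vanish: both factors shrink labels, so
          \<open>m\<close> would lie between two labels of the family.\<close>
        show "(\<Sum>m\<in>lab P.W \<tau> \<Z>. \<kappa> j m * P.\<iota> m l) = \<nu> j l"
          unfolding \<nu>_def
        proof (rule sum.mono_neutral_left)
          show "\<forall>m\<in>P.W - lab P.W \<tau> \<Z>. \<kappa> j m * P.\<iota> m l = 0"
          proof
            fix m assume m: "m \<in> P.W - lab P.W \<tau> \<Z>"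
            show "\<kappa> j m * P.\<iota> m l = 0"
            proof (rule ccontr)
              assume "\<kappa> j m * P.\<iota> m l \<noteq> 0"
              then have "\<tau> m \<subseteq> \<tau> j" "\<tau> l \<subseteq> \<tau> m"
                using J'(4)[of j m] i[of m l] jl m by (auto simp: lab_def)
              moreover have "\<tau> l \<in> \<Z>" "\<tau> j \<in> \<Z>" "\<tau> m \<notin> \<Z>" using jl m by (auto simp: lab_def)
              ultimately show False using order_convex_D[OF co] by blast
            qed
          qed
        qed (use P.finW in \<open>auto simp: lab_def\<close>)
      qed simp_all
    qed
    moreover have "J' \<subseteq> J" using J'(1) by (auto simp: P.W_def)
    ultimately show ?thesis using J'(2,3) \<nu> by blast
  qed
qed

section \<open>Acyclicity\<close>

definition iv :: "nat set \<Rightarrow> nat set \<Rightarrow> nat set set" where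
  "iv P U = {T. P \<subseteq> T \<and> T \<subseteq> U}"

lemma order_convex_iv [simp]: "order_convex (iv P U)"
  by (auto simp: order_convex_def iv_def)

lemma order_convex_single [simp]: "order_convex {T}"
  by (auto simp: order_convex_def)

text \<open>Deletion and contraction of \<open>v\<close>: differentials cannot add \<open>v\<close>
  to a label, so the labels without \<open>v\<close> give a subcomplex and those with
  \<open>v\<close> the quotient.\<close>

lemma split_interval:
  assumes s: "sqc n J \<tau> pos D" and v: "v \<notin> U"
  shows "split_cx D pos (lab J \<tau> (iv P U)) (lab J \<tau> (iv (insert v P) (insert v U)))"
    and "v \<notin> P \<Longrightarrow> lab J \<tau> (iv P U) \<union> lab J \<tau> (iv (insert v P) (insert v U)) = lab J \<tau> (iv P (insert v U))"
proof -
  show *: "lab J \<tau> (iv P U) \<union> lab J \<tau> (iv (insert v P) (insert v U)) = lab J \<tau> (iv P (insert v U))"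
    using v by (auto simp: lab_def iv_def)
  show "split_cx D pos (lab J \<tau> (iv P U)) (lab J \<tau> (iv (insert v P) (insert v U)))"
  proof
    show "bcx D pos (lab J \<tau> (iv P U) \<union> lab J \<tau> (iv (insert v P) (insert v U)))"
      unfolding * by (rule sqc_lab_bcx[OF s]) simp
    show "lab J \<tau> (iv P U) \<inter> lab J \<tau> (iv (insert v P) (insert v U)) = {}"
      using v by (auto simp: lab_def iv_def)
    fix j l assume "j \<in> lab J \<tau> (iv P U)" "l \<in> lab J \<tau> (iv (insert v P) (insert v U))"
    then show "D j l = 0" using sqc_D[OF s, of j l] v by (auto simp: lab_def iv_def)
  qed
qed

text \<open>The hypothesis \<open>ex\<close> bounds the dimension of the cohomology by n - a, and
  \<open>pos\<close> bounds the length of the complex by a. As in the classical acyclicity lemma,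
  this leaves cohomology only at one end, both for the complex and for its dual.\<close>

locale acyclicity =
  fixes n a :: nat and J :: "'j set" and \<tau> :: "'j \<Rightarrow> nat set" and pos :: "'j \<Rightarrow> int"
    and D :: "'j \<Rightarrow> 'j \<Rightarrow> 'k::field"
  assumes s: "sqc n J \<tau> pos D" and an: "a \<le> n"
    and pos: "\<And>j. j \<in> J \<Longrightarrow> - int a \<le> pos j \<and> pos j \<le> 0"
    and ex: "\<And>B i. B \<subseteq> {..<n} \<Longrightarrow> card B > n - a \<Longrightarrow> ex_at D pos (lab J \<tau> (iv {} B)) i"
begin

abbreviation "V P U \<equiv> lab J \<tau> (iv P U)"

lemma trivial_low: "i < - int a \<Longrightarrow> ex_at D pos (V P U) i"
  using pos by (intro ex_at_trivial) (fastforce simp: lab_def)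

lemma trivial_high: "i > 0 \<Longrightarrow> ex_at D pos (V P U) i"
  using pos by (intro ex_at_trivial) (fastforce simp: lab_def)

text \<open>Adding \<open>v\<close> to \<open>P\<close> gives the quotient of the interval from
  \<open>P\<close> to \<open>P \<union> insert v R\<close> by the one from \<open>P\<close> to
  \<open>P \<union> R\<close>; in both of these the free part is still large enough.\<close>

lemma exact_large:
  assumes "finite P" "P \<subseteq> {..<n}" "R \<subseteq> {..<n}" "P \<inter> R = {}" "card R > n - a"
  shows "ex_at D pos (V P (P \<union> R)) i"
  using assms
proof (induction P arbitrary: R i rule: finite_induct)
  case (empty R i)
  then show ?case using ex by simp
next
  case (insert v P R i)
  have v: "v \<notin> P \<union> R" using insert by auto
  interpret split_cx D pos "V P (P \<union> R)" "V (insert v P) (insert v (P \<union> R))"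
    by (rule split_interval[OF s v])
  have "ex_at D pos (V P (P \<union> insert v R)) i"
    using insert.prems insert.hyps v finite_subset[of R "{..<n}"] by (intro insert.IH) auto
  then have "ex_at D pos (V P (P \<union> R) \<union> V (insert v P) (insert v (P \<union> R))) i"
    using split_interval(2)[OF s v] v by auto
  moreover have "ex_at D pos (V P (P \<union> R)) (i + 1)"
    using insert.prems insert.hyps by (intro insert.IH) auto
  ultimately show ?case using ex_quot by simp
qed

text \<open>The complement \<open>Q\<close> of \<open>P \<union> R\<close> decreases when the long exact sequence is used to move an
  element from \<open>Q\<close> to \<open>P\<close> or \<open>R\<close>.\<close>

lemma exact_low:
  assumes "P \<subseteq> {..<n}" "R \<subseteq> {..<n}" "P \<inter> R = {}" "i < - int (card P)"
  shows "ex_at D pos (V P (P \<union> R)) i"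
  using assms
proof (induction "card ({..<n} - (P \<union> R))" arbitrary: P R i)
  case (0 P R i)
  then have PR: "P \<union> R = {..<n}" by auto
  have fin: "finite P" "finite R" using 0 by (auto intro: finite_subset[OF _ finite_lessThan])
  show ?case
  proof (cases "card R > n - a")
    case True
    then show ?thesis using exact_large[OF fin(1)] 0 by simp
  next
    case False
    \<comment> \<open>Here |R| <= n - a, so |P| >= a and \<open>i\<close> lies below all
      positions.\<close>
    have "card P + card R = n" using PR fin 0 by (metis card_Un_disjoint card_lessThan)
    then show ?thesis using False 0(5) an by (intro trivial_low) linarith
  qed
next
  case (Suc m P R i)
  have finPR: "finite P" "finite R" using Suc.prems by (auto intro: finite_subset[OF _ finite_lessThan])
  obtain v where v: "v < n" "v \<notin> P \<union> R"
  proof -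
    have "{..<n} - (P \<union> R) \<noteq> {}" using Suc.hyps(2) by (metis card.empty nat.distinct(1))
    then show ?thesis using that by blast
  qed
  interpret split_cx D pos "V P (P \<union> R)" "V (insert v P) (insert v (P \<union> R))"
    by (rule split_interval[OF s v(2)])
  have c: "m = card ({..<n} - insert v (P \<union> R))"
  proof -
    have "{..<n} - insert v (P \<union> R) = ({..<n} - (P \<union> R)) - {v}" by auto
    then show ?thesis using Suc.hyps(2) v by simp
  qed
  have "ex_at D pos (V P (P \<union> insert v R)) i"
    using Suc.prems v c by (intro Suc.hyps(1)) auto
  then have "ex_at D pos (V P (P \<union> R) \<union> V (insert v P) (insert v (P \<union> R))) i"
    using split_interval(2)[OF s v(2)] v by auto
  \<comment> \<open>The position and the bound - |P| both drop by one.\<close>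
  moreover have "ex_at D pos (V (insert v P) (insert v P \<union> R)) (i - 1)"
    using Suc.prems v c finPR by (intro Suc.hyps(1)) auto
  ultimately show ?case using ex_sub by simp
qed

text \<open>Counterpart of \<open>exact_low\<close> from the other end. An element removed from
  \<open>P\<close> goes to \<open>R\<close>, which keeps the complement of
  \<open>P \<union> R\<close>, or into that complement; in the second case exactness is needed one
  position higher, just where the bound has moved. For empty \<open>P\<close> and |R| <= n - a, the
  position exceeds 0.\<close>

lemma exact_high:
  assumes "finite P" "P \<subseteq> {..<n}" "R \<subseteq> {..<n}" "P \<inter> R = {}"
    "i > - int a + int (card ({..<n} - (P \<union> R)))"
  shows "ex_at D pos (V P (P \<union> R)) i"
  using assms
proof (induction P arbitrary: R i rule: finite_induct)
  case (empty R i)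
  show ?case
  proof (cases "card R > n - a")
    case True
    then show ?thesis using ex empty by simp
  next
    case False
    have "card ({..<n} - R) = n - card R"
      using empty finite_subset[of R "{..<n}"] by (simp add: card_Diff_subset)
    then show ?thesis using False empty an by (intro trivial_high) simp
  qed
next
  case (insert v P R i)
  have v: "v \<notin> P \<union> R" using insert by auto
  have vn: "v \<in> {..<n} - (P \<union> R)" using insert.prems v by auto
  interpret split_cx D pos "V P (P \<union> R)" "V (insert v P) (insert v (P \<union> R))"
    by (rule split_interval[OF s v])
  have c: "card ({..<n} - (P \<union> R)) = Suc (card ({..<n} - insert v (P \<union> R)))"
  proof -
    have "{..<n} - insert v (P \<union> R) = ({..<n} - (P \<union> R)) - {v}" by auto
    then show ?thesis using vn by (metis card_Suc_Diff1 finite_Diff finite_lessThan)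
  qed
  have sub: "P \<subseteq> {..<n}" "R \<subseteq> {..<n}" "insert v R \<subseteq> {..<n}" "P \<inter> R = {}" "P \<inter> insert v R = {}"
    using insert.prems(1-3) insert.hyps(2) by auto
  have i: "i > - int a + int (card ({..<n} - insert v (P \<union> R)))" using insert.prems(4) by simp
  have "ex_at D pos (V P (P \<union> insert v R)) i"
    by (rule insert.IH[OF sub(1,3,5)]) (use i in simp)
  then have "ex_at D pos (V P (P \<union> R) \<union> V (insert v P) (insert v (P \<union> R))) i"
    using split_interval(2)[OF s v] v by auto
  moreover have "ex_at D pos (V P (P \<union> R)) (i + 1)"
    by (rule insert.IH[OF sub(1,2,4)]) (use i c in linarith)
  ultimately show ?case using ex_quot by simp
qed

text \<open>The case of empty \<open>P\<close>: cohomology in position 0 only, so the complex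
  resolves a module.\<close>

lemma exact_lower_sets:
  assumes "B \<subseteq> {..<n}" "i \<noteq> 0" shows "ex_at D pos (V {} B) i"
  using exact_low[of "{}" B i] trivial_high[of i] assms by (cases "i > 0") auto

text \<open>The case of an empty complement: A(D(F)) has cohomology in position - a only, so D(F) is
  a resolution as well.\<close>

lemma exact_upper_sets:
  assumes B: "B \<subseteq> {..<n}" and i: "i \<noteq> - int a" shows "ex_at D pos (V B {..<n}) i"
proof (cases "i < - int a")
  case True then show ?thesis by (rule trivial_low)
next
  case False
  have "B \<union> ({..<n} - B) = {..<n}" using B by auto
  then show ?thesis
    using exact_high[of B "{..<n} - B" i] False i B finite_subset[of B "{..<n}"] by simp
qed

end

lemma qiso_reindex:
  assumes fin: "finite Z" and inj: "inj_on f Z"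
    and D: "\<And>a b. a \<in> Z \<Longrightarrow> b \<in> Z \<Longrightarrow> D' (f a) (f b) = D a b"
    and pos: "\<And>a. a \<in> Z \<Longrightarrow> pos' (f a) = pos a"
  shows "qiso D pos Z D' pos' (f ` Z) (\<lambda>a l. of_bool (f a = l))"
    (is "qiso _ _ _ _ _ _ ?F")
proof -
  have feq: "f a = f b \<longleftrightarrow> a = b" if "a \<in> Z" "b \<in> Z" for a b using that inj by (auto simp: inj_on_def)
  have app: "mapp ?F Z (f ` Z) x (f b) = x b" if "b \<in> Z" for x b
  proof -
    have "(\<Sum>j\<in>Z. x j * of_bool (f j = f b)) = (\<Sum>j\<in>Z. if j = b then x j else 0)"
      using that by (intro sum.cong) (auto simp: feq)
    then show ?thesis using that fin by (simp add: mapp_def)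
  qed
  have appD: "mapp D' (f ` Z) (f ` Z) y (f b) = mapp D Z Z (\<lambda>a. if a \<in> Z then y (f a) else 0) b"
    if "b \<in> Z" for y b
    using that inj by (simp add: mapp_def sum.reindex D)
  have pull: "(\<lambda>a. if a \<in> Z then y (f a) else 0) \<in> vecs (gr pos Z i)"
    if "y \<in> vecs (gr pos' (f ` Z) i)" for y i
    unfolding vecs_def
  proof (intro CollectI allI impI)
    fix a assume "a \<notin> gr pos Z i"
    then have "a \<in> Z \<Longrightarrow> pos' (f a) \<noteq> i" using pos by (auto simp: gr_def)
    then show "(if a \<in> Z then y (f a) else 0) = 0" using vecs_gr_D[OF that, of "f a"] by auto
  qed
  show ?thesis
    unfolding qiso_def
  proof (intro conjI ballI allI impI)
    fix j l assume j: "j \<in> Z" "l \<in> f ` Z"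
    then obtain b where b: "b \<in> Z" "l = f b" by blast
    { assume "?F j l \<noteq> 0" then show "pos' l = pos j" using j pos by auto }
    have "(\<Sum>m\<in>Z. D j m * ?F m l) = (\<Sum>m\<in>Z. if m = b then D j b else 0)"
      using b by (intro sum.cong) (auto simp: feq)
    also have "\<dots> = D j b" using b fin by simp
    also have "\<dots> = (\<Sum>m\<in>Z. if m = j then D j b else 0)" using j fin by simp
    also have "\<dots> = (\<Sum>m\<in>Z. ?F j (f m) * D' (f m) l)"
      using b j by (intro sum.cong) (auto simp: feq D)
    also have "\<dots> = (\<Sum>m\<in>f ` Z. ?F j m * D' m l)" using inj by (simp add: sum.reindex)
    finally show "(\<Sum>m\<in>Z. D j m * ?F m l) = (\<Sum>m\<in>f ` Z. ?F j m * D' m l)" .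
  next
    fix i x assume x: "x \<in> vecs (gr pos Z i)"
      and "\<exists>y\<in>vecs (gr pos' (f ` Z) (i - 1)). mapp ?F Z (f ` Z) x = mapp D' (f ` Z) (f ` Z) y"
    then obtain y where y: "y \<in> vecs (gr pos' (f ` Z) (i - 1))"
        "mapp ?F Z (f ` Z) x = mapp D' (f ` Z) (f ` Z) y" by blast
    have "x = mapp D Z Z (\<lambda>a. if a \<in> Z then y (f a) else 0)"
    proof
      fix b show "x b = mapp D Z Z (\<lambda>a. if a \<in> Z then y (f a) else 0) b"
      proof (cases "b \<in> Z")
        case True then show ?thesis using fun_cong[OF y(2), of "f b"] unfolding app[OF True] appD[OF True] by blast
      next
        case False then show ?thesis using vecs_D[OF vecs_gr_vecs[OF x]] by (simp add: mapp_def)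
      qed
    qed
    then show "\<exists>y\<in>vecs (gr pos Z (i - 1)). x = mapp D Z Z y" using pull[OF y(1)] by blast
  next
    fix i y assume y: "y \<in> vecs (gr pos' (f ` Z) i)" "mapp D' (f ` Z) (f ` Z) y = 0"
    let ?x = "\<lambda>a. if a \<in> Z then y (f a) else 0"
    have "mapp D Z Z ?x = 0"
    proof
      fix b show "mapp D Z Z ?x b = 0 b"
        using appD[of b y] y(2) by (cases "b \<in> Z") (auto simp: mapp_def)
    qed
    moreover have "y = mapp ?F Z (f ` Z) ?x + mapp D' (f ` Z) (f ` Z) 0"
    proof
      fix l show "y l = (mapp ?F Z (f ` Z) ?x + mapp D' (f ` Z) (f ` Z) 0) l"
      proof (cases "l \<in> f ` Z")
        case True then obtain b where b: "b \<in> Z" "l = f b" by blast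
        then show ?thesis using app[OF b(1)] by simp
      next
        case False then show ?thesis using vecs_D[OF vecs_gr_vecs[OF y(1)]] by (simp add: mapp_def)
      qed
    qed
    ultimately show "\<exists>x\<in>vecs (gr pos Z i). mapp D Z Z x = 0 \<and>
        (\<exists>z\<in>vecs (gr pos' (f ` Z) (i - 1)). y = mapp ?F Z (f ` Z) x + mapp D' (f ` Z) (f ` Z) z)"
      by (intro bexI[OF _ pull[OF y(1)]] conjI bexI[OF _ vecs_0])
  qed
qed

section \<open>Koszul complexes and the functor AD\<close>

definition ksign :: "nat \<Rightarrow> nat set \<Rightarrow> 'k::field" where
  "ksign v R = (-1) ^ card {u \<in> R. u < v}"

text \<open>Only the scalars of the Koszul differential; the monomials are determined by the labels
  \<open>R\<close> and \<open>S\<close>. The set \<open>R\<close> is placed in position -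
  |R|.\<close>

definition koszul :: "nat set \<Rightarrow> nat set \<Rightarrow> 'k::field" where
  "koszul R S = (\<Sum>v\<in>R. if S = R - {v} then ksign v R else 0)"

lemma ksign_insert_ge: "u \<ge> v \<Longrightarrow> ksign v (insert u R) = ksign v R"
  unfolding ksign_def by (rule arg_cong[of _ _ "\<lambda>A. (-1) ^ card A"]) auto

lemma ksign_insert_less: "finite R \<Longrightarrow> u < v \<Longrightarrow> u \<notin> R \<Longrightarrow> ksign v (insert u R) = - ksign v R"
proof -
  assume *: "finite R" "u < v" "u \<notin> R"
  have "{w \<in> insert u R. w < v} = insert u {w \<in> R. w < v}" using * by auto
  then have "card {w \<in> insert u R. w < v} = Suc (card {w \<in> R. w < v})" using * by simp
  then show ?thesis by (simp add: ksign_def)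
qed

lemma koszul_nonzeroD:
  assumes "koszul R S \<noteq> (0 :: 'k::field)" obtains v where "v \<in> R" "S = R - {v}"
proof -
  obtain v where "v \<in> R" "(if S = R - {v} then ksign v R else 0) \<noteq> (0 :: 'k)"
    using assms unfolding koszul_def by (rule sum.not_neutral_contains_not_neutral)
  then show ?thesis using that by (auto split: if_splits)
qed

lemma koszul_same [simp]: "koszul R R = (0 :: 'k::field)"
proof (rule ccontr)
  assume "koszul R R \<noteq> (0 :: 'k)"
  then obtain v where "v \<in> R" "R = R - {v}" by (rule koszul_nonzeroD)
  then show False by blast
qed

text \<open>\<open>ksign v\<close> counts elements below \<open>v\<close> only, hence takes the same
  value on \<open>S\<close> and on \<open>insert v S\<close>.\<close>

lemma koszul_app:
  assumes Y: "finite Y" and S: "S \<subseteq> Y"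
  shows "(\<Sum>R\<in>Pow Y. x R * koszul R S) = (\<Sum>v\<in>Y - S. x (insert v S) * ksign v S)"
proof -
  have "(\<Sum>R\<in>Pow Y. x R * koszul R S)
      = (\<Sum>R\<in>Pow Y. \<Sum>v\<in>Y. if v \<in> R \<and> S = R - {v} then x R * ksign v R else 0)"
  proof (rule sum.cong[OF refl])
    fix R assume "R \<in> Pow Y"
    then have "(\<Sum>v\<in>R. if S = R - {v} then x R * ksign v R else 0)
        = (\<Sum>v\<in>Y. if v \<in> R \<and> S = R - {v} then x R * ksign v R else 0)"
      using Y by (intro sum.mono_neutral_cong_left) auto
    then show "x R * koszul R S = (\<Sum>v\<in>Y. if v \<in> R \<and> S = R - {v} then x R * ksign v R else 0)"
      by (simp add: koszul_def sum_distrib_left if_distrib cong: if_cong)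
  qed
  also have "\<dots> = (\<Sum>v\<in>Y. \<Sum>R\<in>Pow Y. if v \<in> R \<and> S = R - {v} then x R * ksign v R else 0)"
    by (rule sum.swap)
  also have "\<dots> = (\<Sum>v\<in>Y. if v \<notin> S then x (insert v S) * ksign v S else 0)"
  proof (rule sum.cong[OF refl])
    fix v assume v: "v \<in> Y"
    have "(\<Sum>R\<in>Pow Y. if v \<in> R \<and> S = R - {v} then x R * ksign v R else 0)
        = (\<Sum>R\<in>Pow Y. if R = insert v S then (if v \<notin> S then x (insert v S) * ksign v (insert v S) else 0) else 0)"
      by (intro sum.cong) auto
    also have "\<dots> = (if v \<notin> S then x (insert v S) * ksign v (insert v S) else 0)"
      using Y S v by simp
    finally show "(\<Sum>R\<in>Pow Y. if v \<in> R \<and> S = R - {v} then x R * ksign v R else 0)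
        = (if v \<notin> S then x (insert v S) * ksign v S else 0)" by (simp add: ksign_insert_ge)
  qed
  also have "\<dots> = (\<Sum>v\<in>Y - S. x (insert v S) * ksign v S)"
    using Y by (intro sum.mono_neutral_cong_right) auto
  finally show ?thesis .
qed

text \<open>Only \<open>R\<close> with two elements v < w more than \<open>S\<close> contributes.
  The two orders of removal have opposite signs, since the sign of w counts v while the sign of v
  does not count w.\<close>

lemma koszul_koszul:
  assumes Y: "finite Y" and S: "S \<subseteq> Y" and R: "R \<subseteq> Y"
  shows "(\<Sum>U\<in>Pow Y. koszul R U * koszul U S) = (0 :: 'k::field)"
proof -
  let ?t = "\<lambda>v. koszul R (insert v S) * ksign v S :: 'k"
  have "(\<Sum>U\<in>Pow Y. koszul R U * koszul U S) = (\<Sum>v\<in>Y - S. ?t v)"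
    by (rule koszul_app[OF Y S])
  also have "\<dots> = 0"
  proof (cases "\<exists>v w. v \<notin> S \<and> w \<notin> S \<and> v < w \<and> R = insert v (insert w S)")
    case False
    have "?t v = 0" if v: "v \<in> Y - S" for v
    proof (rule ccontr)
      assume "?t v \<noteq> 0"
      then have "koszul R (insert v S) \<noteq> (0::'k)" by auto
      then obtain w where "w \<in> R" "insert v S = R - {w}" by (rule koszul_nonzeroD)
      then have "R = insert v (insert w S)" "w \<notin> S" "v \<noteq> w" by auto
      then show False using False v by (metis Diff_iff insert_commute linorder_neqE_nat)
    qed
    then show ?thesis by (simp add: sum.neutral)
  next
    case True
    then obtain v w where vw: "v \<notin> S" "w \<notin> S" "v < w" "R = insert v (insert w S)" by blast
    have fS: "finite S" using S Y finite_subset by auto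
    have fR: "finite R" using R Y finite_subset by auto
    have K: "koszul R (insert p S) = ksign q R" if "R = insert p (insert q S)" "p \<notin> S" "q \<notin> S" "p \<noteq> q" for p q
    proof -
      have "insert p S = R - {u} \<longleftrightarrow> u = q" if "u \<in> R" for u
        using that \<open>R = insert p (insert q S)\<close> \<open>p \<notin> S\<close> \<open>q \<notin> S\<close> \<open>p \<noteq> q\<close> by auto
      then have "koszul R (insert p S) = (\<Sum>u\<in>R. if u = q then ksign q R else 0)"
        unfolding koszul_def by (intro sum.cong) auto
      then show ?thesis using fR that by simp
    qed
    have "(\<Sum>v\<in>Y - S. ?t v) = (\<Sum>u\<in>{v, w}. ?t u)"
    proof (rule sum.mono_neutral_right)
      show "\<forall>u\<in>Y - S - {v, w}. ?t u = 0"
      proof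
        fix u assume u: "u \<in> Y - S - {v, w}"
        then have "u \<notin> R" using vw by auto
        moreover have "u \<in> R" if "koszul R (insert u S) \<noteq> (0::'k)"
          using that by (rule koszul_nonzeroD) auto
        ultimately have "koszul R (insert u S) = (0::'k)" by blast
        then show "?t u = 0" by simp
      qed
    qed (use Y R vw in auto)
    also have "\<dots> = ?t v + ?t w" using vw by simp
    also have "koszul R (insert v S) = (ksign w R :: 'k)" using vw by (intro K) auto
    also have "koszul R (insert w S) = (ksign v R :: 'k)" using vw by (intro K) auto
    also have "ksign w R = - (ksign w S :: 'k)"
      using vw fS ksign_insert_less[of "insert w S" v w] by (simp add: ksign_insert_ge)
    also have "ksign v R = (ksign v S :: 'k)" using vw by (simp add: ksign_insert_ge)
    finally show ?thesis by simp
  qed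
  finally show ?thesis .
qed

text \<open>Contracting homotopy: insert the least element of \<open>Y\<close>. Nothing lies below
  it, so its sign is always 1.\<close>

lemma koszul_exact:
  assumes Y: "finite Y" "Y \<noteq> {}"
  shows "ex_at (koszul :: _ \<Rightarrow> _ \<Rightarrow> 'k::field) (\<lambda>R. - int (card R)) (Pow Y) i"
  unfolding ex_at_def
proof (intro ballI impI)
  fix x :: "nat set \<Rightarrow> 'k"
  assume x: "x \<in> vecs (gr (\<lambda>R. - int (card R)) (Pow Y) i)" and dx: "mapp koszul (Pow Y) (Pow Y) x = 0"
  define v0 where "v0 = Min Y"
  have v0: "v0 \<in> Y" "\<And>u. u \<in> Y \<Longrightarrow> v0 \<le> u" using Y by (auto simp: v0_def)
  define y where "y R = (if v0 \<in> R then x (R - {v0}) else 0)" for R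
  have "y \<in> vecs (gr (\<lambda>R. - int (card R)) (Pow Y) (i - 1))"
    unfolding vecs_def
  proof (intro CollectI allI impI, rule ccontr)
    fix R assume R: "R \<notin> gr (\<lambda>R. - int (card R)) (Pow Y) (i - 1)" "y R \<noteq> 0"
    then have "v0 \<in> R" "x (R - {v0}) \<noteq> 0" by (auto simp: y_def split: if_splits)
    moreover from this have "R - {v0} \<subseteq> Y" "- int (card (R - {v0})) = i" using vecs_gr_D[OF x] by blast+
    moreover from calculation have "R \<subseteq> Y" using v0 by auto
    moreover from this have "card R = Suc (card (R - {v0}))"
      using \<open>v0 \<in> R\<close> finite_subset[OF _ Y(1)] by (intro card.remove) auto
    ultimately have "- int (card R) = i - 1" "R \<subseteq> Y" by linarith+
    then show False using R(1) by (auto simp: gr_def)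
  qed
  moreover have "mapp koszul (Pow Y) (Pow Y) y = x"
  proof
    fix S show "mapp koszul (Pow Y) (Pow Y) y S = x S"
    proof (cases "S \<subseteq> Y")
      case False
      then show ?thesis using vecs_D[OF vecs_gr_vecs[OF x]] by (simp add: mapp_def)
    next
      case S: True
      then have app: "mapp koszul (Pow Y) (Pow Y) y S = (\<Sum>v\<in>Y - S. y (insert v S) * ksign v S)"
        by (simp add: mapp_def koszul_app[OF Y(1)])
      have v0s: "ksign v0 T = (1 :: 'k)" if "T \<subseteq> Y" for T
      proof -
        have *: "{u \<in> T. u < v0} = {}" using v0 that by force
        show ?thesis unfolding ksign_def * by simp
      qed
      show ?thesis
      proof (cases "v0 \<in> S")
        case False
        have "(\<Sum>v\<in>Y - S. y (insert v S) * ksign v S) = (\<Sum>v\<in>Y - S. if v = v0 then x S else 0)"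
          using False v0s[OF S] by (intro sum.cong) (auto simp: y_def)
        then show ?thesis using app False v0 Y by simp
      next
        case True
        define S0 where "S0 = S - {v0}"
        have S0: "S = insert v0 S0" "v0 \<notin> S0" "S0 \<subseteq> Y" "finite S0"
          using True S Y finite_subset by (auto simp: S0_def)
        have "mapp koszul (Pow Y) (Pow Y) x S0 = 0" by (simp add: dx)
        then have "(\<Sum>v\<in>Y - S0. x (insert v S0) * ksign v S0) = 0"
          using S0(3) by (simp add: mapp_def koszul_app[OF Y(1)])
        moreover have "Y - S0 = insert v0 (Y - S)" using S0 v0 by auto
        ultimately have *: "x S + (\<Sum>v\<in>Y - S. x (insert v S0) * ksign v S0) = 0"
          using Y True v0s[OF S0(3)] S0(1)[symmetric] by simp
        have "y (insert v S) * ksign v S = - (x (insert v S0) * ksign v S0)" if "v \<in> Y - S" for v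
        proof -
          have "v0 < v" using v0 that True by (metis DiffD1 DiffD2 le_neq_implies_less)
          then have "ksign v S = - (ksign v S0 :: 'k)" using ksign_insert_less[OF S0(4) _ S0(2)] S0(1) by simp
          moreover have "insert v S - {v0} = insert v S0" using S0 \<open>v0 < v\<close> by auto
          ultimately show ?thesis using True by (simp add: y_def)
        qed
        then have "(\<Sum>v\<in>Y - S. y (insert v S) * ksign v S) = - (\<Sum>v\<in>Y - S. x (insert v S0) * ksign v S0)"
          by (simp add: sum_negf)
        then show ?thesis using app * by (simp add: add_eq_0_iff)
      qed
    qed
  qed
  ultimately show "\<exists>y\<in>vecs (gr (\<lambda>R. - int (card R)) (Pow Y) (i - 1)). mapp koszul (Pow Y) (Pow Y) y = x"
    by blast
qed

section \<open>Replacing each free summand by a Koszul resolution\<close>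

definition psgn :: "int \<Rightarrow> 'k::field" where
  "psgn p = (if even p then 1 else -1)"

lemma psgn_Suc: "psgn (p + 1) = - psgn p" by (simp add: psgn_def)

lemma psgn_nz [simp]: "psgn p \<noteq> 0" by (simp add: psgn_def)

text \<open>The tensor product of the complex \<open>(J, \<tau>, pos, D)\<close> with Koszul complexes: the basis element
  \<open>(j, R)\<close> belongs to the Koszul resolution of \<open>S/(x\<^sub>v : v \<notin> \<tau> j)\<close>.\<close>

definition tot_set :: "nat \<Rightarrow> 'j set \<Rightarrow> ('j \<Rightarrow> nat set) \<Rightarrow> ('j \<times> nat set) set" where
  "tot_set n J \<tau> = (SIGMA j:J. Pow ({..<n} - \<tau> j))"

definition tot_pos :: "('j \<Rightarrow> int) \<Rightarrow> 'j \<times> nat set \<Rightarrow> int" where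
  "tot_pos pos = (\<lambda>(j, R). pos j - int (card R))"

definition tot_D :: "('j \<Rightarrow> int) \<Rightarrow> ('j \<Rightarrow> 'j \<Rightarrow> 'k::field) \<Rightarrow> 'j \<times> nat set \<Rightarrow> 'j \<times> nat set \<Rightarrow> 'k" where
  "tot_D pos D = (\<lambda>(j, R) (l, S). of_bool (S = R) * D j l + of_bool (l = j) * psgn (pos j) * koszul R S)"

lemma tot_nonzero:
  assumes "tot_D pos D (j, R) (l, S) \<noteq> 0"
  shows "S = R \<and> D j l \<noteq> 0 \<or> l = j \<and> (\<exists>v\<in>R. S = R - {v})"
proof (cases "koszul R S = (0::'a)")
  case True
  then show ?thesis using assms by (auto simp: tot_D_def)
next
  case False
  then obtain v where "v \<in> R" "S = R - {v}" by (rule koszul_nonzeroD)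
  moreover from this have "S \<noteq> R" by blast
  ultimately show ?thesis using assms by (auto simp: tot_D_def split: if_splits)
qed

text \<open>The mixed terms cancel because \<open>D\<close> raises \<open>pos\<close> by one and so
  flips \<open>psgn\<close>. Extending the sums to the full product lets the two differentials be
  summed separately; it adds nothing, since \<open>D\<close> shrinks \<open>\<tau>\<close> and so
  only enlarges the room for \<open>R\<close>.\<close>

lemma sqc_tot:
  assumes s: "sqc n J \<tau> pos (D :: 'j \<Rightarrow> 'j \<Rightarrow> 'k::field)"
  shows "sqc n (tot_set n J \<tau>) snd (tot_pos pos) (tot_D pos D)"
proof -
  have finJ: "finite J" using bcx_finite[OF sqc_bcx[OF s]] .
  have mem: "(l, S) \<in> tot_set n J \<tau>"
    if "(j, R) \<in> tot_set n J \<tau>" "l \<in> J" "tot_D pos D (j, R) (l, S) \<noteq> 0" for j R l S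
    using tot_nonzero[OF that(3)] that(1,2) sqc_D[OF s, of j l] by (auto simp: tot_set_def)
  have pos: "tot_pos pos (l, S) = tot_pos pos (j, R) + 1"
    if "(j, R) \<in> tot_set n J \<tau>" "l \<in> J" "tot_D pos D (j, R) (l, S) \<noteq> 0" for j R l S
  proof -
    have "finite R" using that finite_subset[of R "{..<n} - \<tau> j"] by (auto simp: tot_set_def)
    then have "S = R - {v} \<Longrightarrow> v \<in> R \<Longrightarrow> card R = Suc (card S)" for v
      using card.remove[of R v] by simp
    then show ?thesis
      using tot_nonzero[OF that(3)] bcx_pos[OF sqc_bcx[OF s], of j l] that(1,2)
      unfolding tot_pos_def tot_set_def by auto
  qed
  have sq: "(\<Sum>m\<in>tot_set n J \<tau>. tot_D pos D (j, R) m * tot_D pos D m (l, U)) = 0"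
    if jR: "(j, R) \<in> tot_set n J \<tau>" and lU: "(l, U) \<in> tot_set n J \<tau>" for j R l U
  proof -
    have j: "j \<in> J" "R \<subseteq> {..<n}" and l: "l \<in> J" "U \<subseteq> {..<n}" using jR lU by (auto simp: tot_set_def)
    have "(\<Sum>m\<in>tot_set n J \<tau>. tot_D pos D (j, R) m * tot_D pos D m (l, U))
        = (\<Sum>m\<in>J \<times> Pow {..<n}. tot_D pos D (j, R) m * tot_D pos D m (l, U))"
    proof (rule sum.mono_neutral_left)
      show "finite (J \<times> Pow {..<n})" using finJ by simp
      show "tot_set n J \<tau> \<subseteq> J \<times> Pow {..<n}" by (auto simp: tot_set_def)
      show "\<forall>m\<in>J \<times> Pow {..<n} - tot_set n J \<tau>. tot_D pos D (j, R) m * tot_D pos D m (l, U) = 0"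
        using mem[OF jR] by fastforce
    qed
    also have "\<dots> = (\<Sum>m\<in>J. \<Sum>S\<in>Pow {..<n}. tot_D pos D (j, R) (m, S) * tot_D pos D (m, S) (l, U))"
      by (simp add: sum.cartesian_product)
    also have "\<dots> = (\<Sum>m\<in>J. \<Sum>S\<in>Pow {..<n}.
        (if S = R then of_bool (U = R) * (D j m * D m l) else 0)
        + (if m = l then (if S = R then D j l * psgn (pos l) * koszul R U else 0) else 0)
        + (if m = j then (if S = U then psgn (pos j) * koszul R U * D j l else 0) else 0)
        + (if m = j then of_bool (l = j) * (koszul R S * koszul S U) else 0))"
    proof (intro sum.cong refl)
      fix m S
      have p: "psgn (pos j) * (psgn (pos j) :: 'k) = 1" by (simp add: psgn_def)
      have p': "psgn (pos j) * (psgn (pos j) * z) = (z :: 'k)" for z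
        using p by (simp add: mult.assoc[symmetric])
      show "tot_D pos D (j, R) (m, S) * tot_D pos D (m, S) (l, U) =
        (if S = R then of_bool (U = R) * (D j m * D m l) else 0)
        + (if m = l then (if S = R then D j l * psgn (pos l) * koszul R U else 0) else 0)
        + (if m = j then (if S = U then psgn (pos j) * koszul R U * D j l else 0) else 0)
        + (if m = j then of_bool (l = j) * (koszul R S * koszul S U) else 0)"
        by (auto simp: tot_D_def algebra_simps p')
    qed
    also have "\<dots> = of_bool (U = R) * (\<Sum>m\<in>J. D j m * D m l)
        + D j l * psgn (pos l) * koszul R U + psgn (pos j) * koszul R U * D j l
        + of_bool (l = j) * (\<Sum>S\<in>Pow {..<n}. koszul R S * koszul S U)"
    proof -
      have del: "(\<Sum>m\<in>J. \<Sum>S\<in>B. if m = x then g S else 0) = (\<Sum>S\<in>B. g S)" if "x \<in> J"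
        for x and g :: "nat set \<Rightarrow> 'k" and B
        using that finJ by (subst sum.swap) simp
      show ?thesis
        unfolding sum.distrib del[OF j(1)] del[OF l(1)] using j l by (simp add: sum_distrib_left)
    qed
    also have "\<dots> = 0"
    proof -
      have "(\<Sum>m\<in>J. D j m * D m l) = 0" using sqc_bcx[OF s] j l unfolding bcx_def by blast
      moreover have "(\<Sum>S\<in>Pow {..<n}. koszul R S * koszul S U) = (0::'k)"
        using j l by (intro koszul_koszul) auto
      moreover have "D j l * psgn (pos l) * koszul R U + psgn (pos j) * koszul R U * D j l = 0"
      proof (cases "D j l = 0")
        case False
        then have "psgn (pos l) = - (psgn (pos j) :: 'k)"
          using bcx_pos[OF sqc_bcx[OF s] j(1) l(1)] by (simp add: psgn_Suc)
        then show ?thesis by (simp add: algebra_simps)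
      qed simp
      ultimately show ?thesis by simp
    qed
    finally show ?thesis .
  qed
  have "finite (tot_set n J \<tau>)" unfolding tot_set_def using finJ by (intro finite_SigmaI) auto
  then show ?thesis
    unfolding sqc_def bcx_def
  proof (intro conjI ballI impI)
    fix a b assume ab: "a \<in> tot_set n J \<tau>" "b \<in> tot_set n J \<tau>"
    obtain j R l S where [simp]: "a = (j, R)" "b = (l, S)" by (metis prod.exhaust)
    have "l \<in> J" using ab by (simp add: tot_set_def)
    then show "tot_D pos D a b \<noteq> 0 \<Longrightarrow> tot_pos pos b = tot_pos pos a + 1" using pos ab by simp
    show "(\<Sum>m\<in>tot_set n J \<tau>. tot_D pos D a m * tot_D pos D m b) = 0" using sq ab by simp
    show "tot_D pos D a b \<noteq> 0 \<Longrightarrow> snd b \<subseteq> snd a" using tot_nonzero[of pos D j R l S] by auto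
  qed (auto simp: tot_set_def)
qed

text \<open>In degree \<open>B\<close> the summand at \<open>j\<close> is the Koszul complex on
  \<open>B - \<tau> j\<close>, which is exact unless \<open>B \<subseteq> \<tau> j\<close>, and then
  only \<open>R = {}\<close> is left. What remains are the labels containing \<open>B\<close>, that
  is, A(D(F)) in degree \<open>B\<close>.\<close>

lemma tot_qiso:
  assumes s: "sqc n J \<tau> pos (D :: 'j \<Rightarrow> 'j \<Rightarrow> 'k::field)" and B: "B \<subseteq> {..<n}"
  shows "qiso (tot_D pos D) (tot_pos pos) (lab (tot_set n J \<tau>) snd (iv {} B))
    D pos (lab J \<tau> (iv B {..<n})) (\<lambda>(j, R) l. of_bool (R = {} \<and> j = l))"
proof -
  let ?T = "tot_D pos D" and ?p = "tot_pos pos"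
  define Z where "Z = lab (tot_set n J \<tau>) snd (iv {} B)"
  define Z1 where "Z1 = {m \<in> Z. \<not> B \<subseteq> \<tau> (fst m)}"
  define Z2 where "Z2 = {m \<in> Z. B \<subseteq> \<tau> (fst m)}"
  have Z: "Z = Z1 \<union> Z2" by (auto simp: Z1_def Z2_def)
  have Z2_eq: "Z2 = (\<lambda>j. (j, {})) ` lab J \<tau> (iv B {..<n})"
    using B sqc_tau[OF s] by (force simp: Z2_def Z_def lab_def iv_def tot_set_def)
  have bZ: "bcx ?T ?p Z" unfolding Z_def by (intro sqc_lab_bcx[OF sqc_tot[OF s]]) simp
  interpret split_cx ?T ?p Z1 Z2
  proof
    show "bcx ?T ?p (Z1 \<union> Z2)" using bZ Z by simp
    show "Z1 \<inter> Z2 = {}" by (auto simp: Z1_def Z2_def)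
    fix a b assume ab: "a \<in> Z1" "b \<in> Z2"
    obtain j R l S where [simp]: "a = (j, R)" "b = (l, S)" by (metis prod.exhaust)
    show "?T a b = 0"
    proof (rule ccontr)
      assume "?T a b \<noteq> 0"
      then have "D j l \<noteq> 0 \<or> l = j" using tot_nonzero[of pos D j R l S] by auto
      then have "\<tau> l \<subseteq> \<tau> j"
        using ab sqc_D[OF s, of j l] by (auto simp: Z1_def Z2_def Z_def lab_def tot_set_def)
      then show False using ab by (auto simp: Z1_def Z2_def)
    qed
  qed
  \<comment> \<open>The levels are the Koszul strands: the Koszul differential keeps
    \<open>j\<close>, and \<open>D\<close> raises \<open>pos j\<close>.\<close>
  have "ex_at ?T ?p Z1 i" for i
  proof (rule ex_at_levels[OF bcx1, where \<phi> = fst and \<rho> = pos])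
    fix a b assume ab: "a \<in> Z1" "b \<in> Z1" "?T a b \<noteq> 0"
    obtain j R l S where [simp]: "a = (j, R)" "b = (l, S)" by (metis prod.exhaust)
    show "fst b = fst a \<or> pos (fst a) < pos (fst b)"
      using tot_nonzero[of pos D j R l S] ab bcx_pos[OF sqc_bcx[OF s], of j l]
      by (auto simp: Z1_def Z_def lab_def tot_set_def)
  next
    fix j assume "j \<in> fst ` Z1"
    then have j: "j \<in> J" "\<not> B \<subseteq> \<tau> j" by (auto simp: Z1_def Z_def lab_def tot_set_def)
    have eq: "{m \<in> Z1. fst m = j} = Pair j ` Pow (B - \<tau> j)"
    proof (intro set_eqI iffI)
      fix m assume "m \<in> {m \<in> Z1. fst m = j}"
      then have "m = (j, snd m)" "snd m \<subseteq> B - \<tau> j"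
        by (auto simp: Z1_def Z_def lab_def tot_set_def iv_def)
      then show "m \<in> Pair j ` Pow (B - \<tau> j)" by blast
    next
      fix m assume "m \<in> Pair j ` Pow (B - \<tau> j)"
      then obtain R where "m = (j, R)" "R \<subseteq> B - \<tau> j" by blast
      then show "m \<in> {m \<in> Z1. fst m = j}"
        using j B by (auto simp: Z1_def Z_def lab_def tot_set_def iv_def)
    qed
    have D: "D j j = 0" using bcx_diag[OF sqc_bcx[OF s] j(1)] .
    have "ex_at ?T ?p (Pair j ` Pow (B - \<tau> j)) ((i - pos j) + pos j)"
    proof (rule ex_at_reindex[where c = "psgn (pos j)"])
      show "inj_on (Pair j) (Pow (B - \<tau> j))" by (auto simp: inj_on_def)
      show "(psgn (pos j) :: 'k) \<noteq> 0" by simp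
      show "?T (j, R) (j, S) = psgn (pos j) * koszul R S" for R S by (simp add: tot_D_def D)
      show "?p (j, R) = - int (card R) + pos j" for R by (simp add: tot_pos_def)
      show "ex_at (koszul :: _ \<Rightarrow> _ \<Rightarrow> 'k) (\<lambda>R. - int (card R)) (Pow (B - \<tau> j)) (i - pos j)"
        using j B by (intro koszul_exact finite_Diff finite_subset[OF B]) auto
    qed
    then show "ex_at ?T ?p {m \<in> Z1. fst m = j} i" by (simp add: eq)
  qed
  then have q1: "qiso ?T ?p Z ?T ?p Z2 (\<lambda>j l. of_bool (j = l))" unfolding Z by (rule qiso_quot)
  have "qiso ?T ?p Z2 D pos (fst ` Z2) (\<lambda>a l. of_bool (fst a = l))"
    by (rule qiso_reindex[OF fin(2)]) (auto simp: Z2_eq inj_on_def tot_D_def tot_pos_def)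
  moreover have "fst ` Z2 = lab J \<tau> (iv B {..<n})" by (auto simp: Z2_eq image_image)
  ultimately have q2: "qiso ?T ?p Z2 D pos (lab J \<tau> (iv B {..<n})) (\<lambda>a l. of_bool (fst a = l))" by simp
  show ?thesis
    unfolding Z_def[symmetric]
  proof (rule qiso_cong[OF qiso_comp[OF q1 q2 bcx2]])
    fix a l assume "a \<in> Z" "l \<in> lab J \<tau> (iv B {..<n})"
    have "(\<Sum>m\<in>Z2. of_bool (a = m) * of_bool (fst m = l))
        = (\<Sum>m\<in>Z2. if m = a then of_bool (fst a = l) else (0::'k))"
      by (intro sum.cong) auto
    also have "\<dots> = (if a \<in> Z2 then of_bool (fst a = l) else 0)" using fin by simp
    also have "\<dots> = (case a of (j, R) \<Rightarrow> \<lambda>l. of_bool (R = {} \<and> j = l)) l"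
      using \<open>a \<in> Z\<close> \<open>l \<in> _\<close> by (auto simp: Z2_eq lab_def iv_def split: prod.splits)
    finally show "(\<Sum>m\<in>Z2. of_bool (a = m) * of_bool (fst m = l))
        = ((case a of (j, R) \<Rightarrow> \<lambda>l. of_bool (R = {} \<and> j = l)) l :: 'k)" .
  qed simp_all
qed

text \<open>With \<open>R\<close> fixed, the indices left are the \<open>j\<close> with
  \<open>\<tau> j\<close> disjoint from \<open>R\<close>, that is, F in the degree complementary to
  \<open>R\<close>. This is the analogue of the formula of Hochster: cohomology of F in that degree
  gives the Betti numbers of A(D(F)) with label \<open>R\<close>.\<close>

lemma tot_label:
  assumes s: "sqc n J \<tau> pos (D :: 'j \<Rightarrow> 'j \<Rightarrow> 'k::field)" and R: "R \<subseteq> {..<n}"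
  shows "ex_at (tot_D pos D) (tot_pos pos) (lab (tot_set n J \<tau>) snd {R}) (i - int (card R))
    \<longleftrightarrow> ex_at D pos (lab J \<tau> (iv {} ({..<n} - R))) i"
proof -
  let ?V = "lab J \<tau> (iv {} ({..<n} - R))" and ?f = "\<lambda>j. (j, R)"
  have eq: "lab (tot_set n J \<tau>) snd {R} = ?f ` ?V"
    using R sqc_tau[OF s] by (fastforce simp: lab_def iv_def tot_set_def)
  have eq': "fst ` ?f ` ?V = ?V" by (simp add: image_image)
  have "ex_at (tot_D pos D) (tot_pos pos) (?f ` ?V) (i + - int (card R))" if "ex_at D pos ?V i"
    using that by (intro ex_at_reindex[where c = 1])
      (auto simp: inj_on_def tot_D_def tot_pos_def)
  moreover have "ex_at D pos (fst ` ?f ` ?V) (i - int (card R) + int (card R))"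
    if "ex_at (tot_D pos D) (tot_pos pos) (?f ` ?V) (i - int (card R))"
    using that by (intro ex_at_reindex[where c = 1])
      (auto simp: inj_on_def tot_D_def tot_pos_def)
  ultimately show ?thesis unfolding eq eq' by auto
qed

text \<open>By minimality the differential between equal labels is 0, so the cohomology of such a
  strand is spanned by its generators.\<close>

lemma min_ex_at:
  assumes s: "sqc n J \<tau> pos D" and m: "min_sqc J \<tau> D"
  shows "ex_at D pos (lab J \<tau> {R}) i \<longleftrightarrow> (\<forall>j\<in>J. \<tau> j = R \<longrightarrow> pos j \<noteq> i)"
proof
  assume ex: "ex_at D pos (lab J \<tau> {R}) i"
  have D0: "D j l = 0" if "j \<in> lab J \<tau> {R}" "l \<in> lab J \<tau> {R}" for j l
    using that m by (auto simp: min_sqc_def lab_def)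
  have M: "mapp D (lab J \<tau> {R}) (lab J \<tau> {R}) x = 0" for x
    by (auto simp: mapp_def fun_eq_iff D0)
  show "\<forall>j\<in>J. \<tau> j = R \<longrightarrow> pos j \<noteq> i"
  proof (intro ballI impI notI)
    fix j assume j: "j \<in> J" "\<tau> j = R" "pos j = i"
    then have "del1 j 1 \<in> vecs (gr pos (lab J \<tau> {R}) i)" by (intro del1_vecs) (simp add: gr_def lab_def)
    then obtain y where "mapp D (lab J \<tau> {R}) (lab J \<tau> {R}) y = del1 j 1"
      using ex_at_E[OF ex _ M] by blast
    then have "del1 j 1 j = mapp D (lab J \<tau> {R}) (lab J \<tau> {R}) y j" by simp
    then show False unfolding M by simp
  qed
qed (auto intro: ex_at_trivial simp: lab_def)

text \<open>The complex \<open>E\<close> represents \<open>A(D(F))\<close> for \<open>F\<close> represented by \<open>D\<close>: the component of \<open>A(D(F))\<close> of degree \<open>B\<close>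
  is spanned by the basis elements \<open>l\<close> with \<open>B \<subseteq> \<tau> l\<close>.\<close>

theorem ad_model:
  fixes D :: "'j \<Rightarrow> 'j \<Rightarrow> 'k::field"
  assumes s: "sqc n J \<tau> pos D"
  obtains J' :: "('j \<times> nat set) set" and E \<Phi> where
    "sqc n J' snd (tot_pos pos) E" "min_sqc J' snd E"
    "\<And>B. B \<subseteq> {..<n} \<Longrightarrow> qiso E (tot_pos pos) (lab J' snd (iv {} B)) D pos (lab J \<tau> (iv B {..<n})) \<Phi>"
    "\<And>R i. R \<subseteq> {..<n} \<Longrightarrow> ex_at D pos (lab J \<tau> (iv {} ({..<n} - R))) i \<longleftrightarrow>
       (\<forall>j\<in>J'. snd j = R \<longrightarrow> tot_pos pos j \<noteq> i - int (card R))"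
proof -
  let ?T = "tot_set n J \<tau>" and ?d = "tot_D pos D"
  obtain J' E \<iota> where J': "J' \<subseteq> ?T" "sqc n J' snd (tot_pos pos) E" "min_sqc J' snd E"
    and q: "\<And>\<Z>. order_convex \<Z> \<Longrightarrow> qiso E (tot_pos pos) (lab J' snd \<Z>) ?d (tot_pos pos) (lab ?T snd \<Z>) \<iota>"
    using minimal_model[OF sqc_tot[OF s]] by blast
  show ?thesis
  proof (rule that[OF J'(2,3), where \<Phi> = "\<lambda>w l. \<iota> w (l, {})"])
    fix B assume B: "B \<subseteq> {..<n}"
    have fin: "finite (lab ?T snd (iv {} B))"
      by (rule finite_subset[OF lab_subset bcx_finite[OF sqc_bcx[OF sqc_tot[OF s]]]])
    \<comment> \<open>The projection of \<open>tot_qiso\<close> kills all (l, R) with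
      \<open>R\<close> nonempty, so the composite is \<open>\<iota>\<close> followed by reading the
      coordinate at (l, {}).\<close>
    show "qiso E (tot_pos pos) (lab J' snd (iv {} B)) D pos (lab J \<tau> (iv B {..<n})) (\<lambda>w l. \<iota> w (l, {}))"
    proof (rule qiso_cong[OF qiso_comp[OF q tot_qiso[OF s B]]])
      fix w l assume "l \<in> lab J \<tau> (iv B {..<n})"
      then have "(l, {}) \<in> lab ?T snd (iv {} B)" by (auto simp: lab_def iv_def tot_set_def)
      then have "(\<Sum>m\<in>lab ?T snd (iv {} B). if m = (l, {}) then \<iota> w (l, {}) else 0) = \<iota> w (l, {})"
        using fin by simp
      moreover have "(\<Sum>m\<in>lab ?T snd (iv {} B). \<iota> w m * (case m of (j, R) \<Rightarrow> \<lambda>l. of_bool (R = {} \<and> j = l)) l)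
        = (\<Sum>m\<in>lab ?T snd (iv {} B). if m = (l, {}) then \<iota> w (l, {}) else 0)"
        by (intro sum.cong) (auto split: prod.splits)
      ultimately show "(\<Sum>m\<in>lab ?T snd (iv {} B). \<iota> w m * (case m of (j, R) \<Rightarrow> \<lambda>l. of_bool (R = {} \<and> j = l)) l)
        = \<iota> w (l, {})" by simp
    qed (use sqc_lab_bcx[OF sqc_tot[OF s]] in auto)
  next
    fix R i assume R: "R \<subseteq> {..<n}"
    show "ex_at D pos (lab J \<tau> (iv {} ({..<n} - R))) i \<longleftrightarrow>
       (\<forall>j\<in>J'. snd j = R \<longrightarrow> tot_pos pos j \<noteq> i - int (card R))"
      using tot_label[OF s R, of i] qiso_ex_iff[OF q[OF order_convex_single]] min_ex_at[OF J'(2,3)]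
      by metis
  qed
qed

section \<open>Linear maps in general position\<close>

text \<open>Coprimality as a Bezout identity, the form used for Chinese remainders.\<close>

definition comaximal :: "'k::field poly \<Rightarrow> 'k poly \<Rightarrow> bool" where
  "comaximal f g \<longleftrightarrow> (\<exists>a b. a * f + b * g = 1)"

lemma comaximal_sym: "comaximal f g \<Longrightarrow> comaximal g f"
  unfolding comaximal_def by (metis add.commute)

lemma comaximal_mult: "comaximal f g \<Longrightarrow> comaximal f h \<Longrightarrow> comaximal f (g * h)"
proof -
  assume "comaximal f g" "comaximal f h"
  then obtain a b c d where "a * f + b * g = 1" "c * f + d * h = 1" by (auto simp: comaximal_def)
  then have "(a * f + b * g) * (c * f + d * h) = 1" by simp
  then have "(a * c * f + a * d * h + b * g * c) * f + (b * d) * (g * h) = 1"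
    by (simp add: algebra_simps)
  then show ?thesis unfolding comaximal_def by blast
qed

lemma comaximal_1: "comaximal f 1"
  unfolding comaximal_def by (rule exI[of _ 0], rule exI[of _ 1]) simp

lemma comaximal_power: "comaximal f g \<Longrightarrow> comaximal f (g ^ m)"
  by (induction m) (auto intro: comaximal_1 comaximal_mult)

lemma comaximal_prod: "(\<And>i. i \<in> T \<Longrightarrow> comaximal f (g i)) \<Longrightarrow> comaximal f (\<Prod>i\<in>T. g i)"
  by (induction T rule: infinite_finite_induct) (auto intro: comaximal_1 comaximal_mult)

lemma comaximal_dvd_mult:
  assumes "comaximal f g" "f dvd p" "g dvd p" shows "f * g dvd p"
proof -
  obtain a b where "a * f + b * g = 1" using assms by (auto simp: comaximal_def)
  then have "p = (a * f + b * g) * p" by simp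
  also have "\<dots> = a * (f * p) + b * (p * g)" by (simp add: algebra_simps)
  also have "f * g dvd \<dots>" using assms by (intro dvd_add dvd_mult mult_dvd_mono) auto
  finally show ?thesis .
qed

lemma prod_dvd:
  assumes "finite T" "\<And>i j. i \<in> T \<Longrightarrow> j \<in> T \<Longrightarrow> i \<noteq> j \<Longrightarrow> comaximal (f i) (f j)"
    "\<And>i. i \<in> T \<Longrightarrow> f i dvd p"
  shows "(\<Prod>i\<in>T. f i) dvd p"
  using assms
proof (induction T rule: finite_induct)
  case (insert i T)
  have "comaximal (f i) (\<Prod>i\<in>T. f i)" using insert by (intro comaximal_prod) auto
  then show ?case using insert by (auto intro!: comaximal_dvd_mult)
qed simp

lemma chinese_remainder_poly:
  assumes "finite T" "\<And>i j. i \<in> T \<Longrightarrow> j \<in> T \<Longrightarrow> i \<noteq> j \<Longrightarrow> comaximal (f i) (f j)"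
  shows "\<exists>p. \<forall>i\<in>T. f i dvd p - r i"
  using assms
proof (induction T rule: finite_induct)
  case (insert j T)
  obtain p where p: "\<And>i. i \<in> T \<Longrightarrow> f i dvd p - r i" using insert by auto
  have "comaximal (f j) (\<Prod>i\<in>T. f i)" using insert by (intro comaximal_prod) auto
  then obtain a b where ab: "a * f j + b * (\<Prod>i\<in>T. f i) = 1" by (auto simp: comaximal_def)
  define q where "q = p + b * (\<Prod>i\<in>T. f i) * (r j - p)"
  have "f j dvd q - r j"
  proof -
    have "b * (\<Prod>i\<in>T. f i) = 1 - a * f j" using ab by (simp add: algebra_simps)
    then have "q = p + (1 - a * f j) * (r j - p)" unfolding q_def by (rule arg_cong)
    then have "q - r j = f j * (a * (p - r j))" by (simp add: algebra_simps)
    then show ?thesis by simp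
  qed
  moreover have "f i dvd q - r i" if "i \<in> T" for i
  proof -
    have "f i dvd (\<Prod>i\<in>T. f i)" using that insert by (intro dvd_prodI) auto
    then have "f i dvd b * (\<Prod>i\<in>T. f i) * (r j - p)" by (intro dvd_mult2 dvd_mult)
    with p[OF that] have "f i dvd (p - r i) + b * (\<Prod>i\<in>T. f i) * (r j - p)" by (rule dvd_add)
    then show ?thesis by (simp add: q_def algebra_simps)
  qed
  ultimately show ?case by blast
qed simp

text \<open>Euclid's argument, valid over every field: if P is the product of the polynomials found
  so far, then 1 + X P, written \<open>pCons 1 P\<close>, is comaximal to each of them.\<close>

lemma comaximal_family:
  "\<exists>q :: nat \<Rightarrow> 'k::field poly. \<forall>i<n. degree (q i) \<ge> 1 \<and> (\<forall>j<n. i \<noteq> j \<longrightarrow> comaximal (q i) (q j))"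
proof (induction n)
  case (Suc n)
  then obtain q :: "nat \<Rightarrow> 'k poly"
    where q: "\<And>i. i < n \<Longrightarrow> degree (q i) \<ge> 1" "\<And>i j. i < n \<Longrightarrow> j < n \<Longrightarrow> i \<noteq> j \<Longrightarrow> comaximal (q i) (q j)"
    by blast
  define P where "P = (\<Prod>i<n. q i)"
  have "q i \<noteq> 0" if "i < n" for i using q(1)[OF that] by auto
  then have P: "P \<noteq> 0" by (simp add: P_def)
  have dP: "degree (pCons 1 P) \<ge> 1" using P by simp
  have new: "comaximal (q i) (pCons 1 P)" if "i < n" for i
  proof -
    have "q i dvd P" unfolding P_def using that by (intro dvd_prodI) auto
    then obtain c where c: "P = q i * c" by (elim dvdE)
    have "pCons 1 P = 1 + [:0, 1:] * P" by (simp add: one_pCons)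
    then have "(- [:0, 1:] * c) * q i + 1 * pCons 1 P = 1" by (simp add: c algebra_simps)
    then show ?thesis unfolding comaximal_def by blast
  qed
  let ?q = "q(n := pCons 1 P)"
  have "degree (?q i) \<ge> 1 \<and> (\<forall>j<Suc n. i \<noteq> j \<longrightarrow> comaximal (?q i) (?q j))" if "i < Suc n" for i
  proof (cases "i = n")
    case True
    then show ?thesis using dP new by (auto intro: comaximal_sym simp: less_Suc_eq)
  next
    case False
    then show ?thesis using that new q by (auto simp: less_Suc_eq)
  qed
  then show ?case by blast
qed simp

text \<open>Powers of comaximal polynomials are comaximal; the exponent of \<open>q i\<close> is the
  product of the other degrees. Equal degrees make all residue spaces E_i equally large.\<close>

lemma comaximal_family_same_degree:
  "\<exists>(f :: nat \<Rightarrow> 'k::field poly) d. d \<ge> 1 \<and>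
     (\<forall>i<n. degree (f i) = d \<and> (\<forall>j<n. i \<noteq> j \<longrightarrow> comaximal (f i) (f j)))"
proof -
  obtain q :: "nat \<Rightarrow> 'k poly"
    where q: "\<And>i. i < n \<Longrightarrow> degree (q i) \<ge> 1" "\<And>i j. i < n \<Longrightarrow> j < n \<Longrightarrow> i \<noteq> j \<Longrightarrow> comaximal (q i) (q j)"
    using comaximal_family by metis
  define d where "d = (\<Prod>i<n. degree (q i))"
  define f where "f i = q i ^ (\<Prod>j\<in>{..<n} - {i}. degree (q j))" for i
  have "d \<ge> 1" unfolding d_def using q(1) by (intro prod_ge_1) auto
  moreover have "degree (f i) = d" if "i < n" for i
  proof -
    have "q i \<noteq> 0" using q(1)[OF that] by auto
    then show ?thesis using that by (simp add: f_def d_def degree_power_eq prod.remove[of "{..<n}" i] mult.commute)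
  qed
  moreover have "comaximal (f i) (f j)" if "i < n" "j < n" "i \<noteq> j" for i j
    unfolding f_def using q(2)[OF that] by (blast intro: comaximal_power comaximal_sym)
  ultimately show ?thesis by blast
qed

text \<open>Over an infinite field, \<open>d = 1\<close> would be possible: \<open>\<epsilon> i\<close> evaluates polynomials of degree less than \<open>g\<close> in
  the \<open>i\<close>-th of \<open>n\<close> different points. Residues modulo comaximal polynomials of degree \<open>d\<close> do this
  over every field.\<close>

definition general_maps :: "nat \<Rightarrow> nat \<Rightarrow> nat \<Rightarrow> (nat \<Rightarrow> nat \<Rightarrow> nat \<Rightarrow> 'k::field) \<Rightarrow> bool" where
  "general_maps n d g \<epsilon> \<longleftrightarrow> (\<forall>T\<subseteq>{..<n}. card T = g \<longrightarrow>
     (\<forall>u. (\<forall>i\<in>T. \<forall>l<d. (\<Sum>\<kappa><d * g. u \<kappa> * \<epsilon> i \<kappa> l) = 0) \<longrightarrow> (\<forall>\<kappa><d * g. u \<kappa> = 0)) \<and>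
     (\<forall>r. \<exists>u. \<forall>i\<in>T. \<forall>l<d. (\<Sum>\<kappa><d * g. u \<kappa> * \<epsilon> i \<kappa> l) = r i l))"

text \<open>K consists of the polynomials of degree less than d g, and E_i of the residues modulo
  \<open>f i\<close>. For |T| = g the product of the \<open>f i\<close> has degree d g = dim K: a
  multiple of it in K is 0, and Chinese remainders give surjectivity.\<close>

lemma general_maps_exist: "\<exists>d\<ge>1. \<forall>g. \<exists>\<epsilon> :: nat \<Rightarrow> nat \<Rightarrow> nat \<Rightarrow> 'k::field. general_maps n d g \<epsilon>"
proof -
  obtain f :: "nat \<Rightarrow> 'k poly" and d where d: "d \<ge> 1"
    and f: "\<And>i. i < n \<Longrightarrow> degree (f i) = d" "\<And>i j. i < n \<Longrightarrow> j < n \<Longrightarrow> i \<noteq> j \<Longrightarrow> comaximal (f i) (f j)"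
    using comaximal_family_same_degree by metis
  define \<epsilon> where "\<epsilon> i \<kappa> l = coeff (monom 1 \<kappa> mod f i) l" for i \<kappa> l
  have mod_sum: "(\<Sum>\<kappa><m. monom (u \<kappa>) \<kappa>) mod h = (\<Sum>\<kappa><m. smult (u \<kappa>) (monom 1 \<kappa> mod h))"
    for u :: "nat \<Rightarrow> 'k" and m h
    by (induction m) (auto simp: poly_mod_add_left mod_smult_left[symmetric] smult_monom)
  have sum_eps: "(\<Sum>\<kappa><m. u \<kappa> * \<epsilon> i \<kappa> l) = coeff ((\<Sum>\<kappa><m. monom (u \<kappa>) \<kappa>) mod f i) l" for u m i l
    by (simp add: mod_sum coeff_sum \<epsilon>_def)
  have main: "(\<forall>u. (\<forall>i\<in>T. \<forall>l<d. (\<Sum>\<kappa><d * g. u \<kappa> * \<epsilon> i \<kappa> l) = 0) \<longrightarrow> (\<forall>\<kappa><d * g. u \<kappa> = 0)) \<and>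
     (\<forall>r. \<exists>u. \<forall>i\<in>T. \<forall>l<d. (\<Sum>\<kappa><d * g. u \<kappa> * \<epsilon> i \<kappa> l) = r i l)"
    if T: "T \<subseteq> {..<n}" "card T = g" for T g
  proof (intro conjI allI impI)
    have finT: "finite T" using T finite_subset by blast
    have co: "comaximal (f i) (f j)" if "i \<in> T" "j \<in> T" "i \<noteq> j" for i j using f(2) that T by blast
    have nz: "f i \<noteq> 0" if "i \<in> T" for i
    proof -
      have "degree (f i) = d" using f(1) that T by auto
      then show ?thesis using d by auto
    qed
    let ?F = "\<Prod>i\<in>T. f i"
    have F: "?F \<noteq> 0" using nz finT by simp
    have "degree ?F = (\<Sum>i\<in>T. degree (f i))" using nz by (intro degree_prod_eq_sum_degree) auto
    also have "\<dots> = (\<Sum>i\<in>T. d)" using f(1) T by (intro sum.cong) auto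
    finally have dF: "degree ?F = d * g" using T by simp
    have small: "h = 0 \<or> degree h < d" if "i \<in> T" "h = p mod f i" for i p h
      using degree_mod_less[OF nz[OF that(1)], of p] f(1)[of i] that T by auto
    { fix u \<kappa> assume u: "\<forall>i\<in>T. \<forall>l<d. (\<Sum>\<kappa><d * g. u \<kappa> * \<epsilon> i \<kappa> l) = 0" and \<kappa>: "\<kappa> < d * g"
      define p where "p = (\<Sum>\<kappa><d * g. monom (u \<kappa>) \<kappa>)"
      have cp: "coeff p \<kappa> = (if \<kappa> < d * g then u \<kappa> else 0)" for \<kappa>
        by (auto simp: p_def coeff_sum)
      have "f i dvd p" if i: "i \<in> T" for i
      proof -
        have "coeff (p mod f i) l = 0" for l
        proof (cases "l < d")
          case True then show ?thesis using u i by (simp add: sum_eps p_def)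
        next
          case False then show ?thesis using small[OF i refl, of p] by (metis coeff_0 coeff_eq_0 leI less_le_trans)
        qed
        then have "p mod f i = 0" by (simp add: poly_eq_iff)
        then show ?thesis by (simp add: dvd_eq_mod_eq_0)
      qed
      then have "?F dvd p" using finT co by (intro prod_dvd) auto
      have "p = 0"
      proof (rule ccontr)
        assume "p \<noteq> 0"
        then have "d * g \<le> degree p" using dvd_imp_degree_le[OF \<open>?F dvd p\<close>] dF by simp
        then have "coeff p (degree p) = 0" by (simp add: cp)
        then show False using \<open>p \<noteq> 0\<close> by simp
      qed
      then show "u \<kappa> = 0" using cp[of \<kappa>] \<kappa> by simp }
    { fix r :: "nat \<Rightarrow> nat \<Rightarrow> 'k"
      define R where "R i = (\<Sum>l<d. monom (r i l) l)" for i
      have cR: "coeff (R i) l = (if l < d then r i l else 0)" for i l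
        by (auto simp: R_def coeff_sum)
      obtain p where p: "\<And>i. i \<in> T \<Longrightarrow> f i dvd p - R i"
        using chinese_remainder_poly[OF finT, of f R] co by blast
      \<comment> \<open>Reduction modulo the product brings the solution into K and does not change
        its residues.\<close>
      define w where "w = p mod ?F"
      have cw: "coeff w \<kappa> = 0" if "\<kappa> \<ge> d * g" for \<kappa>
        using degree_mod_less[OF F, of p] dF that by (auto simp: w_def coeff_eq_0)
      have w: "w = (\<Sum>\<kappa><d * g. monom (coeff w \<kappa>) \<kappa>)"
      proof (rule poly_eqI)
        fix m
        show "coeff w m = coeff (\<Sum>\<kappa><d * g. monom (coeff w \<kappa>) \<kappa>) m"
          using cw[of m] by (auto simp: coeff_sum)
      qed
      have "(\<Sum>\<kappa><d * g. coeff w \<kappa> * \<epsilon> i \<kappa> l) = r i l" if i: "i \<in> T" and l: "l < d" for i l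
      proof -
        have "f i dvd ?F" using i finT by (intro dvd_prodI) auto
        moreover have "?F dvd w - p" unfolding w_def by (metis dvd_minus_mod dvd_diff_commute)
        ultimately have "f i dvd (w - p) + (p - R i)" using p[OF i] by (meson dvd_add dvd_trans)
        then have "f i dvd w - R i" by simp
        then have "(w - R i) mod f i = 0" by (simp add: dvd_eq_mod_eq_0)
        then have "w mod f i = R i mod f i" by (simp add: poly_mod_diff_left)
        also have "\<dots> = R i"
        proof (rule mod_poly_less)
          have "degree (R i) \<le> d - 1" using d by (intro degree_le) (auto simp: cR)
          then show "degree (R i) < degree (f i)" using f(1)[of i] i T d by auto
        qed
        finally show ?thesis using l by (simp add: sum_eps w[symmetric] cR)
      qed
      then show "\<exists>u. \<forall>i\<in>T. \<forall>l<d. (\<Sum>\<kappa><d * g. u \<kappa> * \<epsilon> i \<kappa> l) = r i l" by blast }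
  qed
  then have "general_maps n d g \<epsilon>" for g unfolding general_maps_def by simp
  then show ?thesis using d by blast
qed

section \<open>Removing a degree\<close>

text \<open>The position of a generator is minus the rank of its degree in \<open>A\<close>. For |A|
  = a + 1 the last condition is the hypothesis \<open>ex\<close> of
  \<open>acyclicity\<close>.\<close>

definition pure_exact ::
  "nat \<Rightarrow> nat set \<Rightarrow> 'j set \<Rightarrow> ('j \<Rightarrow> nat set) \<Rightarrow> ('j \<Rightarrow> int) \<Rightarrow> ('j \<Rightarrow> 'j \<Rightarrow> 'k::field) \<Rightarrow> bool" where
  "pure_exact n A J \<tau> pos D \<longleftrightarrow> sqc n J \<tau> pos D \<and> min_sqc J \<tau> D \<and>
     (\<forall>j\<in>J. card (\<tau> j) \<in> A \<and> pos j = - int (card {x \<in> A. x < card (\<tau> j)})) \<and>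
     (\<forall>s\<in>A. \<exists>j\<in>J. card (\<tau> j) = s) \<and>
     (\<forall>B\<subseteq>{..<n}. \<forall>i. card B + card A > n + 1 \<longrightarrow> ex_at D pos (lab J \<tau> (iv {} B)) i)"

lemma sum_inj_image: "inj_on h J \<Longrightarrow> (\<Sum>m\<in>h ` J. f m) = (\<Sum>m\<in>J. f (h m))"
  by (simp add: sum.reindex)

text \<open>Each removal enlarges the index type; renumbering the finite basis keeps the induction
  over the removed degrees within one type.\<close>

lemma pure_exact_nat:
  assumes "pure_exact n A (J :: 'j set) \<tau> pos (D :: 'j \<Rightarrow> 'j \<Rightarrow> 'k::field)"
  shows "\<exists>(J' :: nat set) \<tau>' pos' (D' :: nat \<Rightarrow> nat \<Rightarrow> 'k). pure_exact n A J' \<tau>' pos' D'"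
proof -
  have s: "sqc n J \<tau> pos D" using assms by (simp add: pure_exact_def)
  obtain h :: "'j \<Rightarrow> nat" where h: "inj_on h J"
    using finite_imp_inj_to_nat_seg[OF bcx_finite[OF sqc_bcx[OF s]]] by blast
  let ?v = "inv_into J h"
  have v: "?v (h j) = j" if "j \<in> J" for j using h that by simp
  have "sqc n (h ` J) (\<lambda>j. \<tau> (?v j)) (\<lambda>j. pos (?v j)) (\<lambda>j l. D (?v j) (?v l))"
    using s h unfolding sqc_def bcx_def by (simp add: v sum_inj_image)
  moreover have "ex_at (\<lambda>j l. D (?v j) (?v l)) (\<lambda>j. pos (?v j)) (lab (h ` J) (\<lambda>j. \<tau> (?v j)) \<Z>) i"
    if "ex_at D pos (lab J \<tau> \<Z>) i" for \<Z> i
  proof -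
    have "lab (h ` J) (\<lambda>j. \<tau> (?v j)) \<Z> = h ` lab J \<tau> \<Z>" by (auto simp: lab_def v)
    moreover have "ex_at (\<lambda>j l. D (?v j) (?v l)) (\<lambda>j. pos (?v j)) (h ` lab J \<tau> \<Z>) (i + 0)"
      using that by (intro ex_at_reindex[where c = 1] inj_on_subset[OF h lab_subset]) (auto simp: v lab_def)
    ultimately show ?thesis by simp
  qed
  ultimately have "pure_exact n A (h ` J) (\<lambda>j. \<tau> (?v j)) (\<lambda>j. pos (?v j)) (\<lambda>j l. D (?v j) (?v l))"
    using assms unfolding pure_exact_def by (simp add: v min_sqc_def)
  then show ?thesis by blast
qed

text \<open>The Koszul complex is the total complex of a single generator with empty label.
  Exactness is claimed for nonempty \<open>B\<close>, and the empty label does not contain such a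
  \<open>B\<close>, so \<open>tot_qiso\<close> compares with the zero complex.\<close>

lemma pure_exact_start:
  "\<exists>(J :: (unit \<times> nat set) set) \<tau> pos (D :: _ \<Rightarrow> _ \<Rightarrow> 'k::field). pure_exact n {0..n} J \<tau> pos D"
proof -
  let ?d = "\<lambda>_ _. 0 :: 'k" and ?\<tau> = "\<lambda>_::unit. {} :: nat set" and ?p = "\<lambda>_::unit. 0 :: int"
  have s: "sqc n UNIV ?\<tau> ?p ?d" by (auto simp: sqc_def bcx_def)
  have "pure_exact n {0..n} (tot_set n UNIV ?\<tau>) snd (tot_pos ?p) (tot_D ?p ?d)"
    unfolding pure_exact_def
  proof (intro conjI sqc_tot[OF s] ballI allI impI)
    show "min_sqc (tot_set n UNIV ?\<tau>) snd (tot_D ?p ?d)"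
      unfolding min_sqc_def by (auto simp: tot_D_def)
    fix m assume "m \<in> tot_set n UNIV ?\<tau>"
    then have m: "snd m \<subseteq> {..<n}" by (auto simp: tot_set_def)
    then have c: "card (snd m) \<le> n" using card_mono[OF finite_lessThan m] by simp
    then show "card (snd m) \<in> {0..n}" by simp
    have "{x \<in> {0..n}. x < card (snd m)} = {..<card (snd m)}" using c by auto
    then show "tot_pos ?p m = - int (card {x \<in> {0..n}. x < card (snd m)})"
      by (auto simp: tot_pos_def split: prod.splits)
  next
    fix t assume "t \<in> {0..n}"
    then have "((), {..<t}) \<in> tot_set n UNIV ?\<tau>" "card (snd ((), {..<t})) = t" by (auto simp: tot_set_def)
    then show "\<exists>m\<in>tot_set n UNIV ?\<tau>. card (snd m) = t" by blast
  next
    fix B i assume B: "B \<subseteq> {..<n}" "card B + card {0..n} > n + 1"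
    then have "lab UNIV ?\<tau> (iv B {..<n}) = {}" by (auto simp: lab_def iv_def)
    then have "ex_at ?d ?p (lab UNIV ?\<tau> (iv B {..<n})) i" by (intro ex_at_trivial) simp
    then show "ex_at (tot_D ?p ?d) (tot_pos ?p) (lab (tot_set n UNIV ?\<tau>) snd (iv {} B)) i"
      using qiso_ex_iff[OF tot_qiso[OF s B(1)]] by blast
  qed
  then show ?thesis by blast
qed

section \<open>The cone that removes one degree\<close>

locale gap_step =
  fixes n g d :: nat and A :: "nat set" and J :: "'j set" and \<tau> :: "'j \<Rightarrow> nat set" and pos :: "'j \<Rightarrow> int"
    and D :: "'j \<Rightarrow> 'j \<Rightarrow> 'k::field" and \<epsilon> :: "nat \<Rightarrow> nat \<Rightarrow> nat \<Rightarrow> 'k"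
  assumes pe: "pure_exact n A J \<tau> pos D" and g: "g \<in> A" and d: "d \<ge> 1"
    and eps_inj: "\<And>T u \<kappa>. T \<subseteq> {..<n} \<Longrightarrow> card T = g \<Longrightarrow>
        (\<And>i l. i \<in> T \<Longrightarrow> l < d \<Longrightarrow> (\<Sum>\<kappa><d * g. u \<kappa> * \<epsilon> i \<kappa> l) = 0) \<Longrightarrow> \<kappa> < d * g \<Longrightarrow> u \<kappa> = 0"
    and eps_surj: "\<And>T r. T \<subseteq> {..<n} \<Longrightarrow> card T = g \<Longrightarrow>
        \<exists>u. \<forall>i\<in>T. \<forall>l<d. (\<Sum>\<kappa><d * g. u \<kappa> * \<epsilon> i \<kappa> l) = r i l"
begin

lemma s: "sqc n J \<tau> pos D" and m: "min_sqc J \<tau> D"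
  and purity: "j \<in> J \<Longrightarrow> card (\<tau> j) \<in> A \<and> pos j = - int (card {x \<in> A. x < card (\<tau> j)})"
  and all_degs: "t \<in> A \<Longrightarrow> \<exists>j\<in>J. card (\<tau> j) = t"
  and exact: "B \<subseteq> {..<n} \<Longrightarrow> card B + card A > n + 1 \<Longrightarrow> ex_at D pos (lab J \<tau> (iv {} B)) i"
  using pe by (auto simp: pure_exact_def)

lemma A_le: "t \<in> A \<Longrightarrow> t \<le> n"
  using all_degs sqc_tau[OF s] card_mono[OF finite_lessThan, of _ n] by fastforce

lemma finA: "finite A"
  using A_le by (metis finite_nat_set_iff_bounded_le)

lemma eps_inj_ge:
  assumes T: "T \<subseteq> {..<n}" "card T \<ge> g"
    and u: "\<And>i l. i \<in> T \<Longrightarrow> l < d \<Longrightarrow> (\<Sum>\<kappa><d * g. u \<kappa> * \<epsilon> i \<kappa> l) = 0" and k: "\<kappa> < d * g"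
  shows "u \<kappa> = 0"
proof -
  obtain T' where "T' \<subseteq> T" "card T' = g" using obtain_subset_with_card_n[OF T(2)] by metis
  then show ?thesis using T(1) u k by (intro eps_inj[of T' u \<kappa>]) auto
qed

lemma superset_card:
  assumes T: "T \<subseteq> {..<n}" "card T \<le> g"
  obtains T' where "T \<subseteq> T'" "T' \<subseteq> {..<n}" "card T' = g"
proof -
  have "\<exists>T'. T \<subseteq> T' \<and> T' \<subseteq> {..<n} \<and> card T' = g"
    using exists_subset_between[of T g "{..<n}"] T A_le[OF g] by auto
  then show ?thesis using that by blast
qed

lemma eps_surj_le:
  assumes T: "T \<subseteq> {..<n}" "card T \<le> g"
  shows "\<exists>u. \<forall>i\<in>T. \<forall>l<d. (\<Sum>\<kappa><d * g. u \<kappa> * \<epsilon> i \<kappa> l) = r i l"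
proof -
  obtain T' where "T \<subseteq> T'" "T' \<subseteq> {..<n}" "card T' = g" using superset_card[OF T] .
  then show ?thesis using eps_surj[of T' r] by (meson subsetD)
qed

text \<open>Enlarge \<open>T\<close> to g elements and take u with nonzero residue only at an added
  element: u is nonzero and its residues on \<open>T\<close> vanish.\<close>

lemma eps_kernel:
  assumes T: "T \<subseteq> {..<n}" "card T < g"
  obtains u \<kappa> where "\<kappa> < d * g" "u \<kappa> \<noteq> 0"
    "\<And>i l. i \<in> T \<Longrightarrow> l < d \<Longrightarrow> (\<Sum>\<kappa><d * g. u \<kappa> * \<epsilon> i \<kappa> l) = 0"
proof -
  obtain T' where T': "T \<subseteq> T'" "T' \<subseteq> {..<n}" "card T' = g" using superset_card[OF T(1)] T(2) by auto
  then obtain v where v: "v \<in> T'" "v \<notin> T" using T(2) by (metis nat_less_le subsetI subset_antisym)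
  obtain u where u: "\<forall>i\<in>T'. \<forall>l<d. (\<Sum>\<kappa><d * g. u \<kappa> * \<epsilon> i \<kappa> l) = of_bool (i = v)"
    using eps_surj[OF T'(2,3), of "\<lambda>i l. of_bool (i = v)"] by blast
  have "\<exists>\<kappa><d * g. u \<kappa> \<noteq> 0"
  proof (rule ccontr)
    assume "\<not> (\<exists>\<kappa><d * g. u \<kappa> \<noteq> 0)"
    then have "(\<Sum>\<kappa><d * g. u \<kappa> * \<epsilon> v \<kappa> 0) = 0" by (intro sum.neutral) auto
    moreover have "(\<Sum>\<kappa><d * g. u \<kappa> * \<epsilon> v \<kappa> 0) = 1" using u v d by auto
    ultimately show False by simp
  qed
  then obtain \<kappa> where "\<kappa> < d * g" "u \<kappa> \<noteq> 0" by blast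
  moreover have "(\<Sum>\<kappa><d * g. u \<kappa> * \<epsilon> i \<kappa> l) = 0" if "i \<in> T" "l < d" for i l
    using u that T' v by auto
  ultimately show ?thesis by (rule that)
qed

text \<open>A residue vector concentrated at one v in \<open>T\<close> is not attained:
  \<open>T - {v}\<close> still has at least g elements, so u would be 0.\<close>

lemma eps_cokernel:
  assumes T: "T \<subseteq> {..<n}" "card T > g"
  obtains r where "\<not> (\<exists>u. \<forall>i\<in>T. \<forall>l<d. (\<Sum>\<kappa><d * g. u \<kappa> * \<epsilon> i \<kappa> l) = r i l)"
proof -
  have "finite T" using T finite_subset by blast
  obtain v where v: "v \<in> T" using T by fastforce
  have no: "\<not> (\<exists>u. \<forall>i\<in>T. \<forall>l<d. (\<Sum>\<kappa><d * g. u \<kappa> * \<epsilon> i \<kappa> l) = of_bool (i = v))"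
  proof
    assume "\<exists>u. \<forall>i\<in>T. \<forall>l<d. (\<Sum>\<kappa><d * g. u \<kappa> * \<epsilon> i \<kappa> l) = of_bool (i = v)"
    then obtain u where u: "\<And>i l. i \<in> T \<Longrightarrow> l < d \<Longrightarrow> (\<Sum>\<kappa><d * g. u \<kappa> * \<epsilon> i \<kappa> l) = of_bool (i = v)"
      by blast
    have "u \<kappa> = 0" if "\<kappa> < d * g" for \<kappa>
    proof (rule eps_inj_ge[of "T - {v}" u, OF _ _ _ that])
      show "g \<le> card (T - {v})" using T v \<open>finite T\<close> by simp
    qed (use T u in auto)
    then have "(\<Sum>\<kappa><d * g. u \<kappa> * \<epsilon> v \<kappa> 0) = 0" by (intro sum.neutral) auto
    then show False using u[OF v, of 0] d by simp
  qed
  then show ?thesis by (rule that)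
qed

end

lemma mapp_eq_0I: "(\<And>j. j \<in> Z \<Longrightarrow> l \<in> Z' \<Longrightarrow> x j * M j l = 0) \<Longrightarrow> mapp M Z Z' x l = 0"
  by (auto simp: mapp_def intro!: sum.neutral)

context gap_step
begin

definition "C = Inl ` {..<d * g} \<union> Inr ` ({..<n} \<times> {..<d})"

definition step_map :: "nat + nat \<times> nat \<Rightarrow> nat + nat \<times> nat \<Rightarrow> 'k" where
  "step_map x y = (case (x, y) of (Inl \<kappa>, Inr (i, l)) \<Rightarrow> \<epsilon> i \<kappa> l | _ \<Rightarrow> 0)"

text \<open>The cone of \<open>X \<otimes> K \<rightarrow> \<Oplus>\<^sub>i X\<^sub>i \<otimes> E\<^sub>i\<close>, where \<open>X\<^sub>i\<close> is the quotient of the complex \<open>X\<close> spanned by the \<open>j\<close>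
  with \<open>i \<in> \<tau> j\<close>: \<open>Inl \<kappa>\<close> indexes the basis of \<open>K\<close>, and \<open>Inr (i, l)\<close> the basis of \<open>E\<^sub>i\<close>.\<close>

definition Y :: "('j \<times> (nat + nat \<times> nat)) set" where
  "Y = {(j, x). j \<in> J \<and> x \<in> C \<and> (\<forall>i l. x = Inr (i, l) \<longrightarrow> i \<in> \<tau> j)}"

text \<open>The cone is shifted such that the source keeps its positions. Degrees below g will stay
  where they are, and degrees above g will move up by one.\<close>

definition ypos :: "'j \<times> (nat + nat \<times> nat) \<Rightarrow> int" where
  "ypos = (\<lambda>(j, x). pos j + of_bool (\<not> isl x))"

definition yD :: "'j \<times> (nat + nat \<times> nat) \<Rightarrow> 'j \<times> (nat + nat \<times> nat) \<Rightarrow> 'k" where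
  "yD = (\<lambda>(j, x) (l, y). of_bool (y = x) * D j l + of_bool (l = j) * psgn (pos j) * step_map x y)"

abbreviation "ylab \<equiv> \<lambda>(j, x). \<tau> j"

lemma finC: "finite C" by (simp add: C_def)

lemma finJ: "finite J" using bcx_finite[OF sqc_bcx[OF s]] .

lemma step_map_nonzero:
  assumes "step_map x y \<noteq> 0" obtains \<kappa> i l where "x = Inl \<kappa>" "y = Inr (i, l)"
  using assms by (auto simp: step_map_def split: sum.splits prod.splits)

lemma step_map_same [simp]: "step_map x x = 0"
  by (auto simp: step_map_def split: sum.splits prod.splits)

lemma step_map_step_map: "step_map x y * step_map y z = 0"
  by (auto simp: step_map_def split: sum.splits prod.splits)

lemma yD_nonzero:
  assumes "yD (j, x) (l, y) \<noteq> 0"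
  shows "y = x \<and> D j l \<noteq> 0 \<or> l = j \<and> isl x \<and> \<not> isl y"
proof (cases "step_map x y = 0")
  case True then show ?thesis using assms by (auto simp: yD_def)
next
  case False
  then obtain \<kappa> i l where *: "x = Inl \<kappa>" "y = Inr (i, l)" by (rule step_map_nonzero)
  then show ?thesis using assms by (auto simp: yD_def)
qed

text \<open>As for \<open>sqc_tot\<close>, with \<open>step_map\<close> in place of the Koszul
  differential. The pairs missing in \<open>Y\<close> contribute nothing to the sums: if i is not in
  \<open>\<tau> q\<close>, it is in no label that \<open>D\<close> reaches from
  \<open>q\<close>.\<close>

lemma sqc_Y: "sqc n Y ylab ypos yD"
proof -
  have sq: "(\<Sum>m\<in>Y. yD (j, x) m * yD m (l, z)) = 0" if jx: "(j, x) \<in> Y" and lz: "(l, z) \<in> Y" for j x l z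
  proof -
    have j: "j \<in> J" "x \<in> C" and l: "l \<in> J" "z \<in> C" using jx lz by (auto simp: Y_def)
    have "(\<Sum>m\<in>Y. yD (j, x) m * yD m (l, z)) = (\<Sum>m\<in>J \<times> C. yD (j, x) m * yD m (l, z))"
    proof (rule sum.mono_neutral_left)
      show "finite (J \<times> C)" using finJ finC by simp
      show "Y \<subseteq> J \<times> C" by (auto simp: Y_def)
      show "\<forall>m\<in>J \<times> C - Y. yD (j, x) m * yD m (l, z) = 0"
      proof
        fix m assume "m \<in> J \<times> C - Y"
        then obtain q y where q: "m = (q, y)" "q \<in> J" "y \<in> C" "(q, y) \<notin> Y" by blast
        have "yD (q, y) (l, z) = 0"
        proof (rule ccontr)
          assume "yD (q, y) (l, z) \<noteq> 0"
          from yD_nonzero[OF this] show False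
          proof
            assume "z = y \<and> D q l \<noteq> 0"
            then show False using q lz sqc_D[OF s q(2) l(1)] by (auto simp: Y_def)
          next
            assume "l = q \<and> isl y \<and> \<not> isl z"
            then show False using q by (auto simp: Y_def)
          qed
        qed
        then show "yD (j, x) m * yD m (l, z) = 0" using q by simp
      qed
    qed
    also have "\<dots> = (\<Sum>m\<in>J. \<Sum>y\<in>C. yD (j, x) (m, y) * yD (m, y) (l, z))"
      by (simp add: sum.cartesian_product)
    also have "\<dots> = (\<Sum>m\<in>J. \<Sum>y\<in>C.
        (if y = x then of_bool (z = x) * (D j m * D m l) else 0)
        + (if m = l then (if y = x then D j l * psgn (pos l) * step_map x z else 0) else 0)
        + (if m = j then (if y = z then psgn (pos j) * step_map x z * D j l else 0) else 0))"
    proof (intro sum.cong refl)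
      fix m y
      show "yD (j, x) (m, y) * yD (m, y) (l, z) =
        (if y = x then of_bool (z = x) * (D j m * D m l) else 0)
        + (if m = l then (if y = x then D j l * psgn (pos l) * step_map x z else 0) else 0)
        + (if m = j then (if y = z then psgn (pos j) * step_map x z * D j l else 0) else 0)"
        using step_map_step_map[of x y z] by (auto simp: yD_def algebra_simps)
    qed
    also have "\<dots> = of_bool (z = x) * (\<Sum>m\<in>J. D j m * D m l)
        + D j l * psgn (pos l) * step_map x z + psgn (pos j) * step_map x z * D j l"
    proof -
      have del: "(\<Sum>m\<in>J. \<Sum>y\<in>B. if m = q then h y else 0) = (\<Sum>y\<in>B. h y)" if "q \<in> J"
        for q and h :: "nat + nat \<times> nat \<Rightarrow> 'k" and B
        using that finJ by (subst sum.swap) simp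
      show ?thesis
        unfolding sum.distrib del[OF j(1)] del[OF l(1)] using j l finC by (simp add: sum_distrib_left)
    qed
    also have "\<dots> = 0"
    proof -
      have "(\<Sum>m\<in>J. D j m * D m l) = 0" using sqc_bcx[OF s] j l unfolding bcx_def by blast
      moreover have "D j l * psgn (pos l) * step_map x z + psgn (pos j) * step_map x z * D j l = 0"
      proof (cases "D j l = 0")
        case False
        then have "psgn (pos l) = - (psgn (pos j) :: 'k)"
          using bcx_pos[OF sqc_bcx[OF s] j(1) l(1)] by (simp add: psgn_Suc)
        then show ?thesis by (simp add: algebra_simps)
      qed simp
      ultimately show ?thesis by simp
    qed
    finally show ?thesis .
  qed
  have "finite Y" using finJ finC by (intro finite_subset[of Y "J \<times> C"]) (auto simp: Y_def)
  then show ?thesis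
    unfolding sqc_def bcx_def
  proof (intro conjI ballI impI)
    fix a b assume ab: "a \<in> Y" "b \<in> Y"
    obtain j x l y where [simp]: "a = (j, x)" "b = (l, y)" by (metis prod.exhaust)
    have jl: "j \<in> J" "l \<in> J" using ab by (auto simp: Y_def)
    show "(\<Sum>m\<in>Y. yD a m * yD m b) = 0" using sq ab by simp
    assume nz: "yD a b \<noteq> 0"
    show "ypos b = ypos a + 1"
      using yD_nonzero[of j x l y] nz bcx_pos[OF sqc_bcx[OF s] jl] by (auto simp: ypos_def)
    show "ylab b \<subseteq> ylab a"
      using yD_nonzero[of j x l y] nz sqc_D[OF s jl] by auto
  qed (use sqc_tau[OF s] in \<open>auto simp: Y_def\<close>)
qed

text \<open>The levels are copies of X on the labels inside \<open>B\<close>, and on those that also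
  contain a fixed v. The latter form a quotient, with subcomplex the labels inside
  \<open>B - {v}\<close>. This set is one element smaller, which is made up for by |A| = |A - {g}| +
  1.\<close>

lemma Y_exact:
  assumes B: "B \<subseteq> {..<n}" "card B + card (A - {g}) > n + 1"
  shows "ex_at yD ypos (lab Y ylab (iv {} B)) i"
proof (rule ex_at_levels[where \<phi> = snd and \<rho> = "\<lambda>x. of_bool (\<not> isl x)"])
  show "bcx yD ypos (lab Y ylab (iv {} B))" by (rule sqc_lab_bcx[OF sqc_Y]) simp
next
  fix a b assume "yD a b \<noteq> 0"
  then show "snd b = snd a \<or> of_bool (\<not> isl (snd a)) < (of_bool (\<not> isl (snd b)) :: int)"
    using yD_nonzero[of "fst a" "snd a" "fst b" "snd b"] by auto
next
  fix x assume x: "x \<in> snd ` lab Y ylab (iv {} B)"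
  then have xC: "x \<in> C" by (auto simp: lab_def Y_def)
  have cA: "card A = Suc (card (A - {g}))" using card.remove[OF finA g] .
  have lev: "ex_at yD ypos ((\<lambda>j. (j, x)) ` L) i" if "ex_at D pos L (i - of_bool (\<not> isl x))" for L
  proof -
    have "ex_at yD ypos ((\<lambda>j. (j, x)) ` L) (i - of_bool (\<not> isl x) + of_bool (\<not> isl x))"
      using that by (intro ex_at_reindex[where c = 1]) (auto simp: inj_on_def yD_def ypos_def)
    then show ?thesis by simp
  qed
  show "ex_at yD ypos {a \<in> lab Y ylab (iv {} B). snd a = x} i"
  proof (cases x)
    case (Inl \<kappa>)
    then have "{a \<in> lab Y ylab (iv {} B). snd a = x} = (\<lambda>j. (j, x)) ` lab J \<tau> (iv {} B)"
      using xC by (auto simp: lab_def Y_def)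
    moreover have "card B + card A > n + 1" using B(2) cA by linarith
    ultimately show ?thesis using lev exact[OF B(1)] by simp
  next
    case (Inr p)
    obtain v l where p: "p = (v, l)" by (metis prod.exhaust)
    obtain q where "q \<in> J" "\<tau> q \<subseteq> B" "v \<in> \<tau> q" using x Inr p by (auto simp: lab_def Y_def iv_def)
    then have vB: "v \<in> B" by blast
    have eq: "{a \<in> lab Y ylab (iv {} B). snd a = x} = (\<lambda>j. (j, x)) ` lab J \<tau> (iv {v} B)"
      using xC Inr p by (auto simp: lab_def Y_def iv_def)
    have vB': "insert v (B - {v}) = B" using vB by auto
    interpret sp: split_cx D pos "lab J \<tau> (iv {} (B - {v}))" "lab J \<tau> (iv {v} B)"
      using split_interval(1)[OF s, of v "B - {v}" "{}"] vB' by simp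
    have un: "lab J \<tau> (iv {} (B - {v})) \<union> lab J \<tau> (iv {v} B) = lab J \<tau> (iv {} B)"
      using split_interval(2)[OF s, of v "B - {v}" "{}"] vB' by simp
    have "finite B" using B finite_subset by blast
    then have "card B = Suc (card (B - {v}))" using vB by (rule card.remove)
    then have "card (B - {v}) + card A > n + 1" using B(2) cA by linarith
    then have "ex_at D pos (lab J \<tau> (iv {} (B - {v}))) k" for k
      using B(1) by (intro exact) auto
    moreover have "ex_at D pos (lab J \<tau> (iv {} B)) k" for k using B(2) cA by (intro exact[OF B(1)]) linarith
    ultimately have "ex_at D pos (lab J \<tau> (iv {v} B)) k" for k
      using sp.ex_quot unfolding un by blast
    then show ?thesis unfolding eq using lev by blast
  qed
qed

lemma pos_eq: "j \<in> J \<Longrightarrow> l \<in> J \<Longrightarrow> \<tau> l = \<tau> j \<Longrightarrow> pos l = pos j"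
  using purity[of j] purity[of l] by simp

text \<open>Minimality removes the contribution of \<open>D\<close>, so the strand of label
  \<open>T\<close> is a direct sum of copies of K -> (+) E_i over i in \<open>T\<close>, up to
  sign.\<close>

lemma yD_label:
  assumes "(j, x) \<in> lab Y ylab {T}" "(l, y) \<in> lab Y ylab {T}"
  shows "yD (j, x) (l, y) = of_bool (l = j) * psgn (pos j) * step_map x y"
  using assms m by (auto simp: yD_def lab_def Y_def min_sqc_def)

lemma in_Y_label:
  assumes "j \<in> J" "\<tau> j = T"
  shows "\<kappa> < d * g \<Longrightarrow> (j, Inl \<kappa>) \<in> lab Y ylab {T}"
    and "i \<in> T \<Longrightarrow> l < d \<Longrightarrow> (j, Inr (i, l)) \<in> lab Y ylab {T}"
  using assms sqc_tau[OF s assms(1)] by (auto simp: lab_def Y_def C_def)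

lemma finYl: "finite (lab Y ylab {T})"
  by (rule finite_subset[OF lab_subset bcx_finite[OF sqc_bcx[OF sqc_Y]]])

lemma y_app:
  assumes j: "j \<in> J" "\<tau> j = T" and i: "i \<in> T" "l < d"
  shows "mapp yD (lab Y ylab {T}) (lab Y ylab {T}) w (j, Inr (i, l))
    = psgn (pos j) * (\<Sum>\<kappa><d * g. w (j, Inl \<kappa>) * \<epsilon> i \<kappa> l)"
proof -
  let ?Z = "lab Y ylab {T}"
  let ?f = "\<lambda>\<kappa>. (j, Inl \<kappa> :: nat + nat \<times> nat)"
  have "(\<Sum>m\<in>?Z. w m * yD m (j, Inr (i, l))) = (\<Sum>m\<in>?f ` {..<d * g}. w m * yD m (j, Inr (i, l)))"
  proof (rule sum.mono_neutral_right[OF finYl])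
    show "?f ` {..<d * g} \<subseteq> ?Z" using in_Y_label(1)[OF j] by auto
    show "\<forall>m\<in>?Z - ?f ` {..<d * g}. w m * yD m (j, Inr (i, l)) = 0"
    proof
      fix m assume m: "m \<in> ?Z - ?f ` {..<d * g}"
      obtain q x where [simp]: "m = (q, x)" by (cases m)
      have "yD m (j, Inr (i, l)) = of_bool (j = q) * psgn (pos q) * step_map x (Inr (i, l))"
        using yD_label[of q x T j] m in_Y_label(2)[OF j i] by simp
      moreover have "q = j \<Longrightarrow> step_map x (Inr (i, l)) = 0"
        using m by (auto simp: lab_def Y_def C_def step_map_def split: sum.splits)
      ultimately show "w m * yD m (j, Inr (i, l)) = 0" by auto
    qed
  qed
  also have "\<dots> = (\<Sum>\<kappa><d * g. w (?f \<kappa>) * yD (?f \<kappa>) (j, Inr (i, l)))"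
    by (subst sum.reindex) (auto simp: inj_on_def)
  also have "\<dots> = (\<Sum>\<kappa><d * g. psgn (pos j) * (w (?f \<kappa>) * \<epsilon> i \<kappa> l))"
    by (intro sum.cong) (auto simp: yD_def step_map_def)
  finally show ?thesis using in_Y_label(2)[OF j i] by (simp add: mapp_def sum_distrib_left)
qed

text \<open>By purity \<open>pos\<close> depends only on the label, so a strand occupies two
  adjacent positions.\<close>

lemma Y_label_pos:
  assumes "j \<in> J" "a \<in> lab Y ylab {\<tau> j}"
  shows "ypos a = pos j \<and> isl (snd a) \<or> ypos a = pos j + 1 \<and> \<not> isl (snd a)"
  using assms pos_eq[of j "fst a"] by (auto simp: lab_def Y_def ypos_def split: prod.splits)

text \<open>With the three lemmas that follow: the strand of label \<open>T\<close> has cohomology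
  only at \<open>pos j\<close> for |T| < g, only at \<open>pos j + 1\<close> for |T| > g, and none
  for |T| = g.\<close>

lemma Y_ex_kernel:
  assumes T: "card T \<ge> g" and j: "j \<in> J" "\<tau> j = T"
  shows "ex_at yD ypos (lab Y ylab {T}) (pos j)"
  unfolding ex_at_def
proof (intro ballI impI)
  let ?Z = "lab Y ylab {T}"
  fix x :: "'j \<times> (nat + nat \<times> nat) \<Rightarrow> 'k" assume x: "x \<in> vecs (gr ypos ?Z (pos j))" and dx: "mapp yD ?Z ?Z x = 0"
  have "x a = 0" for a
  proof (rule ccontr)
    assume nz: "x a \<noteq> 0"
    then have a: "a \<in> ?Z" "ypos a = pos j" using vecs_gr_D[OF x] by auto
    then have "isl (snd a)" using Y_label_pos[OF j(1), of a] j(2) by auto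
    then obtain q \<kappa> where "a = (q, Inl \<kappa>)" by (metis isl_def prod.collapse)
    with a(1) have q: "a = (q, Inl \<kappa>)" "q \<in> J" "\<tau> q = T" "\<kappa> < d * g"
      by (auto simp: lab_def Y_def C_def)
    have "x (q, Inl \<kappa>) = 0"
    proof (rule eps_inj_ge[of T "\<lambda>\<kappa>. x (q, Inl \<kappa>)", OF _ T _ q(4)])
      show "T \<subseteq> {..<n}" using sqc_tau[OF s j(1)] j(2) by simp
      fix i l assume il: "i \<in> T" "l < d"
      have "psgn (pos q) * (\<Sum>\<kappa><d * g. x (q, Inl \<kappa>) * \<epsilon> i \<kappa> l) = 0"
        using y_app[OF q(2,3) il, of x] by (simp add: dx)
      then show "(\<Sum>\<kappa><d * g. x (q, Inl \<kappa>) * \<epsilon> i \<kappa> l) = 0" by simp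
    qed
    then show False using nz q by simp
  qed
  then have "mapp yD ?Z ?Z 0 = x" by (simp add: fun_eq_iff)
  then show "\<exists>y\<in>vecs (gr ypos ?Z (pos j - 1)). mapp yD ?Z ?Z y = x" using vecs_0 by blast
qed

lemma Y_ex_cokernel:
  assumes T: "card T \<le> g" and j: "j \<in> J" "\<tau> j = T"
  shows "ex_at yD ypos (lab Y ylab {T}) (pos j + 1)"
  unfolding ex_at_def
proof (intro ballI impI)
  let ?Z = "lab Y ylab {T}"
  fix x :: "'j \<times> (nat + nat \<times> nat) \<Rightarrow> 'k" assume x: "x \<in> vecs (gr ypos ?Z (pos j + 1))"
  have Tn: "T \<subseteq> {..<n}" using sqc_tau[OF s j(1)] j(2) by simp
  \<comment> \<open>One preimage for each generator \<open>q\<close>. The factor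
    \<open>psgn (pos q)\<close> is its own inverse and undoes the sign in
    \<open>y_app\<close>.\<close>
  have "\<exists>u. \<forall>q. \<forall>i\<in>T. \<forall>l<d. (\<Sum>\<kappa><d * g. u q \<kappa> * \<epsilon> i \<kappa> l) = psgn (pos q) * x (q, Inr (i, l))"
    using eps_surj_le[OF Tn T] by (intro choice allI)
  then obtain u where u: "\<And>q i l. i \<in> T \<Longrightarrow> l < d \<Longrightarrow>
      (\<Sum>\<kappa><d * g. u q \<kappa> * \<epsilon> i \<kappa> l) = psgn (pos q) * x (q, Inr (i, l))" by blast
  define y where "y a = (case a of (q, Inl \<kappa>) \<Rightarrow> if a \<in> ?Z then u q \<kappa> else 0 | _ \<Rightarrow> 0)" for a
  have "y \<in> vecs (gr ypos ?Z (pos j + 1 - 1))"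
    unfolding vecs_def
  proof (intro CollectI allI impI, rule ccontr)
    fix a assume a: "a \<notin> gr ypos ?Z (pos j + 1 - 1)" "y a \<noteq> 0"
    then have "a \<in> ?Z" "isl (snd a)" by (auto simp: y_def split: prod.splits sum.splits if_splits)
    then show False using a Y_label_pos[OF j(1), of a] j(2) by (auto simp: gr_def)
  qed
  moreover have "mapp yD ?Z ?Z y = x"
  proof
    fix a show "mapp yD ?Z ?Z y a = x a"
    proof (cases "a \<in> ?Z")
      case False
      then show ?thesis using vecs_D[OF vecs_gr_vecs[OF x]] by (simp add: mapp_def)
    next
      case True
      obtain q z where a: "a = (q, z)" by (cases a)
      then have q: "q \<in> J" "\<tau> q = T" using True by (auto simp: lab_def Y_def)
      show ?thesis
      proof (cases z)
        case (Inl \<kappa>)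
        then have "ypos a \<noteq> pos j + 1" using Y_label_pos[OF j(1), of a] True j(2) a by auto
        then have "x a = 0" using vecs_gr_D[OF x] by blast
        moreover have "y m * yD m a = 0" if "m \<in> ?Z" for m
        proof (cases m)
          case (Pair r w)
          then show ?thesis using yD_label[of r w T q z] that True a Inl
            by (auto simp: step_map_def split: sum.splits)
        qed
        ultimately show ?thesis by (simp add: mapp_eq_0I)
      next
        case (Inr p)
        obtain i l where p: "p = (i, l)" by (cases p)
        then have il: "i \<in> T" "l < d" using True a Inr q by (auto simp: lab_def Y_def C_def)
        have "mapp yD ?Z ?Z y a = psgn (pos q) * (\<Sum>\<kappa><d * g. y (q, Inl \<kappa>) * \<epsilon> i \<kappa> l)"
          unfolding a Inr p by (rule y_app[OF q il])
        also have "(\<Sum>\<kappa><d * g. y (q, Inl \<kappa>) * \<epsilon> i \<kappa> l) = (\<Sum>\<kappa><d * g. u q \<kappa> * \<epsilon> i \<kappa> l)"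
          using in_Y_label(1)[OF q] by (intro sum.cong) (auto simp: y_def)
        also have "\<dots> = psgn (pos q) * x a" using u[OF il] a Inr p by simp
        also have "psgn (pos q) * (psgn (pos q) * x a) = x a" by (simp add: psgn_def)
        finally show ?thesis .
      qed
    qed
  qed
  ultimately show "\<exists>y\<in>vecs (gr ypos ?Z (pos j + 1 - 1)). mapp yD ?Z ?Z y = x" by blast
qed

lemma Y_not_ex_kernel:
  assumes T: "card T < g" and j: "j \<in> J" "\<tau> j = T"
  shows "\<not> ex_at yD ypos (lab Y ylab {T}) (pos j)"
proof
  let ?Z = "lab Y ylab {T}"
  assume ex: "ex_at yD ypos ?Z (pos j)"
  have Tn: "T \<subseteq> {..<n}" using sqc_tau[OF s j(1)] j(2) by simp
  obtain \<kappa> u where u: "\<kappa> < d * g" "u \<kappa> \<noteq> 0"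
    "\<And>i l. i \<in> T \<Longrightarrow> l < d \<Longrightarrow> (\<Sum>\<kappa><d * g. u \<kappa> * \<epsilon> i \<kappa> l) = 0"
    by (rule eps_kernel[OF Tn T]) (rule that)
  define x :: "'j \<times> (nat + nat \<times> nat) \<Rightarrow> 'k"
    where "x a = (case a of (q, Inl \<kappa>) \<Rightarrow> if q = j \<and> \<kappa> < d * g then u \<kappa> else 0 | _ \<Rightarrow> 0)" for a
  have x: "x \<in> vecs (gr ypos ?Z (pos j))"
    unfolding vecs_def
  proof (intro CollectI allI impI, rule ccontr)
    fix a assume a: "a \<notin> gr ypos ?Z (pos j)" "x a \<noteq> 0"
    then obtain \<kappa> where "a = (j, Inl \<kappa>)" "\<kappa> < d * g"
      by (auto simp: x_def split: prod.splits sum.splits if_splits)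
    then show False using a in_Y_label(1)[OF j] by (auto simp: gr_def ypos_def)
  qed
  have "mapp yD ?Z ?Z x = 0"
  proof
    fix a show "mapp yD ?Z ?Z x a = 0 a"
    proof (cases "a \<in> ?Z \<and> \<not> isl (snd a)")
      case True
      then obtain q i l where a: "a = (q, Inr (i, l))" "q \<in> J" "\<tau> q = T" "i \<in> T" "l < d"
        by (cases a; cases "snd a") (auto simp: lab_def Y_def C_def)
      have "(\<Sum>\<kappa><d * g. x (q, Inl \<kappa>) * \<epsilon> i \<kappa> l) = of_bool (q = j) * (\<Sum>\<kappa><d * g. u \<kappa> * \<epsilon> i \<kappa> l)"
        by (auto simp: x_def)
      then show ?thesis unfolding a(1) y_app[OF a(2-5)] using u(3)[OF a(4,5)] by simp
    next
      case False
      have "x m * yD m a = 0" if "m \<in> ?Z" "a \<in> ?Z" for m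
        using False that yD_label[of "fst m" "snd m" T "fst a" "snd a"]
        by (auto simp: step_map_def split: sum.splits prod.splits)
      then show ?thesis by (simp add: mapp_eq_0I)
    qed
  qed
  then obtain y where y: "y \<in> vecs (gr ypos ?Z (pos j - 1))" "mapp yD ?Z ?Z y = x"
    using ex_at_E[OF ex x] by blast
  have "y = 0"
  proof
    fix a show "y a = 0 a"
      using vecs_gr_D[OF y(1), of a] Y_label_pos[OF j(1), of a] j(2) by fastforce
  qed
  then have "x (j, Inl \<kappa>) = 0" using y(2) by auto
  then show False using u(1,2) by (simp add: x_def)
qed

lemma Y_not_ex_cokernel:
  assumes T: "card T > g" and j: "j \<in> J" "\<tau> j = T"
  shows "\<not> ex_at yD ypos (lab Y ylab {T}) (pos j + 1)"
proof
  let ?Z = "lab Y ylab {T}"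
  assume ex: "ex_at yD ypos ?Z (pos j + 1)"
  have Tn: "T \<subseteq> {..<n}" using sqc_tau[OF s j(1)] j(2) by simp
  obtain r where r: "\<not> (\<exists>u. \<forall>i\<in>T. \<forall>l<d. (\<Sum>\<kappa><d * g. u \<kappa> * \<epsilon> i \<kappa> l) = r i l)"
    using eps_cokernel[OF Tn T] .
  define x :: "'j \<times> (nat + nat \<times> nat) \<Rightarrow> 'k"
    where "x a = (case a of (q, Inr (i, l)) \<Rightarrow> if q = j \<and> i \<in> T \<and> l < d then r i l else 0 | _ \<Rightarrow> 0)" for a
  have x: "x \<in> vecs (gr ypos ?Z (pos j + 1))"
    unfolding vecs_def
  proof (intro CollectI allI impI, rule ccontr)
    fix a assume a: "a \<notin> gr ypos ?Z (pos j + 1)" "x a \<noteq> 0"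
    then obtain i l where "a = (j, Inr (i, l))" "i \<in> T" "l < d"
      by (auto simp: x_def split: prod.splits sum.splits if_splits)
    then show False using a in_Y_label(2)[OF j] by (auto simp: gr_def ypos_def)
  qed
  have "mapp yD ?Z ?Z x = 0"
  proof
    fix a
    have "x m * yD m a = 0" if "m \<in> ?Z" "a \<in> ?Z" for m
      using that yD_label[of "fst m" "snd m" T "fst a" "snd a"]
      by (auto simp: x_def step_map_def split: sum.splits prod.splits)
    then show "mapp yD ?Z ?Z x a = 0 a" by (simp add: mapp_eq_0I)
  qed
  then obtain y where y: "mapp yD ?Z ?Z y = x" using ex_at_E[OF ex x] by blast
  have "(\<Sum>\<kappa><d * g. (psgn (pos j) * y (j, Inl \<kappa>)) * \<epsilon> i \<kappa> l) = r i l" if "i \<in> T" "l < d" for i l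
    using y_app[OF j that, of y] that by (simp add: y x_def sum_distrib_left mult.assoc)
  then have "\<exists>u. \<forall>i\<in>T. \<forall>l<d. (\<Sum>\<kappa><d * g. u \<kappa> * \<epsilon> i \<kappa> l) = r i l"
    by (intro exI[of _ "\<lambda>\<kappa>. psgn (pos j) * y (j, Inl \<kappa>)"]) simp
  with r show False ..
qed

text \<open>By \<open>min_ex_at\<close>, generators of the minimal model sit where the strands of
  \<open>Y\<close> have cohomology. So no label of size g is left, all other sizes survive, and
  positions rise by one exactly for sizes above g, whose rank in \<open>A\<close> has dropped by
  one.\<close>

theorem remove_degree:
  "\<exists>(J' :: ('j \<times> (nat + nat \<times> nat)) set) \<tau>' pos' (D' :: _ \<Rightarrow> _ \<Rightarrow> 'k). pure_exact n (A - {g}) J' \<tau>' pos' D'"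
proof -
  obtain J' E \<iota> where J': "J' \<subseteq> Y" "sqc n J' ylab ypos E" "min_sqc J' ylab E"
    and q: "\<And>\<Z>. order_convex \<Z> \<Longrightarrow> qiso E ypos (lab J' ylab \<Z>) yD ypos (lab Y ylab \<Z>) \<iota>"
    using minimal_model[OF sqc_Y] by blast
  have ex_iff: "ex_at yD ypos (lab Y ylab {T}) i \<longleftrightarrow> (\<forall>a\<in>J'. ylab a = T \<longrightarrow> ypos a \<noteq> i)" for T i
    using qiso_ex_iff[OF q[OF order_convex_single]] min_ex_at[OF J'(2,3)] by metis
  have rank: "int (card {x \<in> A - {g}. x < t}) = int (card {x \<in> A. x < t}) - of_bool (g < t)" for t
  proof -
    have eq: "{x \<in> A - {g}. x < t} = {x \<in> A. x < t} - {g}" by auto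
    show ?thesis
    proof (cases "g < t")
      case True
      then have "card {x \<in> A. x < t} = Suc (card ({x \<in> A. x < t} - {g}))"
        using finA g by (intro card.remove) auto
      moreover have "of_bool (g < t) = (1 :: int)" using True by simp
      ultimately show ?thesis unfolding eq by linarith
    next
      case False
      then have "{x \<in> A. x < t} - {g} = {x \<in> A. x < t}" by auto
      then show ?thesis using False unfolding eq by simp
    qed
  qed
  have "pure_exact n (A - {g}) J' ylab ypos E"
    unfolding pure_exact_def
  proof (intro conjI J'(2,3) ballI allI impI)
    fix a assume a: "a \<in> J'"
    obtain j x where ax: "a = (j, x)" by (cases a)
    have j: "j \<in> J" using a J'(1) ax by (auto simp: Y_def)
    have al: "a \<in> lab Y ylab {\<tau> j}" using a J'(1) ax by (auto simp: lab_def)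
    have no: "\<not> ex_at yD ypos (lab Y ylab {\<tau> j}) (ypos a)" using ex_iff a ax by auto
    have cases: "ypos a = pos j \<or> ypos a = pos j + 1" using Y_label_pos[OF j al] by blast
    have K: "ypos a \<noteq> pos j" if "card (\<tau> j) \<ge> g" using Y_ex_kernel[OF that j refl] no by auto
    have C: "ypos a \<noteq> pos j + 1" if "card (\<tau> j) \<le> g" using Y_ex_cokernel[OF that j refl] no by auto
    have ne: "card (\<tau> j) \<noteq> g" using K C cases by auto
    show "card (ylab a) \<in> A - {g}" using ne purity[OF j] ax by simp
    show "ypos a = - int (card {x \<in> A - {g}. x < card (ylab a)})"
    proof (cases "g < card (\<tau> j)")
      case True
      then have "ypos a = pos j + 1" "of_bool (g < card (ylab a)) = (1 :: int)" using K cases ax by auto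
      then show ?thesis using purity[OF j] unfolding rank by (simp add: ax)
    next
      case False
      then have "ypos a = pos j" "of_bool (g < card (ylab a)) = (0 :: int)" using C cases ax by auto
      then show ?thesis using purity[OF j] unfolding rank by (simp add: ax)
    qed
  next
    fix t assume t: "t \<in> A - {g}"
    then obtain j where j: "j \<in> J" "card (\<tau> j) = t" using all_degs by blast
    have "\<not> ex_at yD ypos (lab Y ylab {\<tau> j}) (if t < g then pos j else pos j + 1)"
      using Y_not_ex_kernel[OF _ j(1) refl] Y_not_ex_cokernel[OF _ j(1) refl] j(2) t by auto
    then obtain a where "a \<in> J'" "ylab a = \<tau> j" unfolding ex_iff by metis
    then show "\<exists>a\<in>J'. card (ylab a) = t" using j(2) by (intro bexI[of _ a]) simp_all
  next
    fix B i assume "B \<subseteq> {..<n}" "n + 1 < card B + card (A - {g})"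
    then show "ex_at E ypos (lab J' ylab (iv {} B)) i"
      using Y_exact qiso_ex_iff[OF q[OF order_convex_iv]] by blast
  qed
  then show ?thesis by blast
qed

end

lemma pure_exact_remove:
  assumes "pure_exact n A (J :: 'j set) \<tau> pos (D :: 'j \<Rightarrow> 'j \<Rightarrow> 'k::field)" "g \<in> A"
  shows "\<exists>(J' :: nat set) \<tau>' pos' (D' :: nat \<Rightarrow> nat \<Rightarrow> 'k). pure_exact n (A - {g}) J' \<tau>' pos' D'"
proof -
  obtain d :: nat and \<epsilon> :: "nat \<Rightarrow> nat \<Rightarrow> nat \<Rightarrow> 'k" where d: "d \<ge> 1" "general_maps n d g \<epsilon>"
    using general_maps_exist by blast
  interpret gap_step n g d A J \<tau> pos D \<epsilon>
  proof
    show "pure_exact n A J \<tau> pos D" "g \<in> A" "d \<ge> 1" by (fact assms d(1))+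
    fix T assume T: "T \<subseteq> {..<n}" "card T = g"
    show "u \<kappa> = 0" if "\<And>i l. i \<in> T \<Longrightarrow> l < d \<Longrightarrow> (\<Sum>\<kappa><d * g. u \<kappa> * \<epsilon> i \<kappa> l) = 0" "\<kappa> < d * g" for u \<kappa>
      using d(2) T that unfolding general_maps_def by simp
    show "\<exists>u. \<forall>i\<in>T. \<forall>l<d. (\<Sum>\<kappa><d * g. u \<kappa> * \<epsilon> i \<kappa> l) = r i l" for r
      using d(2) T unfolding general_maps_def by simp
  qed
  obtain J' :: "('j \<times> (nat + nat \<times> nat)) set" and \<tau>' pos' and D' :: "_ \<Rightarrow> _ \<Rightarrow> 'k"
    where "pure_exact n (A - {g}) J' \<tau>' pos' D'" using remove_degree by blast
  then show ?thesis by (rule pure_exact_nat)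
qed

theorem pure_exact_exists:
  assumes A: "A \<subseteq> {0..n}"
  shows "\<exists>(J :: nat set) \<tau> pos (D :: nat \<Rightarrow> nat \<Rightarrow> 'k::field). pure_exact n A J \<tau> pos D"
proof -
  have "\<exists>(J :: nat set) \<tau> pos (D :: nat \<Rightarrow> nat \<Rightarrow> 'k). pure_exact n ({0..n} - G) J \<tau> pos D"
    if "finite G" "G \<subseteq> {0..n}" for G
    using that
  proof (induction G rule: finite_induct)
    case empty
    obtain J :: "(unit \<times> nat set) set" and \<tau> pos and D :: "_ \<Rightarrow> _ \<Rightarrow> 'k"
      where "pure_exact n {0..n} J \<tau> pos D" using pure_exact_start by blast
    then show ?case using pure_exact_nat by simp
  next
    case (insert g G)
    then obtain J :: "nat set" and \<tau> pos and D :: "nat \<Rightarrow> nat \<Rightarrow> 'k"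
      where "pure_exact n ({0..n} - G) J \<tau> pos D" by blast
    then have "\<exists>(J' :: nat set) \<tau>' pos' (D' :: nat \<Rightarrow> nat \<Rightarrow> 'k). pure_exact n ({0..n} - G - {g}) J' \<tau>' pos' D'"
      using insert by (intro pure_exact_remove) auto
    moreover have "{0..n} - G - {g} = {0..n} - insert g G" by auto
    ultimately show ?case by simp
  qed
  from this[of "{0..n} - A"] show ?thesis using A by (simp add: double_diff)
qed

section \<open>Linear duals\<close>

lemma mapp_lincomb:
  "mapp M Z Z' (\<lambda>l. \<Sum>j\<in>G. c j * y j l) = (\<lambda>l. \<Sum>j\<in>G. c j * mapp M Z Z' (y j) l)"
proof
  fix l
  have "(\<Sum>m\<in>Z. (\<Sum>j\<in>G. c j * y j m) * M m l) = (\<Sum>j\<in>G. \<Sum>m\<in>Z. c j * y j m * M m l)"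
    unfolding sum_distrib_right by (rule sum.swap)
  then show "mapp M Z Z' (\<lambda>l. \<Sum>j\<in>G. c j * y j l) l = (\<Sum>j\<in>G. c j * mapp M Z Z' (y j) l)"
    by (simp add: mapp_def sum_distrib_left mult.assoc)
qed

lemma mapp_lower_set:
  assumes s: "sqc n J \<tau> pos D" and Q: "Q \<subseteq> Q'" and y: "y \<in> vecs (lab J \<tau> (iv {} Q))"
  shows "mapp D (lab J \<tau> (iv {} Q')) (lab J \<tau> (iv {} Q')) y
    = mapp D (lab J \<tau> (iv {} Q)) (lab J \<tau> (iv {} Q)) y"
proof
  fix l
  let ?Z = "lab J \<tau> (iv {} Q)" and ?Z' = "lab J \<tau> (iv {} Q')"
  have fin: "finite ?Z'" by (rule finite_subset[OF lab_subset bcx_finite[OF sqc_bcx[OF s]]])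
  have sub: "?Z \<subseteq> ?Z'" using Q by (auto simp: lab_def iv_def)
  have "(\<Sum>j\<in>?Z'. y j * D j l) = (\<Sum>j\<in>?Z. y j * D j l)"
    using fin sub vecs_D[OF y] by (intro sum.mono_neutral_right) auto
  moreover have "(\<Sum>j\<in>?Z. y j * D j l) = 0" if "l \<in> ?Z'" "l \<notin> ?Z"
  proof (rule sum.neutral, rule ballI)
    fix j assume "j \<in> ?Z"
    then have "D j l = 0" using that sqc_D[OF s, of j l] by (auto simp: lab_def iv_def)
    then show "y j * D j l = 0" by simp
  qed
  ultimately show "mapp D ?Z' ?Z' y l = mapp D ?Z ?Z y l" using sub by (auto simp: mapp_def)
qed

lemma mapp_upper_set:
  assumes s: "sqc n J \<tau> pos D" and Q: "Q' \<subseteq> Q"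
  shows "mapp D (lab J \<tau> (iv Q U)) (lab J \<tau> (iv Q U)) (restr (lab J \<tau> (iv Q U)) x)
    = restr (lab J \<tau> (iv Q U)) (mapp D (lab J \<tau> (iv Q' U)) (lab J \<tau> (iv Q' U)) x)"
proof
  fix l
  let ?Z = "lab J \<tau> (iv Q U)" and ?Z' = "lab J \<tau> (iv Q' U)"
  have fin: "finite ?Z'" by (rule finite_subset[OF lab_subset bcx_finite[OF sqc_bcx[OF s]]])
  have sub: "?Z \<subseteq> ?Z'" using Q by (auto simp: lab_def iv_def)
  have "(\<Sum>j\<in>?Z'. x j * D j l) = (\<Sum>j\<in>?Z. restr ?Z x j * D j l)" if l: "l \<in> ?Z"
  proof (rule sum.mono_neutral_cong_right[OF fin sub])
    show "\<forall>j\<in>?Z' - ?Z. x j * D j l = 0"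
    proof
      fix j assume "j \<in> ?Z' - ?Z"
      then have "D j l = 0" using l sqc_D[OF s, of j l] by (auto simp: lab_def iv_def)
      then show "x j * D j l = 0" by simp
    qed
  qed (simp add: restr_def)
  then show "mapp D ?Z ?Z (restr ?Z x) l = restr ?Z (mapp D ?Z' ?Z' x) l"
    using sub by (auto simp: mapp_def restr_def)
qed

section \<open>From acyclicity at both ends to linear resolutions\<close>

locale pure_cx =
  fixes n a b c :: nat and A :: "nat set" and J :: "'j set" and \<tau> :: "'j \<Rightarrow> nat set" and pos :: "'j \<Rightarrow> int"
    and D :: "'j \<Rightarrow> 'j \<Rightarrow> 'k::field"
  assumes pe: "pure_exact n A J \<tau> pos D"
    and A: "A \<subseteq> {c..n - b}" "c \<in> A" "n - b \<in> A" and cardA: "card A = Suc a" and bn: "b \<le> n"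
begin

lemma s: "sqc n J \<tau> pos D" and m: "min_sqc J \<tau> D"
  and purity: "j \<in> J \<Longrightarrow> card (\<tau> j) \<in> A \<and> pos j = - int (card {x \<in> A. x < card (\<tau> j)})"
  and all_degs: "t \<in> A \<Longrightarrow> \<exists>j\<in>J. card (\<tau> j) = t"
  and exact: "B \<subseteq> {..<n} \<Longrightarrow> card B + card A > n + 1 \<Longrightarrow> ex_at D pos (lab J \<tau> (iv {} B)) i"
  using pe by (auto simp: pure_exact_def)

lemma finA: "finite A" using A finite_subset by blast

lemma a_le: "a + b + c \<le> n"
  using card_mono[OF _ A(1)] cardA A(2,3) bn A(1) by auto

lemma tau: "j \<in> J \<Longrightarrow> \<tau> j \<subseteq> {..<n} \<and> finite (\<tau> j)"
  using sqc_tau[OF s] finite_subset by blast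

lemma pos_range: assumes "j \<in> J" shows "- int a \<le> pos j \<and> pos j \<le> 0"
proof -
  have "{x \<in> A. x < card (\<tau> j)} \<subset> A" using purity[OF assms] by auto
  then have "card {x \<in> A. x < card (\<tau> j)} < card A" using finA by (rule psubset_card_mono[rotated])
  then show ?thesis using purity[OF assms] cardA by simp
qed

lemma pos_top: assumes "j \<in> J" "pos j = 0" shows "card (\<tau> j) = c"
proof -
  have "{x \<in> A. x < card (\<tau> j)} = {}" using purity[OF assms(1)] assms(2) finA by simp
  then have "\<not> c < card (\<tau> j)" using A(2) by auto
  moreover have "c \<le> card (\<tau> j)" using purity[OF assms(1)] A(1) by auto
  ultimately show ?thesis by simp
qed

text \<open>An element of \<open>A\<close> below the maximum has at most |A| - 2 = a - 1 elements of
  \<open>A\<close> beneath it.\<close>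

lemma pos_bottom: assumes "j \<in> J" "pos j = - int a" shows "card (\<tau> j) = n - b"
proof (rule ccontr)
  assume ne: "card (\<tau> j) \<noteq> n - b"
  have "card (\<tau> j) \<in> A" using purity[OF assms(1)] by simp
  then have "card (\<tau> j) < n - b" using A(1) ne by auto
  then have "{x \<in> A. x < card (\<tau> j)} \<subseteq> A - {n - b, card (\<tau> j)}" by auto
  moreover have "card (A - {n - b, card (\<tau> j)}) = card A - 2"
    using finA A(3) \<open>card (\<tau> j) \<in> A\<close> ne by (simp add: card_Diff_subset)
  ultimately have "card {x \<in> A. x < card (\<tau> j)} \<le> card A - 2"
    using finA by (metis card_mono finite_Diff)
  moreover have "card A \<ge> 2"
    using card_mono[OF finA, of "{n - b, card (\<tau> j)}"] A(3) \<open>card (\<tau> j) \<in> A\<close> ne by simp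
  ultimately show False using purity[OF assms(1)] assms(2) cardA by simp
qed

sublocale acyclicity n a J \<tau> pos D
proof
  show "sqc n J \<tau> pos D" by (rule s)
  show "a \<le> n" using a_le by simp
  show "ex_at D pos (lab J \<tau> (iv {} B)) i" if "B \<subseteq> {..<n}" "card B > n - a" for B i
    using exact[OF that(1)] that(2) cardA by auto
qed (use pos_range in auto)

lemma compl: "R \<subseteq> {..<n} \<Longrightarrow> {..<n} - ({..<n} - R) = R" by blast

lemma card_compl: "R \<subseteq> {..<n} \<Longrightarrow> card ({..<n} - R) = n - card R"
  using finite_subset[of R "{..<n}"] by (simp add: card_Diff_subset)

lemma card_le: "R \<subseteq> {..<n} \<Longrightarrow> card R \<le> n"
  using card_mono[OF finite_lessThan, of R n] by simp

text \<open>The module resolved by the complex is generated in degrees of size c <= t. If it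
  vanishes in all degrees of size t, then each generator inside \<open>Q'\<close> already dies in
  some \<open>Q\<close> of size t between its label and \<open>Q'\<close>.\<close>

lemma lower_set_exact_mono:
  assumes t: "c \<le> t" "\<And>Q. Q \<subseteq> {..<n} \<Longrightarrow> card Q = t \<Longrightarrow> ex_at D pos (V {} Q) 0"
    and Q': "Q' \<subseteq> {..<n}" "t \<le> card Q'"
  shows "ex_at D pos (V {} Q') 0"
  unfolding ex_at_def
proof (intro ballI impI)
  fix x :: "'j \<Rightarrow> 'k" assume x: "x \<in> vecs (gr pos (V {} Q') 0)"
  have gens: "\<exists>y\<in>vecs (gr pos (V {} Q') (0 - 1)). mapp D (V {} Q') (V {} Q') y = del1 j 1"
    if j: "j \<in> gr pos (V {} Q') 0" for j
  proof -
    have jJ: "j \<in> J" "pos j = 0" "\<tau> j \<subseteq> Q'" using j by (auto simp: gr_def lab_def iv_def)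
    have "card (\<tau> j) \<le> t" using pos_top[OF jJ(1,2)] t(1) by simp
    then obtain Q where Q: "\<tau> j \<subseteq> Q" "Q \<subseteq> Q'" "card Q = t"
      using exists_subset_between[of "\<tau> j" t Q'] jJ(3) Q' finite_subset[of Q' "{..<n}"] by auto
    have d: "del1 j 1 \<in> vecs (gr pos (V {} Q) 0)"
      using jJ Q by (intro del1_vecs) (auto simp: gr_def lab_def iv_def)
    have bc: "bcx D pos (V {} Q)" by (rule sqc_lab_bcx[OF s order_convex_iv])
    \<comment> \<open>Position 0 is the last one.\<close>
    have "mapp D (V {} Q) (V {} Q) (del1 j 1) = 0"
    proof
      fix l
      have "l \<notin> gr pos (V {} Q) (0 + 1)" using pos_range[of l] by (auto simp: gr_def lab_def)
      then show "mapp D (V {} Q) (V {} Q) (del1 j 1) l = 0 l" using vecs_D[OF bcx_gr[OF bc d]] by simp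
    qed
    then obtain y where y: "y \<in> vecs (gr pos (V {} Q) (0 - 1))" "mapp D (V {} Q) (V {} Q) y = del1 j 1"
      using ex_at_E[OF t(2)[of Q] d] Q Q' by (metis order_trans)
    have "V {} Q \<subseteq> V {} Q'" using Q by (auto simp: lab_def iv_def)
    then have "y \<in> vecs (gr pos (V {} Q') (0 - 1))" using y(1) gr_mono vecs_mono by metis
    then show ?thesis using mapp_lower_set[OF s Q(2) vecs_gr_vecs[OF y(1)]] y(2) by metis
  qed
  have "\<forall>j. \<exists>y. j \<in> gr pos (V {} Q') 0 \<longrightarrow>
      y \<in> vecs (gr pos (V {} Q') (0 - 1)) \<and> mapp D (V {} Q') (V {} Q') y = del1 j 1"
    using gens by blast
  then obtain y where y: "\<And>j. j \<in> gr pos (V {} Q') 0 \<Longrightarrow>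
      y j \<in> vecs (gr pos (V {} Q') (0 - 1)) \<and> mapp D (V {} Q') (V {} Q') (y j) = del1 j 1"
    by metis
  let ?G = "gr pos (V {} Q') 0"
  have finG: "finite ?G"
    using bcx_finite[OF sqc_bcx[OF s]] by (rule rev_finite_subset) (auto simp: gr_def lab_def)
  let ?y = "\<lambda>l. \<Sum>j\<in>?G. x j * y j l"
  have "?y \<in> vecs (gr pos (V {} Q') (0 - 1))"
    unfolding vecs_def using y vecs_D by (fastforce intro!: sum.neutral)
  moreover have "mapp D (V {} Q') (V {} Q') ?y = x"
  proof
    fix l
    have "mapp D (V {} Q') (V {} Q') ?y l = (\<Sum>j\<in>?G. x j * del1 j 1 l)"
      unfolding mapp_lincomb using y by (intro sum.cong) auto
    also have "\<dots> = (\<Sum>j\<in>?G. if j = l then x l else 0)" by (intro sum.cong) (auto simp: del1_def)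
    also have "\<dots> = x l" using finG vecs_D[OF x] by auto
    finally show "mapp D (V {} Q') (V {} Q') ?y l = x l" .
  qed
  ultimately show "\<exists>y\<in>vecs (gr pos (V {} Q') (0 - 1)). mapp D (V {} Q') (V {} Q') y = x" by blast
qed

text \<open>Position - a is the first one, so exactness there means that nonzero cocycles do not
  exist. A cocycle with nonzero coordinate at \<open>j\<close>, where |\<tau> j| = n - b, would
  restrict to a nonzero cocycle on the labels containing \<open>Q\<close>, for every
  \<open>Q\<close> between \<open>Q'\<close> and \<open>\<tau> j\<close>.\<close>

lemma upper_set_exact_mono:
  assumes t: "t \<le> n - b" "\<And>Q. Q \<subseteq> {..<n} \<Longrightarrow> card Q = t \<Longrightarrow> ex_at D pos (V Q {..<n}) (- int a)"
    and Q': "Q' \<subseteq> {..<n}" "card Q' \<le> t"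
  shows "ex_at D pos (V Q' {..<n}) (- int a)"
  unfolding ex_at_def
proof (intro ballI impI)
  fix x :: "'j \<Rightarrow> 'k" assume x: "x \<in> vecs (gr pos (V Q' {..<n}) (- int a))"
    and dx: "mapp D (V Q' {..<n}) (V Q' {..<n}) x = 0"
  have "x j = 0" for j
  proof (rule ccontr)
    assume nz: "x j \<noteq> 0"
    then have j: "j \<in> J" "pos j = - int a" "Q' \<subseteq> \<tau> j" using vecs_gr_D[OF x, of j] by (auto simp: lab_def iv_def)
    obtain Q where Q: "Q' \<subseteq> Q" "Q \<subseteq> \<tau> j" "card Q = t"
      using exists_subset_between[of Q' t "\<tau> j"] j(3) Q' t(1) pos_bottom[OF j(1,2)] tau[OF j(1)] by auto
    let ?r = "restr (V Q {..<n}) x"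
    have sub: "V Q {..<n} \<subseteq> V Q' {..<n}" using Q by (auto simp: lab_def iv_def)
    have "mapp D (V Q {..<n}) (V Q {..<n}) ?r = 0"
      using mapp_upper_set[OF s Q(1), of "{..<n}" x] by (simp add: dx)
    moreover have "?r \<in> vecs (gr pos (V Q {..<n}) (- int a))" using x sub by (rule restr_gr)
    moreover have "ex_at D pos (V Q {..<n}) (- int a)" using t(2)[of Q] Q tau[OF j(1)] by auto
    ultimately obtain y where y: "y \<in> vecs (gr pos (V Q {..<n}) (- int a - 1))"
      "mapp D (V Q {..<n}) (V Q {..<n}) y = ?r" by (rule_tac ex_at_E)
    have "y = 0"
    proof
      fix l show "y l = 0 l"
        using vecs_gr_D[OF y(1), of l] pos_range[of l] by (cases "y l = 0") (auto simp: lab_def)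
    qed
    then have "?r j = 0" using y(2) by auto
    moreover have "j \<in> V Q {..<n}" using j Q tau[OF j(1)] by (auto simp: lab_def iv_def)
    ultimately show False using nz by (simp add: restr_def)
  qed
  then have "mapp D (V Q' {..<n}) (V Q' {..<n}) 0 = x" by (simp add: fun_eq_iff)
  then show "\<exists>y\<in>vecs (gr pos (V Q' {..<n}) (- int a - 1)). mapp D (V Q' {..<n}) (V Q' {..<n}) y = x"
    using vecs_0 by blast
qed

end

definition linear_cx :: "'j set \<Rightarrow> ('j \<Rightarrow> nat set) \<Rightarrow> ('j \<Rightarrow> int) \<Rightarrow> nat \<Rightarrow> nat \<Rightarrow> int \<Rightarrow> bool" where
  "linear_cx J \<tau> pos l u e \<longleftrightarrow>
     (\<forall>j\<in>J. card (\<tau> j) \<in> {l..u} \<and> pos j = e - int (card (\<tau> j))) \<and>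
     (\<forall>t\<in>{l..u}. \<exists>j\<in>J. card (\<tau> j) = t)"

context pure_cx
begin

text \<open>Labels and positions in A(D(F)) come from the cohomology of F in complementary degrees,
  concentrated in position 0; those in the second iterate come from A(D(F)), concentrated in
  position - a. Hence both are linear, and the two monotonicity lemmas exclude gaps between the
  extreme sizes.\<close>

theorem linear_duals:
  obtains J1 :: "('j \<times> nat set) set" and E1 \<Phi>1 and J2 :: "(('j \<times> nat set) \<times> nat set) set" and E2 \<Phi>2
  where
    "sqc n J1 snd (tot_pos pos) E1" "min_sqc J1 snd E1"
    "\<And>B. B \<subseteq> {..<n} \<Longrightarrow> qiso E1 (tot_pos pos) (lab J1 snd (iv {} B)) D pos (lab J \<tau> (iv B {..<n})) \<Phi>1"
    "linear_cx J1 snd (tot_pos pos) a (n - c) 0"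
    "sqc n J2 snd (tot_pos (tot_pos pos)) E2" "min_sqc J2 snd E2"
    "\<And>B. B \<subseteq> {..<n} \<Longrightarrow> qiso E2 (tot_pos (tot_pos pos)) (lab J2 snd (iv {} B))
      E1 (tot_pos pos) (lab J1 snd (iv B {..<n})) \<Phi>2"
    "linear_cx J2 snd (tot_pos (tot_pos pos)) b (n - a) (- int a)"
proof -
  obtain J1 :: "('j \<times> nat set) set" and E1 \<Phi>1 where G: "sqc n J1 snd (tot_pos pos) E1" "min_sqc J1 snd E1"
    and q1: "\<And>B. B \<subseteq> {..<n} \<Longrightarrow> qiso E1 (tot_pos pos) (lab J1 snd (iv {} B)) D pos (lab J \<tau> (iv B {..<n})) \<Phi>1"
    and b1: "\<And>R i. R \<subseteq> {..<n} \<Longrightarrow> ex_at D pos (V {} ({..<n} - R)) i \<longleftrightarrow>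
       (\<forall>j\<in>J1. snd j = R \<longrightarrow> tot_pos pos j \<noteq> i - int (card R))"
    by (rule ad_model[OF s]) (rule that)
  obtain J2 :: "(('j \<times> nat set) \<times> nat set) set" and E2 \<Phi>2
    where H: "sqc n J2 snd (tot_pos (tot_pos pos)) E2" "min_sqc J2 snd E2"
    and q2: "\<And>B. B \<subseteq> {..<n} \<Longrightarrow> qiso E2 (tot_pos (tot_pos pos)) (lab J2 snd (iv {} B))
      E1 (tot_pos pos) (lab J1 snd (iv B {..<n})) \<Phi>2"
    and b2: "\<And>R i. R \<subseteq> {..<n} \<Longrightarrow> ex_at E1 (tot_pos pos) (lab J1 snd (iv {} ({..<n} - R))) i \<longleftrightarrow>
       (\<forall>j\<in>J2. snd j = R \<longrightarrow> tot_pos (tot_pos pos) j \<noteq> i - int (card R))"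
    by (rule ad_model[OF G(1)]) (rule that)
  have G_n: "snd w \<subseteq> {..<n}" if "w \<in> J1" for w using sqc_tau[OF G(1) that] .
  have H_n: "snd w \<subseteq> {..<n}" if "w \<in> J2" for w using sqc_tau[OF H(1) that] .
  have G_not: "\<not> ex_at D pos (V {} ({..<n} - snd w)) (tot_pos pos w + int (card (snd w)))" if "w \<in> J1" for w
    using b1[OF G_n[OF that]] that by auto
  have G_pos: "tot_pos pos w = - int (card (snd w))" if "w \<in> J1" for w
    using G_not[OF that] exact_lower_sets[of "{..<n} - snd w" "tot_pos pos w + int (card (snd w))"] by force
  have G_occurs: "\<exists>w\<in>J1. snd w = R" if "R \<subseteq> {..<n}" "\<not> ex_at D pos (V {} ({..<n} - R)) 0" for R
    using b1[OF that(1), of 0] that(2) by blast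
  have G_upper: "card (snd w) \<le> n - c" if w: "w \<in> J1" for w
  proof (rule ccontr)
    assume "\<not> card (snd w) \<le> n - c"
    then have small: "card ({..<n} - snd w) < c" using card_compl[OF G_n[OF w]] card_le[OF G_n[OF w]] by auto
    have "j \<notin> V {} ({..<n} - snd w)" for j
    proof
      assume "j \<in> V {} ({..<n} - snd w)"
      then have j: "j \<in> J" "\<tau> j \<subseteq> {..<n} - snd w" by (auto simp: lab_def iv_def)
      then have "card (\<tau> j) < c" using card_mono[of "{..<n} - snd w" "\<tau> j"] small by simp
      then show False using purity[OF j(1)] A(1) by auto
    qed
    then have "ex_at D pos (V {} ({..<n} - snd w)) i" for i by (intro ex_at_trivial) blast
    then show False using G_not[OF w] by blast
  qed
  \<comment> \<open>A label of the largest size n - b has no other label above it, so A(D(F)) has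
    nonzero cohomology in that degree.\<close>
  have G_ne: "J1 \<noteq> {}"
  proof
    assume e: "J1 = {}"
    obtain j where j: "j \<in> J" "card (\<tau> j) = n - b" using all_degs[OF A(3)] by blast
    have "V (\<tau> j) {..<n} = lab J \<tau> {\<tau> j}"
    proof (intro set_eqI iffI)
      fix l assume "l \<in> V (\<tau> j) {..<n}"
      then have l: "l \<in> J" "\<tau> j \<subseteq> \<tau> l" by (auto simp: lab_def iv_def)
      have "card (\<tau> l) \<le> n - b" using purity[OF l(1)] A(1) by auto
      then have "\<tau> j = \<tau> l" using l tau[OF l(1)] j(2) by (intro card_seteq) auto
      then show "l \<in> lab J \<tau> {\<tau> j}" using l by (simp add: lab_def)
    qed (use tau[OF j(1)] in \<open>auto simp: lab_def iv_def\<close>)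
    then have "\<not> ex_at D pos (V (\<tau> j) {..<n}) (pos j)" using min_ex_at[OF s m] j(1) by auto
    moreover have "ex_at E1 (tot_pos pos) (lab J1 snd (iv {} (\<tau> j))) (pos j)"
      by (rule ex_at_trivial) (simp add: lab_def e)
    ultimately show False using qiso_ex_iff[OF q1[of "\<tau> j"]] tau[OF j(1)] by blast
  qed
  \<comment> \<open>No other label of \<open>J1\<close> lies below one of minimal size, so
    \<open>E1\<close> has cohomology in that degree. It can only be in position - a, and the
    position is minus the size: the minimal size is a.\<close>
  define w0 where "w0 = (ARG_MIN (\<lambda>w. card (snd w)) w. w \<in> J1)"
  have w0: "w0 \<in> J1" "\<And>w. w \<in> J1 \<Longrightarrow> card (snd w0) \<le> card (snd w)"
    unfolding w0_def using G_ne by (auto intro: arg_min_natI arg_min_nat_le)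
  have w0_lab: "lab J1 snd (iv {} (snd w0)) = lab J1 snd {snd w0}"
  proof (intro set_eqI iffI)
    fix w assume "w \<in> lab J1 snd (iv {} (snd w0))"
    then have w: "w \<in> J1" "snd w \<subseteq> snd w0" by (auto simp: lab_def iv_def)
    then have "snd w = snd w0" using w0(2)[OF w(1)] G_n[OF w0(1)] finite_subset by (intro card_seteq) auto
    then show "w \<in> lab J1 snd {snd w0}" using w by (simp add: lab_def)
  qed (auto simp: lab_def iv_def)
  have w0_not: "\<not> ex_at E1 (tot_pos pos) (lab J1 snd (iv {} (snd w0))) (tot_pos pos w0)"
    unfolding w0_lab min_ex_at[OF G] using w0(1) by auto
  then have "\<not> ex_at D pos (V (snd w0) {..<n}) (tot_pos pos w0)"
    using qiso_ex_iff[OF q1[OF G_n[OF w0(1)]]] by blast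
  then have "tot_pos pos w0 = - int a" using exact_upper_sets[OF G_n[OF w0(1)]] by blast
  then have c0: "card (snd w0) = a" using G_pos[OF w0(1)] by simp
  have G_lower: "a \<le> card (snd w)" if "w \<in> J1" for w using w0(2)[OF that] c0 by simp
  \<comment> \<open>If size t did not occur, F would be exact at 0 in all degrees of size n - t,
    hence also in the complement of \<open>snd w0\<close>, which has size n - a >= n - t. This
    contradicts the presence of \<open>w0\<close>.\<close>
  have G_between: "\<exists>w\<in>J1. card (snd w) = t" if t: "t \<in> {a..n - c}" for t
  proof (rule ccontr)
    assume no: "\<not> (\<exists>w\<in>J1. card (snd w) = t)"
    have tn: "t \<le> n" using t by (meson atLeastAtMost_iff diff_le_self order_trans)
    have "ex_at D pos (V {} ({..<n} - snd w0)) 0"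
    proof (rule lower_set_exact_mono)
      show "c \<le> n - t" using t a_le by auto
      fix Q assume Q: "Q \<subseteq> {..<n}" "card Q = n - t"
      then have "card ({..<n} - Q) = t" using card_compl[of Q] tn by simp
      then have none: "\<not> (\<exists>w\<in>J1. snd w = {..<n} - Q)" using no by metis
      show "ex_at D pos (V {} Q) 0"
      proof (rule ccontr)
        assume "\<not> ex_at D pos (V {} Q) 0"
        then show False using G_occurs[of "{..<n} - Q"] none unfolding compl[OF Q(1)] by blast
      qed
    next
      show "n - t \<le> card ({..<n} - snd w0)" using card_compl[OF G_n[OF w0(1)]] c0 t by auto
    qed simp
    then show False using G_not[OF w0(1)] G_pos[OF w0(1)] by simp
  qed
  have linG: "linear_cx J1 snd (tot_pos pos) a (n - c) 0"
    unfolding linear_cx_def using G_lower G_upper G_pos G_between by simp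
  have ED: "ex_at E1 (tot_pos pos) (lab J1 snd (iv {} B)) i \<longleftrightarrow> ex_at D pos (V B {..<n}) i" if "B \<subseteq> {..<n}" for B i
    by (rule qiso_ex_iff[OF q1[OF that]])
  have H_not: "\<not> ex_at E1 (tot_pos pos) (lab J1 snd (iv {} ({..<n} - snd w)))
      (tot_pos (tot_pos pos) w + int (card (snd w)))" if "w \<in> J2" for w
    using b2[OF H_n[OF that]] that by auto
  \<comment> \<open>The cohomology of A(D(F)) sits in position - a instead of 0, which shifts the
    second strand by - a.\<close>
  have H_pos: "tot_pos (tot_pos pos) w = - int a - int (card (snd w))" if "w \<in> J2" for w
    using H_not[OF that] ED[of "{..<n} - snd w"]
      exact_upper_sets[of "{..<n} - snd w" "tot_pos (tot_pos pos) w + int (card (snd w))"] by force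
  have H_occurs: "\<exists>w\<in>J2. snd w = R" if "R \<subseteq> {..<n}" "\<not> ex_at D pos (V ({..<n} - R) {..<n}) (- int a)" for R
    using b2[OF that(1), of "- int a"] ED[of "{..<n} - R"] that(2) by blast
  have H_upper: "card (snd w) \<le> n - a" if w: "w \<in> J2" for w
  proof (rule ccontr)
    assume "\<not> card (snd w) \<le> n - a"
    then have small: "card ({..<n} - snd w) < a" using card_compl[OF H_n[OF w]] card_le[OF H_n[OF w]] by auto
    have "v \<notin> lab J1 snd (iv {} ({..<n} - snd w))" for v
    proof
      assume "v \<in> lab J1 snd (iv {} ({..<n} - snd w))"
      then have v: "v \<in> J1" "snd v \<subseteq> {..<n} - snd w" by (auto simp: lab_def iv_def)
      then have "card (snd v) < a" using card_mono[of "{..<n} - snd w" "snd v"] small by simp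
      then show False using G_lower[OF v(1)] by simp
    qed
    then have "ex_at E1 (tot_pos pos) (lab J1 snd (iv {} ({..<n} - snd w))) i" for i
      by (intro ex_at_trivial) blast
    then show False using H_not[OF w] by blast
  qed
  have H_lower: "b \<le> card (snd w)" if w: "w \<in> J2" for w
  proof (rule ccontr)
    assume "\<not> b \<le> card (snd w)"
    then have big: "card ({..<n} - snd w) > n - b" using card_compl[OF H_n[OF w]] bn by auto
    have "j \<notin> V ({..<n} - snd w) {..<n}" for j
    proof
      assume "j \<in> V ({..<n} - snd w) {..<n}"
      then have j: "j \<in> J" "{..<n} - snd w \<subseteq> \<tau> j" by (auto simp: lab_def iv_def)
      then have "card (\<tau> j) > n - b" using card_mono[of "\<tau> j" "{..<n} - snd w"] big tau[OF j(1)] by simp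
      then show False using purity[OF j(1)] A(1) by auto
    qed
    then have "ex_at D pos (V ({..<n} - snd w) {..<n}) i" for i by (intro ex_at_trivial) blast
    then show False using H_not[OF w] ED[of "{..<n} - snd w"] by blast
  qed
  \<comment> \<open>If size t did not occur, the labels above any \<open>Q\<close> of size n - t
    would be exact at - a, hence also those above \<open>snd w0\<close>, of size a <= n - t; but
    there A(D(F)) has cohomology.\<close>
  have H_between: "\<exists>w\<in>J2. card (snd w) = t" if t: "t \<in> {b..n - a}" for t
  proof (rule ccontr)
    assume no: "\<not> (\<exists>w\<in>J2. card (snd w) = t)"
    have tn: "t \<le> n" using t by (meson atLeastAtMost_iff diff_le_self order_trans)
    have "ex_at D pos (V (snd w0) {..<n}) (- int a)"
    proof (rule upper_set_exact_mono)
      show "n - t \<le> n - b" using t by auto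
      fix Q assume Q: "Q \<subseteq> {..<n}" "card Q = n - t"
      then have "card ({..<n} - Q) = t" using card_compl[of Q] tn by simp
      then have none: "\<not> (\<exists>w\<in>J2. snd w = {..<n} - Q)" using no by metis
      show "ex_at D pos (V Q {..<n}) (- int a)"
      proof (rule ccontr)
        assume "\<not> ex_at D pos (V Q {..<n}) (- int a)"
        then show False using H_occurs[of "{..<n} - Q"] none unfolding compl[OF Q(1)] by blast
      qed
    next
      show "snd w0 \<subseteq> {..<n}" by (rule G_n[OF w0(1)])
      show "card (snd w0) \<le> n - t" using c0 t a_le by auto
    qed
    then show False using w0_not ED[OF G_n[OF w0(1)]] G_pos[OF w0(1)] c0 by simp
  qed
  have linH: "linear_cx J2 snd (tot_pos (tot_pos pos)) b (n - a) (- int a)"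
    unfolding linear_cx_def using H_lower H_upper H_pos H_between by simp
  show ?thesis by (rule that[OF G q1 linG H q2 linH])
qed

end

section \<open>Free squarefree modules\<close>

definition sqm :: "nat set \<Rightarrow> nat \<Rightarrow>\<^sub>0 nat" where
  "sqm T = (\<Sum>i\<in>T. Poly_Mapping.single i 1)"

lemma lookup_sqm: "finite T \<Longrightarrow> Poly_Mapping.lookup (sqm T) i = of_bool (i \<in> T)"
  by (simp add: sqm_def lookup_sum lookup_single when_def)

lemma sqf_monom_eq: "sqf_monom T = Poly_Mapping.single (sqm T) 1"
  by (simp add: sqf_monom_def sqm_def)

lemma keys_sqm: "finite T \<Longrightarrow> Poly_Mapping.keys (sqm T) = T"
  by (auto simp: in_keys_iff lookup_sqm)

lemma sqm_monoms: "T \<subseteq> {..<n} \<Longrightarrow> sqm T \<in> monoms n"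
  using finite_subset[of T "{..<n}"] by (simp add: monoms_def keys_sqm)

lemma sqm_add: "finite S \<Longrightarrow> finite T \<Longrightarrow> S \<inter> T = {} \<Longrightarrow> sqm S + sqm T = sqm (S \<union> T)"
  by (simp add: sqm_def sum.union_disjoint)

lemma fine_deg_add: "fine_deg (u + v) = fine_deg u + fine_deg v"
  by (auto simp: fine_deg_def fun_eq_iff lookup_add)

lemma fine_deg_sqm: "finite T \<Longrightarrow> fine_deg (sqm T) = unit_vec T"
  by (auto simp: fine_deg_def unit_vec_def fun_eq_iff lookup_sqm)

lemma fine_deg_inj: "fine_deg u = fine_deg v \<longleftrightarrow> u = v"
  by (auto simp: fine_deg_def fun_eq_iff intro: poly_mapping_eqI)

lemma monoms_add: "u \<in> monoms n \<Longrightarrow> v \<in> monoms n \<Longrightarrow> u + v \<in> monoms n"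
  using keys_add[of u v] by (auto simp: monoms_def)

lemma polys_0 [simp]: "0 \<in> polys n"
  by (simp add: polys_def)

lemma polys_add: "p \<in> polys n \<Longrightarrow> q \<in> polys n \<Longrightarrow> p + q \<in> polys n"
  using keys_add[of p q] by (auto simp: polys_def)

lemma polys_mult: "p \<in> polys n \<Longrightarrow> q \<in> polys n \<Longrightarrow> p * q \<in> polys n"
  using keys_mult[of p q] monoms_add by (fastforce simp: polys_def)

lemma polys_single: "u \<in> monoms n \<Longrightarrow> Poly_Mapping.single u c \<in> polys n"
  by (simp add: polys_def)

lemma polys_sum: "(\<And>i. i \<in> I \<Longrightarrow> p i \<in> polys n) \<Longrightarrow> (\<Sum>i\<in>I. p i) \<in> polys n"
  by (induction I rule: infinite_finite_induct) (auto intro: polys_add)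

lemma poly_mapping_expand:
  "p = (\<Sum>u\<in>Poly_Mapping.keys p. Poly_Mapping.single u (Poly_Mapping.lookup p u))"
  by (rule poly_mapping_eqI) (auto simp: lookup_sum lookup_single when_def in_keys_iff)

lemma lookup_single_mult:
  fixes q :: "'k::field mpoly"
  shows "Poly_Mapping.lookup (Poly_Mapping.single u c * q) v =
    (\<Sum>w\<in>Poly_Mapping.keys q. if u + w = v then c * Poly_Mapping.lookup q w else 0)"
proof -
  have "Poly_Mapping.single u c * q
      = (\<Sum>w\<in>Poly_Mapping.keys q. Poly_Mapping.single u c * Poly_Mapping.single w (Poly_Mapping.lookup q w))"
    by (subst (1) poly_mapping_expand[of q]) (simp add: sum_distrib_left)
  then show ?thesis by (simp add: mult_single lookup_sum lookup_single when_def)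
qed

lemma lookup_single_mult_add:
  fixes q :: "'k::field mpoly"
  shows "Poly_Mapping.lookup (Poly_Mapping.single u c * q) (u + v) = c * Poly_Mapping.lookup q v"
  by (auto simp: lookup_single_mult in_keys_iff)

lemma sum_fun_apply: "(\<Sum>i\<in>I. f i) x = (\<Sum>i\<in>I. f i x)"
  for f :: "'i \<Rightarrow> 'x \<Rightarrow> 'a::comm_monoid_add"
  by (induction I rule: infinite_finite_induct) auto

section \<open>Homogeneous parts and the module axioms for sums of twists of S\<close>

definition hpart :: "((nat \<Rightarrow>\<^sub>0 nat) \<Rightarrow> 'g) \<Rightarrow> 'k::field mpoly \<Rightarrow> 'g \<Rightarrow> 'k mpoly" where
  "hpart w p b = (\<Sum>u\<in>{u \<in> Poly_Mapping.keys p. w u = b}. Poly_Mapping.single u (Poly_Mapping.lookup p u))"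

lemma lookup_hpart: "Poly_Mapping.lookup (hpart w p b) u = (if w u = b then Poly_Mapping.lookup p u else 0)"
  by (auto simp: hpart_def lookup_sum lookup_single when_def in_keys_iff)

lemma keys_hpart: "Poly_Mapping.keys (hpart w p b) = {u \<in> Poly_Mapping.keys p. w u = b}"
  by (auto simp: in_keys_iff lookup_hpart split: if_splits)

lemma hpart_polys: "p \<in> polys n \<Longrightarrow> hpart w p b \<in> polys n"
  by (auto simp: polys_def keys_hpart)

lemma hpart_finite: "finite {b. hpart w p b \<noteq> 0}"
proof (rule finite_subset)
  show "{b. hpart w p b \<noteq> 0} \<subseteq> w ` Poly_Mapping.keys p"
  proof
    fix b assume "b \<in> {b. hpart w p b \<noteq> 0}"
    then have "Poly_Mapping.keys (hpart w p b) \<noteq> {}" by simp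
    then show "b \<in> w ` Poly_Mapping.keys p" unfolding keys_hpart by blast
  qed
qed simp

lemma hpart_sum:
  assumes "finite B" "w ` Poly_Mapping.keys p \<subseteq> B" shows "p = (\<Sum>b\<in>B. hpart w p b)"
proof (rule poly_mapping_eqI)
  fix u
  have "(\<Sum>b\<in>B. Poly_Mapping.lookup (hpart w p b) u) = (if w u \<in> B then Poly_Mapping.lookup p u else 0)"
    using assms(1) by (simp add: lookup_hpart)
  also have "\<dots> = Poly_Mapping.lookup p u"
  proof (cases "u \<in> Poly_Mapping.keys p")
    case True then show ?thesis using assms(2) by auto
  next
    case False then show ?thesis by (simp add: in_keys_iff)
  qed
  finally show "Poly_Mapping.lookup p u = Poly_Mapping.lookup (\<Sum>b\<in>B. hpart w p b) u"
    by (simp add: lookup_sum)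
qed

text \<open>The twist turns the weight of a monomial u into w u + c. The decomposition is unique
  because the coefficient of u can only come from the component of that degree.\<close>

lemma graded_module_twist:
  fixes w :: "(nat \<Rightarrow>\<^sub>0 nat) \<Rightarrow> 'g::ab_group_add"
  assumes w: "\<And>u v. w (u + v) = w u + w v"
  shows "graded_module n w (twist (S_mod n w :: ('k::field, 'g, 'k mpoly) gmod) c)"
proof
  let ?M = "twist (S_mod n w :: ('k, 'g, 'k mpoly) gmod) c"
  note defs = twist_def S_mod_def
  show "0 \<in> carr ?M" by (simp add: defs)
  show "x + y \<in> carr ?M" if "x \<in> carr ?M" "y \<in> carr ?M" for x y
    using that by (simp add: defs polys_add)
  show "scal ?M p x \<in> carr ?M" if "p \<in> polys n" "x \<in> carr ?M" for p x
    using that by (simp add: defs polys_mult)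
  show "scal ?M p (x + y) = scal ?M p x + scal ?M p y" for p x y by (simp add: defs algebra_simps)
  show "scal ?M (p + q) x = scal ?M p x + scal ?M q x" for p q x by (simp add: defs algebra_simps)
  show "scal ?M p (scal ?M q x) = scal ?M (p * q) x" for p q x by (simp add: defs algebra_simps)
  show "scal ?M 1 x = x" for x by (simp add: defs)
  show "hcomp ?M b \<subseteq> carr ?M" for b by (auto simp: defs)
  show "0 \<in> hcomp ?M b" for b by (simp add: defs)
  show "x + y \<in> hcomp ?M b" if "x \<in> hcomp ?M b" "y \<in> hcomp ?M b" for x y b
    using that keys_add[of x y] by (auto simp: defs polys_add)
  show "scal ?M (Poly_Mapping.single u d) x \<in> hcomp ?M (w u + b)" if "u \<in> monoms n" "x \<in> hcomp ?M b" for u d x b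
  proof -
    have "w v = w u + b - c" if "v \<in> Poly_Mapping.keys (Poly_Mapping.single u d * x)" for v
    proof -
      have "v \<in> {a + e |a e. a \<in> Poly_Mapping.keys (Poly_Mapping.single u d) \<and> e \<in> Poly_Mapping.keys x}"
        using that keys_mult by blast
      then obtain e where "v = u + e" "e \<in> Poly_Mapping.keys x" by (auto split: if_splits)
      then show ?thesis using \<open>x \<in> hcomp ?M b\<close> by (simp add: defs w)
    qed
    then show ?thesis using that by (simp add: defs polys_mult polys_single)
  qed
  fix x assume x: "x \<in> carr ?M"
  let ?y = "\<lambda>b. hpart (\<lambda>u. w u + c) x b"
  show "\<exists>!y. (\<forall>b. y b \<in> hcomp ?M b) \<and> finite {b. y b \<noteq> 0} \<and> x = (\<Sum>b | y b \<noteq> 0. y b)"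
  proof (rule ex1I[of _ ?y])
    have "x = (\<Sum>b\<in>(\<lambda>u. w u + c) ` Poly_Mapping.keys x. ?y b)" by (rule hpart_sum) auto
    also have "\<dots> = (\<Sum>b | ?y b \<noteq> 0. ?y b)"
    proof (rule sum.mono_neutral_right)
      show "{b. ?y b \<noteq> 0} \<subseteq> (\<lambda>u. w u + c) ` Poly_Mapping.keys x"
      proof
        fix b assume "b \<in> {b. ?y b \<noteq> 0}"
        then have "Poly_Mapping.keys (?y b) \<noteq> {}" by simp
        then show "b \<in> (\<lambda>u. w u + c) ` Poly_Mapping.keys x" unfolding keys_hpart by blast
      qed
    qed auto
    finally have "x = (\<Sum>b | ?y b \<noteq> 0. ?y b)" .
    moreover have "?y b \<in> hcomp ?M b" for b
      using x hpart_polys[of x n "\<lambda>u. w u + c" b] by (auto simp: defs keys_hpart)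
    ultimately show "(\<forall>b. ?y b \<in> hcomp ?M b) \<and> finite {b. ?y b \<noteq> 0} \<and> x = (\<Sum>b | ?y b \<noteq> 0. ?y b)"
      using hpart_finite by blast
  next
    fix y assume y: "(\<forall>b. y b \<in> hcomp ?M b) \<and> finite {b. y b \<noteq> 0} \<and> x = (\<Sum>b | y b \<noteq> 0. y b)"
    show "y = ?y"
    proof
      fix b
      have deg: "w u + c = b'" if "Poly_Mapping.lookup (y b') u \<noteq> 0" for u b'
        using y that by (auto simp: defs in_keys_iff)
      show "y b = ?y b"
      proof (rule poly_mapping_eqI)
        fix u
        have "Poly_Mapping.lookup x u = (\<Sum>b' | y b' \<noteq> 0. Poly_Mapping.lookup (y b') u)"
          using y by (simp add: lookup_sum[symmetric])
        also have "\<dots> = (\<Sum>b' | y b' \<noteq> 0. if b' = w u + c then Poly_Mapping.lookup (y (w u + c)) u else 0)"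
          using deg by (intro sum.cong) auto
        also have "\<dots> = Poly_Mapping.lookup (y (w u + c)) u" using y by auto
        finally show "Poly_Mapping.lookup (y b) u = Poly_Mapping.lookup (?y b) u"
          using deg[of b u] by (auto simp: lookup_hpart)
      qed
    qed
  qed
qed

lemma carr_dsum:
  "f \<in> carr (dsum Ms) \<longleftrightarrow> (\<forall>j<length Ms. f j \<in> carr (Ms ! j)) \<and> (\<forall>j\<ge>length Ms. f j = 0)"
  unfolding dsum_def by (auto simp: not_le[symmetric])

lemma hcomp_dsum:
  "f \<in> hcomp (dsum Ms) b \<longleftrightarrow> (\<forall>j<length Ms. f j \<in> hcomp (Ms ! j) b) \<and> (\<forall>j\<ge>length Ms. f j = 0)"
  unfolding dsum_def by (auto simp: not_le[symmetric])

lemma scal_dsum: "scal (dsum Ms) p f j = (if j < length Ms then scal (Ms ! j) p (f j) else 0)"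
  by (simp add: dsum_def)

lemma graded_module_dsum:
  fixes Ms :: "('k::field, 'g::ab_group_add, 'm::ab_group_add) gmod list"
  assumes M: "\<And>M. M \<in> set Ms \<Longrightarrow> graded_module n w M"
  shows "graded_module n w (dsum Ms)"
proof
  let ?N = "length Ms"
  have G: "graded_module n w (Ms ! j)" if "j < ?N" for j using M that by simp
  note defs = carr_dsum hcomp_dsum scal_dsum
  show "0 \<in> carr (dsum Ms)" unfolding defs by (auto intro: graded_module.zero_closed[OF G])
  show "x + y \<in> carr (dsum Ms)" if "x \<in> carr (dsum Ms)" "y \<in> carr (dsum Ms)" for x y
    using that unfolding defs by (auto intro: graded_module.add_closed[OF G])
  show "scal (dsum Ms) p x \<in> carr (dsum Ms)" if "p \<in> polys n" "x \<in> carr (dsum Ms)" for p x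
    using that unfolding defs by (auto intro: graded_module.scal_closed[OF G])
  show "scal (dsum Ms) p (x + y) = scal (dsum Ms) p x + scal (dsum Ms) p y"
    if "p \<in> polys n" "x \<in> carr (dsum Ms)" "y \<in> carr (dsum Ms)" for p x y
    using that by (auto simp: defs fun_eq_iff intro: graded_module.scal_right_distrib[OF G])
  show "scal (dsum Ms) (p + q) x = scal (dsum Ms) p x + scal (dsum Ms) q x"
    if "p \<in> polys n" "q \<in> polys n" "x \<in> carr (dsum Ms)" for p q x
    using that by (auto simp: defs fun_eq_iff intro: graded_module.scal_left_distrib[OF G])
  show "scal (dsum Ms) p (scal (dsum Ms) q x) = scal (dsum Ms) (p * q) x"
    if "p \<in> polys n" "q \<in> polys n" "x \<in> carr (dsum Ms)" for p q x
    using that by (auto simp: defs fun_eq_iff intro: graded_module.scal_scal[OF G])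
  show "scal (dsum Ms) 1 x = x" if "x \<in> carr (dsum Ms)" for x
  proof
    fix j show "scal (dsum Ms) 1 x j = x j"
      using that unfolding defs by (cases "j < ?N") (auto intro: graded_module.scal_one[OF G])
  qed
  show "hcomp (dsum Ms) b \<subseteq> carr (dsum Ms)" for b
    unfolding subset_iff defs using graded_module.hcomp_carr[OF G] by blast
  show "0 \<in> hcomp (dsum Ms) b" for b by (auto simp: defs graded_module.hcomp_zero[OF G])
  show "x + y \<in> hcomp (dsum Ms) b" if "x \<in> hcomp (dsum Ms) b" "y \<in> hcomp (dsum Ms) b" for x y b
    using that unfolding defs by (auto intro: graded_module.hcomp_add[OF G])
  show "scal (dsum Ms) (Poly_Mapping.single u c) x \<in> hcomp (dsum Ms) (w u + b)"
    if "u \<in> monoms n" "x \<in> hcomp (dsum Ms) b" for u c x b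
    using that unfolding defs by (auto intro: graded_module.hcomp_scal[OF G])
  fix x assume x: "x \<in> carr (dsum Ms)"
  have "\<exists>!y. (\<forall>b. y b \<in> hcomp (Ms ! j) b) \<and> finite {b. y b \<noteq> 0} \<and> x j = (\<Sum>b | y b \<noteq> 0. y b)" if "j < ?N" for j
    using x that by (intro graded_module.direct_sum_decomp[OF G]) (auto simp: defs)
  then obtain y where y: "\<And>j. j < ?N \<Longrightarrow> (\<forall>b. y j b \<in> hcomp (Ms ! j) b) \<and> finite {b. y j b \<noteq> 0}
      \<and> x j = (\<Sum>b | y j b \<noteq> 0. y j b)"
    and uniq: "\<And>j z. j < ?N \<Longrightarrow> (\<forall>b. z b \<in> hcomp (Ms ! j) b) \<and> finite {b. z b \<noteq> 0}
      \<and> x j = (\<Sum>b | z b \<noteq> 0. z b) \<Longrightarrow> z = y j"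
    by metis
  define Y where "Y b j = (if j < ?N then y j b else 0)" for b j
  have finY: "finite {b. Y b \<noteq> 0}"
  proof (rule finite_subset)
    show "{b. Y b \<noteq> 0} \<subseteq> (\<Union>j\<in>{..<?N}. {b. y j b \<noteq> 0})"
    proof
      fix b assume "b \<in> {b. Y b \<noteq> 0}"
      then obtain j where "Y b j \<noteq> 0" by (auto simp: fun_eq_iff)
      then show "b \<in> (\<Union>j\<in>{..<?N}. {b. y j b \<noteq> 0})" by (auto simp: Y_def split: if_splits)
    qed
  qed (use y in auto)
  have sumY: "(\<Sum>b | Z b \<noteq> 0. Z b) j = (\<Sum>b | Z b j \<noteq> 0. Z b j)" if "finite {b. Z b \<noteq> 0}"
    for Z :: "'g \<Rightarrow> nat \<Rightarrow> 'm" and j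
    unfolding sum_fun_apply using that by (intro sum.mono_neutral_right) auto
  show "\<exists>!y. (\<forall>b. y b \<in> hcomp (dsum Ms) b) \<and> finite {b. y b \<noteq> 0} \<and> x = (\<Sum>b | y b \<noteq> 0. y b)"
  proof (rule ex1I[of _ Y])
    have "x = (\<Sum>b | Y b \<noteq> 0. Y b)"
    proof
      fix j show "x j = (\<Sum>b | Y b \<noteq> 0. Y b) j"
        unfolding sumY[OF finY] using x y[of j] by (cases "j < ?N") (auto simp: Y_def defs)
    qed
    moreover have "Y b \<in> hcomp (dsum Ms) b" for b using y by (auto simp: defs Y_def)
    ultimately show "(\<forall>b. Y b \<in> hcomp (dsum Ms) b) \<and> finite {b. Y b \<noteq> 0} \<and> x = (\<Sum>b | Y b \<noteq> 0. Y b)"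
      using finY by blast
  next
    fix Z assume Z: "(\<forall>b. Z b \<in> hcomp (dsum Ms) b) \<and> finite {b. Z b \<noteq> 0} \<and> x = (\<Sum>b | Z b \<noteq> 0. Z b)"
    have "Z b j = Y b j" for b j
    proof (cases "j < ?N")
      case True
      have "(\<lambda>b. Z b j) = y j"
      proof (rule uniq[OF True], intro conjI allI)
        show "Z b j \<in> hcomp (Ms ! j) b" for b using Z True by (auto simp: defs)
        show "finite {b. Z b j \<noteq> 0}"
          by (rule finite_subset[of _ "{b. Z b \<noteq> 0}"]) (use Z in auto)
        show "x j = (\<Sum>b | Z b j \<noteq> 0. Z b j)" using Z sumY[of Z j] by simp
      qed
      then show ?thesis using True by (simp add: Y_def fun_eq_iff)
    next
      case False
      then show ?thesis using Z by (auto simp: Y_def defs)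
    qed
    then show "Z = Y" by (simp add: fun_eq_iff)
  qed
qed

definition free_module :: "nat \<Rightarrow> nat set list \<Rightarrow> ('k::field, mdegree, nat \<Rightarrow> 'k mpoly) gmod" where
  "free_module n Rs = dsum (map (\<lambda>R. twist (S_mod n fine_deg) (unit_vec R)) Rs)"

lemma carr_free:
  "f \<in> carr (free_module n Rs) \<longleftrightarrow> (\<forall>j<length Rs. f j \<in> polys n) \<and> (\<forall>j\<ge>length Rs. f j = 0)"
  by (simp add: free_module_def carr_dsum twist_def S_mod_def)

lemma scal_free:
  "scal (free_module n Rs) p f j = (if j < length Rs then p * f j else 0)"
  by (simp add: free_module_def scal_dsum twist_def S_mod_def)

lemma hcomp_free:
  "f \<in> hcomp (free_module n Rs) b \<longleftrightarrow> (\<forall>j<length Rs. f j \<in> polys n \<and>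
     (\<forall>u\<in>Poly_Mapping.keys (f j). fine_deg u = b - unit_vec (Rs ! j))) \<and> (\<forall>j\<ge>length Rs. f j = 0)"
  by (simp add: free_module_def hcomp_dsum twist_def S_mod_def)

lemma graded_module_free: "graded_module n fine_deg (free_module n Rs)"
  unfolding free_module_def
  by (intro graded_module_dsum) (auto intro: graded_module_twist fine_deg_add)

lemma graded_iso_refl: "graded_iso n M M"
  unfolding graded_iso_def by (rule exI[of _ "\<lambda>x. x"]) (auto simp: lin_map_def bij_betw_def)

lemma free_sqf_free:
  assumes "\<forall>R\<in>set Rs. R \<subseteq> {..<n}" shows "free_sqf n (free_module n Rs)"
  unfolding free_sqf_def
  using assms graded_module_free graded_iso_refl[of n "free_module n Rs"] unfolding free_module_def by blast

lemma total_deg_fine_deg: assumes "u \<in> monoms n" shows "total_deg u = (\<Sum>i<n. fine_deg u i)"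
  unfolding total_deg_def fine_deg_def using assms
  by (intro sum.mono_neutral_left) (auto simp: monoms_def in_keys_iff)

lemma sum_unit_vec: "R \<subseteq> {..<n} \<Longrightarrow> (\<Sum>i<n. unit_vec R i) = int (card R)"
  by (simp add: unit_vec_def sum.If_cases of_bool_def Int_absorb1)

text \<open>The identity is the isomorphism: as all labels have the same size d, every summand
  becomes S(-d) in the coarse grading. Conversely, an element of coarse degree e splits into its
  parts in the finitely many multidegrees that occur in it.\<close>

lemma singly_graded_free:
  assumes R: "\<And>R. R \<in> set Rs \<Longrightarrow> R \<subseteq> {..<n} \<and> card R = d"
  shows "graded_iso n (singly_graded n (free_module n Rs :: ('k::field, mdegree, nat \<Rightarrow> 'k mpoly) gmod))
    (dsum (replicate (length Rs) (twist (S_mod n total_deg) (int d))))"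
    (is "graded_iso n ?M ?N")
proof -
  have carr: "carr ?M = carr ?N"
    by (auto simp: singly_graded_def carr_free carr_dsum twist_def S_mod_def)
  have scal: "scal ?M p f = scal ?N p f" for p f
    by (auto simp: singly_graded_def scal_free scal_dsum twist_def S_mod_def fun_eq_iff)
  have deg: "(\<Sum>i<n. b i) = total_deg u + int d"
    if "u \<in> monoms n" "fine_deg u = b - unit_vec (Rs ! j)" "j < length Rs" for u b j
  proof -
    have "Rs ! j \<subseteq> {..<n} \<and> card (Rs ! j) = d" using R that(3) by simp
    moreover have "(\<Sum>i<n. b i) = (\<Sum>i<n. fine_deg u i + unit_vec (Rs ! j) i)"
      by (rule sum.cong) (simp_all add: that(2))
    ultimately show ?thesis by (simp add: sum.distrib sum_unit_vec total_deg_fine_deg[OF that(1)])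
  qed
  have hN: "f \<in> hcomp ?N e \<longleftrightarrow> (\<forall>j<length Rs. f j \<in> polys n \<and>
     (\<forall>u\<in>Poly_Mapping.keys (f j). total_deg u = e - int d)) \<and> (\<forall>j\<ge>length Rs. f j = 0)" for f e
    by (auto simp: hcomp_dsum twist_def S_mod_def)
  have "hcomp ?M e = hcomp ?N e" for e
  proof (intro set_eqI iffI)
    fix f assume "f \<in> hcomp ?M e"
    then obtain T x where T: "f = (\<Sum>b\<in>T. x b)" "finite T"
      and b: "\<And>b. b \<in> T \<Longrightarrow> (\<Sum>i<n. b i) = e \<and> x b \<in> hcomp (free_module n Rs) b"
      unfolding singly_graded_def by auto
    show "f \<in> hcomp ?N e"
      unfolding hN
    proof (intro conjI allI impI)
      fix j assume j: "j < length Rs"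
      have p: "x b j \<in> polys n" if "b \<in> T" for b using b[OF that] j by (auto simp: hcomp_free)
      have fj: "f j = (\<Sum>b\<in>T. x b j)" by (simp add: T(1) sum_fun_apply)
      show "f j \<in> polys n" using p by (auto simp: fj intro: polys_sum)
      show "\<forall>u\<in>Poly_Mapping.keys (f j). total_deg u = e - int d"
      proof
        fix u assume "u \<in> Poly_Mapping.keys (f j)"
        then have "(\<Sum>b\<in>T. Poly_Mapping.lookup (x b j) u) \<noteq> 0" by (simp add: fj lookup_sum in_keys_iff)
        then obtain b' where b': "b' \<in> T" "u \<in> Poly_Mapping.keys (x b' j)"
          by (auto simp: in_keys_iff elim!: sum.not_neutral_contains_not_neutral)
        then have "fine_deg u = b' - unit_vec (Rs ! j)" "u \<in> monoms n"
          using b[OF b'(1)] p[OF b'(1)] j by (auto simp: hcomp_free polys_def)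
        then show "total_deg u = e - int d" using deg[of u b' j] j b[OF b'(1)] by simp
      qed
    next
      fix j assume "length Rs \<le> j"
      then show "f j = 0" using b by (auto simp: T(1) sum_fun_apply hcomp_free)
    qed
  next
    fix f assume f: "f \<in> hcomp ?N e"
    define w where "w j u = fine_deg u + unit_vec (Rs ! j)" for j u
    define T where "T = (\<Union>j\<in>{..<length Rs}. w j ` Poly_Mapping.keys (f j))"
    define x where "x b j = (if j < length Rs then hpart (w j) (f j) b else 0)" for b j
    have fin: "finite T" by (simp add: T_def)
    have "f = (\<Sum>b\<in>T. x b)"
    proof
      fix j show "f j = (\<Sum>b\<in>T. x b) j"
      proof (cases "j < length Rs")
        case True
        have "f j = (\<Sum>b\<in>T. hpart (w j) (f j) b)" using True by (intro hpart_sum[OF fin]) (auto simp: T_def)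
        then show ?thesis using True by (simp add: sum_fun_apply x_def)
      next
        case False
        then show ?thesis using f by (auto simp: hN sum_fun_apply x_def)
      qed
    qed
    moreover have "(\<Sum>i<n. b i) = e \<and> x b \<in> hcomp (free_module n Rs) b" if bT: "b \<in> T" for b
    proof
      obtain j u where ju: "j < length Rs" "u \<in> Poly_Mapping.keys (f j)" "b = w j u"
        using bT by (auto simp: T_def)
      then have "u \<in> monoms n" "total_deg u = e - int d" using f by (auto simp: hN polys_def)
      then show "(\<Sum>i<n. b i) = e" using deg[of u b j] ju by (simp add: w_def)
      show "x b \<in> hcomp (free_module n Rs) b"
        using f by (auto simp: hN hcomp_free x_def keys_hpart w_def intro: hpart_polys)
    qed
    ultimately show "f \<in> hcomp ?M e"
      using fin unfolding singly_graded_def by auto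
  qed
  then show ?thesis
    unfolding graded_iso_def using carr scal
    by (intro exI[of _ "\<lambda>x. x"]) (auto simp: lin_map_def bij_betw_def)
qed

section \<open>The complex of a based complex\<close>

definition expo :: "mdegree \<Rightarrow> (nat \<Rightarrow>\<^sub>0 nat)" where
  "expo b = Abs_poly_mapping (\<lambda>i. nat (b i))"

definition zdeg :: "nat \<Rightarrow> mdegree set" where
  "zdeg n = {b. \<forall>i\<ge>n. b i = 0}"

text \<open>The case distinction is needed as \<open>expo\<close> truncates negative entries to 0.
  With the value 0 there, coefficients at a shifted degree b - e need no side conditions.\<close>

definition co :: "'k::field mpoly \<Rightarrow> mdegree \<Rightarrow> 'k" where
  "co p b = (if \<forall>i. 0 \<le> b i then Poly_Mapping.lookup p (expo b) else 0)"

lemma nonneg_zdeg: "b \<in> nonneg_degs n \<longleftrightarrow> b \<in> zdeg n \<and> (\<forall>i. 0 \<le> b i)"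
  by (auto simp: nonneg_degs_def zdeg_def)

lemma zdeg_add: "b \<in> zdeg n \<Longrightarrow> e \<in> zdeg n \<Longrightarrow> b + e \<in> zdeg n"
  and zdeg_diff: "b \<in> zdeg n \<Longrightarrow> e \<in> zdeg n \<Longrightarrow> b - e \<in> zdeg n"
  by (auto simp: zdeg_def)

lemma fine_deg_nonneg: "u \<in> monoms n \<Longrightarrow> fine_deg u \<in> nonneg_degs n"
  by (auto simp: monoms_def fine_deg_def nonneg_degs_def in_keys_iff)

lemma fine_deg_zdeg: "u \<in> monoms n \<Longrightarrow> fine_deg u \<in> zdeg n"
  using fine_deg_nonneg nonneg_zdeg by blast

lemma unit_vec_zdeg: "R \<subseteq> {..<n} \<Longrightarrow> unit_vec R \<in> zdeg n"
  by (auto simp: unit_vec_def zdeg_def)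

lemma lookup_expo:
  assumes "b \<in> zdeg n" shows "Poly_Mapping.lookup (expo b) i = nat (b i)"
proof -
  have "finite {i. nat (b i) \<noteq> 0}"
    by (rule finite_subset[of _ "{..<n}"]) (use assms in \<open>auto simp: zdeg_def not_le[symmetric]\<close>)
  then show ?thesis by (simp add: expo_def)
qed

lemma fine_deg_expo: assumes "b \<in> nonneg_degs n" shows "fine_deg (expo b) = b"
  using assms lookup_expo[of b n] by (auto simp: fine_deg_def nonneg_zdeg fun_eq_iff)

lemma expo_monoms: assumes "b \<in> nonneg_degs n" shows "expo b \<in> monoms n"
proof -
  have "i < n" if "i \<in> Poly_Mapping.keys (expo b)" for i
  proof (rule ccontr)
    assume "\<not> i < n"
    then have "b i = 0" using assms by (simp add: nonneg_degs_def)
    moreover have "b \<in> zdeg n" using assms by (simp add: nonneg_zdeg)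
    ultimately show False using that by (simp add: in_keys_iff lookup_expo)
  qed
  then show ?thesis by (auto simp: monoms_def)
qed

lemma expo_fine_deg: "expo (fine_deg u) = u"
  by (simp add: expo_def fine_deg_def)

lemma co_0 [simp]: "co 0 b = 0" by (simp add: co_def)

lemma co_add: "co (p + q) b = co p b + co q b" by (simp add: co_def lookup_add)

lemma co_sum: "co (\<Sum>i\<in>I. p i) b = (\<Sum>i\<in>I. co (p i) b)"
  by (induction I rule: infinite_finite_induct) (auto simp: co_add)

lemma co_nonzero:
  assumes "co q b \<noteq> 0" "b \<in> zdeg n" shows "b \<in> nonneg_degs n" "expo b \<in> Poly_Mapping.keys q"
  using assms by (auto simp: co_def nonneg_zdeg in_keys_iff split: if_splits)

lemma co_single_mult:
  assumes u: "u \<in> monoms n" and b: "b \<in> zdeg n"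
  shows "co (Poly_Mapping.single u c * q) b = c * co q (b - fine_deg u)"
proof -
  have z: "b - fine_deg u \<in> zdeg n" using b fine_deg_zdeg[OF u] by (rule zdeg_diff)
  show ?thesis
  proof (cases "\<forall>i. 0 \<le> (b - fine_deg u) i")
    case True
    then have 1: "b - fine_deg u \<in> nonneg_degs n" using z by (simp add: nonneg_zdeg)
    have "0 \<le> b i" for i using spec[OF True, of i] by (simp add: fine_deg_def)
    then have 2: "b \<in> nonneg_degs n" using b by (simp add: nonneg_zdeg)
    have "fine_deg (expo b) = fine_deg (u + expo (b - fine_deg u))"
      by (simp add: fine_deg_add fine_deg_expo[OF 1] fine_deg_expo[OF 2])
    then have "expo b = u + expo (b - fine_deg u)" by (simp add: fine_deg_inj)
    then show ?thesis using 1 2 by (simp add: co_def nonneg_zdeg lookup_single_mult_add)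
  next
    case False
    have "co (Poly_Mapping.single u c * q) b = 0"
    proof (rule ccontr)
      assume nz: "co (Poly_Mapping.single u c * q) b \<noteq> 0"
      note bn = co_nonzero[OF nz b]
      have "Poly_Mapping.lookup (Poly_Mapping.single u c * q) (expo b) \<noteq> 0" using bn(2) by (simp add: in_keys_iff)
      then obtain w where "u + w = expo b"
        unfolding lookup_single_mult by (auto elim!: sum.not_neutral_contains_not_neutral split: if_splits)
      then have "fine_deg u + fine_deg w = b" by (metis fine_deg_add fine_deg_expo[OF bn(1)])
      then have "b - fine_deg u = fine_deg w" by (metis add_diff_cancel_left')
      then show False using False by (auto simp: fine_deg_def)
    qed
    then show ?thesis using False by (auto simp: co_def)
  qed
qed

lemma co_mult:
  assumes p: "p \<in> polys n" and b: "b \<in> zdeg n"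
  shows "co (p * q) b = (\<Sum>u\<in>Poly_Mapping.keys p. Poly_Mapping.lookup p u * co q (b - fine_deg u))"
proof -
  have "p * q = (\<Sum>u\<in>Poly_Mapping.keys p. Poly_Mapping.single u (Poly_Mapping.lookup p u) * q)"
    by (subst (1) poly_mapping_expand[of p]) (simp add: sum_distrib_right)
  then have "co (p * q) b = (\<Sum>u\<in>Poly_Mapping.keys p. co (Poly_Mapping.single u (Poly_Mapping.lookup p u) * q) b)"
    by (simp add: co_sum)
  also have "\<dots> = (\<Sum>u\<in>Poly_Mapping.keys p. Poly_Mapping.lookup p u * co q (b - fine_deg u))"
    using p b by (intro sum.cong) (auto simp: polys_def intro: co_single_mult)
  finally show ?thesis .
qed

lemma co_single:
  assumes "b \<in> zdeg n"
  shows "co (Poly_Mapping.single u c) b = (if b = fine_deg u then c else 0)"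
proof (cases "\<forall>i. 0 \<le> b i")
  case True
  then have "b \<in> nonneg_degs n" using assms by (simp add: nonneg_zdeg)
  then have "u = expo b \<longleftrightarrow> b = fine_deg u" using fine_deg_expo[of b n] expo_fine_deg[of u] by auto
  then show ?thesis using True by (simp add: co_def lookup_single when_def)
next
  case False
  then have "b \<noteq> fine_deg u" by (auto simp: fine_deg_def)
  then show ?thesis using False by (auto simp: co_def)
qed

lemma co_eqI:
  assumes "p \<in> polys n" "q \<in> polys n" "\<And>b. b \<in> nonneg_degs n \<Longrightarrow> co p b = co q b" shows "p = q"
proof (rule poly_mapping_eqI)
  fix u
  show "Poly_Mapping.lookup p u = Poly_Mapping.lookup q u"
  proof (cases "u \<in> monoms n")
    case True
    then show ?thesis
      using assms(3)[OF fine_deg_nonneg[OF True]] fine_deg_nonneg[OF True]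
      by (simp add: co_def expo_fine_deg nonneg_zdeg)
  next
    case False
    then have "u \<notin> Poly_Mapping.keys p" "u \<notin> Poly_Mapping.keys q" using assms(1,2) by (auto simp: polys_def)
    then show ?thesis by (simp add: in_keys_iff)
  qed
qed

text \<open>\<open>dsum\<close> is indexed by lists, so every position needs some ordering of its
  basis.\<close>

definition enum_pos :: "('j \<Rightarrow> int) \<Rightarrow> 'j set \<Rightarrow> int \<Rightarrow> 'j list" where
  "enum_pos pos J i = (SOME xs. set xs = gr pos J i \<and> distinct xs)"

text \<open>The monomial attached to an entry from \<open>j\<close> to \<open>l\<close> is
  x^(\<open>\<tau> j - \<tau> l\<close>), the only one that makes the map homogeneous for the fine
  grading.\<close>

definition cplx_of ::
  "nat \<Rightarrow> 'j set \<Rightarrow> ('j \<Rightarrow> nat set) \<Rightarrow> ('j \<Rightarrow> int) \<Rightarrow> ('j \<Rightarrow> 'j \<Rightarrow> 'k::field) \<Rightarrow> ('k, nat \<Rightarrow> 'k mpoly) cplx" where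
  "cplx_of n J \<tau> pos D =
     \<lparr>obj = (\<lambda>i. free_module n (map \<tau> (enum_pos pos J i))),
      diff = (\<lambda>i f m. if m < length (enum_pos pos J (i + 1)) then
         \<Sum>p<length (enum_pos pos J i). Poly_Mapping.single
           (sqm (\<tau> (enum_pos pos J i ! p) - \<tau> (enum_pos pos J (i + 1) ! m)))
           (D (enum_pos pos J i ! p) (enum_pos pos J (i + 1) ! m)) * f p
         else 0)\<rparr>"

locale sqf_cx =
  fixes n :: nat and J :: "'j set" and \<tau> :: "'j \<Rightarrow> nat set" and pos :: "'j \<Rightarrow> int"
    and D :: "'j \<Rightarrow> 'j \<Rightarrow> 'k::field"
  assumes s: "sqc n J \<tau> pos D"
begin

abbreviation "L \<equiv> enum_pos pos J"
abbreviation "F \<equiv> cplx_of n J \<tau> pos D"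
abbreviation "low b \<equiv> lab J \<tau> (iv {} (supp b))"

definition ix :: "int \<Rightarrow> 'j \<Rightarrow> nat" where
  "ix i j = (THE m. m < length (L i) \<and> L i ! m = j)"

lemma finJ: "finite J" using bcx_finite[OF sqc_bcx[OF s]] .

lemma L: "set (L i) = gr pos J i" "distinct (L i)"
proof -
  have "finite (gr pos J i)" using finJ by (rule rev_finite_subset) (auto simp: gr_def)
  then have "\<exists>xs. set xs = gr pos J i \<and> distinct xs" using finite_distinct_list by blast
  then have "set (L i) = gr pos J i \<and> distinct (L i)" unfolding enum_pos_def by (rule someI_ex)
  then show "set (L i) = gr pos J i" "distinct (L i)" by auto
qed

lemma ix_nth: "m < length (L i) \<Longrightarrow> ix i (L i ! m) = m"
  unfolding ix_def using L(2)[of i] by (auto simp: nth_eq_iff_index_eq)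

lemma nth_ix: assumes "j \<in> gr pos J i" shows "ix i j < length (L i)" "L i ! ix i j = j"
proof -
  obtain m where "m < length (L i)" "L i ! m = j" using assms L(1)[of i] by (metis in_set_conv_nth)
  then show "ix i j < length (L i)" "L i ! ix i j = j" using ix_nth by auto
qed

lemma nth_gr: "m < length (L i) \<Longrightarrow> L i ! m \<in> gr pos J i"
  using L(1)[of i] nth_mem by blast

lemma sum_L: "(\<Sum>m<length (L i). h m) = (\<Sum>j\<in>gr pos J i. h (ix i j))"
proof -
  have "bij_betw (\<lambda>m. L i ! m) {..<length (L i)} (gr pos J i)"
    using bij_betw_nth[OF L(2) refl L(1)[symmetric]] by simp
  from sum.reindex_bij_betw[OF this, of "\<lambda>j. h (ix i j)"] show ?thesis
    by (simp add: ix_nth)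
qed

lemma gr_J: "j \<in> gr pos J i \<Longrightarrow> j \<in> J" by (simp add: gr_def)

lemma tau_n: "j \<in> J \<Longrightarrow> \<tau> j \<subseteq> {..<n}" using sqc_tau[OF s] .

lemma tau_fin: "j \<in> J \<Longrightarrow> finite (\<tau> j)" using tau_n finite_subset by blast

lemma carr_F: "f \<in> carr (obj F i) \<longleftrightarrow> (\<forall>m<length (L i). f m \<in> polys n) \<and> (\<forall>m\<ge>length (L i). f m = 0)"
  by (simp add: cplx_of_def carr_free)

lemma scal_F: "scal (obj F i) p f m = (if m < length (L i) then p * f m else 0)"
  by (simp add: cplx_of_def scal_free)

lemma hcomp_F: "f \<in> hcomp (obj F i) b \<longleftrightarrow> (\<forall>m<length (L i). f m \<in> polys n \<and>
     (\<forall>u\<in>Poly_Mapping.keys (f m). fine_deg u = b - unit_vec (\<tau> (L i ! m)))) \<and> (\<forall>m\<ge>length (L i). f m = 0)"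
  by (auto simp: cplx_of_def hcomp_free)

lemma diff_F: "diff F i f m = (if m < length (L (i + 1)) then
    \<Sum>p<length (L i). Poly_Mapping.single (sqm (\<tau> (L i ! p) - \<tau> (L (i + 1) ! m)))
       (D (L i ! p) (L (i + 1) ! m)) * f p else 0)"
  by (simp add: cplx_of_def)

lemma graded_module_F: "graded_module n fine_deg (obj F i)"
  by (simp add: cplx_of_def graded_module_free)

text \<open>Coordinates of the component of degree \<open>b\<close>: each generator \<open>j\<close>
  contributes at most one monomial there, and only if \<open>\<tau> j \<subseteq> supp b\<close>.
  The component is thus the space of vectors on \<open>low b\<close>.\<close>

definition crd :: "(nat \<Rightarrow> 'k mpoly) \<Rightarrow> int \<Rightarrow> mdegree \<Rightarrow> 'j \<Rightarrow> 'k" where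
  "crd f i b j = (if j \<in> gr pos J i then co (f (ix i j)) (b - unit_vec (\<tau> j)) else 0)"

lemma crd_add: "crd (f + g) i b = crd f i b + crd g i b"
  by (auto simp: crd_def co_add fun_eq_iff)

lemma crd_0 [simp]: "crd 0 i b = 0"
  by (auto simp: crd_def fun_eq_iff)

lemma crd_shift_zdeg: "j \<in> gr pos J i \<Longrightarrow> b \<in> zdeg n \<Longrightarrow> b - unit_vec (\<tau> j) \<in> zdeg n"
  by (intro zdeg_diff unit_vec_zdeg tau_n) (auto simp: gr_def)

lemma crd_scal:
  assumes p: "p \<in> polys n" and b: "b \<in> zdeg n"
  shows "crd (scal (obj F i) p f) i b j =
    (\<Sum>u\<in>Poly_Mapping.keys p. Poly_Mapping.lookup p u * crd f i (b - fine_deg u) j)"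
proof (cases "j \<in> gr pos J i")
  case True
  have sw: "b - fine_deg u - unit_vec (\<tau> j) = b - unit_vec (\<tau> j) - fine_deg u" for u by (simp add: algebra_simps)
  show ?thesis
    using True nth_ix[OF True] co_mult[OF p crd_shift_zdeg[OF True b]]
    by (simp add: crd_def scal_F sw)
qed (simp add: crd_def)

lemma crd_vecs:
  assumes b: "b \<in> zdeg n"
  shows "crd f i b \<in> vecs (gr pos (low b) i)"
  unfolding vecs_def
proof (intro CollectI allI impI, rule ccontr)
  fix j assume j: "j \<notin> gr pos (low b) i" "crd f i b j \<noteq> 0"
  then have jg: "j \<in> gr pos J i" by (auto simp: crd_def split: if_splits)
  then have "b - unit_vec (\<tau> j) \<in> nonneg_degs n"
    using j(2) crd_shift_zdeg[OF jg b] by (auto simp: crd_def intro: co_nonzero)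
  then have nn: "0 \<le> b v - unit_vec (\<tau> j) v" for v by (simp add: nonneg_degs_def)
  have "\<tau> j \<subseteq> supp b"
  proof
    fix v assume "v \<in> \<tau> j"
    then show "v \<in> supp b" using nn[of v] by (simp add: supp_def unit_vec_def)
  qed
  then show False using j(1) jg by (auto simp: gr_def lab_def iv_def)
qed

lemma unit_vec_split: "j \<in> J \<Longrightarrow> l \<in> J \<Longrightarrow> D j l \<noteq> 0 \<Longrightarrow>
    unit_vec (\<tau> l) + fine_deg (sqm (\<tau> j - \<tau> l)) = unit_vec (\<tau> j)"
  using sqc_D[OF s, of j l] tau_fin[of j] by (auto simp: fine_deg_sqm fun_eq_iff unit_vec_def)

lemma sqm_diff_monoms: "j \<in> J \<Longrightarrow> sqm (\<tau> j - R) \<in> monoms n"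
  using tau_n[of j] by (intro sqm_monoms) auto

lemma crd_diff_sum:
  assumes b: "b \<in> zdeg n" and l: "l \<in> gr pos J (i + 1)"
  shows "crd (diff F i f) (i + 1) b l = (\<Sum>j\<in>gr pos J i. crd f i b j * D j l)"
proof -
  have "crd (diff F i f) (i + 1) b l = co (\<Sum>j\<in>gr pos J i.
      Poly_Mapping.single (sqm (\<tau> j - \<tau> l)) (D j l) * f (ix i j)) (b - unit_vec (\<tau> l))"
    using l nth_ix[OF l] by (simp add: crd_def diff_F sum_L nth_ix cong: sum.cong)
  also have "\<dots> = (\<Sum>j\<in>gr pos J i. crd f i b j * D j l)"
    unfolding co_sum
  proof (rule sum.cong[OF refl])
    fix j assume j: "j \<in> gr pos J i"
    have z: "b - unit_vec (\<tau> l) \<in> zdeg n" by (rule crd_shift_zdeg[OF l b])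
    have "co (Poly_Mapping.single (sqm (\<tau> j - \<tau> l)) (D j l) * f (ix i j)) (b - unit_vec (\<tau> l))
      = D j l * co (f (ix i j)) (b - unit_vec (\<tau> l) - fine_deg (sqm (\<tau> j - \<tau> l)))"
      by (rule co_single_mult[OF sqm_diff_monoms[OF gr_J[OF j]] z])
    also have "\<dots> = D j l * co (f (ix i j)) (b - unit_vec (\<tau> j))"
    proof (cases "D j l = 0")
      case False
      have "b - unit_vec (\<tau> l) - fine_deg (sqm (\<tau> j - \<tau> l)) = b - unit_vec (\<tau> j)"
        unfolding unit_vec_split[OF gr_J[OF j] gr_J[OF l] False, symmetric] by (simp add: algebra_simps)
      then show ?thesis by (simp only:)
    qed simp
    finally show "co (Poly_Mapping.single (sqm (\<tau> j - \<tau> l)) (D j l) * f (ix i j)) (b - unit_vec (\<tau> l))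
      = crd f i b j * D j l" using j by (simp add: crd_def)
  qed
  finally show ?thesis .
qed

text \<open>In a fixed degree all monomials act as 1, so the differential is the matrix
  \<open>D\<close> on the labels inside \<open>supp b\<close>. This reduces the complex of modules
  to finite linear algebra.\<close>

lemma crd_diff:
  assumes b: "b \<in> zdeg n"
  shows "crd (diff F i f) (i + 1) b = mapp D (low b) (low b) (crd f i b)"
proof
  fix l
  have bc: "bcx D pos (low b)" by (rule sqc_lab_bcx[OF s order_convex_iv])
  have v: "mapp D (low b) (low b) (crd f i b) \<in> vecs (gr pos (low b) (i + 1))"
    by (rule bcx_gr[OF bc crd_vecs[OF b]])
  show "crd (diff F i f) (i + 1) b l = mapp D (low b) (low b) (crd f i b) l"
  proof (cases "l \<in> gr pos (low b) (i + 1)")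
    case False
    then show ?thesis using vecs_D[OF v False] vecs_D[OF crd_vecs[OF b] False] by simp
  next
    case True
    then have l: "l \<in> gr pos J (i + 1)" "l \<in> low b" by (auto simp: gr_def lab_def)
    have "(\<Sum>j\<in>gr pos J i. crd f i b j * D j l) = (\<Sum>j\<in>J. crd f i b j * D j l)"
      using finJ by (intro sum.mono_neutral_left) (auto simp: gr_def crd_def)
    also have "\<dots> = (\<Sum>j\<in>low b. crd f i b j * D j l)"
      using finJ vecs_D[OF vecs_gr_vecs[OF crd_vecs[OF b]]]
      by (intro sum.mono_neutral_right) (auto simp: lab_def)
    finally show ?thesis using l by (simp add: crd_diff_sum[OF b l(1)] mapp_def)
  qed
qed

lemma crd_inj:
  assumes "f \<in> carr (obj F i)" "g \<in> carr (obj F i)" and eq: "\<And>b. b \<in> nonneg_degs n \<Longrightarrow> crd f i b = crd g i b"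
  shows "f = g"
proof
  fix m show "f m = g m"
  proof (cases "m < length (L i)")
    case True
    let ?j = "L i ! m"
    have j: "?j \<in> gr pos J i" by (rule nth_gr[OF True])
    show ?thesis
    proof (rule co_eqI)
      show "f m \<in> polys n" "g m \<in> polys n" using assms(1,2) True by (auto simp: carr_F)
      fix b assume b: "b \<in> nonneg_degs n"
      have "b + unit_vec (\<tau> ?j) \<in> nonneg_degs n"
        using b unit_vec_zdeg[OF tau_n[OF gr_J[OF j]]] zdeg_add
        by (auto simp: nonneg_zdeg unit_vec_def add_nonneg_nonneg)
      then have "crd f i (b + unit_vec (\<tau> ?j)) ?j = crd g i (b + unit_vec (\<tau> ?j)) ?j" by (simp add: eq)
      then show "co (f m) b = co (g m) b" using j by (simp add: crd_def ix_nth[OF True])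
    qed
  next
    case False
    then show ?thesis using assms(1,2) by (auto simp: carr_F)
  qed
qed

lemma crd_finite:
  shows "finite {b \<in> zdeg n. crd f i b \<noteq> 0}"
proof (rule finite_subset)
  show "{b \<in> zdeg n. crd f i b \<noteq> 0} \<subseteq>
      (\<Union>j\<in>gr pos J i. (\<lambda>u. fine_deg u + unit_vec (\<tau> j)) ` Poly_Mapping.keys (f (ix i j)))"
  proof
    fix b assume "b \<in> {b \<in> zdeg n. crd f i b \<noteq> 0}"
    then obtain j where b: "b \<in> zdeg n" and nz: "crd f i b j \<noteq> 0" by (auto simp: fun_eq_iff)
    then have j: "j \<in> gr pos J i" and nz': "co (f (ix i j)) (b - unit_vec (\<tau> j)) \<noteq> 0"
      by (auto simp: crd_def split: if_splits)
    note c = co_nonzero[OF nz' crd_shift_zdeg[OF j b]]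
    have "b = fine_deg (expo (b - unit_vec (\<tau> j))) + unit_vec (\<tau> j)"
      unfolding fine_deg_expo[OF c(1)] by simp
    then show "b \<in> (\<Union>j\<in>gr pos J i. (\<lambda>u. fine_deg u + unit_vec (\<tau> j)) ` Poly_Mapping.keys (f (ix i j)))"
      using j c(2) by blast
  qed
  show "finite (\<Union>j\<in>gr pos J i. (\<lambda>u. fine_deg u + unit_vec (\<tau> j)) ` Poly_Mapping.keys (f (ix i j)))"
    using finJ by (auto simp: gr_def)
qed

text \<open>Used to build one module element from primitives or cocycles chosen separately in
  finitely many degrees. Vectors on \<open>low b\<close> are admissible because then b -
  \<open>unit_vec (\<tau> j)\<close> has no negative entry.\<close>

lemma crd_assemble:
  assumes fin: "finite S" and S: "S \<subseteq> nonneg_degs n"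
    and y: "\<And>b. b \<in> S \<Longrightarrow> y b \<in> vecs (gr pos (low b) i)"
  obtains f where "f \<in> carr (obj F i)" "\<And>b. b \<in> nonneg_degs n \<Longrightarrow> crd f i b = (if b \<in> S then y b else 0)"
proof
  define f where "f m = (if m < length (L i) then \<Sum>b\<in>{b \<in> S. L i ! m \<in> gr pos (low b) i}.
      Poly_Mapping.single (expo (b - unit_vec (\<tau> (L i ! m)))) (y b (L i ! m)) else 0)" for m
  have nn: "b - unit_vec (\<tau> j) \<in> nonneg_degs n" if "b \<in> nonneg_degs n" "j \<in> gr pos (low b) i" for b j
  proof -
    have j: "j \<in> gr pos J i" "\<tau> j \<subseteq> supp b" using that by (auto simp: gr_def lab_def iv_def)
    have "0 \<le> b v - unit_vec (\<tau> j) v" for v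
    proof (cases "v \<in> \<tau> j")
      case True
      then have "b v \<noteq> 0" "0 \<le> b v" using j that by (auto simp: supp_def nonneg_degs_def)
      then show ?thesis using True by (simp add: unit_vec_def)
    qed (use that in \<open>simp add: unit_vec_def nonneg_degs_def\<close>)
    then show ?thesis using crd_shift_zdeg[OF j(1)] that by (auto simp: nonneg_zdeg)
  qed
  show "f \<in> carr (obj F i)"
    using S nn by (auto simp: carr_F f_def intro!: polys_sum polys_single expo_monoms)
  fix b assume b: "b \<in> nonneg_degs n"
  show "crd f i b = (if b \<in> S then y b else 0)"
  proof
    fix j
    show "crd f i b j = (if b \<in> S then y b else 0) j"
    proof (cases "j \<in> gr pos (low b) i")
      case False
      then show ?thesis using vecs_D[OF crd_vecs False, of f] y[of b] b by (auto simp: nonneg_zdeg vecs_D)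
    next
      case True
      then have j: "j \<in> gr pos J i" by (auto simp: gr_def lab_def)
      have "crd f i b j = (\<Sum>b'\<in>{b \<in> S. j \<in> gr pos (low b) i}.
          co (Poly_Mapping.single (expo (b' - unit_vec (\<tau> j))) (y b' j)) (b - unit_vec (\<tau> j)))"
        using j nth_ix[OF j] by (simp add: crd_def f_def co_sum)
      also have "\<dots> = (\<Sum>b'\<in>{b \<in> S. j \<in> gr pos (low b) i}. if b' = b then y b j else 0)"
      proof (rule sum.cong[OF refl])
        fix b' assume "b' \<in> {b \<in> S. j \<in> gr pos (low b) i}"
        then have b': "b' - unit_vec (\<tau> j) \<in> nonneg_degs n" using nn S by blast
        have "b - unit_vec (\<tau> j) \<in> zdeg n" using nn[OF b True] by (simp add: nonneg_zdeg)
        then show "co (Poly_Mapping.single (expo (b' - unit_vec (\<tau> j))) (y b' j)) (b - unit_vec (\<tau> j))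
          = (if b' = b then y b j else 0)"
          by (auto simp: co_single fine_deg_expo[OF b'])
      qed
      also have "\<dots> = (if b \<in> S then y b else 0) j" using fin True by auto
      finally show ?thesis .
    qed
  qed
qed

lemma hcomp_crd:
  assumes f: "f \<in> hcomp (obj F i) b" and b': "b' \<in> zdeg n" "b' \<noteq> b" shows "crd f i b' = 0"
proof
  fix j show "crd f i b' j = 0 j"
  proof (cases "j \<in> gr pos J i")
    case True
    have "co (f (ix i j)) (b' - unit_vec (\<tau> j)) = 0"
    proof (rule ccontr)
      assume "co (f (ix i j)) (b' - unit_vec (\<tau> j)) \<noteq> 0"
      note c = co_nonzero[OF this crd_shift_zdeg[OF True b'(1)]]
      have "\<forall>u\<in>Poly_Mapping.keys (f (ix i j)). fine_deg u = b - unit_vec (\<tau> (L i ! ix i j))"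
        using f nth_ix(1)[OF True] unfolding hcomp_F by (auto split: if_splits)
      then have "fine_deg (expo (b' - unit_vec (\<tau> j))) = b - unit_vec (\<tau> j)"
        using c(2) nth_ix(2)[OF True] by simp
      then show False using b'(2) unfolding fine_deg_expo[OF c(1)] by simp
    qed
    then show ?thesis using True by (simp add: crd_def)
  qed (simp add: crd_def)
qed

lemma diff_closed: assumes "f \<in> carr (obj F i)" shows "diff F i f \<in> carr (obj F (i + 1))"
  using assms nth_gr[THEN gr_J]
  by (auto simp: carr_F diff_F intro!: polys_sum polys_mult polys_single sqm_diff_monoms)

lemma diff_add: "diff F i (f + g) = diff F i f + diff F i g"
  by (auto simp: diff_F fun_eq_iff algebra_simps sum.distrib)

lemma diff_scal: "diff F i (scal (obj F i) p f) = scal (obj F (i + 1)) p (diff F i f)"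
  by (auto simp: diff_F scal_F fun_eq_iff sum_distrib_left mult.left_commute intro!: sum.cong)

lemma diff_diff: assumes "f \<in> carr (obj F i)" shows "diff F (i + 1) (diff F i f) = 0"
proof (rule crd_inj)
  show "diff F (i + 1) (diff F i f) \<in> carr (obj F (i + 1 + 1))" using assms by (intro diff_closed)
  show "0 \<in> carr (obj F (i + 1 + 1))" by (auto simp: carr_F)
  fix b assume "b \<in> nonneg_degs n"
  then have b: "b \<in> zdeg n" by (simp add: nonneg_zdeg)
  have bc: "bcx D pos (low b)" by (rule sqc_lab_bcx[OF s order_convex_iv])
  show "crd (diff F (i + 1) (diff F i f)) (i + 1 + 1) b = crd 0 (i + 1 + 1) b"
    by (simp only: crd_diff[OF b] bcx_dd[OF bc] crd_0)
qed

lemma graded_hom_diff: "graded_hom n (obj F i) (obj F (i + 1)) (diff F i)"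
  unfolding graded_hom_def lin_map_def
proof (intro conjI ballI allI)
  fix f g p assume "f \<in> carr (obj F i)"
  then show "diff F i f \<in> carr (obj F (i + 1))" by (rule diff_closed)
  show "diff F i (f + g) = diff F i f + diff F i g" by (rule diff_add)
  show "diff F i (scal (obj F i) p f) = scal (obj F (i + 1)) p (diff F i f)" by (rule diff_scal)
next
  fix b
  show "diff F i ` hcomp (obj F i) b \<subseteq> hcomp (obj F (i + 1)) b"
  proof
    fix h assume "h \<in> diff F i ` hcomp (obj F i) b"
    then obtain f where f: "f \<in> hcomp (obj F i) b" "h = diff F i f" by blast
    have "f \<in> carr (obj F i)" using f(1) graded_module.hcomp_carr[OF graded_module_F] by blast
    then have hc: "h \<in> carr (obj F (i + 1))" using f(2) diff_closed by simp
    have "fine_deg u = b - unit_vec (\<tau> (L (i + 1) ! m))"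
      if m: "m < length (L (i + 1))" and u: "u \<in> Poly_Mapping.keys (h m)" for m u
    proof -
      let ?l = "L (i + 1) ! m"
      have l: "?l \<in> J" by (rule gr_J[OF nth_gr[OF m]])
      have "(\<Sum>p<length (L i). Poly_Mapping.lookup
         (Poly_Mapping.single (sqm (\<tau> (L i ! p) - \<tau> ?l)) (D (L i ! p) ?l) * f p) u) \<noteq> 0"
        using u m by (simp add: f(2) diff_F in_keys_iff lookup_sum)
      then obtain p where p: "p < length (L i)"
        and nz: "Poly_Mapping.lookup (Poly_Mapping.single (sqm (\<tau> (L i ! p) - \<tau> ?l)) (D (L i ! p) ?l) * f p) u \<noteq> 0"
        by (auto elim!: sum.not_neutral_contains_not_neutral)
      let ?j = "L i ! p"
      have j: "?j \<in> J" by (rule gr_J[OF nth_gr[OF p]])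
      obtain w where w: "w \<in> Poly_Mapping.keys (f p)" "sqm (\<tau> ?j - \<tau> ?l) + w = u" "D ?j ?l \<noteq> 0"
        using nz unfolding lookup_single_mult by (auto elim!: sum.not_neutral_contains_not_neutral split: if_splits)
      have "fine_deg w = b - unit_vec (\<tau> ?j)" using f(1) w(1) p by (auto simp: hcomp_F)
      then have "fine_deg u = fine_deg (sqm (\<tau> ?j - \<tau> ?l)) + (b - unit_vec (\<tau> ?j))"
        using w(2) by (auto simp: fine_deg_add)
      also have "\<dots> = b - unit_vec (\<tau> ?l)"
        unfolding unit_vec_split[OF j l w(3), symmetric] by (simp add: algebra_simps)
      finally show ?thesis .
    qed
    then show "h \<in> hcomp (obj F (i + 1)) b" using hc by (auto simp: hcomp_F carr_F)
  qed
qed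

lemma empty_pos: "gr pos J i = {} \<Longrightarrow> carr (obj F i) = {0}"
  using L(1)[of i] by (auto simp: carr_F fun_eq_iff)

lemma bounded_F: "bounded_complex n F"
  unfolding bounded_complex_def
proof (intro conjI allI ballI)
  show "graded_hom n (obj F i) (obj F (i + 1)) (diff F i)" for i by (rule graded_hom_diff)
  show "diff F (i + 1) (diff F i f) = 0" if "f \<in> carr (obj F i)" for i f using that by (rule diff_diff)
  show "\<exists>N. \<forall>i. N < \<bar>i\<bar> \<longrightarrow> carr (obj F i) = {0}"
  proof (intro exI allI impI)
    fix i assume i: "(\<Sum>j\<in>J. \<bar>pos j\<bar>) < \<bar>i\<bar>"
    have "gr pos J i = {}"
    proof (rule ccontr)
      assume "gr pos J i \<noteq> {}"
      then obtain j where "j \<in> J" "pos j = i" by (auto simp: gr_def)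
      moreover from this have "\<bar>pos j\<bar> \<le> (\<Sum>j\<in>J. \<bar>pos j\<bar>)" using finJ by (intro member_le_sum) auto
      ultimately show False using i by simp
    qed
    then show "carr (obj F i) = {0}" by (rule empty_pos)
  qed
qed

lemma free_F: "free_sqf_complex n F"
  unfolding free_sqf_complex_def
proof (intro conjI allI bounded_F)
  fix i
  have "\<forall>R\<in>set (map \<tau> (L i)). R \<subseteq> {..<n}" using L(1)[of i] tau_n by (auto simp: gr_def)
  from free_sqf_free[OF this] show "free_sqf n (obj F i)" by (simp add: cplx_of_def)
qed

text \<open>For every nonzero entry choose a variable v in \<open>\<tau> j - \<tau> l\<close>, split
  it off the monomial, and collect the terms belonging to the same variable.\<close>

lemma minimal_F: assumes m: "min_sqc J \<tau> D" shows "minimal_complex n F"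
  unfolding minimal_complex_def
proof (intro allI subsetI)
  fix i h assume "h \<in> diff F i ` carr (obj F i)"
  then obtain f where f: "f \<in> carr (obj F i)" "h = diff F i f" by blast
  define v where "v j l = (SOME v. v \<in> \<tau> j - \<tau> l)" for j l
  define t where "t p q = Poly_Mapping.single (sqm (\<tau> (L i ! p) - \<tau> (L (i + 1) ! q) - {v (L i ! p) (L (i + 1) ! q)}))
      (D (L i ! p) (L (i + 1) ! q)) * f p" for p q
  define y where "y w q = (if q < length (L (i + 1)) then
      \<Sum>p\<in>{p. p < length (L i) \<and> v (L i ! p) (L (i + 1) ! q) = w \<and> D (L i ! p) (L (i + 1) ! q) \<noteq> 0}. t p q else 0)" for w q
  have v: "v j l \<in> \<tau> j - \<tau> l" if "j \<in> J" "l \<in> J" "D j l \<noteq> 0" for j l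
  proof -
    have "\<tau> l \<subseteq> \<tau> j" "\<tau> l \<noteq> \<tau> j" using sqc_D[OF s] m that by (auto simp: min_sqc_def)
    then have "\<exists>v. v \<in> \<tau> j - \<tau> l" by blast
    then show ?thesis unfolding v_def by (rule someI_ex)
  qed
  have tP: "t p q \<in> polys n" if "p < length (L i)" for p q
    using f(1) that tau_n[OF gr_J[OF nth_gr[OF that]]] unfolding t_def
    by (intro polys_mult polys_single sqm_monoms) (auto simp: carr_F)
  have "y w \<in> carr (obj F (i + 1))" for w
    using tP by (auto simp: carr_F y_def intro!: polys_sum)
  moreover have "h = (\<Sum>w<n. scal (obj F (i + 1)) (sqf_monom {w}) (y w))"
  proof
    fix q
    show "h q = (\<Sum>w<n. scal (obj F (i + 1)) (sqf_monom {w}) (y w)) q"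
    proof (cases "q < length (L (i + 1))")
      case False
      then show ?thesis by (simp add: f(2) diff_F sum_fun_apply scal_F)
    next
      case q: True
      let ?l = "L (i + 1) ! q"
      have l: "?l \<in> J" by (rule gr_J[OF nth_gr[OF q]])
      let ?P = "{p. p < length (L i) \<and> D (L i ! p) ?l \<noteq> 0}"
      have "h q = (\<Sum>p\<in>?P. Poly_Mapping.single (sqm (\<tau> (L i ! p) - \<tau> ?l)) (D (L i ! p) ?l) * f p)"
        using q by (auto simp: f(2) diff_F intro!: sum.mono_neutral_right)
      also have "\<dots> = (\<Sum>p\<in>?P. sqf_monom {v (L i ! p) ?l} * t p q)"
      proof (rule sum.cong[OF refl])
        fix p assume "p \<in> ?P"
        then have p: "L i ! p \<in> J" "D (L i ! p) ?l \<noteq> 0" using gr_J[OF nth_gr] by auto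
        let ?T = "\<tau> (L i ! p) - \<tau> ?l" and ?v = "v (L i ! p) ?l"
        have vT: "?v \<in> ?T" by (rule v[OF p(1) l p(2)])
        have "sqm {?v} + sqm (?T - {?v}) = sqm ({?v} \<union> (?T - {?v}))"
          using tau_fin[OF p(1)] by (intro sqm_add) auto
        also have "{?v} \<union> (?T - {?v}) = ?T" using vT by blast
        finally have "sqm ?T = sqm {?v} + sqm (?T - {?v})" by simp
        then show "Poly_Mapping.single (sqm ?T) (D (L i ! p) ?l) * f p = sqf_monom {?v} * t p q"
          by (simp add: t_def sqf_monom_eq mult_single mult.assoc[symmetric])
      qed
      also have "\<dots> = (\<Sum>w<n. \<Sum>p\<in>{p \<in> ?P. v (L i ! p) ?l = w}. sqf_monom {v (L i ! p) ?l} * t p q)"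
      proof (rule sum.group[symmetric])
        show "(\<lambda>p. v (L i ! p) ?l) ` ?P \<subseteq> {..<n}"
          using v[OF gr_J[OF nth_gr] l] tau_n[OF gr_J[OF nth_gr]] by blast
      qed auto
      also have "\<dots> = (\<Sum>w<n. sqf_monom {w} * y w q)"
        using q by (auto simp: y_def sum_distrib_left intro!: sum.cong)
      also have "\<dots> = (\<Sum>w<n. scal (obj F (i + 1)) (sqf_monom {w}) (y w)) q"
        using q by (simp add: sum_fun_apply scal_F)
      finally show ?thesis .
    qed
  qed
  ultimately show "h \<in> max_ideal_mult n (obj F (i + 1))" unfolding max_ideal_mult_def by blast
qed

end

section \<open>The two dualities\<close>

lemma lin_map_zero:
  assumes "lin_map n M N h" "0 \<in> carr M" shows "h 0 = (0 :: 'l::ab_group_add)"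
proof -
  have "h (0 + 0) = h 0 + h 0" using assms unfolding lin_map_def by blast
  then show ?thesis by simp
qed

lemma supp_n: "b \<in> zdeg n \<Longrightarrow> supp b \<subseteq> {..<n}"
  by (auto simp: supp_def zdeg_def) (meson not_le)

lemma unit_vec_compl: "B \<subseteq> {..<n} \<Longrightarrow> unit_vec ({..<n} - B) = unit_vec {..<n} - unit_vec B"
  by (auto simp: unit_vec_def fun_eq_iff)

lemma unit_vec_diff: "B \<subseteq> T \<Longrightarrow> unit_vec (T - B) = unit_vec T - unit_vec B"
  by (auto simp: unit_vec_def fun_eq_iff)

section \<open>Coordinates on the dual modules Hom(F, S(-1))\<close>

context sqf_cx
begin

abbreviation "W \<equiv> twist (S_mod n fine_deg) (unit_vec {..<n}) :: ('k, mdegree, 'k mpoly) gmod"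
abbreviation "HM i \<equiv> Hom_mod n (obj F i) W"
abbreviation "DA i b \<equiv> dual_arg n (HM i) b"
abbreviation "AX \<equiv> alex_dual n (std_dual n F)"
abbreviation "up b \<equiv> lab J \<tau> (iv (supp b) {..<n})"

lemma carr_W: "carr W = polys n" by (simp add: twist_def S_mod_def)

lemma scal_W: "scal W = (*)" by (simp add: twist_def S_mod_def)

lemma hcomp_W: "p \<in> hcomp W a \<longleftrightarrow> p \<in> polys n \<and> (\<forall>u\<in>Poly_Mapping.keys p. fine_deg u = a - unit_vec {..<n})"
  by (simp add: twist_def S_mod_def)

lemma obj_AX: "obj AX i = alex_mod n (HM i)"
  by (simp add: alex_dual_def std_dual_def)

text \<open>The twist by (1,...,1) in \<open>W\<close> cancels against the complement in
  \<open>dual_arg\<close>: a form in this component lowers degrees by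
  \<open>unit_vec (supp b)\<close>.\<close>

lemma DA_iff: "b \<in> zdeg n \<Longrightarrow> h \<in> DA i b \<longleftrightarrow> lin_map n (obj F i) W h \<and> (\<forall>x. x \<notin> carr (obj F i) \<longrightarrow> h x = 0) \<and>
    (\<forall>a. \<forall>f\<in>hcomp (obj F i) a. h f \<in> polys n \<and>
       (\<forall>u\<in>Poly_Mapping.keys (h f). fine_deg u = a - unit_vec (supp b)))"
  unfolding dual_arg_def Hom_mod_def
  by (auto simp: image_subset_iff hcomp_W unit_vec_compl[OF supp_n] algebra_simps)

definition ebas :: "nat \<Rightarrow> nat \<Rightarrow> 'k mpoly" where
  "ebas m = (\<lambda>p. if p = m then 1 else 0)"

lemma one_polys: "1 \<in> polys n"
  by (simp add: polys_def monoms_def)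

lemma ebas_carr: "m < length (L i) \<Longrightarrow> ebas m \<in> carr (obj F i)"
  by (auto simp: carr_F ebas_def one_polys)

lemma ebas_hcomp: "m < length (L i) \<Longrightarrow> ebas m \<in> hcomp (obj F i) (unit_vec (\<tau> (L i ! m)))"
  by (auto simp: hcomp_F ebas_def one_polys fine_deg_def fun_eq_iff)

lemma zero_carr: "0 \<in> carr (obj F i)" by (simp add: carr_F)

lemma F_expand: assumes "f \<in> carr (obj F i)"
  shows "f = (\<Sum>m<length (L i). scal (obj F i) (f m) (ebas m))"
proof
  fix q
  have "(\<Sum>m<length (L i). scal (obj F i) (f m) (ebas m) q) = (\<Sum>m<length (L i). if m = q then f q else 0)"
    by (intro sum.cong) (auto simp: scal_F ebas_def)
  also have "\<dots> = f q" using assms by (auto simp: carr_F)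
  finally show "f q = (\<Sum>m<length (L i). scal (obj F i) (f m) (ebas m)) q" by (simp add: sum_fun_apply)
qed

lemma lin_map_expand:
  assumes h: "lin_map n (obj F i) W h" and f: "f \<in> carr (obj F i)"
  shows "h f = (\<Sum>m<length (L i). f m * h (ebas m))"
proof -
  have cl: "scal (obj F i) (f m) (ebas m) \<in> carr (obj F i)" if "m < length (L i)" for m
    using that f ebas_carr[OF that] graded_module.scal_closed[OF graded_module_F] by (auto simp: carr_F)
  have "h (\<Sum>m<k. scal (obj F i) (f m) (ebas m)) = (\<Sum>m<k. f m * h (ebas m)) \<and>
      (\<Sum>m<k. scal (obj F i) (f m) (ebas m)) \<in> carr (obj F i)" if "k \<le> length (L i)" for k
    using that
  proof (induction k)
    case 0
    show ?case
      unfolding lessThan_0 sum.empty using lin_map_zero[OF h zero_carr] zero_carr by blast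
  next
    case (Suc k)
    let ?S = "\<Sum>m<k. scal (obj F i) (f m) (ebas m)" and ?t = "scal (obj F i) (f k) (ebas k)"
    have k: "k < length (L i)" using Suc.prems by simp
    have IH: "h ?S = (\<Sum>m<k. f m * h (ebas m))" "?S \<in> carr (obj F i)" using Suc by auto
    have "h (?S + ?t) = h ?S + h ?t" using h IH(2) cl[OF k] unfolding lin_map_def by blast
    moreover have "h ?t = f k * h (ebas k)"
      using h ebas_carr[OF k] f k unfolding lin_map_def scal_W[symmetric] by (auto simp: carr_F)
    moreover have "?S + ?t \<in> carr (obj F i)"
      using IH(2) cl[OF k] graded_module.add_closed[OF graded_module_F] by blast
    ultimately show ?case using IH(1) by (simp only: sum.lessThan_Suc simp_thms)
  qed
  from this[of "length (L i)"] show ?thesis using F_expand[OF f] by simp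
qed

text \<open>For degree reasons a form in \<open>DA i b\<close> sends the generator \<open>j\<close>
  to a scalar times x^(\<open>\<tau> j - supp b\<close>), and to 0 if \<open>supp b\<close> is not
  inside \<open>\<tau> j\<close>. \<open>cof\<close> collects these scalars, and
  \<open>hom_of\<close> is the inverse.\<close>

definition cof :: "int \<Rightarrow> mdegree \<Rightarrow> ((nat \<Rightarrow> 'k mpoly) \<Rightarrow> 'k mpoly) \<Rightarrow> 'j \<Rightarrow> 'k" where
  "cof i b h j = (if j \<in> gr pos (up b) i then Poly_Mapping.lookup (h (ebas (ix i j))) (sqm (\<tau> j - supp b)) else 0)"

definition hom_of :: "int \<Rightarrow> mdegree \<Rightarrow> ('j \<Rightarrow> 'k) \<Rightarrow> (nat \<Rightarrow> 'k mpoly) \<Rightarrow> 'k mpoly" where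
  "hom_of i b c f = (if f \<in> carr (obj F i) then
     \<Sum>m<length (L i). Poly_Mapping.single (sqm (\<tau> (L i ! m) - supp b)) (c (L i ! m)) * f m else 0)"

lemma up_gr: "j \<in> gr pos (up b) i \<Longrightarrow> j \<in> gr pos J i \<and> supp b \<subseteq> \<tau> j"
  by (auto simp: gr_def lab_def iv_def)

lemma in_up_gr: "j \<in> gr pos J i \<Longrightarrow> supp b \<subseteq> \<tau> j \<Longrightarrow> j \<in> gr pos (up b) i"
  using tau_n by (auto simp: gr_def lab_def iv_def)

lemma cof_vecs: "cof i b h \<in> vecs (gr pos (up b) i)"
  by (simp add: cof_def vecs_def)

lemma cof_add: "cof i b (h + h') = cof i b h + cof i b h'"
  by (auto simp: cof_def fun_eq_iff lookup_add)

lemma hom_of_DA: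
  assumes b: "b \<in> zdeg n" and c: "c \<in> vecs (gr pos (up b) i)"
  shows "hom_of i b c \<in> DA i b"
  unfolding DA_iff[OF b] lin_map_def
proof (intro conjI ballI allI impI)
  have P: "Poly_Mapping.single (sqm (\<tau> (L i ! m) - supp b)) (c (L i ! m)) * f m \<in> polys n"
    if "f \<in> carr (obj F i)" "m < length (L i)" for f m
    using that nth_gr[OF that(2), THEN gr_J]
    by (intro polys_mult polys_single sqm_diff_monoms) (auto simp: carr_F)
  then show carr: "hom_of i b c f \<in> carr W" if "f \<in> carr (obj F i)" for f
    using that by (auto simp: carr_W hom_of_def intro!: polys_sum)
  show "hom_of i b c (f + g) = hom_of i b c f + hom_of i b c g"
    if "f \<in> carr (obj F i)" "g \<in> carr (obj F i)" for f g
    using that graded_module.add_closed[OF graded_module_F that]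
    by (simp add: hom_of_def algebra_simps sum.distrib)
  show "hom_of i b c (scal (obj F i) p f) = scal W p (hom_of i b c f)"
    if "p \<in> polys n" "f \<in> carr (obj F i)" for p f
    using that graded_module.scal_closed[OF graded_module_F that]
    by (auto simp: hom_of_def scal_F scal_W sum_distrib_left mult.left_commute intro!: sum.cong)
  show "hom_of i b c f = 0" if "f \<notin> carr (obj F i)" for f using that by (simp add: hom_of_def)
  fix a f assume f: "f \<in> hcomp (obj F i) a"
  have fc: "f \<in> carr (obj F i)" using f graded_module.hcomp_carr[OF graded_module_F] by blast
  show "hom_of i b c f \<in> polys n" using carr[OF fc] by (simp add: carr_W)
  fix u assume "u \<in> Poly_Mapping.keys (hom_of i b c f)"
  then have "(\<Sum>m<length (L i). Poly_Mapping.lookup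
      (Poly_Mapping.single (sqm (\<tau> (L i ! m) - supp b)) (c (L i ! m)) * f m) u) \<noteq> 0"
    using fc by (simp add: hom_of_def in_keys_iff lookup_sum)
  then obtain m where m: "m < length (L i)" and nz: "Poly_Mapping.lookup
      (Poly_Mapping.single (sqm (\<tau> (L i ! m) - supp b)) (c (L i ! m)) * f m) u \<noteq> 0"
    by (auto elim!: sum.not_neutral_contains_not_neutral)
  let ?j = "L i ! m"
  obtain w where w: "w \<in> Poly_Mapping.keys (f m)" "sqm (\<tau> ?j - supp b) + w = u" "c ?j \<noteq> 0"
    using nz unfolding lookup_single_mult by (auto elim!: sum.not_neutral_contains_not_neutral split: if_splits)
  have "supp b \<subseteq> \<tau> ?j" using up_gr vecs_D[OF c] w(3) by blast
  then have "fine_deg (sqm (\<tau> ?j - supp b)) = unit_vec (\<tau> ?j) - unit_vec (supp b)"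
    using tau_fin[OF gr_J[OF nth_gr[OF m]]] by (simp add: fine_deg_sqm unit_vec_diff)
  moreover have "fine_deg w = a - unit_vec (\<tau> ?j)" using f w(1) m by (auto simp: hcomp_F)
  moreover have "fine_deg u = fine_deg (sqm (\<tau> ?j - supp b)) + fine_deg w" using w(2) fine_deg_add by blast
  ultimately show "fine_deg u = a - unit_vec (supp b)" by simp
qed

lemma hom_of_ebas:
  assumes m: "m < length (L i)"
  shows "hom_of i b c (ebas m) = Poly_Mapping.single (sqm (\<tau> (L i ! m) - supp b)) (c (L i ! m))"
proof -
  have "hom_of i b c (ebas m) =
      (\<Sum>q<length (L i). Poly_Mapping.single (sqm (\<tau> (L i ! q) - supp b)) (c (L i ! q)) * ebas m q)"
    using ebas_carr[OF m] by (simp add: hom_of_def)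
  also have "\<dots> = (\<Sum>q<length (L i). if q = m then
      Poly_Mapping.single (sqm (\<tau> (L i ! m) - supp b)) (c (L i ! m)) else 0)"
    by (intro sum.cong refl) (simp add: ebas_def)
  finally show ?thesis using m by simp
qed

lemma cof_hom_of:
  assumes c: "c \<in> vecs (gr pos (up b) i)" shows "cof i b (hom_of i b c) = c"
proof
  fix j show "cof i b (hom_of i b c) j = c j"
    using up_gr[of j b i] nth_ix[of j i] vecs_D[OF c, of j] by (auto simp: cof_def hom_of_ebas)
qed

lemma DA_ebas:
  assumes b: "b \<in> zdeg n" and h: "h \<in> DA i b" and j: "j \<in> gr pos J i"
  shows "h (ebas (ix i j)) = Poly_Mapping.single (sqm (\<tau> j - supp b)) (cof i b h j)"
proof (rule poly_mapping_eqI)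
  fix u
  have "ebas (ix i j) \<in> hcomp (obj F i) (unit_vec (\<tau> j))" using ebas_hcomp nth_ix[OF j] by metis
  then have deg: "fine_deg u = unit_vec (\<tau> j) - unit_vec (supp b)"
    if "Poly_Mapping.lookup (h (ebas (ix i j))) u \<noteq> 0" for u
    using h[unfolded DA_iff[OF b]] that by (auto simp: in_keys_iff)
  show "Poly_Mapping.lookup (h (ebas (ix i j))) u
      = Poly_Mapping.lookup (Poly_Mapping.single (sqm (\<tau> j - supp b)) (cof i b h j)) u"
  proof (cases "supp b \<subseteq> \<tau> j")
    case True
    have "unit_vec (\<tau> j) - unit_vec (supp b) = fine_deg (sqm (\<tau> j - supp b))"
      using True tau_fin[OF gr_J[OF j]] by (simp add: fine_deg_sqm unit_vec_diff)
    then have "Poly_Mapping.lookup (h (ebas (ix i j))) u = 0" if "u \<noteq> sqm (\<tau> j - supp b)"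
      using deg[of u] that fine_deg_inj by metis
    then show ?thesis using in_up_gr[OF j True] by (auto simp: lookup_single when_def cof_def)
  next
    case False
    then obtain v where v: "v \<in> supp b" "v \<notin> \<tau> j" by blast
    have "Poly_Mapping.lookup (h (ebas (ix i j))) u = 0"
    proof (rule ccontr)
      assume "Poly_Mapping.lookup (h (ebas (ix i j))) u \<noteq> 0"
      then have "fine_deg u v = unit_vec (\<tau> j) v - unit_vec (supp b) v" using deg by simp
      then show False using v by (simp add: unit_vec_def fine_deg_def)
    qed
    moreover have "cof i b h j = 0" using up_gr False by (auto simp: cof_def)
    ultimately show ?thesis by simp
  qed
qed

lemma DA_hom_of:
  assumes b: "b \<in> zdeg n" and h: "h \<in> DA i b" shows "hom_of i b (cof i b h) = h"
proof
  fix f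
  show "hom_of i b (cof i b h) f = h f"
  proof (cases "f \<in> carr (obj F i)")
    case True
    have "h f = (\<Sum>m<length (L i). f m * h (ebas m))"
      using h[unfolded DA_iff[OF b]] True by (intro lin_map_expand) auto
    also have "\<dots> = (\<Sum>m<length (L i). Poly_Mapping.single (sqm (\<tau> (L i ! m) - supp b)) (cof i b h (L i ! m)) * f m)"
    proof (rule sum.cong[OF refl])
      fix m assume "m \<in> {..<length (L i)}"
      then have "h (ebas m) = Poly_Mapping.single (sqm (\<tau> (L i ! m) - supp b)) (cof i b h (L i ! m))"
        using DA_ebas[OF b h nth_gr[of m i]] by (simp add: ix_nth)
      then show "f m * h (ebas m) = Poly_Mapping.single (sqm (\<tau> (L i ! m) - supp b)) (cof i b h (L i ! m)) * f m"
        by (simp add: mult.commute)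
    qed
    finally show ?thesis using True by (simp add: hom_of_def)
  next
    case False
    then show ?thesis using h[unfolded DA_iff[OF b]] by (simp add: hom_of_def)
  qed
qed

lemma DA_add:
  assumes b: "b \<in> zdeg n" and "h \<in> DA i b" "h' \<in> DA i b" shows "h + h' \<in> DA i b"
proof -
  have "hom_of i b (cof i b h + cof i b h') = h + h'"
  proof
    fix f
    have "hom_of i b (cof i b h + cof i b h') f = hom_of i b (cof i b h) f + hom_of i b (cof i b h') f"
      by (simp add: hom_of_def single_add algebra_simps sum.distrib)
    then show "hom_of i b (cof i b h + cof i b h') f = (h + h') f"
      by (simp add: DA_hom_of[OF b assms(2)] DA_hom_of[OF b assms(3)])
  qed
  moreover have "hom_of i b (cof i b h + cof i b h') \<in> DA i b"
    by (intro hom_of_DA b vecs_add cof_vecs)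
  ultimately show ?thesis by simp
qed

lemma lookup_const_mult: "Poly_Mapping.lookup (const c * p) u = c * Poly_Mapping.lookup p u"
  using lookup_single_mult_add[of 0 c p u] by (simp add: const_def)

lemma scal_HM: "scal (HM i) p h f = (if f \<in> carr (obj F i) then p * h f else 0)"
  by (simp add: Hom_mod_def scal_W)

lemma cof_const: "cof i b (scal (HM i) (const c) h) = (\<lambda>j. c * cof i b h j)"
  using nth_ix(1) up_gr ebas_carr by (auto simp: cof_def fun_eq_iff scal_HM lookup_const_mult)

text \<open>Multiplication by \<open>x\<^bsup>supp b - supp b'\<^esup>\<close> is dual to the projection from \<open>up b'\<close> to \<open>up b\<close>.\<close>

lemma DA_mult:
  assumes b: "b \<in> zdeg n" "b' \<in> zdeg n" and sub: "supp b' \<subseteq> supp b" and h: "h \<in> DA i b"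
  shows "scal (HM i) (sqf_monom (supp b - supp b')) h \<in> DA i b'"
    and "cof i b' (scal (HM i) (sqf_monom (supp b - supp b')) h) = cof i b h"
proof -
  let ?x = "Poly_Mapping.single (sqm (supp b - supp b')) 1 :: 'k mpoly"
  let ?h = "scal (HM i) (sqf_monom (supp b - supp b')) h"
  have fin: "finite (supp b)" using supp_n[OF b(1)] finite_subset by blast
  have xP: "?x \<in> polys n" using supp_n[OF b(1)] by (intro polys_single sqm_monoms) auto
  have app: "?h f = (if f \<in> carr (obj F i) then ?x * h f else 0)" for f
    by (simp add: scal_HM sqf_monom_eq)
  note hD = h[unfolded DA_iff[OF b(1)] lin_map_def carr_W scal_W]
  show "?h \<in> DA i b'"
    unfolding DA_iff[OF b(2)] lin_map_def
  proof (intro conjI ballI allI impI)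
    show "?h f \<in> carr W" if "f \<in> carr (obj F i)" for f
      using that hD xP by (auto simp: app carr_W intro: polys_mult)
    show "?h (f + g) = ?h f + ?h g" if "f \<in> carr (obj F i)" "g \<in> carr (obj F i)" for f g
      using that hD graded_module.add_closed[OF graded_module_F that] by (simp add: app algebra_simps)
    show "?h (scal (obj F i) p f) = scal W p (?h f)" if "p \<in> polys n" "f \<in> carr (obj F i)" for p f
      using that hD graded_module.scal_closed[OF graded_module_F that] by (simp add: app scal_W algebra_simps)
    show "?h f = 0" if "f \<notin> carr (obj F i)" for f using that by (simp add: app)
    fix a f assume f: "f \<in> hcomp (obj F i) a"
    then have fc: "f \<in> carr (obj F i)" using graded_module.hcomp_carr[OF graded_module_F] by blast
    then show "?h f \<in> polys n" using hD xP by (auto simp: app intro: polys_mult)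
    fix u assume "u \<in> Poly_Mapping.keys (?h f)"
    then have "Poly_Mapping.lookup (?x * h f) u \<noteq> 0" using fc by (simp add: app in_keys_iff)
    then obtain w where w: "w \<in> Poly_Mapping.keys (h f)" "sqm (supp b - supp b') + w = u"
      unfolding lookup_single_mult by (auto elim!: sum.not_neutral_contains_not_neutral split: if_splits)
    have "fine_deg w = a - unit_vec (supp b)" using hD f w(1) by blast
    moreover have "fine_deg u = fine_deg (sqm (supp b - supp b')) + fine_deg w" using w(2) fine_deg_add by blast
    moreover have "fine_deg (sqm (supp b - supp b')) = unit_vec (supp b) - unit_vec (supp b')"
      using fin sub by (simp add: fine_deg_sqm unit_vec_diff)
    ultimately show "fine_deg u = a - unit_vec (supp b')" by simp
  qed
  show "cof i b' ?h = cof i b h"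
  proof
    fix j show "cof i b' ?h j = cof i b h j"
    proof (cases "j \<in> gr pos (up b') i")
      case True
      then have j: "j \<in> gr pos J i" "supp b' \<subseteq> \<tau> j" using up_gr by auto
      have "ebas (ix i j) \<in> carr (obj F i)" using ebas_carr nth_ix(1)[OF j(1)] by blast
      then have eq: "cof i b' ?h j = Poly_Mapping.lookup
          (Poly_Mapping.single (sqm (supp b - supp b') + sqm (\<tau> j - supp b)) (cof i b h j)) (sqm (\<tau> j - supp b'))"
        using True DA_ebas[OF b(1) h j(1)] by (simp add: cof_def[of i b'] app mult_single)
      show ?thesis
      proof (cases "supp b \<subseteq> \<tau> j")
        case True
        then have "sqm (supp b - supp b') + sqm (\<tau> j - supp b) = sqm ((supp b - supp b') \<union> (\<tau> j - supp b))"
          using fin tau_fin[OF gr_J[OF j(1)]] by (intro sqm_add) auto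
        also have "(supp b - supp b') \<union> (\<tau> j - supp b) = \<tau> j - supp b'" using True sub by auto
        finally show ?thesis by (simp add: eq)
      next
        case False
        then have "cof i b h j = 0" using up_gr by (auto simp: cof_def)
        then show ?thesis by (simp add: eq)
      qed
    next
      case False
      then have "j \<notin> gr pos (up b) i" using sub by (auto simp: gr_def lab_def iv_def)
      then show ?thesis using False by (simp add: cof_def)
    qed
  qed
qed

lemma diff_std_dual:
  "diff (std_dual n F) (- (i + 1)) h = (\<lambda>f. if f \<in> carr (obj F i) then h (diff F i f) else 0)"
  by (simp add: std_dual_def fun_eq_iff)

text \<open>In coordinates the dual differential is the transpose of \<open>D\<close> on the labels
  containing \<open>supp b\<close>; the two monomials multiply to
  x^(\<open>\<tau> j - supp b\<close>), whatever \<open>l\<close> is.\<close>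

lemma DA_diff:
  assumes b: "b \<in> zdeg n" and h: "h \<in> DA (i + 1) b"
  shows "diff (std_dual n F) (- (i + 1)) h \<in> DA i b"
    and "j \<in> gr pos (up b) i \<Longrightarrow> cof i b (diff (std_dual n F) (- (i + 1)) h) j
      = (\<Sum>l\<in>gr pos (up b) (i + 1). D j l * cof (i + 1) b h l)"
proof -
  let ?h = "\<lambda>f. if f \<in> carr (obj F i) then h (diff F i f) else 0"
  note hD = h[unfolded DA_iff[OF b] lin_map_def carr_W scal_W]
  show "diff (std_dual n F) (- (i + 1)) h \<in> DA i b"
    unfolding DA_iff[OF b] lin_map_def diff_std_dual
  proof (intro conjI ballI allI impI)
    show "?h f \<in> carr W" if "f \<in> carr (obj F i)" for f
      using that hD diff_closed[OF that] by (simp add: carr_W)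
    show "?h (f + g) = ?h f + ?h g" if "f \<in> carr (obj F i)" "g \<in> carr (obj F i)" for f g
      using that hD diff_closed graded_module.add_closed[OF graded_module_F that] by (simp add: diff_add)
    show "?h (scal (obj F i) p f) = scal W p (?h f)" if "p \<in> polys n" "f \<in> carr (obj F i)" for p f
      using that hD diff_closed graded_module.scal_closed[OF graded_module_F that] by (simp add: diff_scal scal_W)
    show "?h f = 0" if "f \<notin> carr (obj F i)" for f using that by simp
    fix a f assume f: "f \<in> hcomp (obj F i) a"
    then have fc: "f \<in> carr (obj F i)" using graded_module.hcomp_carr[OF graded_module_F] by blast
    have "diff F i f \<in> hcomp (obj F (i + 1)) a" using f graded_hom_diff unfolding graded_hom_def by blast
    then have "h (diff F i f) \<in> polys n \<and> (\<forall>u\<in>Poly_Mapping.keys (h (diff F i f)). fine_deg u = a - unit_vec (supp b))"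
      using hD by blast
    then show "?h f \<in> polys n" "\<And>u. u \<in> Poly_Mapping.keys (?h f) \<Longrightarrow> fine_deg u = a - unit_vec (supp b)"
      using fc by auto
  qed
  assume j: "j \<in> gr pos (up b) i"
  then have jJ: "j \<in> gr pos J i" "supp b \<subseteq> \<tau> j" using up_gr by auto
  note m = nth_ix[OF jJ(1)]
  have eb: "ebas (ix i j) \<in> carr (obj F i)" using ebas_carr[OF m(1)] .
  have de: "diff F i (ebas (ix i j)) q = Poly_Mapping.single (sqm (\<tau> j - \<tau> (L (i + 1) ! q))) (D j (L (i + 1) ! q))"
    if "q < length (L (i + 1))" for q
  proof -
    have "diff F i (ebas (ix i j)) q = (\<Sum>p<length (L i).
        Poly_Mapping.single (sqm (\<tau> (L i ! p) - \<tau> (L (i + 1) ! q))) (D (L i ! p) (L (i + 1) ! q)) *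
        ebas (ix i j) p)"
      using that by (simp add: diff_F)
    also have "\<dots> = (\<Sum>p<length (L i). if p = ix i j then
        Poly_Mapping.single (sqm (\<tau> j - \<tau> (L (i + 1) ! q))) (D j (L (i + 1) ! q)) else 0)"
      by (intro sum.cong refl) (simp add: ebas_def m(2))
    finally show ?thesis using m(1) by simp
  qed
  have "h (diff F i (ebas (ix i j))) = hom_of (i + 1) b (cof (i + 1) b h) (diff F i (ebas (ix i j)))"
    unfolding DA_hom_of[OF b h] ..
  also have "\<dots> = (\<Sum>q<length (L (i + 1)). Poly_Mapping.single (sqm (\<tau> (L (i + 1) ! q) - supp b))
      (cof (i + 1) b h (L (i + 1) ! q)) *
      Poly_Mapping.single (sqm (\<tau> j - \<tau> (L (i + 1) ! q))) (D j (L (i + 1) ! q)))"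
    using diff_closed[OF eb] by (simp add: hom_of_def de)
  also have "\<dots> = (\<Sum>q<length (L (i + 1)). Poly_Mapping.single (sqm (\<tau> j - supp b))
      (cof (i + 1) b h (L (i + 1) ! q) * D j (L (i + 1) ! q)))"
  proof (rule sum.cong[OF refl])
    fix q assume "q \<in> {..<length (L (i + 1))}"
    then have lJ: "L (i + 1) ! q \<in> J" using gr_J[OF nth_gr] by blast
    let ?l = "L (i + 1) ! q"
    show "Poly_Mapping.single (sqm (\<tau> ?l - supp b)) (cof (i + 1) b h ?l) *
        Poly_Mapping.single (sqm (\<tau> j - \<tau> ?l)) (D j ?l)
      = Poly_Mapping.single (sqm (\<tau> j - supp b)) (cof (i + 1) b h ?l * D j ?l)"
    proof (cases "cof (i + 1) b h ?l = 0 \<or> D j ?l = 0")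
      case False
      then have sub: "supp b \<subseteq> \<tau> ?l" "\<tau> ?l \<subseteq> \<tau> j"
        using up_gr[of ?l b "i + 1"] sqc_D[OF s gr_J[OF jJ(1)] lJ] by (auto simp: cof_def split: if_splits)
      then have "sqm (\<tau> ?l - supp b) + sqm (\<tau> j - \<tau> ?l) = sqm ((\<tau> ?l - supp b) \<union> (\<tau> j - \<tau> ?l))"
        using tau_fin lJ gr_J[OF jJ(1)] by (intro sqm_add) auto
      also have "(\<tau> ?l - supp b) \<union> (\<tau> j - \<tau> ?l) = \<tau> j - supp b" using sub by auto
      finally show ?thesis by (simp add: mult_single)
    qed auto
  qed
  finally have "Poly_Mapping.lookup (h (diff F i (ebas (ix i j)))) (sqm (\<tau> j - supp b))
      = (\<Sum>q<length (L (i + 1)). cof (i + 1) b h (L (i + 1) ! q) * D j (L (i + 1) ! q))"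
    by (simp add: lookup_sum)
  also have "\<dots> = (\<Sum>l\<in>gr pos J (i + 1). cof (i + 1) b h l * D j l)"
    by (simp add: sum_L nth_ix cong: sum.cong)
  also have "\<dots> = (\<Sum>l\<in>gr pos (up b) (i + 1). D j l * cof (i + 1) b h l)"
  proof (rule sum.mono_neutral_cong_right)
    show "finite (gr pos J (i + 1))" using finJ by (rule rev_finite_subset) (auto simp: gr_def)
  qed (auto simp: gr_def lab_def cof_def)
  finally show "cof i b (diff (std_dual n F) (- (i + 1)) h) j
      = (\<Sum>l\<in>gr pos (up b) (i + 1). D j l * cof (i + 1) b h l)"
    unfolding diff_std_dual using eb j by (simp add: cof_def[of i b])
qed

end

section \<open>Coordinates on the Alexander dual of the dual complex\<close>

context sqf_cx
begin

text \<open>\<open>cof\<close> identifies \<open>DA i b\<close> with the vectors on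
  \<open>up b\<close>, so linear forms on it are given by pairing with such vectors
  \<open>P b\<close>. \<open>pcoord\<close> recovers them by evaluation on the dual basis.\<close>

definition fam :: "int \<Rightarrow> (mdegree \<Rightarrow> 'j \<Rightarrow> 'k) \<Rightarrow> mdegree \<Rightarrow> ((nat \<Rightarrow> 'k mpoly) \<Rightarrow> 'k mpoly) \<Rightarrow> 'k" where
  "fam i P b h = (if b \<in> nonneg_degs n \<and> h \<in> DA i b
     then \<Sum>j\<in>gr pos (up b) i. cof i b h j * P b j else 0)"

definition pcoord :: "int \<Rightarrow> (mdegree \<Rightarrow> ((nat \<Rightarrow> 'k mpoly) \<Rightarrow> 'k mpoly) \<Rightarrow> 'k) \<Rightarrow> mdegree \<Rightarrow> 'j \<Rightarrow> 'k" where
  "pcoord i \<phi> b j = (if j \<in> gr pos (up b) i then \<phi> b (hom_of i b (del1 j 1)) else 0)"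

lemma finUp: "finite (gr pos (up b) i)"
  using finJ by (rule rev_finite_subset) (auto simp: gr_def lab_def)

lemma nonneg_Z: "b \<in> nonneg_degs n \<Longrightarrow> b \<in> zdeg n" by (simp add: nonneg_zdeg)

lemma pcoord_vecs: "pcoord i \<phi> b \<in> vecs (gr pos (up b) i)"
  by (simp add: pcoord_def vecs_def)

lemma carr_AX: "\<phi> \<in> carr (obj AX i) \<longleftrightarrow> finite {b. \<phi> b \<noteq> 0} \<and>
    (\<forall>b. if b \<in> nonneg_degs n then \<phi> b \<in> dual_space (HM i) (DA i b) else \<phi> b = 0)"
  by (simp add: obj_AX alex_mod_def)

lemma scal_const_DA:
  assumes b: "b \<in> zdeg n" and h: "h \<in> DA i b"
  shows "scal (HM i) (const c) h = hom_of i b (\<lambda>j. c * cof i b h j)"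
    and "scal (HM i) (const c) h \<in> DA i b"
proof -
  show 1: "scal (HM i) (const c) h = hom_of i b (\<lambda>j. c * cof i b h j)"
  proof
    fix f
    have "const c * hom_of i b (cof i b h) f = hom_of i b (\<lambda>j. c * cof i b h j) f" if "f \<in> carr (obj F i)"
      using that by (simp add: hom_of_def sum_distrib_left const_def mult_single mult.assoc[symmetric])
    then show "scal (HM i) (const c) h f = hom_of i b (\<lambda>j. c * cof i b h j) f"
      by (simp add: scal_HM DA_hom_of[OF b h]) (simp add: hom_of_def)
  qed
  show "scal (HM i) (const c) h \<in> DA i b"
    unfolding 1 using cof_vecs[of i b h] by (intro hom_of_DA b) (simp add: vecs_def)
qed

lemma fam_0: "b \<notin> nonneg_degs n \<Longrightarrow> fam i P b = 0"
  by (simp add: fam_def fun_eq_iff)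

lemma nonneg_add: "a \<in> nonneg_degs n \<Longrightarrow> c \<in> nonneg_degs n \<Longrightarrow> a + c \<in> nonneg_degs n"
  by (auto simp: nonneg_degs_def)

lemma fam_carr:
  assumes fin: "finite {b \<in> nonneg_degs n. P b \<noteq> 0}"
  shows "fam i P \<in> carr (obj AX i)"
  unfolding carr_AX
proof (intro conjI allI)
  have "fam i P b = 0" if "P b = 0" for b using that by (simp add: fam_def fun_eq_iff)
  then have "{b. fam i P b \<noteq> 0} \<subseteq> {b \<in> nonneg_degs n. P b \<noteq> 0}" using fam_0 by blast
  then show "finite {b. fam i P b \<noteq> 0}" using fin finite_subset by blast
  fix b
  show "if b \<in> nonneg_degs n then fam i P b \<in> dual_space (HM i) (DA i b) else fam i P b = 0"
  proof (cases "b \<in> nonneg_degs n")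
    case True
    note Z = nonneg_Z[OF True]
    have "fam i P b (h + h') = fam i P b h + fam i P b h'" if "h \<in> DA i b" "h' \<in> DA i b" for h h'
      using that DA_add[OF Z that] by (simp add: fam_def cof_add algebra_simps sum.distrib)
    moreover have "fam i P b (scal (HM i) (const c) h) = c * fam i P b h" if "h \<in> DA i b" for c h
      using that scal_const_DA(2)[OF Z that] by (simp add: fam_def cof_const sum_distrib_left mult.assoc)
    ultimately show ?thesis using True by (simp add: dual_space_def fam_def)
  qed (simp add: fam_0)
qed

text \<open>A linear form is determined by its values on the basis
  \<open>hom_of i b (del1 j 1)\<close>. As \<open>dual_space\<close> gives additivity and scaling
  only inside the component, this is shown by induction over partial sums that stay in it.\<close>

lemma fam_pcoord:
  assumes phi: "\<phi> \<in> carr (obj AX i)"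
  shows "fam i (pcoord i \<phi>) = \<phi>"
proof
  fix b
  show "fam i (pcoord i \<phi>) b = \<phi> b"
  proof (cases "b \<in> nonneg_degs n")
    case False
    then show ?thesis using phi by (simp add: fam_0 carr_AX)
  next
    case True
    note Z = nonneg_Z[OF True]
    have ds: "\<phi> b \<in> dual_space (HM i) (DA i b)" using phi True by (simp add: carr_AX)
    have add: "\<phi> b (h + h') = \<phi> b h + \<phi> b h'" if "h \<in> DA i b" "h' \<in> DA i b" for h h'
      using ds that unfolding dual_space_def by blast
    have cm: "\<phi> b (scal (HM i) (const c) h) = c * \<phi> b h" if "h \<in> DA i b" for c h
      using ds that unfolding dual_space_def by blast
    have out: "\<phi> b h = 0" if "h \<notin> DA i b" for h using ds that unfolding dual_space_def by blast
    let ?G = "gr pos (up b) i"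
    have z: "hom_of i b (\<lambda>j. 0) \<in> DA i b" by (rule hom_of_DA[OF Z]) (simp add: vecs_def)
    have "hom_of i b (\<lambda>j. 0) + hom_of i b (\<lambda>j. 0) = hom_of i b (\<lambda>j. 0)"
      by (auto simp: hom_of_def fun_eq_iff)
    then have "\<phi> b (hom_of i b (\<lambda>j. 0)) + \<phi> b (hom_of i b (\<lambda>j. 0)) = \<phi> b (hom_of i b (\<lambda>j. 0))"
      using add[OF z z] by metis
    then have z0: "\<phi> b (hom_of i b (\<lambda>j. 0)) = 0" by (metis add_cancel_right_right)
    have lin: "\<phi> b (hom_of i b (\<lambda>j. if j \<in> S then c j else 0)) = (\<Sum>j\<in>S. c j * \<phi> b (hom_of i b (del1 j 1)))"
      if "finite S" "S \<subseteq> ?G" for S c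
      using that
    proof (induction S rule: finite_induct)
      case empty
      then show ?case using z0 by simp
    next
      case (insert j S)
      have e: "del1 j 1 \<in> vecs ?G" using insert.prems by (intro del1_vecs) auto
      have dj: "hom_of i b (del1 j 1) \<in> DA i b" by (rule hom_of_DA[OF Z e])
      have S: "hom_of i b (\<lambda>j. if j \<in> S then c j else 0) \<in> DA i b"
        using insert.prems by (intro hom_of_DA[OF Z]) (auto simp: vecs_def)
      have sc: "scal (HM i) (const (c j)) (hom_of i b (del1 j 1)) = hom_of i b (\<lambda>l. c j * del1 j 1 l)"
        using scal_const_DA(1)[OF Z dj] by (simp add: cof_hom_of[OF e])
      have "hom_of i b (\<lambda>l. if l \<in> insert j S then c l else 0)
        = hom_of i b (\<lambda>j. if j \<in> S then c j else 0) + scal (HM i) (const (c j)) (hom_of i b (del1 j 1))"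
      proof
        fix f
        have *: "(if l \<in> insert j S then c l else 0) = (if l \<in> S then c l else 0) + c j * del1 j 1 l" for l
          using insert.hyps by (auto simp: del1_def)
        show "hom_of i b (\<lambda>l. if l \<in> insert j S then c l else 0) f
          = (hom_of i b (\<lambda>j. if j \<in> S then c j else 0) + scal (HM i) (const (c j)) (hom_of i b (del1 j 1))) f"
          unfolding sc * by (simp add: hom_of_def single_add algebra_simps sum.distrib)
      qed
      then have "\<phi> b (hom_of i b (\<lambda>l. if l \<in> insert j S then c l else 0))
        = \<phi> b (hom_of i b (\<lambda>j. if j \<in> S then c j else 0)) + c j * \<phi> b (hom_of i b (del1 j 1))"
        using add[OF S scal_const_DA(2)[OF Z dj]] cm[OF dj] by simp
      then show ?case using insert by simp
    qed
    show ?thesis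
    proof
      fix h show "fam i (pcoord i \<phi>) b h = \<phi> b h"
      proof (cases "h \<in> DA i b")
        case h: True
        have "(\<lambda>j. if j \<in> ?G then cof i b h j else 0) = cof i b h"
          using cof_vecs[of i b h] by (auto simp: fun_eq_iff vecs_def)
        then have "\<phi> b h = (\<Sum>j\<in>?G. cof i b h j * \<phi> b (hom_of i b (del1 j 1)))"
          using lin[OF finUp order_refl, of "cof i b h"] DA_hom_of[OF Z h] by simp
        also have "\<dots> = (\<Sum>j\<in>?G. cof i b h j * pcoord i \<phi> b j)" by (intro sum.cong) (auto simp: pcoord_def)
        finally show ?thesis using True h by (simp add: fam_def)
      next
        case False
        then show ?thesis using out by (simp add: fam_def)
      qed
    qed
  qed
qed

lemma pcoord_fam:
  assumes b: "b \<in> nonneg_degs n" and P: "P b \<in> vecs (gr pos (up b) i)"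
  shows "pcoord i (fam i P) b = P b"
proof
  fix j show "pcoord i (fam i P) b j = P b j"
  proof (cases "j \<in> gr pos (up b) i")
    case True
    then have e: "del1 j 1 \<in> vecs (gr pos (up b) i)" by (intro del1_vecs)
    have "(\<Sum>l\<in>gr pos (up b) i. del1 j 1 l * P b l) = (\<Sum>l\<in>gr pos (up b) i. if l = j then P b j else 0)"
      by (intro sum.cong) (auto simp: del1_def)
    also have "\<dots> = P b j" using True finUp by simp
    finally show ?thesis
      using True b hom_of_DA[OF nonneg_Z[OF b] e] cof_hom_of[OF e] by (simp add: pcoord_def fam_def)
  next
    case False
    then show ?thesis using vecs_D[OF P] by (simp add: pcoord_def)
  qed
qed

lemma fam_cong:
  assumes "\<And>b. b \<in> nonneg_degs n \<Longrightarrow> P b = Q b" shows "fam i P = fam i Q"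
  using assms by (auto simp: fam_def fun_eq_iff)

lemma fam_add: "fam i P + fam i Q = fam i (\<lambda>b. P b + Q b)"
  by (auto simp: fam_def fun_eq_iff algebra_simps sum.distrib)

lemma fam_diff: "fam i P - fam i Q = fam i (\<lambda>b. P b - Q b)"
  by (auto simp: fam_def fun_eq_iff algebra_simps sum_subtractf)

lemma diff_AX: "diff AX i \<phi> b h =
    (if h \<in> DA (i + 1) b then \<phi> b (diff (std_dual n F) (- (i + 1)) h) else 0)"
proof -
  have "obj (std_dual n F) (- (i + 1)) = HM (i + 1)" by (simp add: std_dual_def add.commute)
  then show ?thesis by (simp add: alex_dual_def)
qed

text \<open>Two transpositions give back the matrix \<open>D\<close>, now on the labels containing
  \<open>supp b\<close>.\<close>

lemma diff_fam:
  assumes P: "\<And>b. b \<in> nonneg_degs n \<Longrightarrow> P b \<in> vecs (gr pos (up b) i)"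
  shows "diff AX i (fam i P) = fam (i + 1) (\<lambda>b. mapp D (up b) (up b) (P b))"
proof (intro ext)
  fix b h
  show "diff AX i (fam i P) b h = fam (i + 1) (\<lambda>b. mapp D (up b) (up b) (P b)) b h"
  proof (cases "b \<in> nonneg_degs n \<and> h \<in> DA (i + 1) b")
    case False
    then show ?thesis by (auto simp: diff_AX fam_def)
  next
    case True
    then have b: "b \<in> nonneg_degs n" and h: "h \<in> DA (i + 1) b" by auto
    note Z = nonneg_Z[OF b]
    let ?h = "diff (std_dual n F) (- (i + 1)) h"
    have "diff AX i (fam i P) b h = (\<Sum>j\<in>gr pos (up b) i. cof i b ?h j * P b j)"
      using b h DA_diff(1)[OF Z h] by (simp add: diff_AX fam_def del: minus_add_distrib)
    also have "\<dots> = (\<Sum>j\<in>gr pos (up b) i. \<Sum>l\<in>gr pos (up b) (i + 1). D j l * cof (i + 1) b h l * P b j)"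
      using DA_diff(2)[OF Z h] by (intro sum.cong refl) (simp add: sum_distrib_right del: minus_add_distrib)
    also have "\<dots> = (\<Sum>l\<in>gr pos (up b) (i + 1). \<Sum>j\<in>gr pos (up b) i. D j l * cof (i + 1) b h l * P b j)"
      by (rule sum.swap)
    also have "\<dots> = (\<Sum>l\<in>gr pos (up b) (i + 1). cof (i + 1) b h l * mapp D (up b) (up b) (P b) l)"
    proof (rule sum.cong[OF refl])
      fix l assume l: "l \<in> gr pos (up b) (i + 1)"
      have fin: "finite (up b)" using finJ by (rule rev_finite_subset) (auto simp: lab_def)
      have "(\<Sum>j\<in>up b. P b j * D j l) = (\<Sum>j\<in>gr pos (up b) i. P b j * D j l)"
        using fin vecs_D[OF P[OF b]] by (intro sum.mono_neutral_right) (auto simp: gr_def)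
      moreover have "l \<in> up b" using l by (simp add: gr_def)
      ultimately have m: "mapp D (up b) (up b) (P b) l = (\<Sum>j\<in>gr pos (up b) i. P b j * D j l)"
        by (simp add: mapp_def)
      show "(\<Sum>j\<in>gr pos (up b) i. D j l * cof (i + 1) b h l * P b j)
          = cof (i + 1) b h l * mapp D (up b) (up b) (P b) l"
        unfolding m by (simp add: sum_distrib_left mult_ac)
    qed
    finally show ?thesis using b h by (simp add: fam_def)
  qed
qed

lemma scal_AX: "scal (obj AX i) p \<phi> b h = (if h \<in> DA i b then
    \<Sum>u | u \<in> Poly_Mapping.keys p \<and> b - fine_deg u \<in> nonneg_degs n. Poly_Mapping.lookup p u *
      \<phi> (b - fine_deg u) (scal (HM i) (sqf_monom (supp b - supp (b - fine_deg u))) h) else 0)"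
  by (simp add: obj_AX alex_mod_def)

lemma hcomp_AX: "hcomp (obj AX i) b = {\<phi> \<in> carr (obj AX i). \<forall>a. a \<noteq> b \<longrightarrow> \<phi> a = 0}"
  by (simp add: obj_AX alex_mod_def)

lemma supp_diff: "b - fine_deg u \<in> nonneg_degs n \<Longrightarrow> supp (b - fine_deg u) \<subseteq> supp b"
proof
  fix v assume b: "b - fine_deg u \<in> nonneg_degs n" and v: "v \<in> supp (b - fine_deg u)"
  have "0 \<le> (b - fine_deg u) v" "(b - fine_deg u) v \<noteq> 0" "0 \<le> fine_deg u v"
    using b v by (auto simp: nonneg_degs_def supp_def fine_deg_def)
  then show "v \<in> supp b" by (auto simp: supp_def)
qed

lemma crd_neg: "b \<in> zdeg n \<Longrightarrow> b \<notin> nonneg_degs n \<Longrightarrow> crd f i b = 0"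
proof
  fix j assume b: "b \<in> zdeg n" "b \<notin> nonneg_degs n"
  then obtain v where v: "b v < 0" by (auto simp: nonneg_zdeg not_le)
  have "(b - unit_vec (\<tau> j)) v < 0" using v by (simp add: unit_vec_def)
  then have "co (f (ix i j)) (b - unit_vec (\<tau> j)) = 0" unfolding co_def by (meson not_le)
  then show "crd f i b j = 0 j" by (simp add: crd_def)
qed

end

text \<open>The comparison map applies the one matrix \<open>\<Phi>\<close> to the coordinates of
  every degree. Independence of the degree makes it linear over S, and the statements on cohomology
  are those of \<open>q\<close> in each degree.\<close>

theorem is_AD_model:
  fixes D :: "'j \<Rightarrow> 'j \<Rightarrow> 'k::field" and E :: "'l \<Rightarrow> 'l \<Rightarrow> 'k"
  assumes s: "sqc n J \<tau> pos D" and s': "sqc n J' \<tau>' pos' E" and m': "min_sqc J' \<tau>' E"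
    and q: "\<And>B. B \<subseteq> {..<n} \<Longrightarrow> qiso E pos' (lab J' \<tau>' (iv {} B)) D pos (lab J \<tau> (iv B {..<n})) \<Phi>"
  shows "is_AD n (cplx_of n J \<tau> pos D) (cplx_of n J' \<tau>' pos' E)"
proof -
  interpret X: sqf_cx n J \<tau> pos D by unfold_locales (rule s)
  interpret Y: sqf_cx n J' \<tau>' pos' E by unfold_locales (rule s')
  let ?G = "cplx_of n J' \<tau>' pos' E"
  define Q where "Q x i b = mapp \<Phi> (Y.low b) (X.up b) (Y.crd x i b)" for x i b
  define f where "f i x = X.fam i (Q x i)" for i x
  have q': "qiso E pos' (Y.low b) D pos (X.up b) \<Phi>" if "b \<in> nonneg_degs n" for b
    using q[OF supp_n[OF X.nonneg_Z[OF that]]] .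
  have Qv: "Q x i b \<in> vecs (gr pos (X.up b) i)" if "b \<in> nonneg_degs n" for x i b
    unfolding Q_def by (rule qiso_gr[OF q'[OF that] Y.crd_vecs[OF X.nonneg_Z[OF that]]])
  have finQ: "finite {b \<in> nonneg_degs n. Q x i b \<noteq> 0}" for x i
  proof (rule finite_subset[OF _ Y.crd_finite[of x i]])
    show "{b \<in> nonneg_degs n. Q x i b \<noteq> 0} \<subseteq> {b \<in> zdeg n. Y.crd x i b \<noteq> 0}"
      using X.nonneg_Z by (auto simp: Q_def)
  qed
  have finLow: "finite (Y.low b)" for b using Y.finJ by (rule rev_finite_subset) (auto simp: lab_def)
  have fc: "f i x \<in> carr (obj X.AX i)" for i x unfolding f_def by (rule X.fam_carr[OF finQ])
  have fadd: "f i (x + y) = f i x + f i y" for i x y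
    unfolding f_def X.fam_add by (rule X.fam_cong) (simp add: Q_def Y.crd_add mapp_add)
  \<comment> \<open>A monomial of degree u takes coordinates in degree b - u to degree b by
    inclusion of \<open>Y.low\<close> in the source and by restriction to the smaller
    \<open>X.up b\<close> in the target; \<open>\<Phi>\<close> is compatible with both.\<close>
  have fscal: "f i (scal (obj ?G i) p x) = scal (obj X.AX i) p (f i x)" if p: "p \<in> polys n" for i p x
  proof (intro ext)
    fix b h
    show "f i (scal (obj ?G i) p x) b h = scal (obj X.AX i) p (f i x) b h"
    proof (cases "h \<in> X.DA i b")
      case False
      then show ?thesis by (simp add: f_def X.fam_def X.scal_AX)
    next
      case h: True
      let ?K = "{u \<in> Poly_Mapping.keys p. b - fine_deg u \<in> nonneg_degs n}"
      have mon: "u \<in> monoms n" if "u \<in> Poly_Mapping.keys p" for u using p that by (auto simp: polys_def)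
      show ?thesis
      proof (cases "b \<in> nonneg_degs n")
        case False
        have "b - fine_deg u \<notin> nonneg_degs n" if "u \<in> Poly_Mapping.keys p" for u
        proof
          assume a: "b - fine_deg u \<in> nonneg_degs n"
          have "(b - fine_deg u) + fine_deg u \<in> nonneg_degs n"
            using a fine_deg_nonneg[OF mon[OF that]] by (rule X.nonneg_add)
          then show False using False by simp
        qed
        then have K: "?K = {}" by blast
        show ?thesis using False h unfolding X.scal_AX K by (simp add: f_def X.fam_0)
      next
        case b: True
        note Z = X.nonneg_Z[OF b]
        have Zu: "b - fine_deg u \<in> zdeg n" if "u \<in> Poly_Mapping.keys p" for u
          using Z fine_deg_zdeg[OF mon[OF that]] by (rule zdeg_diff)
        let ?g = "gr pos (X.up b) i"
        have Qp: "Q (scal (obj ?G i) p x) i b j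
            = (\<Sum>u\<in>?K. Poly_Mapping.lookup p u * (\<Sum>w\<in>Y.low b. Y.crd x i (b - fine_deg u) w * \<Phi> w j))"
          if j: "j \<in> ?g" for j
        proof -
          have "Q (scal (obj ?G i) p x) i b j = (\<Sum>w\<in>Y.low b.
              (\<Sum>u\<in>Poly_Mapping.keys p. Poly_Mapping.lookup p u * Y.crd x i (b - fine_deg u) w) * \<Phi> w j)"
            using j unfolding Q_def mapp_def Y.crd_scal[OF p Z] by (simp add: gr_def)
          also have "\<dots> = (\<Sum>u\<in>Poly_Mapping.keys p. \<Sum>w\<in>Y.low b.
              Poly_Mapping.lookup p u * Y.crd x i (b - fine_deg u) w * \<Phi> w j)"
            unfolding sum_distrib_right by (rule sum.swap)
          also have "\<dots> = (\<Sum>u\<in>?K. \<Sum>w\<in>Y.low b. Poly_Mapping.lookup p u * Y.crd x i (b - fine_deg u) w * \<Phi> w j)"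
          proof (rule sum.mono_neutral_right)
            show "\<forall>u\<in>Poly_Mapping.keys p - ?K.
                (\<Sum>w\<in>Y.low b. Poly_Mapping.lookup p u * Y.crd x i (b - fine_deg u) w * \<Phi> w j) = 0"
            proof
              fix u assume "u \<in> Poly_Mapping.keys p - ?K"
              then have "Y.crd x i (b - fine_deg u) = 0" using Zu Y.crd_neg by blast
              then show "(\<Sum>w\<in>Y.low b. Poly_Mapping.lookup p u * Y.crd x i (b - fine_deg u) w * \<Phi> w j) = 0" by simp
            qed
          qed auto
          finally show ?thesis by (simp add: sum_distrib_left mult.assoc)
        qed
        have summand: "f i x (b - fine_deg u) (scal (X.HM i) (sqf_monom (supp b - supp (b - fine_deg u))) h)
            = (\<Sum>j\<in>?g. X.cof i b h j * (\<Sum>w\<in>Y.low b. Y.crd x i (b - fine_deg u) w * \<Phi> w j))"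
          if u: "u \<in> ?K" for u
        proof -
          let ?b = "b - fine_deg u"
          have nb: "?b \<in> nonneg_degs n" using u by simp
          have sub: "supp ?b \<subseteq> supp b" by (rule X.supp_diff[OF nb])
          note M = X.DA_mult[OF Z X.nonneg_Z[OF nb] sub h]
          have "f i x ?b (scal (X.HM i) (sqf_monom (supp b - supp ?b)) h)
              = (\<Sum>j\<in>gr pos (X.up ?b) i. X.cof i b h j * Q x i ?b j)"
            using nb M by (simp add: f_def X.fam_def)
          also have "\<dots> = (\<Sum>j\<in>?g. X.cof i b h j * (\<Sum>w\<in>Y.low b. Y.crd x i ?b w * \<Phi> w j))"
          proof (rule sum.mono_neutral_cong_right[OF X.finUp])
            show "?g \<subseteq> gr pos (X.up ?b) i" using sub by (auto simp: gr_def lab_def iv_def)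
            show "\<forall>j\<in>gr pos (X.up ?b) i - ?g. X.cof i b h j * Q x i ?b j = 0"
              using vecs_D[OF X.cof_vecs] by fastforce
            fix j assume "j \<in> ?g"
            then have "j \<in> X.up ?b" using sub by (auto simp: gr_def lab_def iv_def)
            moreover have "(\<Sum>w\<in>Y.low b. Y.crd x i ?b w * \<Phi> w j) = (\<Sum>w\<in>Y.low ?b. Y.crd x i ?b w * \<Phi> w j)"
            proof (rule sum.mono_neutral_right[OF finLow])
              show "Y.low ?b \<subseteq> Y.low b" using sub by (auto simp: lab_def iv_def)
              show "\<forall>w\<in>Y.low b - Y.low ?b. Y.crd x i ?b w * \<Phi> w j = 0"
                using vecs_D[OF vecs_gr_vecs[OF Y.crd_vecs[OF X.nonneg_Z[OF nb]]]] by fastforce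
            qed
            ultimately show "X.cof i b h j * Q x i ?b j
                = X.cof i b h j * (\<Sum>w\<in>Y.low b. Y.crd x i ?b w * \<Phi> w j)"
              by (simp add: Q_def mapp_def)
          qed
          finally show ?thesis .
        qed
        have "f i (scal (obj ?G i) p x) b h = (\<Sum>j\<in>?g. X.cof i b h j * Q (scal (obj ?G i) p x) i b j)"
          using b h by (simp add: f_def X.fam_def)
        also have "\<dots> = (\<Sum>j\<in>?g. \<Sum>u\<in>?K. X.cof i b h j *
            (Poly_Mapping.lookup p u * (\<Sum>w\<in>Y.low b. Y.crd x i (b - fine_deg u) w * \<Phi> w j)))"
          by (intro sum.cong refl) (simp only: Qp sum_distrib_left)
        also have "\<dots> = (\<Sum>u\<in>?K. \<Sum>j\<in>?g. X.cof i b h j *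
            (Poly_Mapping.lookup p u * (\<Sum>w\<in>Y.low b. Y.crd x i (b - fine_deg u) w * \<Phi> w j)))"
          by (rule sum.swap)
        also have "\<dots> = (\<Sum>u\<in>?K. Poly_Mapping.lookup p u *
            f i x (b - fine_deg u) (scal (X.HM i) (sqf_monom (supp b - supp (b - fine_deg u))) h))"
          by (intro sum.cong refl, simp only: summand) (simp add: sum_distrib_left mult_ac)
        finally show ?thesis using h by (simp add: X.scal_AX)
      qed
    qed
  qed
  have fhom: "graded_hom n (obj ?G i) (obj X.AX i) (f i)" for i
    unfolding graded_hom_def lin_map_def
  proof (intro conjI ballI allI)
    show "f i ` hcomp (obj ?G i) b \<subseteq> hcomp (obj X.AX i) b" for b
    proof
      fix \<phi> assume "\<phi> \<in> f i ` hcomp (obj ?G i) b"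
      then obtain x where x: "x \<in> hcomp (obj ?G i) b" "\<phi> = f i x" by blast
      have "\<phi> a = 0" if "a \<noteq> b" for a
      proof (cases "a \<in> nonneg_degs n")
        case True
        then have "Y.crd x i a = 0" using Y.hcomp_crd[OF x(1)] X.nonneg_Z that by blast
        then have "Q x i a = 0" unfolding Q_def by (simp only: mapp_0)
        then show ?thesis by (intro ext) (simp add: x(2) f_def X.fam_def)
      qed (simp add: x(2) f_def X.fam_0)
      then show "\<phi> \<in> hcomp (obj X.AX i) b" using fc x(2) by (simp add: X.hcomp_AX)
    qed
  qed (use fc fadd fscal in auto)
  have dQ: "diff X.AX i (f i x) = X.fam (i + 1) (\<lambda>b. mapp D (X.up b) (X.up b) (Q x i b))" for i x
    unfolding f_def by (rule X.diff_fam[OF Qv])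
  have chain: "f (i + 1) (diff ?G i x) = diff X.AX i (f i x)" for i x
    unfolding dQ unfolding f_def
  proof (rule X.fam_cong)
    fix b assume b: "b \<in> nonneg_degs n"
    show "Q (diff ?G i x) (i + 1) b = mapp D (X.up b) (X.up b) (Q x i b)"
      unfolding Q_def Y.crd_diff[OF X.nonneg_Z[OF b]] by (rule qiso_chain[OF q'[OF b]])
  qed
  have cocyc: "mapp E (Y.low b) (Y.low b) (Y.crd x i b) = 0" if "x \<in> cocycles ?G i" "b \<in> nonneg_degs n" for x i b
    using that Y.crd_diff[OF X.nonneg_Z[OF that(2)], of i x] by (simp add: cocycles_def)
  have im1: "i - 1 + 1 = (i :: int)" for i by simp
  have inj: "x \<in> coboundaries ?G i" if x: "x \<in> cocycles ?G i" and fx: "f i x \<in> coboundaries X.AX i" for i x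
  proof -
    have xc: "x \<in> carr (obj ?G i)" using x by (simp add: cocycles_def)
    obtain \<phi> where \<phi>: "\<phi> \<in> carr (obj X.AX (i - 1))" "f i x = diff X.AX (i - 1) \<phi>"
      using fx by (auto simp: coboundaries_def)
    let ?P = "X.pcoord (i - 1) \<phi>"
    have "f i x = diff X.AX (i - 1) (X.fam (i - 1) ?P)" using \<phi> X.fam_pcoord by simp
    also have "\<dots> = X.fam (i - 1 + 1) (\<lambda>b. mapp D (X.up b) (X.up b) (?P b))"
      by (rule X.diff_fam[OF X.pcoord_vecs])
    finally have eq: "X.fam i (Q x i) = X.fam i (\<lambda>b. mapp D (X.up b) (X.up b) (?P b))" by (simp add: f_def)
    have QP: "Q x i b = mapp D (X.up b) (X.up b) (?P b)" if b: "b \<in> nonneg_degs n" for b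
    proof -
      have "mapp D (X.up b) (X.up b) (?P b) \<in> vecs (gr pos (X.up b) i)"
        by (rule bcx_gr'[OF sqc_lab_bcx[OF s order_convex_iv] X.pcoord_vecs])
      then have "X.pcoord i (X.fam i (\<lambda>b. mapp D (X.up b) (X.up b) (?P b))) b = mapp D (X.up b) (X.up b) (?P b)"
        by (intro X.pcoord_fam[OF b])
      moreover have "X.pcoord i (X.fam i (Q x i)) b = Q x i b" by (rule X.pcoord_fam[OF b]) (rule Qv[OF b])
      ultimately show ?thesis using eq by simp
    qed
    have "\<exists>w\<in>vecs (gr pos' (Y.low b) (i - 1)). Y.crd x i b = mapp E (Y.low b) (Y.low b) w"
      if b: "b \<in> nonneg_degs n" for b
      using qiso_inj[OF q'[OF b] Y.crd_vecs[OF X.nonneg_Z[OF b]] cocyc[OF x b] X.pcoord_vecs QP[OF b, unfolded Q_def]]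
      by metis
    then obtain w where w: "\<And>b. b \<in> nonneg_degs n \<Longrightarrow> w b \<in> vecs (gr pos' (Y.low b) (i - 1)) \<and>
        Y.crd x i b = mapp E (Y.low b) (Y.low b) (w b)" by metis
    \<comment> \<open>Where the coordinates of \<open>x\<close> vanish, the primitive is replaced by
      0, so that finitely many degrees remain.\<close>
    define S where "S = {b \<in> nonneg_degs n. Y.crd x i b \<noteq> 0}"
    have "finite S" unfolding S_def
      by (rule finite_subset[OF _ Y.crd_finite[of x i]]) (auto dest: X.nonneg_Z)
    then obtain y where y: "y \<in> carr (obj ?G (i - 1))"
      "\<And>b. b \<in> nonneg_degs n \<Longrightarrow> Y.crd y (i - 1) b = (if b \<in> S then w b else 0)"
      using Y.crd_assemble[of S w "i - 1"] w by (auto simp: S_def)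
    have "diff ?G (i - 1) y = x"
    proof (rule Y.crd_inj)
      show "diff ?G (i - 1) y \<in> carr (obj ?G i)" using Y.diff_closed[OF y(1)] by simp
      show "x \<in> carr (obj ?G i)" by (rule xc)
      fix b assume b: "b \<in> nonneg_degs n"
      have "Y.crd (diff ?G (i - 1) y) i b = mapp E (Y.low b) (Y.low b) (Y.crd y (i - 1) b)"
        using Y.crd_diff[OF X.nonneg_Z[OF b], of "i - 1" y] by simp
      then show "Y.crd (diff ?G (i - 1) y) i b = Y.crd x i b"
        using y(2)[OF b] w[OF b] b by (auto simp: S_def)
    qed
    then show ?thesis using y(1) by (auto simp: coboundaries_def)
  qed
  have surj: "\<exists>x\<in>cocycles ?G i. y - f i x \<in> coboundaries X.AX i" if y: "y \<in> cocycles X.AX i" for i y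
  proof -
    have yc: "y \<in> carr (obj X.AX i)" and dy: "diff X.AX i y = 0" using y by (auto simp: cocycles_def)
    let ?P = "X.pcoord i y"
    have yP: "y = X.fam i ?P" using X.fam_pcoord[OF yc] by simp
    have P0: "mapp D (X.up b) (X.up b) (?P b) = 0" if b: "b \<in> nonneg_degs n" for b
    proof -
      let ?R = "\<lambda>b. mapp D (X.up b) (X.up b) (?P b)"
      have "X.fam (i + 1) ?R = 0" using X.diff_fam[of ?P i, OF X.pcoord_vecs] dy yP by simp
      moreover have "?R b \<in> vecs (gr pos (X.up b) (i + 1))"
        by (rule bcx_gr[OF sqc_lab_bcx[OF s order_convex_iv] X.pcoord_vecs])
      ultimately have "?R b = X.pcoord (i + 1) 0 b" using X.pcoord_fam[OF b, of ?R "i + 1"] by simp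
      then show ?thesis by (simp add: X.pcoord_def fun_eq_iff)
    qed
    have "\<exists>x z. x \<in> vecs (gr pos' (Y.low b) i) \<and> mapp E (Y.low b) (Y.low b) x = 0 \<and>
        z \<in> vecs (gr pos (X.up b) (i - 1)) \<and> ?P b = mapp \<Phi> (Y.low b) (X.up b) x + mapp D (X.up b) (X.up b) z"
      if b: "b \<in> nonneg_degs n" for b
      using qiso_surj[OF q'[OF b] X.pcoord_vecs P0[OF b]] by metis
    then obtain x0 z0 where xz: "\<And>b. b \<in> nonneg_degs n \<Longrightarrow>
        x0 b \<in> vecs (gr pos' (Y.low b) i) \<and> mapp E (Y.low b) (Y.low b) (x0 b) = 0 \<and>
        z0 b \<in> vecs (gr pos (X.up b) (i - 1)) \<and>
        ?P b = mapp \<Phi> (Y.low b) (X.up b) (x0 b) + mapp D (X.up b) (X.up b) (z0 b)" by metis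
    \<comment> \<open>Outside the support of \<open>y\<close> both the cocycle and the correction
      are taken to be 0, which keeps both families finite.\<close>
    define S where "S = {b \<in> nonneg_degs n. ?P b \<noteq> 0}"
    have finS: "finite S"
    proof (rule finite_subset)
      show "S \<subseteq> {b. y b \<noteq> 0}" by (auto simp: S_def X.pcoord_def fun_eq_iff)
      show "finite {b. y b \<noteq> 0}" using yc by (simp add: X.carr_AX)
    qed
    obtain x where x: "x \<in> carr (obj ?G i)"
      "\<And>b. b \<in> nonneg_degs n \<Longrightarrow> Y.crd x i b = (if b \<in> S then x0 b else 0)"
      using Y.crd_assemble[OF finS, of x0 i] xz by (auto simp: S_def)
    have xcyc: "x \<in> cocycles ?G i"
      unfolding cocycles_def
    proof (intro CollectI conjI x(1))
      show "diff ?G i x = 0"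
      proof (rule Y.crd_inj)
        show "diff ?G i x \<in> carr (obj ?G (i + 1))" by (rule Y.diff_closed[OF x(1)])
        show "0 \<in> carr (obj ?G (i + 1))" by (rule Y.zero_carr)
        fix b assume b: "b \<in> nonneg_degs n"
        show "Y.crd (diff ?G i x) (i + 1) b = Y.crd 0 (i + 1) b"
          using Y.crd_diff[OF X.nonneg_Z[OF b], of i x] x(2)[OF b] xz[OF b] by simp
      qed
    qed
    define z where "z b = (if b \<in> S then z0 b else 0)" for b
    have zv: "z b \<in> vecs (gr pos (X.up b) (i - 1))" if "b \<in> nonneg_degs n" for b
      using xz[OF that] by (simp add: z_def)
    have "finite {b \<in> nonneg_degs n. z b \<noteq> 0}" by (rule finite_subset[OF _ finS]) (auto simp: z_def)
    then have zc: "X.fam (i - 1) z \<in> carr (obj X.AX (i - 1))" by (rule X.fam_carr)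
    have "y - f i x = X.fam i (\<lambda>b. ?P b - Q x i b)"
      unfolding f_def X.fam_diff[symmetric] using yP by simp
    also have "\<dots> = X.fam i (\<lambda>b. mapp D (X.up b) (X.up b) (z b))"
    proof (rule X.fam_cong)
      fix b assume b: "b \<in> nonneg_degs n"
      show "?P b - Q x i b = mapp D (X.up b) (X.up b) (z b)"
      proof (cases "b \<in> S")
        case True
        have "?P b - Q x i b = ?P b - mapp \<Phi> (Y.low b) (X.up b) (x0 b)" using x(2)[OF b] True by (simp add: Q_def)
        then show ?thesis using xz[OF b] True by (simp add: z_def)
      next
        case False
        then show ?thesis using x(2)[OF b] b by (simp add: Q_def z_def S_def)
      qed
    qed
    also have "\<dots> = diff X.AX (i - 1) (X.fam (i - 1) z)" using X.diff_fam[of z "i - 1", OF zv] by simp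
    finally have "y - f i x \<in> coboundaries X.AX i" using zc by (auto simp: coboundaries_def)
    then show ?thesis using xcyc by blast
  qed
  have "quasi_iso n ?G X.AX f"
    unfolding quasi_iso_def using fhom chain inj surj by blast
  then show ?thesis
    unfolding is_AD_def is_res_def using Y.free_F Y.minimal_F[OF m'] by blast
qed

section \<open>Pure complexes\<close>

text \<open>As \<open>ds\<close> is strictly increasing, the size of a label determines its position
  and conversely; each term of the complex thus has labels of one size.\<close>

lemma pure_complex_of:
  fixes D :: "'j \<Rightarrow> 'j \<Rightarrow> 'k::field"
  assumes s: "sqc n J \<tau> pos D" and ds: "ds \<noteq> []" "sorted_wrt (<) ds"
    and J: "\<And>j. j \<in> J \<Longrightarrow> \<exists>k<length ds. card (\<tau> j) = ds ! k \<and> pos j = p - int k"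
    and occ: "\<And>k. k < length ds \<Longrightarrow> \<exists>j\<in>J. card (\<tau> j) = ds ! k"
  shows "pure_complex n (cplx_of n J \<tau> pos D) (int ` set ds)"
proof -
  interpret X: sqf_cx n J \<tau> pos D by unfold_locales (rule s)
  have less: "ds ! k < ds ! m" if "k < m" "m < length ds" for k m
    using sorted_wrt_nth_less[OF ds(2)] that by blast
  have inj: "k = m" if "k < length ds" "m < length ds" "ds ! k = ds ! m" for k m
    using less[of k m] less[of m k] that by (metis linorder_neqE_nat less_irrefl)
  have deg: "j \<in> gr pos J (p - int k) \<longleftrightarrow> j \<in> J \<and> card (\<tau> j) = ds ! k" if "k < length ds" for j k
    using J[of j] inj that by (auto simp: gr_def)
  show ?thesis
    unfolding pure_complex_def
  proof (intro conjI X.free_F exI[of _ p] exI[of _ "map int ds"] exI[of _ "\<lambda>k. length (X.L (p - int k))"] allI impI)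
    show "map int ds \<noteq> []" using ds by simp
    show "sorted_wrt (<) (map int ds)" using ds by (simp add: sorted_wrt_map)
    show "set (map int ds) = int ` set ds" by simp
    fix k assume "k < length (map int ds)"
    then have k: "k < length ds" by simp
    obtain j where "j \<in> gr pos J (p - int k)" using occ[OF k] deg[OF k] by blast
    then show "1 \<le> length (X.L (p - int k))" using X.L(1)[of "p - int k"] by (cases "X.L (p - int k)") auto
    have "R \<subseteq> {..<n} \<and> card R = ds ! k" if "R \<in> set (map \<tau> (X.L (p - int k)))" for R
      using that X.L(1)[of "p - int k"] deg[OF k] X.tau_n by auto
    from singly_graded_free[of "map \<tau> (X.L (p - int k))" n "ds ! k", OF this]
    show "graded_iso n (singly_graded n (obj X.F (p - int k)))
        (dsum (replicate (length (X.L (p - int k))) (twist (S_mod n total_deg) (map int ds ! k))))"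
      using k by (simp add: cplx_of_def)
  next
    fix i assume i: "p < i \<or> i \<le> p - int (length (map int ds))"
    have "gr pos J i = {}"
    proof (rule ccontr)
      assume "gr pos J i \<noteq> {}"
      then obtain j where "j \<in> J" "pos j = i" by (auto simp: gr_def)
      then show False using J[of j] i by auto
    qed
    then show "carr (obj X.F i) = {0}" by (rule X.empty_pos)
  qed
qed

lemma pure_complex_linear:
  assumes s: "sqc n J \<tau> pos D" and l: "linear_cx J \<tau> pos l u e" and lu: "l \<le> u"
  shows "pure_complex n (cplx_of n J \<tau> pos D) (int ` {l..u})"
proof -
  have set: "set [l..<Suc u] = {l..u}" by auto
  have len: "length [l..<Suc u] = Suc u - l" by (rule length_upt)
  have nth: "k < Suc u - l \<Longrightarrow> [l..<Suc u] ! k = l + k" for k by (simp del: upt_Suc)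
  have "pure_complex n (cplx_of n J \<tau> pos D) (int ` set [l..<Suc u])"
  \<comment> \<open>The generators of the smallest size l occupy the highest position.\<close>
  proof (rule pure_complex_of[OF s, where p = "e - int l"])
    show "[l..<Suc u] \<noteq> []" using lu by simp
    show "sorted_wrt (<) [l..<Suc u]" by (rule sorted_wrt_upt)
    fix j assume "j \<in> J"
    then have j: "l \<le> card (\<tau> j)" "card (\<tau> j) \<le> u" "pos j = e - int (card (\<tau> j))"
      using l by (auto simp: linear_cx_def)
    then show "\<exists>k<length [l..<Suc u]. card (\<tau> j) = [l..<Suc u] ! k \<and> pos j = e - int l - int k"
      unfolding len by (intro exI[of _ "card (\<tau> j) - l"]) (simp add: nth del: upt_Suc)
  next
    fix k assume "k < length [l..<Suc u]"
    then have k: "k < Suc u - l" by (simp only: len)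
    then have "l + k \<in> {l..u}" by auto
    then show "\<exists>j\<in>J. card (\<tau> j) = [l..<Suc u] ! k" using l unfolding linear_cx_def nth[OF k] by blast
  qed
  then show ?thesis by (simp only: set)
qed

lemma card_less_nth:
  fixes ds :: "nat list"
  assumes "sorted_wrt (<) ds" "k < length ds" shows "card {x \<in> set ds. x < ds ! k} = k"
proof -
  have less: "ds ! i < ds ! m" if "i < m" "m < length ds" for i m
    using sorted_wrt_nth_less[OF assms(1)] that by blast
  have "{x \<in> set ds. x < ds ! k} = (\<lambda>i. ds ! i) ` {..<k}"
  proof (intro set_eqI iffI)
    fix x assume "x \<in> {x \<in> set ds. x < ds ! k}"
    then obtain i where i: "i < length ds" "x = ds ! i" "ds ! i < ds ! k" by (auto simp: in_set_conv_nth)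
    have "\<not> k < i" "i \<noteq> k" using less[of k i] i by auto
    then show "x \<in> (\<lambda>i. ds ! i) ` {..<k}" using i by auto
  qed (use less assms(2) in auto)
  moreover have "inj_on (\<lambda>i. ds ! i) {..<k}"
  proof (rule inj_onI)
    fix i m assume "i \<in> {..<k}" "m \<in> {..<k}" "ds ! i = ds ! m"
    then show "i = m" using less[of i m] less[of m i] assms(2) by (cases i m rule: linorder_cases) auto
  qed
  ultimately show ?thesis by (simp add: card_image)
qed

lemma pure_complex_exact:
  assumes pe: "pure_exact n A J \<tau> pos D" and A: "finite A" "A \<noteq> {}"
  shows "pure_complex n (cplx_of n J \<tau> pos D) (int ` A)"
proof -
  define ds where "ds = sorted_list_of_set A"
  have ds: "set ds = A" "sorted_wrt (<) ds" "ds \<noteq> []"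
    using A by (auto simp: ds_def)
  have "pure_complex n (cplx_of n J \<tau> pos D) (int ` set ds)"
  proof (rule pure_complex_of[where p = 0])
    show "sqc n J \<tau> pos D" using pe by (simp add: pure_exact_def)
    show "ds \<noteq> []" "sorted_wrt (<) ds" by (fact ds)+
    fix j assume "j \<in> J"
    then have j: "card (\<tau> j) \<in> set ds" "pos j = - int (card {x \<in> set ds. x < card (\<tau> j)})"
      using pe ds(1) by (auto simp: pure_exact_def)
    then obtain k where k: "k < length ds" "card (\<tau> j) = ds ! k" by (metis in_set_conv_nth)
    then show "\<exists>k<length ds. card (\<tau> j) = ds ! k \<and> pos j = 0 - int k"
      using j(2) card_less_nth[OF ds(2) k(1)] by auto
  next
    fix k assume "k < length ds"
    then have "ds ! k \<in> A" using ds(1) nth_mem by blast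
    then show "\<exists>j\<in>J. card (\<tau> j) = ds ! k" using pe by (simp add: pure_exact_def)
  qed
  then show ?thesis by (simp only: ds(1))
qed

lemma interval_endpoints:
  fixes l u :: nat
  assumes "B \<subseteq> {l..u}" "l \<in> B" "u \<in> B" "\<exists>l u. B = {l..u}" shows "B = {l..u}"
  using assms by auto

theorem theorem4p8:
  fixes n :: nat and A B C :: "nat set"
  assumes "balanced_degree_triplet n A B C"
    and "\<exists>l u. B = {l..u}"
    and "\<exists>l u. C = {l..u}"
  shows "\<exists>(F :: ('k::field, nat \<Rightarrow> 'k mpoly) cplx)
           (G :: ('k, nat \<Rightarrow> 'k mpoly) cplx)
           (H :: ('k, nat \<Rightarrow> 'k mpoly) cplx).
           free_sqf_complex n F \<and> is_AD n F G \<and> is_AD n G H \<and>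
           pure_complex n F (int ` A) \<and> pure_complex n G (int ` B) \<and> pure_complex n H (int ` C)"
proof -
  obtain a b c where abc: "a \<le> n" "b \<le> n" "c \<le> n"
    and A: "A \<subseteq> {c..n - b}" "c \<in> A" "n - b \<in> A"
    and B0: "B \<subseteq> {a..n - c}" "a \<in> B" "n - c \<in> B"
    and C0: "C \<subseteq> {b..n - a}" "b \<in> C" "n - a \<in> C"
    and n: "n = a + b + c + card ({c..n - b} - A) + card ({a..n - c} - B) + card ({b..n - a} - C)"
    using assms(1) unfolding balanced_degree_triplet_def by auto
  have B: "B = {a..n - c}" using B0 assms(2) by (rule interval_endpoints)
  have C: "C = {b..n - a}" using C0 assms(3) by (rule interval_endpoints)
  have finA: "finite A" using A(1) finite_subset by blast
  have "card ({c..n - b} - A) = card {c..n - b} - card A" using A(1) finA by (simp add: card_Diff_subset)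
  moreover have "card A \<le> card {c..n - b}" using A(1) by (intro card_mono) auto
  moreover have "c \<le> n - b" using A by auto
  \<comment> \<open>The gaps of B and C are empty, so the balance condition reads n = a + b + c + (n
    - b - c + 1 - |A|).\<close>
  ultimately have cardA: "card A = Suc a" using n by (simp add: B C)
  have "{c..n - b} \<subseteq> {0..n}" by auto
  with A(1) have "A \<subseteq> {0..n}" by (rule order_trans)
  then obtain J :: "nat set" and \<tau> pos and D :: "nat \<Rightarrow> nat \<Rightarrow> 'k" where pe: "pure_exact n A J \<tau> pos D"
    using pure_exact_exists by blast
  interpret pure_cx n a b c A J \<tau> pos D
    by unfold_locales (fact pe A cardA abc)+
  obtain J1 :: "(nat \<times> nat set) set" and E1 \<Phi>1 and J2 :: "((nat \<times> nat set) \<times> nat set) set" and E2 \<Phi>2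
    where G: "sqc n J1 snd (tot_pos pos) E1" "min_sqc J1 snd E1"
    "\<And>B. B \<subseteq> {..<n} \<Longrightarrow> qiso E1 (tot_pos pos) (lab J1 snd (iv {} B)) D pos (lab J \<tau> (iv B {..<n})) \<Phi>1"
    "linear_cx J1 snd (tot_pos pos) a (n - c) 0"
    and H: "sqc n J2 snd (tot_pos (tot_pos pos)) E2" "min_sqc J2 snd E2"
    "\<And>B. B \<subseteq> {..<n} \<Longrightarrow> qiso E2 (tot_pos (tot_pos pos)) (lab J2 snd (iv {} B))
      E1 (tot_pos pos) (lab J1 snd (iv B {..<n})) \<Phi>2"
    "linear_cx J2 snd (tot_pos (tot_pos pos)) b (n - a) (- int a)"
    by (rule linear_duals) (rule that)
  show ?thesis
  proof (intro exI conjI)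
    show "pure_complex n (cplx_of n J \<tau> pos D) (int ` A)"
      using pe finA A by (intro pure_complex_exact) auto
    then show "free_sqf_complex n (cplx_of n J \<tau> pos D)" by (simp add: pure_complex_def)
    show "is_AD n (cplx_of n J \<tau> pos D) (cplx_of n J1 snd (tot_pos pos) E1)"
      by (rule is_AD_model[OF s G(1-3)])
    show "is_AD n (cplx_of n J1 snd (tot_pos pos) E1) (cplx_of n J2 snd (tot_pos (tot_pos pos)) E2)"
      by (rule is_AD_model[OF G(1) H(1-3)])
    show "pure_complex n (cplx_of n J1 snd (tot_pos pos) E1) (int ` B)"
      unfolding B using B0 by (intro pure_complex_linear[OF G(1,4)]) auto
    show "pure_complex n (cplx_of n J2 snd (tot_pos (tot_pos pos)) E2) (int ` C)"
      unfolding C using C0 by (intro pure_complex_linear[OF H(1,4)]) auto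
  qed
qed

end
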